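(* Let $V$ be a simple weight $\mathfrak{age}(1)$-module and let $H(V)=\mathrm{Ind}_{\mathfrak{age}(1)}^{\mathcal{S}}V=U(\mathcal{S})\otimes_{U(\mathfrak{age}(1))}V$. (a) If $V$ is a highest weight module over $\mathfrak{age}(1)$, then $H(V)$ is a highest weight $\mathcal{S}$-module, which has a unique simple quotient. (b) If $V\cong\bar M^-_{\mathfrak{age}(1)}(\dot z,\dot h)$ with $\dot z\neq0$, then $$H(V)\cong M^-_{\mathcal{H}}(\dot z)^{\mathcal{S}}\otimes M_{\mathfrak{sl}_2}(\dot h-\tfrac12)^{\mathcal{S}}.$$ The latter module has a unique simple quotient, and this simple quotient is isomorphic to $M^-_{\mathcal{H}}(\dot z)^{\mathcal{S}}\otimes\bar M_{\mathfrak{sl}_2}(\dot h-\tfrac12)^{\mathcal{S}}$. (c) If $V\cong Q(\lambda,\dot h)$ for some $\dot h\in\mathbb{C}$ and $\lambda\in\mathbb{C}^*$, then $H(V)$ is simple. (d) If $V\cong Q'(\dot z,\dot h,\lambda)$ for some $\dot h\in\mathbb{C}$, $\dot z\in\mathbb{C}^*$, $\lambda\in\mathbb{C}\setminus\mathbb{Z}$, then $$H(V)\cong G(\dot z,\lambda)^{\mathcal{S}}\otimes M_{\mathfrak{sl}_2}(\lambda+\dot h+\tfrac12)^{\mathcal{S}}.$$ The latter module has a unique simple quotient, and this simple quotient is isomorphic to $G(\dot z,\lambda)^{\mathcal{S}}\otimes\bar M_{\mathfrak{sl}_2}(\lambda+\dot h+\tfrac12)^{\mathcal{S}}$. (e)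 If $V\cong N_{\dot z,\dot h}$, where $\dot z,\dot h\in\mathbb{C}$ and $N$ is an infinite dimensional simple $R_{\dot z}$-module, then any simple quotient of $H(V)$ is isomorphic to $N_{\dot c,\dot z,\dot h}$ for some $\dot c\in\mathbb{C}$.
   Context: All vector spaces and algebras are over $\mathbb{C}$; $\otimes$ means $\otimes_{\mathbb{C}}$ unless a subscript indicates otherwise. The extended Schrödinger algebra $\mathcal{S}$ is the complex Lie algebra with basis $\{f,q,h,e,p,z\}$, $z$ central, and brackets $[h,e]=2e$, $[e,f]=h$, $[h,f]=-2f$, $[e,q]=p$, $[e,p]=0$, $[h,p]=p$, $[f,p]=q$, $[f,q]=0$, $[h,q]=-q$, $[p,q]=z$. The ageing algebra $\mathfrak{age}(1)$ is the Lie subalgebra spanned by $e,h,p,q,z$; the Heisenberg algebra $\mathcal{H}$ is spanned by $p,q,z$; $\mathfrak{sl}_2$ is spanned by $e,f,h$. On every simple module over $\mathfrak{age}(1)$ or $\mathcal{S}$, $z$ acts as a scalar, denoted $\dot z$. A weight module is one on which $h$ acts diagonalizably. A highest weight module over $\mathfrak{age}(1)$ or $\mathcal{S}$ is a module generated by a nonzero $h$-eigenvector $w$ (on which $z$ acts as a scalar) with $ew=pw=0$. Verma-type modules: $\bar M^-_{\mathfrak{age}(1)}(\dot z,\dot h)$ is the unique simple quotient of the lowest weight Verma module $M^-_{\mathfrak{age}(1)}(\dot z,\dot h)$, i.e. the $\mathfrak{age}(1)$-module induced from the one-dimensional module $\mathbb{C}w$ over the span of $h,z,q$ with $hw=\dot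 hw$, $zw=\dot zw$, $qw=0$. $M^-_{\mathcal{H}}(\dot z)$ is the $\mathcal{H}$-module induced from the one-dimensional module $\mathbb{C}w$ over the span of $q,z$ with $qw=0$, $zw=\dot zw$. $M_{\mathfrak{sl}_2}(\mu)$ is the highest weight Verma module of $\mathfrak{sl}_2$, generated by $w$ with $ew=0$, $hw=\mu w$, and $\bar M_{\mathfrak{sl}_2}(\mu)$ is its unique simple quotient. Extensions to $\mathcal{S}$: if $V$ is a simple $\mathcal{H}$-module on which $z$ acts as $\dot z\neq0$, then $V^{\mathcal{S}}$ is the $\mathcal{S}$-module on the space $V$ with the same action of $\mathcal{H}$ and $$ev=\tfrac{1}{2\dot z}p^2v,\quad fv=-\tfrac{1}{2\dot z}q^2v,\quad hv=\big(-\tfrac{pq}{\dot z}+\tfrac12\big)v\qquad(v\in V).$$ If $W$ is an $\mathfrak{sl}_2$-module, $W^{\mathcal{S}}$ is the $\mathcal{S}$-module on $W$ with the same $\mathfrak{sl}_2$-action and $\mathcal{H}W=0$. For $\dot z\in\mathbb{C}^*$, $\lambda\in\mathbb{C}\setminus\mathbb{Z}$, $G(\dot z,\lambda)=\mathbb{C}[x,x^{-1}]$ is the simple $\mathcal{H}$-module with $qx^i=x^{i+1}$, $px^i=\dot z(\lambda+i)x^{i-1}$, $zx^i=\dot zx^i$. For $\dot h\in\mathbb{C}$, $\lambda\in\mathbb{C}^*$, $Q(\lambda,\dot h)=\mathbb{C}[x,x^{-1}]$ is the $\mathfrak{age}(1)$-module with $zx^i=px^i=0$, $qx^i=x^{i+1}$,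 $ex^i=\lambda x^{i-2}$, $hx^i=(\dot h-i)x^i$. For $\dot h\in\mathbb{C}$, $\dot z\in\mathbb{C}^*$, $\lambda\in\mathbb{C}\setminus\mathbb{Z}$, $Q'(\dot z,\dot h,\lambda)=\mathbb{C}[x,x^{-1}]$ is the $\mathfrak{age}(1)$-module with $qx^i=x^{i+1}$, $px^i=\dot z(\lambda+i)x^{i-1}$, $zx^i=\dot zx^i$, $hx^i=(\dot h-i)x^i$, $ex^i=\frac{\dot z}{2}(\lambda+i)(\lambda+i-1)x^{i-2}$. Let $\mathbf{A}$ be the first Weyl algebra, generated by $t$ and $\frac{d}{dt}$ with $\frac{d}{dt}t-t\frac{d}{dt}=1$. Let $R_0$ be the unital subalgebra of $\mathbf{A}$ generated by $t$ and $t^2\frac{d}{dt}$, and for $\dot z\in\mathbb{C}^*$ let $R_{\dot z}=R_1$ be the unital subalgebra generated by $t$ and $t\frac{d}{dt}$. For $\dot z,\dot h\in\mathbb{C}$ and an $R_{\dot z}$-module $N$, the $\mathfrak{age}(1)$-module $N_{\dot z,\dot h}$ is the space $N\otimes\mathbb{C}[x,x^{-1}]$ with, for $v\in N$, $i\in\mathbb{Z}$, $$h(v\otimes x^i)=(\dot h-i)v\otimes x^i,\quad z(v\otimes x^i)=\dot zv\otimes x^i,\quad q(v\otimes x^i)=v\otimes x^{i+1},$$ and, if $\dot z=0$, $p(v\otimes x^i)=(tv)\otimes x^{i-1}$, $e(v\otimes x^i)=\big((t^2\frac{d}{dt}+(i-2)t)v\big)\otimes x^{i-2}$; while, if $\dot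 z\neq0$, $$p(v\otimes x^i)=\big((2\dot zt\tfrac{d}{dt}+(i-1)\dot z)v\big)\otimes x^{i-1},$$ $$e(v\otimes x^i)=\big((t+(2i-3)\dot zt\tfrac{d}{dt}+2\dot z(t\tfrac{d}{dt})^2+\tfrac{(i-1)(i-2)}{2}\dot z)v\big)\otimes x^{i-2}.$$ If $N$ is an infinite dimensional simple $R_{\dot z}$-module, then $t$ acts bijectively on $N$, so $N$ is naturally a module over the localization $\mathbb{C}[t,t^{-1},\frac{d}{dt}]$ of $\mathbf{A}$ at powers of $t$. For $\dot c\in\mathbb{C}$, $N_{\dot c,\dot z,\dot h}$ is the $\mathcal{S}$-module extending the $\mathfrak{age}(1)$-module $N_{\dot z,\dot h}$ by letting $f$ act as follows: if $\dot z=0$, $$f(v\otimes x^i)=\big((\tfrac{d}{dt}+(\dot h-2)t^{-1}+\dot ct^{-2})v\big)\otimes x^{i+2};$$ if $\dot z\neq0$, $$f(v\otimes x^i)=\Big(\big(-\tfrac{1}{2\dot z}-(\dot h-\tfrac12)\tfrac{d}{dt}-t(\tfrac{d}{dt})^2-\big(\tfrac{(\dot h-1)(\dot h-2)}{4}+\tfrac{\dot c}{2\dot z}\big)t^{-1}\big)v\Big)\otimes x^{i+2}.$$ *)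

theory Defs
  imports
    "HOL-Analysis.Cartesian_Space"
    "HOL-Library.Poly_Mapping"
    "HOL-Algebra.QuotRing"
    "HOL-Algebra.Generated_Rings"
begin

section \<open>Complex vector spaces with operators\<close>

definition \<CC> :: "complex ring" where
  "\<CC> = \<lparr>carrier = UNIV, mult = (*), one = 1, zero = 0, add = (+)\<rparr>"

text \<open>
  Vector spaces are \<open>HOL-Algebra\<close> modules over \<open>\<CC>\<close> (the multiplicative fields inherited from
  the ring record are irrelevant). A representation carries in addition an operator for every
  element of a Lie algebra or an associative algebra.
\<close>

record ('x, 'm) rep = "(complex, 'm) module" +
  act :: "'x \<Rightarrow> 'm \<Rightarrow> 'm"

definition lin_span :: "(complex, 'm, 'z) module_scheme \<Rightarrow> 'm set \<Rightarrow> 'm set" where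
  "lin_span M B = \<Inter>{N. submodule N \<CC> M \<and> B \<subseteq> N}"

definition fin_dim :: "(complex, 'm, 'z) module_scheme \<Rightarrow> bool" where
  "fin_dim M \<longleftrightarrow> (\<exists>B. finite B \<and> B \<subseteq> carrier M \<and> lin_span M B = carrier M)"

definition subrep :: "'x set \<Rightarrow> ('x, 'm) rep \<Rightarrow> 'm set \<Rightarrow> bool" where
  "subrep L M N \<longleftrightarrow> submodule N \<CC> M \<and> (\<forall>x\<in>L. \<forall>v\<in>N. act M x v \<in> N)"

definition irreducible_rep :: "'x set \<Rightarrow> ('x, 'm) rep \<Rightarrow> bool" where
  "irreducible_rep L M \<longleftrightarrow> carrier M \<noteq> {\<zero>\<^bsub>M\<^esub>} \<and>
     (\<forall>N. subrep L M N \<longrightarrow> N = {\<zero>\<^bsub>M\<^esub>} \<or> N = carrier M)"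

definition quot_rep :: "('x, 'm) rep \<Rightarrow> 'm set \<Rightarrow> ('x, 'm set) rep" where
  "quot_rep M N = \<lparr>carrier = a_rcosets\<^bsub>M\<^esub> N, mult = undefined, one = undefined, zero = N,
     add = set_add M,
     smult = (\<lambda>c C. \<Union>v\<in>C. N +>\<^bsub>M\<^esub> (c \<odot>\<^bsub>M\<^esub> v)),
     act = (\<lambda>x C. \<Union>v\<in>C. N +>\<^bsub>M\<^esub> act M x v)\<rparr>"

definition rep_iso :: "'x set \<Rightarrow> ('x, 'm) rep \<Rightarrow> ('x, 'n) rep \<Rightarrow> bool" where
  "rep_iso L M M' \<longleftrightarrow> (\<exists>\<phi>. bij_betw \<phi> (carrier M) (carrier M') \<and>
     (\<forall>u\<in>carrier M. \<forall>v\<in>carrier M. \<phi> (u \<oplus>\<^bsub>M\<^esub> v) = \<phi> u \<oplus>\<^bsub>M'\<^esub> \<phi> v) \<and>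
     (\<forall>c. \<forall>v\<in>carrier M. \<phi> (c \<odot>\<^bsub>M\<^esub> v) = c \<odot>\<^bsub>M'\<^esub> \<phi> v) \<and>
     (\<forall>x\<in>L. \<forall>v\<in>carrier M. \<phi> (act M x v) = act M' x (\<phi> v)))"


section \<open>Free vector spaces, free algebras and tensor products\<close>

definition scale :: "complex \<Rightarrow> ('k \<Rightarrow>\<^sub>0 complex) \<Rightarrow> ('k \<Rightarrow>\<^sub>0 complex)" where
  "scale c y = Poly_Mapping.map ((*) c) y"

definition lin_ext :: "('k \<Rightarrow> ('l \<Rightarrow>\<^sub>0 complex)) \<Rightarrow> ('k \<Rightarrow>\<^sub>0 complex) \<Rightarrow> ('l \<Rightarrow>\<^sub>0 complex)" where
  "lin_ext g y = (\<Sum>k\<in>Poly_Mapping.keys y. scale (Poly_Mapping.lookup y k) (g k))"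

definition free_rep :: "'k set \<Rightarrow> ('x \<Rightarrow> 'k \<Rightarrow> ('k \<Rightarrow>\<^sub>0 complex)) \<Rightarrow> ('x, 'k \<Rightarrow>\<^sub>0 complex) rep" where
  "free_rep A g = \<lparr>carrier = {y. Poly_Mapping.keys y \<subseteq> A}, mult = undefined, one = undefined,
     zero = 0, add = (+), smult = scale, act = (\<lambda>x. lin_ext (g x))\<rparr>"

text \<open>
  \<open>tensor_rep M N B g\<close> is the quotient of \<open>M \<otimes> N\<close> (over the complex numbers) in which
  \<open>m \<otimes> n\<close> and \<open>m' \<otimes> n'\<close> are identified for all \<open>((m, n), (m', n')) \<in> B\<close>; the operator
  \<open>x\<close> sends \<open>m \<otimes> n\<close> to the tensor represented by \<open>g x (m, n)\<close>.
\<close>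

definition tensor_rels ::
    "(complex, 'a, 'y) module_scheme \<Rightarrow> (complex, 'b, 'z) module_scheme \<Rightarrow>
     (('a \<times> 'b) \<Rightarrow>\<^sub>0 complex) set" where
  "tensor_rels M N =
     {Poly_Mapping.single (m \<oplus>\<^bsub>M\<^esub> m', n) 1 - Poly_Mapping.single (m, n) 1
        - Poly_Mapping.single (m', n) 1 |
        m m' n. m \<in> carrier M \<and> m' \<in> carrier M \<and> n \<in> carrier N} \<union>
     {Poly_Mapping.single (m, n \<oplus>\<^bsub>N\<^esub> n') 1 - Poly_Mapping.single (m, n) 1
        - Poly_Mapping.single (m, n') 1 |
        m n n'. m \<in> carrier M \<and> n \<in> carrier N \<and> n' \<in> carrier N} \<union>
     {Poly_Mapping.single (c \<odot>\<^bsub>M\<^esub> m, n) 1 - Poly_Mapping.single (m, n) c |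
        c m n. m \<in> carrier M \<and> n \<in> carrier N} \<union>
     {Poly_Mapping.single (m, c \<odot>\<^bsub>N\<^esub> n) 1 - Poly_Mapping.single (m, n) c |
        c m n. m \<in> carrier M \<and> n \<in> carrier N}"

definition tensor_rep ::
    "(complex, 'a, 'y) module_scheme \<Rightarrow> (complex, 'b, 'z) module_scheme \<Rightarrow>
     (('a \<times> 'b) \<times> ('a \<times> 'b)) set \<Rightarrow> ('x \<Rightarrow> 'a \<times> 'b \<Rightarrow> (('a \<times> 'b) \<Rightarrow>\<^sub>0 complex)) \<Rightarrow>
     ('x, (('a \<times> 'b) \<Rightarrow>\<^sub>0 complex) set) rep" where
  "tensor_rep M N B g =
     (let F = free_rep (carrier M \<times> carrier N) g in
      quot_rep F (lin_span F (tensor_rels M N \<union>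
        {Poly_Mapping.single k 1 - Poly_Mapping.single l 1 | k l. (k, l) \<in> B})))"

datatype 'a word = Word (letters: "'a list")

instantiation word :: (type) monoid_add
begin
definition "0 = Word []"
definition "u + v = Word (letters u @ letters v)"
instance by standard (simp_all add: zero_word_def plus_word_def)
end

text \<open>The product of \<open>'a word \<Rightarrow>\<^sub>0 complex\<close> is the convolution along concatenation of words.\<close>

definition free_alg :: "'a set \<Rightarrow> ('a word \<Rightarrow>\<^sub>0 complex) ring" where
  "free_alg A = \<lparr>carrier = {y. \<forall>w\<in>Poly_Mapping.keys y. set (letters w) \<subseteq> A},
     mult = (*), one = 1, zero = 0, add = (+)\<rparr>"

abbreviation letter :: "'a \<Rightarrow> ('a word \<Rightarrow>\<^sub>0 complex)" where
  "letter a \<equiv> Poly_Mapping.single (Word [a]) 1"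

abbreviation const :: "complex \<Rightarrow> ('a word \<Rightarrow>\<^sub>0 complex)" where
  "const c \<equiv> Poly_Mapping.single 0 c"


section \<open>The extended Schroedinger algebra\<close>

datatype gen = gF | gQ | gH | gE | gP | gZ

lemma UNIV_gen: "(UNIV :: gen set) = {gF, gQ, gH, gE, gP, gZ}"
  using gen.exhaust by blast

instance gen :: finite
  by standard (simp add: UNIV_gen)

type_synonym schr = "complex ^ gen"

abbreviation bas :: "gen \<Rightarrow> schr" where
  "bas a \<equiv> axis a 1"

text \<open>The nonzero brackets, each for one of the two orders of the basis elements.\<close>

fun bracket_table :: "gen \<Rightarrow> gen \<Rightarrow> schr" where
  "bracket_table gH gE = 2 *s bas gE"
| "bracket_table gE gF = bas gH"
| "bracket_table gH gF = (-2) *s bas gF"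
| "bracket_table gE gQ = bas gP"
| "bracket_table gH gP = bas gP"
| "bracket_table gF gP = bas gQ"
| "bracket_table gH gQ = - bas gQ"
| "bracket_table gP gQ = bas gZ"
| "bracket_table _ _ = 0"

definition bracket :: "schr \<Rightarrow> schr \<Rightarrow> schr" where
  "bracket x y = (\<Sum>a\<in>UNIV. \<Sum>b\<in>UNIV. (x $ a * y $ b) *s (bracket_table a b - bracket_table b a))"

lemma sum_gen:
  "(\<Sum>a\<in>(UNIV::gen set). f a) = f gF + f gQ + f gH + f gE + f gP + f gZ"
  for f :: "gen \<Rightarrow> 'a::ab_group_add"
  by (simp add: UNIV_gen algebra_simps)

lemma bracket_coords: "bracket x y = (\<chi> c. case c of
     gF \<Rightarrow> -2 * (x$gH * y$gF - x$gF * y$gH)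
   | gE \<Rightarrow> 2 * (x$gH * y$gE - x$gE * y$gH)
   | gH \<Rightarrow> x$gE * y$gF - x$gF * y$gE
   | gQ \<Rightarrow> (x$gF * y$gP - x$gP * y$gF) - (x$gH * y$gQ - x$gQ * y$gH)
   | gP \<Rightarrow> (x$gE * y$gQ - x$gQ * y$gE) + (x$gH * y$gP - x$gP * y$gH)
   | gZ \<Rightarrow> x$gP * y$gQ - x$gQ * y$gP)"
  apply (simp add: vec_eq_iff)
  apply (intro allI)
  subgoal for i by (cases i) (simp_all add: bracket_def sum_gen axis_def algebra_simps)
  done

lemma bracket_jacobi:
  "bracket x (bracket y z) + bracket y (bracket z x) + bracket z (bracket x y) = 0"
  apply (simp add: vec_eq_iff)
  apply (intro allI)
  subgoal for i by (cases i) (simp_all add: bracket_coords algebra_simps)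
  done

abbreviation schrodinger :: "schr set" where
  "schrodinger \<equiv> UNIV"

definition age1 :: "schr set" where
  "age1 = vec.span {bas gE, bas gH, bas gP, bas gQ, bas gZ}"

definition heis :: "schr set" where
  "heis = vec.span {bas gP, bas gQ, bas gZ}"

definition sl2 :: "schr set" where
  "sl2 = vec.span {bas gE, bas gF, bas gH}"

text \<open>In what follows, \<open>L\<close> and \<open>K\<close> range over Lie subalgebras of the Schroedinger algebra.\<close>

definition lie_module :: "schr set \<Rightarrow> (schr, 'm) rep \<Rightarrow> bool" where
  "lie_module L M \<longleftrightarrow> Module.module \<CC> M \<and>
     (\<forall>x\<in>L. \<forall>v\<in>carrier M. act M x v \<in> carrier M) \<and>
     (\<forall>x\<in>L. \<forall>u\<in>carrier M. \<forall>v\<in>carrier M. act M x (u \<oplus>\<^bsub>M\<^esub> v) = act M x u \<oplus>\<^bsub>M\<^esub> act M x v) \<and>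
     (\<forall>x\<in>L. \<forall>c. \<forall>v\<in>carrier M. act M x (c \<odot>\<^bsub>M\<^esub> v) = c \<odot>\<^bsub>M\<^esub> act M x v) \<and>
     (\<forall>x\<in>L. \<forall>y\<in>L. \<forall>v\<in>carrier M. act M (x + y) v = act M x v \<oplus>\<^bsub>M\<^esub> act M y v) \<and>
     (\<forall>x\<in>L. \<forall>c. \<forall>v\<in>carrier M. act M (c *s x) v = c \<odot>\<^bsub>M\<^esub> act M x v) \<and>
     (\<forall>x\<in>L. \<forall>y\<in>L. \<forall>v\<in>carrier M.
        act M (bracket x y) v = act M x (act M y v) \<ominus>\<^bsub>M\<^esub> act M y (act M x v))"

definition simple_module :: "schr set \<Rightarrow> (schr, 'm) rep \<Rightarrow> bool" where
  "simple_module L M \<longleftrightarrow> lie_module L M \<and> irreducible_rep L M"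

definition simple_quotient :: "schr set \<Rightarrow> (schr, 'm) rep \<Rightarrow> 'm set \<Rightarrow> bool" where
  "simple_quotient L M N \<longleftrightarrow> subrep L M N \<and> simple_module L (quot_rep M N)"

definition has_unique_simple_quotient :: "schr set \<Rightarrow> (schr, 'm) rep \<Rightarrow> bool" where
  "has_unique_simple_quotient L M \<longleftrightarrow> (\<exists>!N. simple_quotient L M N)"

text \<open>Meaningful if \<^const>\<open>has_unique_simple_quotient\<close> holds.\<close>

definition the_simple_quotient :: "schr set \<Rightarrow> (schr, 'm) rep \<Rightarrow> (schr, 'm set) rep" where
  "the_simple_quotient L M = quot_rep M (THE N. simple_quotient L M N)"

definition weight_module :: "(schr, 'm) rep \<Rightarrow> bool" where
  "weight_module M \<longleftrightarrow>
     lin_span M {v \<in> carrier M. \<exists>\<mu>. act M (bas gH) v = \<mu> \<odot>\<^bsub>M\<^esub> v} = carrier M"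

definition highest_weight_module :: "schr set \<Rightarrow> (schr, 'm) rep \<Rightarrow> bool" where
  "highest_weight_module L M \<longleftrightarrow> lie_module L M \<and>
     (\<exists>w\<in>carrier M. w \<noteq> \<zero>\<^bsub>M\<^esub> \<and>
        (\<exists>\<mu>. act M (bas gH) w = \<mu> \<odot>\<^bsub>M\<^esub> w) \<and> (\<exists>\<zeta>. act M (bas gZ) w = \<zeta> \<odot>\<^bsub>M\<^esub> w) \<and>
        act M (bas gE) w = \<zero>\<^bsub>M\<^esub> \<and> act M (bas gP) w = \<zero>\<^bsub>M\<^esub> \<and>
        (\<forall>N. subrep L M N \<and> w \<in> N \<longrightarrow> N = carrier M))"


section \<open>Universal enveloping algebras and induced modules\<close>

definition uea_rels :: "schr set \<Rightarrow> (schr word \<Rightarrow>\<^sub>0 complex) set" where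
  "uea_rels L =
     {letter (x + y) - letter x - letter y | x y. x \<in> L \<and> y \<in> L} \<union>
     {letter (c *s x) - const c * letter x | c x. x \<in> L} \<union>
     {letter x * letter y - letter y * letter x - letter (bracket x y) | x y. x \<in> L \<and> y \<in> L}"

definition uea_ideal :: "schr set \<Rightarrow> (schr word \<Rightarrow>\<^sub>0 complex) set" where
  "uea_ideal L = Idl\<^bsub>free_alg L\<^esub> (uea_rels L)"

definition uea :: "schr set \<Rightarrow> (schr word \<Rightarrow>\<^sub>0 complex) set ring" where
  "uea L = free_alg L Quot uea_ideal L"

definition uea_class :: "schr set \<Rightarrow> (schr word \<Rightarrow>\<^sub>0 complex) \<Rightarrow> (schr word \<Rightarrow>\<^sub>0 complex) set" where
  "uea_class L y = uea_ideal L +>\<^bsub>free_alg L\<^esub> y"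

definition uea_space :: "schr set \<Rightarrow> (complex, (schr word \<Rightarrow>\<^sub>0 complex) set) module" where
  "uea_space L = ring.extend (uea L)
     \<lparr>smult = (\<lambda>c u. uea_class L (const c) \<otimes>\<^bsub>uea L\<^esub> u)\<rparr>"

text \<open>
  For \<open>Y\<close> in the enveloping algebra of \<open>K \<subseteq> L\<close>, the following are the image of \<open>Y\<close> in the
  enveloping algebra of \<open>L\<close> and the action of \<open>Y\<close> on a \<open>K\<close>-module; both are computed on
  representatives in the free algebra and do not depend on the choice of these.
\<close>

definition uea_incl ::
    "schr set \<Rightarrow> (schr word \<Rightarrow>\<^sub>0 complex) set \<Rightarrow> (schr word \<Rightarrow>\<^sub>0 complex) set" where
  "uea_incl L Y = the_elem (uea_class L ` Y)"

definition free_act :: "('x, 'm) rep \<Rightarrow> ('x word \<Rightarrow>\<^sub>0 complex) \<Rightarrow> 'm \<Rightarrow> 'm" where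
  "free_act M y v = (\<Oplus>\<^bsub>M\<^esub>w\<in>Poly_Mapping.keys y.
     Poly_Mapping.lookup y w \<odot>\<^bsub>M\<^esub> foldr (act M) (letters w) v)"

definition uea_act :: "(schr, 'm) rep \<Rightarrow> (schr word \<Rightarrow>\<^sub>0 complex) set \<Rightarrow> 'm \<Rightarrow> 'm" where
  "uea_act M Y v = the_elem ((\<lambda>y. free_act M y v) ` Y)"

definition Ind :: "schr set \<Rightarrow> schr set \<Rightarrow> (schr, 'm) rep \<Rightarrow>
    (schr, (((schr word \<Rightarrow>\<^sub>0 complex) set \<times> 'm) \<Rightarrow>\<^sub>0 complex) set) rep" where
  "Ind L K V = tensor_rep (uea_space L) V
     {((u \<otimes>\<^bsub>uea L\<^esub> uea_incl L Y, v), (u, uea_act V Y v)) |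
        u Y v. u \<in> carrier (uea L) \<and> Y \<in> carrier (uea K) \<and> v \<in> carrier V}
     (\<lambda>x (u, v). Poly_Mapping.single (uea_class L (letter x) \<otimes>\<^bsub>uea L\<^esub> u, v) 1)"

abbreviation H_ind where
  "H_ind V \<equiv> Ind schrodinger age1 V"

definition lie_tensor :: "(schr, 'm) rep \<Rightarrow> (schr, 'n) rep \<Rightarrow>
    (schr, (('m \<times> 'n) \<Rightarrow>\<^sub>0 complex) set) rep" where
  "lie_tensor M N = tensor_rep M N {}
     (\<lambda>x (m, n). Poly_Mapping.single (act M x m, n) 1 + Poly_Mapping.single (m, act N x n) 1)"


section \<open>Verma modules and extensions to the Schroedinger algebra\<close>

definition one_dim :: "(schr \<Rightarrow> complex) \<Rightarrow> (schr, complex) rep" where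
  "one_dim \<theta> = \<lparr>carrier = UNIV, mult = (*), one = 1, zero = 0, add = (+), smult = (*),
     act = (\<lambda>x c. \<theta> x * c)\<rparr>"

abbreviation lowest_verma_age1 where
  "lowest_verma_age1 zdot hdot \<equiv>
     Ind age1 (vec.span {bas gH, bas gZ, bas gQ}) (one_dim (\<lambda>x. x $ gH * hdot + x $ gZ * zdot))"

abbreviation lowest_simple_age1 where
  "lowest_simple_age1 zdot hdot \<equiv> the_simple_quotient age1 (lowest_verma_age1 zdot hdot)"

abbreviation lowest_verma_heis where
  "lowest_verma_heis zdot \<equiv> Ind heis (vec.span {bas gQ, bas gZ}) (one_dim (\<lambda>x. x $ gZ * zdot))"

abbreviation verma_sl2 where
  "verma_sl2 \<mu> \<equiv> Ind sl2 (vec.span {bas gE, bas gH}) (one_dim (\<lambda>x. x $ gH * \<mu>))"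

abbreviation simple_sl2 where
  "simple_sl2 \<mu> \<equiv> the_simple_quotient sl2 (verma_sl2 \<mu>)"

definition basis_act :: "(complex, 'm, 'z) module_scheme \<Rightarrow> (gen \<Rightarrow> 'm \<Rightarrow> 'm) \<Rightarrow> schr \<Rightarrow> 'm \<Rightarrow> 'm" where
  "basis_act M g x v = (\<Oplus>\<^bsub>M\<^esub>b\<in>UNIV. (x $ b) \<odot>\<^bsub>M\<^esub> g b v)"

definition extend_heis :: "complex \<Rightarrow> (schr, 'm) rep \<Rightarrow> (schr, 'm) rep" where
  "extend_heis zdot V = V\<lparr>act := basis_act V (\<lambda>b v.
     case b of
       gE \<Rightarrow> (1 / (2 * zdot)) \<odot>\<^bsub>V\<^esub> act V (bas gP) (act V (bas gP) v)
     | gF \<Rightarrow> (- 1 / (2 * zdot)) \<odot>\<^bsub>V\<^esub> act V (bas gQ) (act V (bas gQ) v)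
     | gH \<Rightarrow> (- 1 / zdot) \<odot>\<^bsub>V\<^esub> act V (bas gP) (act V (bas gQ) v) \<oplus>\<^bsub>V\<^esub> (1 / 2) \<odot>\<^bsub>V\<^esub> v
     | _ \<Rightarrow> act V (bas b) v)\<rparr>"

definition extend_sl2 :: "(schr, 'm) rep \<Rightarrow> (schr, 'm) rep" where
  "extend_sl2 W = W\<lparr>act := basis_act W (\<lambda>b v.
     if b \<in> {gP, gQ, gZ} then \<zero>\<^bsub>W\<^esub> else act W (bas b) v)\<rparr>"


section \<open>Modules on Laurent polynomials\<close>

text \<open>
  \<open>int \<Rightarrow>\<^sub>0 complex\<close> is the ring of Laurent polynomials in \<open>x\<close>; \<open>mon i\<close> is the \<open>i\<close>-th power of \<open>x\<close>.
\<close>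

abbreviation mon :: "int \<Rightarrow> (int \<Rightarrow>\<^sub>0 complex)" where
  "mon i \<equiv> Poly_Mapping.single i 1"

definition laurent :: "(complex, int \<Rightarrow>\<^sub>0 complex) module" where
  "laurent = \<lparr>carrier = UNIV, mult = (*), one = 1, zero = 0, add = (+), smult = scale\<rparr>"

definition laurent_rep :: "(gen \<Rightarrow> int \<Rightarrow> (int \<Rightarrow>\<^sub>0 complex)) \<Rightarrow> (schr, int \<Rightarrow>\<^sub>0 complex) rep" where
  "laurent_rep g = module.extend laurent \<lparr>act = basis_act laurent (\<lambda>b. lin_ext (g b))\<rparr>"

text \<open>
  \<open>G_heis\<close> is a module over \<^const>\<open>heis\<close> only, and \<open>Q_age1\<close>, \<open>Q'_age1\<close> are modules over
  \<^const>\<open>age1\<close> only: the coordinates at the remaining basis elements vanish there, so the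
  values \<open>0\<close> assigned to these elements play no role.
\<close>

definition G_heis :: "complex \<Rightarrow> complex \<Rightarrow> (schr, int \<Rightarrow>\<^sub>0 complex) rep" where
  "G_heis zdot lam = laurent_rep (\<lambda>b i. case b of
       gQ \<Rightarrow> mon (i + 1)
     | gP \<Rightarrow> scale (zdot * (lam + of_int i)) (mon (i - 1))
     | gZ \<Rightarrow> scale zdot (mon i)
     | _ \<Rightarrow> 0)"

definition Q_age1 :: "complex \<Rightarrow> complex \<Rightarrow> (schr, int \<Rightarrow>\<^sub>0 complex) rep" where
  "Q_age1 lam hdot = laurent_rep (\<lambda>b i. case b of
       gQ \<Rightarrow> mon (i + 1)
     | gE \<Rightarrow> scale lam (mon (i - 2))
     | gH \<Rightarrow> scale (hdot - of_int i) (mon i)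
     | _ \<Rightarrow> 0)"

definition Q'_age1 :: "complex \<Rightarrow> complex \<Rightarrow> complex \<Rightarrow> (schr, int \<Rightarrow>\<^sub>0 complex) rep" where
  "Q'_age1 zdot hdot lam = laurent_rep (\<lambda>b i. case b of
       gQ \<Rightarrow> mon (i + 1)
     | gP \<Rightarrow> scale (zdot * (lam + of_int i)) (mon (i - 1))
     | gZ \<Rightarrow> scale zdot (mon i)
     | gH \<Rightarrow> scale (hdot - of_int i) (mon i)
     | gE \<Rightarrow> scale (zdot / 2 * (lam + of_int i) * (lam + of_int i - 1)) (mon (i - 2))
     | gF \<Rightarrow> 0)"


section \<open>The Weyl algebra and the modules built from its subalgebras\<close>

datatype weyl_gen = wT | wD

type_synonym weyl_elem = "(weyl_gen word \<Rightarrow>\<^sub>0 complex) set"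

definition weyl_ideal :: weyl_elem where
  "weyl_ideal = Idl\<^bsub>free_alg UNIV\<^esub> {letter wD * letter wT - letter wT * letter wD - 1}"

definition weyl :: "weyl_elem ring" where
  "weyl = free_alg UNIV Quot weyl_ideal"

definition weyl_class :: "(weyl_gen word \<Rightarrow>\<^sub>0 complex) \<Rightarrow> weyl_elem" where
  "weyl_class y = weyl_ideal +>\<^bsub>free_alg UNIV\<^esub> y"

abbreviation weyl_t :: weyl_elem where
  "weyl_t \<equiv> weyl_class (letter wT)"

abbreviation weyl_td :: weyl_elem where
  "weyl_td \<equiv> weyl_class (letter wT * letter wD)"

abbreviation weyl_ttd :: weyl_elem where
  "weyl_ttd \<equiv> weyl_class (letter wT * letter wT * letter wD)"

text \<open>Including the scalars among the generators yields the generated complex subalgebra.\<close>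

definition R_alg :: "complex \<Rightarrow> weyl_elem set" where
  "R_alg zdot = generate_ring weyl
     (range (\<lambda>c. weyl_class (const c)) \<union> {weyl_t, if zdot = 0 then weyl_ttd else weyl_td})"

definition alg_module :: "weyl_elem set \<Rightarrow> (weyl_elem, 'm) rep \<Rightarrow> bool" where
  "alg_module R N \<longleftrightarrow> Module.module \<CC> N \<and>
     (\<forall>r\<in>R. \<forall>v\<in>carrier N. act N r v \<in> carrier N) \<and>
     (\<forall>r\<in>R. \<forall>u\<in>carrier N. \<forall>v\<in>carrier N. act N r (u \<oplus>\<^bsub>N\<^esub> v) = act N r u \<oplus>\<^bsub>N\<^esub> act N r v) \<and>
     (\<forall>r\<in>R. \<forall>s\<in>R. \<forall>v\<in>carrier N. act N (r \<oplus>\<^bsub>weyl\<^esub> s) v = act N r v \<oplus>\<^bsub>N\<^esub> act N s v) \<and>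
     (\<forall>r\<in>R. \<forall>s\<in>R. \<forall>v\<in>carrier N. act N (r \<otimes>\<^bsub>weyl\<^esub> s) v = act N r (act N s v)) \<and>
     (\<forall>c. \<forall>v\<in>carrier N. act N (weyl_class (const c)) v = c \<odot>\<^bsub>N\<^esub> v)"

definition simple_alg_module :: "weyl_elem set \<Rightarrow> (weyl_elem, 'm) rep \<Rightarrow> bool" where
  "simple_alg_module R N \<longleftrightarrow> alg_module R N \<and> irreducible_rep R N"

text \<open>
  The actions of \<open>1/t\<close> and of \<open>d/dt\<close> on a module on which \<open>t\<close> acts bijectively. Both subalgebras
  contain the square of \<open>t\<close> times \<open>d/dt\<close>, so that in the localization \<open>d/dt\<close> is this element
  divided by the square of \<open>t\<close>.
\<close>

definition t_inv :: "(weyl_elem, 'm) rep \<Rightarrow> 'm \<Rightarrow> 'm" where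
  "t_inv N v = (THE w. w \<in> carrier N \<and> act N weyl_t w = v)"

definition d_dt :: "(weyl_elem, 'm) rep \<Rightarrow> 'm \<Rightarrow> 'm" where
  "d_dt N v = t_inv N (t_inv N (act N weyl_ttd v))"

text \<open>The basis element \<open>b\<close> sends \<open>v \<otimes> x^i\<close> to \<open>(op b i v) \<otimes> x^(i + shift b)\<close>.\<close>

definition shift :: "gen \<Rightarrow> int" where
  "shift b = (case b of gF \<Rightarrow> 2 | gQ \<Rightarrow> 1 | gH \<Rightarrow> 0 | gE \<Rightarrow> -2 | gP \<Rightarrow> -1 | gZ \<Rightarrow> 0)"

definition laurent_tensor :: "(weyl_elem, 'm) rep \<Rightarrow> (gen \<Rightarrow> int \<Rightarrow> 'm \<Rightarrow> 'm) \<Rightarrow>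
    (schr, (('m \<times> (int \<Rightarrow>\<^sub>0 complex)) \<Rightarrow>\<^sub>0 complex) set) rep" where
  "laurent_tensor N op = tensor_rep N laurent {} (\<lambda>x (v, g).
     \<Sum>b\<in>UNIV. scale (x $ b) (lin_ext (\<lambda>i. Poly_Mapping.single (op b i v, mon (i + shift b)) 1) g))"

definition N_op :: "complex \<Rightarrow> complex \<Rightarrow> (weyl_elem, 'm) rep \<Rightarrow> gen \<Rightarrow> int \<Rightarrow> 'm \<Rightarrow> 'm" where
  "N_op zdot hdot N b i v = (case b of
       gH \<Rightarrow> (hdot - of_int i) \<odot>\<^bsub>N\<^esub> v
     | gZ \<Rightarrow> zdot \<odot>\<^bsub>N\<^esub> v
     | gQ \<Rightarrow> v
     | gP \<Rightarrow>
        (if zdot = 0 then act N weyl_t v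
         else (2 * zdot) \<odot>\<^bsub>N\<^esub> act N weyl_td v \<oplus>\<^bsub>N\<^esub> ((of_int i - 1) * zdot) \<odot>\<^bsub>N\<^esub> v)
     | gE \<Rightarrow>
        (if zdot = 0 then act N weyl_ttd v \<oplus>\<^bsub>N\<^esub> (of_int i - 2) \<odot>\<^bsub>N\<^esub> act N weyl_t v
         else act N weyl_t v
            \<oplus>\<^bsub>N\<^esub> ((2 * of_int i - 3) * zdot) \<odot>\<^bsub>N\<^esub> act N weyl_td v
            \<oplus>\<^bsub>N\<^esub> (2 * zdot) \<odot>\<^bsub>N\<^esub> act N weyl_td (act N weyl_td v)
            \<oplus>\<^bsub>N\<^esub> ((of_int i - 1) * (of_int i - 2) / 2 * zdot) \<odot>\<^bsub>N\<^esub> v)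
     | gF \<Rightarrow> \<zero>\<^bsub>N\<^esub>)"

definition f_op :: "complex \<Rightarrow> complex \<Rightarrow> complex \<Rightarrow> (weyl_elem, 'm) rep \<Rightarrow> 'm \<Rightarrow> 'm" where
  "f_op cdot zdot hdot N v =
     (if zdot = 0 then
        d_dt N v \<oplus>\<^bsub>N\<^esub> (hdot - 2) \<odot>\<^bsub>N\<^esub> t_inv N v \<oplus>\<^bsub>N\<^esub> cdot \<odot>\<^bsub>N\<^esub> t_inv N (t_inv N v)
      else
        (- 1 / (2 * zdot)) \<odot>\<^bsub>N\<^esub> v
          \<ominus>\<^bsub>N\<^esub> (hdot - 1 / 2) \<odot>\<^bsub>N\<^esub> d_dt N v
          \<ominus>\<^bsub>N\<^esub> act N weyl_t (d_dt N (d_dt N v))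
          \<ominus>\<^bsub>N\<^esub> ((hdot - 1) * (hdot - 2) / 4 + cdot / (2 * zdot)) \<odot>\<^bsub>N\<^esub> t_inv N v)"

definition N_age1 :: "complex \<Rightarrow> complex \<Rightarrow> (weyl_elem, 'm) rep \<Rightarrow>
    (schr, (('m \<times> (int \<Rightarrow>\<^sub>0 complex)) \<Rightarrow>\<^sub>0 complex) set) rep" where
  "N_age1 zdot hdot N = laurent_tensor N (N_op zdot hdot N)"

definition N_schr :: "complex \<Rightarrow> complex \<Rightarrow> complex \<Rightarrow> (weyl_elem, 'm) rep \<Rightarrow>
    (schr, (('m \<times> (int \<Rightarrow>\<^sub>0 complex)) \<Rightarrow>\<^sub>0 complex) set) rep" where
  "N_schr cdot zdot hdot N = laurent_tensor N
     (\<lambda>b i v. if b = gF then f_op cdot zdot hdot N v else N_op zdot hdot N b i v)"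

end

theory Submission
  imports
    "HOL-Computational_Algebra.Fundamental_Theorem_Algebra"
    "HOL-Analysis.Continuum_Not_Denumerable"
    Defs
begin

text \<open>
  Writing \<open>H(V)\<close> as sums of \<open>f\<^sup>k v\<close> and comparing it with the sequences of vectors of \<open>V\<close> shows that
  these sums are direct. (a) A highest weight vector of \<open>V\<close> generates \<open>H(V)\<close>, which is graded by
  \<open>h\<close>-weight with one-dimensional top, so all proper submodules lie in a largest one.
  (c) When \<open>p V = 0\<close>, the element \<open>p\<close> lowers the degree in \<open>f\<close> and acts there through \<open>q\<close>, which is
  injective; hence every nonzero submodule meets \<open>V\<close>.
  (b), (d) Here \<open>V\<close> is the restriction of a simple Heisenberg module \<open>M\<close> with shifted \<open>h\<close>. The map
  \<open>V \<rightarrow> M \<otimes> (highest weight space of the Verma module)\<close> extends to an isomorphism from \<open>H(V)\<close>. Since \<open>pq\<close>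
  has simple spectrum on \<open>M\<close> and \<open>p, q\<close> act on \<open>M\<close> only, the submodules of \<open>M \<otimes> W\<close> are the \<open>M \<otimes> W'\<close>.
  (e) On a simple quotient of \<open>H(V)\<close>, which has countable dimension, the central element
  \<open>f p\<^sup>2 - h p q - e q\<^sup>2 - z (2 f e + (h\<^sup>2 + h) / 2)\<close> is a scalar. As \<open>p\<^sup>2 - 2 z e\<close> maps the image of \<open>V\<close>
  onto itself, this scalar determines \<open>f\<close> on that image, which is therefore the whole quotient.
\<close>

section \<open>Complex vector spaces and linear functionals\<close>

text \<open>For \<open>z \<noteq> 0\<close> the elements \<open>e - p^2/(2z)\<close>,
  \<open>f + q^2/(2z)\<close>, \<open>h + pq/z - 1/2\<close> commute with \<open>p\<close> and
  \<open>q\<close> and satisfy the relations of sl2. This is why modules with nonzero central charge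
  split into a Heisenberg factor and an sl2 factor, and it is the origin of the cubic central
  element: up to an added multiple of \<open>z\<close> it is \<open>-z\<close> times the Casimir
  element of this triple, which leaves no denominators and so makes sense for \<open>z = 0\<close>
  too. The main obstacle is that enveloping algebras are given by generators and relations only, so
  that no basis of an induced module is known beforehand. Spanning statements come from moving
  elements past \<open>f\<close>. Nonvanishing statements come from homomorphisms into modules with
  explicit operators, which the universal property provides. The countable-dimension argument serves
  twice: for the central element, and to exclude that \<open>t\<close> acts on \<open>N\<close> by
  zero, on which the inversion of \<open>t\<close> rests.\<close>

abbreviation cmod :: "(complex, 'm, 'z) module_scheme \<Rightarrow> bool" where
  "cmod M \<equiv> Module.module \<CC> M"

lemma CC_simps [simp]:
  "carrier \<CC> = UNIV" "mult \<CC> = (*)" "one \<CC> = 1" "zero \<CC> = 0" "add \<CC> = (+)"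
  by (simp_all add: \<CC>_def)

lemma cring_CC: "cring \<CC>"
proof (rule cringI)
  show "abelian_group \<CC>"
    by (rule abelian_groupI) (auto simp: algebra_simps intro: exI[of _ "- x" for x])
  show "comm_monoid \<CC>"
    by (rule comm_monoidI) (auto simp: algebra_simps)
qed (auto simp: algebra_simps)

lemma CC_a_inv [simp]: "\<ominus>\<^bsub>\<CC>\<^esub> c = - c"
proof -
  interpret cring \<CC> by (rule cring_CC)
  show ?thesis using minus_equality[of "- c" c] by simp
qed

lemma cmodI:
  assumes "\<And>u v. u \<in> carrier M \<Longrightarrow> v \<in> carrier M \<Longrightarrow> u \<oplus>\<^bsub>M\<^esub> v \<in> carrier M"
    and "\<zero>\<^bsub>M\<^esub> \<in> carrier M"
    and "\<And>c v. v \<in> carrier M \<Longrightarrow> c \<odot>\<^bsub>M\<^esub> v \<in> carrier M"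
    and "\<And>u v w. u \<in> carrier M \<Longrightarrow> v \<in> carrier M \<Longrightarrow> w \<in> carrier M \<Longrightarrow>
        u \<oplus>\<^bsub>M\<^esub> v \<oplus>\<^bsub>M\<^esub> w = u \<oplus>\<^bsub>M\<^esub> (v \<oplus>\<^bsub>M\<^esub> w)"
    and "\<And>u v. u \<in> carrier M \<Longrightarrow> v \<in> carrier M \<Longrightarrow> u \<oplus>\<^bsub>M\<^esub> v = v \<oplus>\<^bsub>M\<^esub> u"
    and z: "\<And>v. v \<in> carrier M \<Longrightarrow> \<zero>\<^bsub>M\<^esub> \<oplus>\<^bsub>M\<^esub> v = v"
    and n: "\<And>v. v \<in> carrier M \<Longrightarrow> (-1) \<odot>\<^bsub>M\<^esub> v \<oplus>\<^bsub>M\<^esub> v = \<zero>\<^bsub>M\<^esub>"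
    and "\<And>c d v. v \<in> carrier M \<Longrightarrow> (c + d) \<odot>\<^bsub>M\<^esub> v = c \<odot>\<^bsub>M\<^esub> v \<oplus>\<^bsub>M\<^esub> d \<odot>\<^bsub>M\<^esub> v"
    and "\<And>c u v. u \<in> carrier M \<Longrightarrow> v \<in> carrier M \<Longrightarrow>
        c \<odot>\<^bsub>M\<^esub> (u \<oplus>\<^bsub>M\<^esub> v) = c \<odot>\<^bsub>M\<^esub> u \<oplus>\<^bsub>M\<^esub> c \<odot>\<^bsub>M\<^esub> v"
    and "\<And>c d v. v \<in> carrier M \<Longrightarrow> (c * d) \<odot>\<^bsub>M\<^esub> v = c \<odot>\<^bsub>M\<^esub> (d \<odot>\<^bsub>M\<^esub> v)"
    and "\<And>v. v \<in> carrier M \<Longrightarrow> 1 \<odot>\<^bsub>M\<^esub> v = v"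
  shows "cmod M"
proof (rule moduleI)
  show "abelian_group M"
  proof (rule abelian_groupI)
    fix v assume "v \<in> carrier M"
    then show "\<exists>u\<in>carrier M. u \<oplus>\<^bsub>M\<^esub> v = \<zero>\<^bsub>M\<^esub>" using n assms(3) by blast
  qed (use assms in auto)
qed (use assms cring_CC in auto)

definition lmap ::
    "(complex, 'm, 'y) module_scheme \<Rightarrow> (complex, 'n, 'z) module_scheme \<Rightarrow> ('m \<Rightarrow> 'n) \<Rightarrow> bool" where
  "lmap M M' \<phi> \<longleftrightarrow> (\<forall>v\<in>carrier M. \<phi> v \<in> carrier M') \<and>
     (\<forall>u\<in>carrier M. \<forall>v\<in>carrier M. \<phi> (u \<oplus>\<^bsub>M\<^esub> v) = \<phi> u \<oplus>\<^bsub>M'\<^esub> \<phi> v) \<and>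
     (\<forall>c. \<forall>v\<in>carrier M. \<phi> (c \<odot>\<^bsub>M\<^esub> v) = c \<odot>\<^bsub>M'\<^esub> \<phi> v)"

definition cfun :: "(complex, 'm, 'y) module_scheme \<Rightarrow> ('m \<Rightarrow> complex) \<Rightarrow> bool" where
  "cfun M \<xi> \<longleftrightarrow> (\<forall>u\<in>carrier M. \<forall>v\<in>carrier M. \<xi> (u \<oplus>\<^bsub>M\<^esub> v) = \<xi> u + \<xi> v) \<and>
     (\<forall>c. \<forall>v\<in>carrier M. \<xi> (c \<odot>\<^bsub>M\<^esub> v) = c * \<xi> v)"

lemma lmapI:
  assumes "\<And>v. v \<in> carrier M \<Longrightarrow> \<phi> v \<in> carrier M'"
    and "\<And>u v. u \<in> carrier M \<Longrightarrow> v \<in> carrier M \<Longrightarrow> \<phi> (u \<oplus>\<^bsub>M\<^esub> v) = \<phi> u \<oplus>\<^bsub>M'\<^esub> \<phi> v"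
    and "\<And>c v. v \<in> carrier M \<Longrightarrow> \<phi> (c \<odot>\<^bsub>M\<^esub> v) = c \<odot>\<^bsub>M'\<^esub> \<phi> v"
  shows "lmap M M' \<phi>"
  using assms by (simp add: lmap_def)

lemma lmapD:
  assumes "lmap M M' \<phi>"
  shows lmap_closed: "v \<in> carrier M \<Longrightarrow> \<phi> v \<in> carrier M'"
    and lmap_add: "u \<in> carrier M \<Longrightarrow> v \<in> carrier M \<Longrightarrow> \<phi> (u \<oplus>\<^bsub>M\<^esub> v) = \<phi> u \<oplus>\<^bsub>M'\<^esub> \<phi> v"
    and lmap_smult: "v \<in> carrier M \<Longrightarrow> \<phi> (c \<odot>\<^bsub>M\<^esub> v) = c \<odot>\<^bsub>M'\<^esub> \<phi> v"
  using assms by (simp_all add: lmap_def)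

lemma cfunI:
  assumes "\<And>u v. u \<in> carrier M \<Longrightarrow> v \<in> carrier M \<Longrightarrow> \<xi> (u \<oplus>\<^bsub>M\<^esub> v) = \<xi> u + \<xi> v"
    and "\<And>c v. v \<in> carrier M \<Longrightarrow> \<xi> (c \<odot>\<^bsub>M\<^esub> v) = c * \<xi> v"
  shows "cfun M \<xi>"
  using assms by (simp add: cfun_def)

lemma cfun_add: "cfun M \<xi> \<Longrightarrow> u \<in> carrier M \<Longrightarrow> v \<in> carrier M \<Longrightarrow> \<xi> (u \<oplus>\<^bsub>M\<^esub> v) = \<xi> u + \<xi> v"
  and cfun_smult: "cfun M \<xi> \<Longrightarrow> v \<in> carrier M \<Longrightarrow> \<xi> (c \<odot>\<^bsub>M\<^esub> v) = c * \<xi> v"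
  by (simp_all add: cfun_def)

lemma lmap_comp: "lmap M M' \<phi> \<Longrightarrow> lmap M' M'' \<psi> \<Longrightarrow> lmap M M'' (\<lambda>v. \<psi> (\<phi> v))"
  by (simp add: lmap_def)

lemma cfun_comp: "lmap M M' \<phi> \<Longrightarrow> cfun M' \<xi> \<Longrightarrow> cfun M (\<lambda>v. \<xi> (\<phi> v))"
  by (simp add: lmap_def cfun_def)

locale cvec = module \<CC> M for M :: "(complex, 'm, 'z) module_scheme" (structure)
begin

lemma smult_closed' [simp, intro]: "v \<in> carrier M \<Longrightarrow> c \<odot> v \<in> carrier M"
  by (rule smult_closed) auto

lemma minus_smult:
  assumes "v \<in> carrier M"
  shows "\<ominus> v = (-1) \<odot> v"
proof -
  have "(\<ominus>\<^bsub>\<CC>\<^esub> 1) \<odot> v = \<ominus> (1 \<odot> v)" by (rule smult_l_minus) (use assms in auto)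
  then show ?thesis using smult_one[OF assms] by (simp only: CC_a_inv CC_simps)
qed

lemma add_minus_smult: "v \<in> carrier M \<Longrightarrow> v \<oplus> (-1) \<odot> v = \<zero>"
  using M.r_neg[of v] by (simp only: minus_smult)

lemma diff_smult: "u \<in> carrier M \<Longrightarrow> v \<in> carrier M \<Longrightarrow> u \<ominus> v = u \<oplus> (-1) \<odot> v"
  by (simp add: a_minus_def minus_smult)

lemma zero_smult [simp]: "v \<in> carrier M \<Longrightarrow> 0 \<odot> v = \<zero>" "c \<odot> \<zero> = \<zero>"
  using smult_l_null[of v] smult_r_null[of c] by simp_all

lemma one_smult [simp]: "v \<in> carrier M \<Longrightarrow> 1 \<odot> v = v"
  using smult_one[of v] by simp

lemma smult_smult: "v \<in> carrier M \<Longrightarrow> c \<odot> (d \<odot> v) = (c * d) \<odot> v"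
  using smult_assoc1[of c d v] by simp

lemma smult_add_left: "v \<in> carrier M \<Longrightarrow> (c + d) \<odot> v = c \<odot> v \<oplus> d \<odot> v"
  using smult_l_distr[of c d v] by simp

lemma smult_add_right: "u \<in> carrier M \<Longrightarrow> v \<in> carrier M \<Longrightarrow> c \<odot> (u \<oplus> v) = c \<odot> u \<oplus> c \<odot> v"
  using smult_r_distr[of c u v] by simp

lemma smult_eq_zero: "v \<in> carrier M \<Longrightarrow> c \<odot> v = \<zero> \<Longrightarrow> c \<noteq> 0 \<Longrightarrow> v = \<zero>"
  using smult_smult[of v "inverse c" c] by simp

lemma diff_zero_iff: "u \<in> carrier M \<Longrightarrow> v \<in> carrier M \<Longrightarrow> u \<ominus> v = \<zero> \<longleftrightarrow> u = v"
  using M.minus_equality[of u "\<ominus> v"] M.r_neg[of v] by (auto simp: a_minus_def)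

lemma cfun_zero [simp]: "cfun M \<xi> \<Longrightarrow> \<xi> \<zero> = 0"
  using cfun_smult[of M \<xi> \<zero> 0] by simp

lemma cfun_neg [simp]: "cfun M \<xi> \<Longrightarrow> v \<in> carrier M \<Longrightarrow> \<xi> (\<ominus> v) = - \<xi> v"
  by (simp add: minus_smult cfun_smult)

lemma cfun_diff [simp]: "cfun M \<xi> \<Longrightarrow> u \<in> carrier M \<Longrightarrow> v \<in> carrier M \<Longrightarrow> \<xi> (u \<ominus> v) = \<xi> u - \<xi> v"
  by (simp add: a_minus_def cfun_add)

lemma cfun_finsum: "cfun M \<xi> \<Longrightarrow> f \<in> A \<rightarrow> carrier M \<Longrightarrow> \<xi> (finsum M f A) = (\<Sum>i\<in>A. \<xi> (f i))"
proof (induction A rule: infinite_finite_induct)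
  case (insert i A)
  then have "f \<in> A \<rightarrow> carrier M" "f i \<in> carrier M" by auto
  with insert show ?case by (simp add: cfun_add)
qed (simp_all add: finsum_infinite)

lemma diff_simps [simp]:
  assumes "v \<in> carrier M"
  shows "v \<ominus> \<zero> = v" "v \<ominus> v = \<zero>"
  using assms M.r_neg[OF assms] by (simp_all add: diff_smult add_minus_smult)

lemma submoduleI':
  assumes "H \<subseteq> carrier M" "\<zero> \<in> H" "\<And>u v. u \<in> H \<Longrightarrow> v \<in> H \<Longrightarrow> u \<oplus> v \<in> H"
    "\<And>c v. v \<in> H \<Longrightarrow> c \<odot> v \<in> H"
  shows "submodule H \<CC> M"
  by (rule submoduleI) (use assms in \<open>auto simp: minus_smult subset_iff\<close>)

lemma submoduleD:
  assumes "submodule H \<CC> M"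
  shows "H \<subseteq> carrier M" "\<And>v. v \<in> H \<Longrightarrow> v \<in> carrier M" "\<zero> \<in> H"
    "\<And>u v. u \<in> H \<Longrightarrow> v \<in> H \<Longrightarrow> u \<oplus> v \<in> H"
    "\<And>c v. v \<in> H \<Longrightarrow> c \<odot> v \<in> H" "\<And>u v. u \<in> H \<Longrightarrow> v \<in> H \<Longrightarrow> u \<ominus> v \<in> H"
proof -
  note E = submoduleE[OF assms]
  show 1: "H \<subseteq> carrier M" "\<And>v. v \<in> H \<Longrightarrow> v \<in> carrier M" using E by auto
  show 2: "\<And>u v. u \<in> H \<Longrightarrow> v \<in> H \<Longrightarrow> u \<oplus> v \<in> H"
    "\<And>c v. v \<in> H \<Longrightarrow> c \<odot> v \<in> H" using E by auto
  show "\<zero> \<in> H" using E(2) 1 2(2)[of _ 0] by fastforce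
  show "\<And>u v. u \<in> H \<Longrightarrow> v \<in> H \<Longrightarrow> u \<ominus> v \<in> H"
    using 1 2 by (simp add: diff_smult)
qed

lemma submodule_finsum:
  assumes "submodule H \<CC> M" "\<And>i. i \<in> A \<Longrightarrow> f i \<in> H"
  shows "finsum M f A \<in> H"
  using assms(2)
proof (induction A rule: infinite_finite_induct)
  case (insert i A)
  then have "f \<in> A \<rightarrow> carrier M" "f i \<in> carrier M" using submoduleD(2)[OF assms(1)] by auto
  with insert show ?case using submoduleD(4)[OF assms(1)] by simp
qed (simp_all add: finsum_infinite submoduleD[OF assms(1)])

end

lemma cvecI: "cmod M \<Longrightarrow> cvec M"
  by (simp add: cvec_def)

section \<open>Free vector spaces of finitely supported functions\<close>

lemma scale_lookup [simp]: "Poly_Mapping.lookup (scale c y) k = c * Poly_Mapping.lookup y k"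
  unfolding scale_def by (cases "Poly_Mapping.lookup y k = 0") (simp_all add: Poly_Mapping.map.rep_eq when_def)

lemma scale_simps [simp]:
  "scale c 0 = 0" "scale 0 y = 0" "scale 1 y = y" "scale c (scale d y) = scale (c * d) y"
  "scale c (Poly_Mapping.single k d) = Poly_Mapping.single k (c * d)"
  by (auto intro!: poly_mapping_eqI simp: lookup_single when_def)

lemma scale_distrib:
  "scale c (y + y') = scale c y + scale c y'" "scale (c + d) y = scale c y + scale d y"
  "scale c (y - y') = scale c y - scale c y'" "scale (-1) y = - y" "scale c (- y) = - scale c y"
  by (auto intro!: poly_mapping_eqI simp: lookup_add lookup_minus algebra_simps)

lemma scale_sum: "scale c (sum f A) = (\<Sum>i\<in>A. scale c (f i))"
  by (induction A rule: infinite_finite_induct) (simp_all add: scale_distrib)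

lemma keys_scale: "Poly_Mapping.keys (scale c y) \<subseteq> Poly_Mapping.keys y"
  by (auto simp: in_keys_iff)

lemma pm_induct [consumes 1, case_names zero add]:
  fixes y :: "'k \<Rightarrow>\<^sub>0 complex"
  assumes "Poly_Mapping.keys y \<subseteq> A" "P 0"
    and add: "\<And>k c y. k \<in> A \<Longrightarrow> Poly_Mapping.keys y \<subseteq> A \<Longrightarrow> P y \<Longrightarrow> P (Poly_Mapping.single k c + y)"
  shows "P y"
  using assms(1)
proof (induction y rule: update_induct)
  case const
  show ?case by (rule assms(2))
next
  case (update f a b)
  have "Poly_Mapping.update a b f = Poly_Mapping.single a b + f"
    using update(1) by (auto intro!: poly_mapping_eqI simp: lookup_update lookup_add lookup_single when_def in_keys_iff)
  moreover have "Poly_Mapping.keys f \<subseteq> A" "a \<in> A" using update by (auto simp: keys_update)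
  ultimately show ?case using update add by simp
qed

global_interpretation pmvs: vector_space "scale :: complex \<Rightarrow> ('k \<Rightarrow>\<^sub>0 complex) \<Rightarrow> _"
  by unfold_locales (simp_all add: scale_distrib)

text \<open>Linear extension with values in an abstract module; \<open>lin_ext\<close> is its
  counterpart for a free target.\<close>

definition lext :: "(complex, 'm, 'z) module_scheme \<Rightarrow> ('k \<Rightarrow> 'm) \<Rightarrow> ('k \<Rightarrow>\<^sub>0 complex) \<Rightarrow> 'm" where
  "lext X \<beta> y = (\<Oplus>\<^bsub>X\<^esub>k\<in>Poly_Mapping.keys y. Poly_Mapping.lookup y k \<odot>\<^bsub>X\<^esub> \<beta> k)"

context cvec
begin

lemma lext_superset:
  assumes "finite B" "Poly_Mapping.keys y \<subseteq> B" "\<beta> \<in> B \<rightarrow> carrier M"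
  shows "lext M \<beta> y = (\<Oplus>k\<in>B. Poly_Mapping.lookup y k \<odot> \<beta> k)"
  unfolding lext_def
  by (rule add.finprod_mono_neutral_cong_left)
    (use assms in \<open>auto simp: Pi_iff not_in_keys_iff_lookup_eq_zero subset_iff\<close>)

lemma lext_closed:
  assumes "\<beta> \<in> Poly_Mapping.keys y \<rightarrow> carrier M"
  shows "lext M \<beta> y \<in> carrier M"
  unfolding lext_def by (rule finsum_closed) (use assms in \<open>auto simp: Pi_iff\<close>)

lemma lext_cfun:
  assumes "cfun M \<xi>" "\<beta> \<in> Poly_Mapping.keys y \<rightarrow> carrier M"
  shows "\<xi> (lext M \<beta> y) = (\<Sum>k\<in>Poly_Mapping.keys y. Poly_Mapping.lookup y k * \<xi> (\<beta> k))"
  unfolding lext_def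
  by (subst cfun_finsum) (use assms in \<open>auto simp: Pi_iff cfun_smult intro!: sum.cong\<close>)

lemma lext_zero [simp]: "lext M \<beta> 0 = \<zero>"
  by (simp add: lext_def)

lemma lext_single:
  assumes "\<beta> k \<in> carrier M"
  shows "lext M \<beta> (Poly_Mapping.single k c) = c \<odot> \<beta> k"
  using assms by (cases "c = 0") (simp_all add: lext_def)

lemma lext_add:
  assumes "\<beta> \<in> Poly_Mapping.keys y \<rightarrow> carrier M" "\<beta> \<in> Poly_Mapping.keys y' \<rightarrow> carrier M"
  shows "lext M \<beta> (y + y') = lext M \<beta> y \<oplus> lext M \<beta> y'"
proof -
  let ?B = "Poly_Mapping.keys y \<union> Poly_Mapping.keys y'"
  have B: "finite ?B" "\<beta> \<in> ?B \<rightarrow> carrier M" using assms by auto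
  have *: "lext M \<beta> x = (\<Oplus>k\<in>?B. Poly_Mapping.lookup x k \<odot> \<beta> k)" if "Poly_Mapping.keys x \<subseteq> ?B" for x
    by (rule lext_superset[OF B(1) that B(2)])
  have "lext M \<beta> (y + y') = (\<Oplus>k\<in>?B. Poly_Mapping.lookup y k \<odot> \<beta> k \<oplus> Poly_Mapping.lookup y' k \<odot> \<beta> k)"
    unfolding *[OF keys_add]
    by (rule finsum_cong') (use B in \<open>auto simp: lookup_add smult_add_left Pi_iff\<close>)
  also have "\<dots> = lext M \<beta> y \<oplus> lext M \<beta> y'"
    unfolding *[OF Un_upper1] *[OF Un_upper2]
    by (rule finsum_addf) (use B in \<open>auto simp: Pi_iff\<close>)
  finally show ?thesis .
qed

lemma lext_scale:
  assumes "\<beta> \<in> Poly_Mapping.keys y \<rightarrow> carrier M"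
  shows "lext M \<beta> (scale c y) = c \<odot> lext M \<beta> y"
proof -
  have "lext M \<beta> (scale c y) = (\<Oplus>k\<in>Poly_Mapping.keys y. c \<odot> (Poly_Mapping.lookup y k \<odot> \<beta> k))"
    by (subst lext_superset[OF _ keys_scale assms], simp, rule finsum_cong')
      (use assms in \<open>auto simp: Pi_iff smult_smult\<close>)
  also have "\<dots> = c \<odot> lext M \<beta> y"
    unfolding lext_def by (rule finsum_smult_ldistr[symmetric]) (use assms in auto)
  finally show ?thesis .
qed

text \<open>Linear algebra for types is available on the free vector space over the elements of the
  carrier, not on the carrier itself. The formal element \<open>w\<close> lies outside the kernel
  \<open>?S\<close> of the evaluation map, so it can be added to a basis of \<open>?S\<close>; a
  functional that is 1 at \<open>w\<close> and 0 on that basis kills \<open>?S\<close>. It is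
  additive and homogeneous on the carrier because the corresponding formal differences evaluate to
  zero.\<close>

lemma cfun_separates:
  assumes w: "w \<in> carrier M" "w \<noteq> \<zero>"
  obtains \<xi> where "cfun M \<xi>" "\<xi> w \<noteq> 0"
proof -
  let ?ev = "lext M id"
  let ?S = "{y. Poly_Mapping.keys y \<subseteq> carrier M \<and> ?ev y = \<zero>}"
  have K: "id \<in> Poly_Mapping.keys y \<rightarrow> carrier M" if "Poly_Mapping.keys y \<subseteq> carrier M" for y :: "'m \<Rightarrow>\<^sub>0 complex"
    using that by auto
  have ev: "?ev (Poly_Mapping.single v c) = c \<odot> v" if "v \<in> carrier M" for v c
    using that by (simp add: lext_single)
  have S: "pmvs.subspace ?S"
    unfolding pmvs.subspace_def
  proof (intro conjI ballI allI)
    fix x y c assume x: "x \<in> ?S"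
    then show "scale c x \<in> ?S" using keys_scale[of c x] by (auto simp: lext_scale K)
    assume y: "y \<in> ?S"
    then show "x + y \<in> ?S" using x keys_add[of x y] by (auto simp: lext_add K)
  qed simp
  obtain B where B: "B \<subseteq> ?S" "pmvs.independent B" "?S \<subseteq> pmvs.span B"
    using pmvs.maximal_independent_subset[of ?S] by blast
  have "pmvs.span B = ?S"
    using B S by (simp add: pmvs.span_subspace)
  moreover have "Poly_Mapping.single w 1 \<notin> ?S"
    using w by (simp add: lext_single)
  ultimately have ind: "pmvs.independent (insert (Poly_Mapping.single w 1) B)"
    using B(2) by (simp add: pmvs.independent_insertI)
  interpret vector_space_pair "scale :: complex \<Rightarrow> ('m \<Rightarrow>\<^sub>0 complex) \<Rightarrow> _" "(*) :: complex \<Rightarrow> complex \<Rightarrow> complex"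
    by unfold_locales (simp_all add: algebra_simps)
  obtain g where g: "Vector_Spaces.linear scale (*) g"
    "\<forall>x\<in>insert (Poly_Mapping.single w 1) B. g x = (if x = Poly_Mapping.single w 1 then 1 else 0)"
    using linear_independent_extend[OF ind, of "\<lambda>x. if x = Poly_Mapping.single w 1 then 1 else 0"] by blast
  interpret g: Vector_Spaces.linear scale "(*)" g by (rule g(1))
  have "g y = 0" if "y \<in> pmvs.span B" for y
    using that
  proof (induction rule: pmvs.span_induct)
    case base
    show ?case by (simp add: pmvs.subspace_def g.add g.scale)
  next
    case (step x)
    moreover have "Poly_Mapping.single w 1 \<notin> B" using B(1) \<open>Poly_Mapping.single w 1 \<notin> ?S\<close> by blast
    ultimately show ?case using g(2) by auto
  qed
  then have 0: "g y = 0" if "y \<in> ?S" for y using B(3) that by blast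
  have "cfun M (\<lambda>v. g (Poly_Mapping.single v 1))"
  proof (rule cfunI)
    fix u v assume uv: "u \<in> carrier M" "v \<in> carrier M"
    have "Poly_Mapping.single (u \<oplus> v) 1 + scale (-1) (Poly_Mapping.single u 1 + Poly_Mapping.single v 1) \<in> ?S"
      (is "?y + scale _ (?a + ?b) \<in> _")
    proof -
      have k: "Poly_Mapping.keys ?y \<subseteq> carrier M" "Poly_Mapping.keys ?a \<subseteq> carrier M"
        "Poly_Mapping.keys ?b \<subseteq> carrier M" "Poly_Mapping.keys (?a + ?b) \<subseteq> carrier M"
        "Poly_Mapping.keys (scale (-1) (?a + ?b)) \<subseteq> carrier M"
        "Poly_Mapping.keys (?y + scale (-1) (?a + ?b)) \<subseteq> carrier M"
        using uv keys_add[of ?a ?b] keys_scale[of "-1" "?a + ?b"] keys_add[of ?y "scale (-1) (?a + ?b)"]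
        by auto
      have "?ev (?y + scale (-1) (?a + ?b)) = (u \<oplus> v) \<oplus> (-1) \<odot> (u \<oplus> v)"
        using k uv by (simp only: lext_add lext_scale K ev one_smult a_closed)
      also have "\<dots> = \<zero>" using uv by (simp add: add_minus_smult)
      finally show ?thesis using k by simp
    qed
    from 0[OF this] show "g (Poly_Mapping.single (u \<oplus> v) 1) = g (Poly_Mapping.single u 1) + g (Poly_Mapping.single v 1)"
      by (simp only: g.add g.scale) (simp add: algebra_simps)
  next
    fix c v assume v: "v \<in> carrier M"
    have "Poly_Mapping.single (c \<odot> v) 1 + scale (-1) (Poly_Mapping.single v c) \<in> ?S"
      (is "?y + scale _ ?a \<in> _")
    proof -
      have k: "Poly_Mapping.keys ?y \<subseteq> carrier M" "Poly_Mapping.keys ?a \<subseteq> carrier M"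
        "Poly_Mapping.keys (scale (-1) ?a) \<subseteq> carrier M"
        "Poly_Mapping.keys (?y + scale (-1) ?a) \<subseteq> carrier M"
        using v keys_scale[of "-1" "?a"] keys_add[of ?y "scale (-1) ?a"]
        by (auto simp: subset_iff split: if_split_asm)
      have "?ev (?y + scale (-1) ?a) = (c \<odot> v) \<oplus> (-1) \<odot> (c \<odot> v)"
        using k v by (simp only: lext_add lext_scale K ev one_smult smult_closed')
      also have "\<dots> = \<zero>" using v by (intro add_minus_smult) auto
      finally show ?thesis using k by simp
    qed
    from 0[OF this] have "g (Poly_Mapping.single (c \<odot> v) 1) = g (Poly_Mapping.single v c)"
      by (simp only: g.add g.scale) (simp add: algebra_simps)
    also have "Poly_Mapping.single v c = scale c (Poly_Mapping.single v 1)" by simp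
    finally show "g (Poly_Mapping.single (c \<odot> v) 1) = c * g (Poly_Mapping.single v 1)"
      by (simp only: g.scale)
  qed
  then show thesis by (rule that) (simp add: g(2))
qed

text \<open>Turns an identity of vectors into one of complex numbers, which the simplifier decides
  after pushing the functional through sums and multiples. Most vector identities below are checked
  this way.\<close>

lemma vec_eqI:
  assumes "u \<in> carrier M" "v \<in> carrier M" "\<And>\<xi>. cfun M \<xi> \<Longrightarrow> \<xi> u = \<xi> v"
  shows "u = v"
proof (rule ccontr)
  assume "u \<noteq> v"
  then have "u \<ominus> v \<noteq> \<zero>" using assms by (simp add: diff_zero_iff)
  then obtain \<xi> where "cfun M \<xi>" "\<xi> (u \<ominus> v) \<noteq> 0"
    using assms cfun_separates[of "u \<ominus> v"] by auto
  then show False using assms by simp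
qed

end

section \<open>Quotients and homomorphisms\<close>

abbreviation proj :: "('x, 'm) rep \<Rightarrow> 'm set \<Rightarrow> 'm \<Rightarrow> 'm set" where
  "proj M N v \<equiv> N +>\<^bsub>M\<^esub> v"

text \<open>Each module axiom for \<open>M'\<close> is an equation between images and is pulled back
  along the surjection.\<close>

lemma cmod_image:
  assumes M: "cmod M" and \<phi>: "lmap M M' \<phi>" "\<phi> ` carrier M = carrier M'" "\<phi> \<zero>\<^bsub>M\<^esub> = \<zero>\<^bsub>M'\<^esub>"
  shows "cmod M'"
proof -
  interpret cvec M by (rule cvecI[OF M])
  note s = lmap_add[OF \<phi>(1), symmetric] lmap_smult[OF \<phi>(1), symmetric] \<phi>(3)[symmetric]
  have z: "(-1) \<odot>\<^bsub>M\<^esub> v \<oplus>\<^bsub>M\<^esub> v = \<zero>\<^bsub>M\<^esub>" if "v \<in> carrier M" for v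
    using add_minus_smult[OF that] that by (simp add: M.a_comm)
  have c: "\<phi> u \<oplus>\<^bsub>M'\<^esub> \<phi> v = \<phi> v \<oplus>\<^bsub>M'\<^esub> \<phi> u" if "u \<in> carrier M" "v \<in> carrier M" for u v
    using that M.a_comm[of u v] by (simp add: s)
  show ?thesis
    by (rule cmodI; (unfold \<phi>(2)[symmetric]); (elim imageE)?; hypsubst?, (rule c; assumption)?)
      (simp_all add: s z M.a_assoc smult_smult smult_add_left smult_add_right)
qed

context
  fixes M :: "('x, 'm) rep" and N :: "'m set"
  assumes cM: "cmod M" and sN: "submodule N \<CC> M"
begin

interpretation cvec M by (rule cvecI[OF cM])

lemma proj_mem:
  assumes "v \<in> carrier M"
  shows "u \<in> proj M N v \<longleftrightarrow> u \<in> carrier M \<and> u \<ominus>\<^bsub>M\<^esub> v \<in> N"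
proof
  assume "u \<in> proj M N v"
  then obtain n where n: "n \<in> N" "u = n \<oplus>\<^bsub>M\<^esub> v" by (auto simp: a_r_coset_def')
  then have "n \<in> carrier M" using submoduleD[OF sN] by auto
  then have "u \<ominus>\<^bsub>M\<^esub> v = n" by (intro vec_eqI) (simp_all add: n assms cfun_add)
  then show "u \<in> carrier M \<and> u \<ominus>\<^bsub>M\<^esub> v \<in> N" using n assms \<open>n \<in> carrier M\<close> by simp
next
  assume u: "u \<in> carrier M \<and> u \<ominus>\<^bsub>M\<^esub> v \<in> N"
  then have "u = (u \<ominus>\<^bsub>M\<^esub> v) \<oplus>\<^bsub>M\<^esub> v" using assms by (intro vec_eqI) (simp_all add: cfun_add)
  then show "u \<in> proj M N v" using u by (auto simp: a_r_coset_def')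
qed

lemma proj_eq:
  assumes "u \<in> carrier M" "v \<in> carrier M"
  shows "proj M N u = proj M N v \<longleftrightarrow> u \<ominus>\<^bsub>M\<^esub> v \<in> N"
proof
  assume "proj M N u = proj M N v"
  moreover have "u \<in> proj M N u" using assms submoduleD(3)[OF sN] by (simp add: proj_mem M.r_neg a_minus_def)
  ultimately show "u \<ominus>\<^bsub>M\<^esub> v \<in> N" using assms by (simp add: proj_mem)
next
  assume uv: "u \<ominus>\<^bsub>M\<^esub> v \<in> N"
  have "w \<ominus>\<^bsub>M\<^esub> u \<in> N \<longleftrightarrow> w \<ominus>\<^bsub>M\<^esub> v \<in> N" if "w \<in> carrier M" for w
  proof -
    have "w \<ominus>\<^bsub>M\<^esub> v = (w \<ominus>\<^bsub>M\<^esub> u) \<oplus>\<^bsub>M\<^esub> (u \<ominus>\<^bsub>M\<^esub> v)" "w \<ominus>\<^bsub>M\<^esub> u = (w \<ominus>\<^bsub>M\<^esub> v) \<ominus>\<^bsub>M\<^esub> (u \<ominus>\<^bsub>M\<^esub> v)"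
      using that assms by (intro vec_eqI; simp add: cfun_add)+
    then show ?thesis using submoduleD(4,6)[OF sN] uv by metis
  qed
  then show "proj M N u = proj M N v" using assms by (auto simp: proj_mem)
qed

text \<open>The operations of \<open>quot_rep\<close> are unions over all representatives of a
  coset. The union collapses because representatives differ by elements of \<open>N\<close>, and the
  linear map \<open>f\<close> sends these into \<open>N\<close>.\<close>

lemma quot_union:
  assumes f: "lmap M M f" "\<And>n. n \<in> N \<Longrightarrow> f n \<in> N" and v: "v \<in> carrier M"
  shows "(\<Union>u\<in>proj M N v. proj M N (f u)) = proj M N (f v)"
proof -
  have "proj M N (f u) = proj M N (f v)" if "u \<in> proj M N v" for u
  proof -
    have u: "u \<in> carrier M" "u \<ominus>\<^bsub>M\<^esub> v \<in> N" using that v by (auto simp: proj_mem)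
    have "f u \<ominus>\<^bsub>M\<^esub> f v = f (u \<ominus>\<^bsub>M\<^esub> v)"
      using u(1) v f(1) by (simp add: diff_smult lmap_add lmap_smult lmap_closed)
    then show ?thesis using f u v by (simp add: proj_eq lmap_closed)
  qed
  moreover have "v \<in> proj M N v" using v submoduleD(3)[OF sN] by (simp add: proj_mem M.r_neg a_minus_def)
  ultimately show ?thesis by blast
qed

lemma quot_carrier: "carrier (quot_rep M N) = proj M N ` carrier M"
  by (auto simp: quot_rep_def A_RCOSETS_def')

lemma quot_zero: "\<zero>\<^bsub>quot_rep M N\<^esub> = proj M N \<zero>\<^bsub>M\<^esub>" "\<zero>\<^bsub>quot_rep M N\<^esub> = N"
proof -
  have "proj M N \<zero>\<^bsub>M\<^esub> = N"
    using submoduleD[OF sN] by (auto simp: proj_mem a_minus_def)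
  then show "\<zero>\<^bsub>quot_rep M N\<^esub> = proj M N \<zero>\<^bsub>M\<^esub>" "\<zero>\<^bsub>quot_rep M N\<^esub> = N" by (simp_all add: quot_rep_def)
qed

lemma proj_zero_iff: "v \<in> carrier M \<Longrightarrow> proj M N v = \<zero>\<^bsub>quot_rep M N\<^esub> \<longleftrightarrow> v \<in> N"
  by (simp add: quot_zero(1) proj_eq)

lemma quot_lmap: "lmap M (quot_rep M N) (proj M N)"
proof (rule lmapI)
  fix u v assume uv: "u \<in> carrier M" "v \<in> carrier M"
  show "proj M N (u \<oplus>\<^bsub>M\<^esub> v) = proj M N u \<oplus>\<^bsub>quot_rep M N\<^esub> proj M N v" (is "?l = ?r")
  proof (rule Set.set_eqI)
    fix w
    have r: "?r = (\<Union>a\<in>proj M N u. \<Union>b\<in>proj M N v. {a \<oplus>\<^bsub>M\<^esub> b})"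
      by (simp add: quot_rep_def set_add_def')
    show "w \<in> ?l \<longleftrightarrow> w \<in> ?r"
    proof
      assume "w \<in> ?l"
      then have w: "w \<in> carrier M" "w \<ominus>\<^bsub>M\<^esub> (u \<oplus>\<^bsub>M\<^esub> v) \<in> N" using uv by (auto simp: proj_mem)
      have "w = (w \<ominus>\<^bsub>M\<^esub> v) \<oplus>\<^bsub>M\<^esub> v" "(w \<ominus>\<^bsub>M\<^esub> v) \<ominus>\<^bsub>M\<^esub> u = w \<ominus>\<^bsub>M\<^esub> (u \<oplus>\<^bsub>M\<^esub> v)" "v \<ominus>\<^bsub>M\<^esub> v = \<zero>\<^bsub>M\<^esub>"
        using w uv by (intro vec_eqI; simp add: cfun_add)+
      moreover from this have "w \<ominus>\<^bsub>M\<^esub> v \<in> proj M N u" "v \<in> proj M N v"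
        using w uv submoduleD(3)[OF sN] by (simp_all add: proj_mem)
      ultimately show "w \<in> ?r" unfolding r by blast
    next
      assume "w \<in> ?r"
      then obtain a b where ab: "a \<in> carrier M" "b \<in> carrier M" "a \<ominus>\<^bsub>M\<^esub> u \<in> N" "b \<ominus>\<^bsub>M\<^esub> v \<in> N" "w = a \<oplus>\<^bsub>M\<^esub> b"
        using uv by (auto simp: r proj_mem)
      have "w \<ominus>\<^bsub>M\<^esub> (u \<oplus>\<^bsub>M\<^esub> v) = (a \<ominus>\<^bsub>M\<^esub> u) \<oplus>\<^bsub>M\<^esub> (b \<ominus>\<^bsub>M\<^esub> v)"
        using ab uv by (intro vec_eqI) (simp_all add: cfun_add)
      then show "w \<in> ?l" using ab uv submoduleD(4)[OF sN] by (simp add: proj_mem)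
    qed
  qed
next
  fix c v assume v: "v \<in> carrier M"
  have "lmap M M (\<lambda>v. c \<odot>\<^bsub>M\<^esub> v)"
    by (rule lmapI) (auto simp: smult_add_right smult_smult mult.commute)
  from quot_union[OF this _ v] submoduleD(5)[OF sN]
  show "proj M N (c \<odot>\<^bsub>M\<^esub> v) = c \<odot>\<^bsub>quot_rep M N\<^esub> proj M N v"
    by (simp add: quot_rep_def)
qed (simp add: quot_carrier)

lemma quot_act:
  assumes "lmap M M (act M x)" "\<And>n. n \<in> N \<Longrightarrow> act M x n \<in> N" "v \<in> carrier M"
  shows "act (quot_rep M N) x (proj M N v) = proj M N (act M x v)"
  using quot_union[OF assms] by (simp add: quot_rep_def)

lemma quot_cmod: "cmod (quot_rep M N)"
proof -
  show ?thesis
    by (rule cmod_image[OF cM quot_lmap]) (simp_all only: quot_carrier quot_zero(1))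
qed

lemma quot_factor:
  assumes X: "lmap M X \<phi>" "\<And>n. n \<in> N \<Longrightarrow> \<phi> n = \<zero>\<^bsub>X\<^esub>" "cmod X"
  obtains \<psi> where "lmap (quot_rep M N) X \<psi>" "\<And>v. v \<in> carrier M \<Longrightarrow> \<psi> (proj M N v) = \<phi> v"
proof -
  interpret X: cvec X by (rule cvecI[OF X(3)])
  define \<psi> where "\<psi> C = \<phi> (SOME v. v \<in> carrier M \<and> proj M N v = C)" for C
  have *: "\<psi> (proj M N v) = \<phi> v" if v: "v \<in> carrier M" for v
  proof -
    let ?u = "SOME u. u \<in> carrier M \<and> proj M N u = proj M N v"
    have u: "?u \<in> carrier M \<and> proj M N ?u = proj M N v" by (rule someI[of _ v]) (use v in simp)
    then have "?u \<ominus>\<^bsub>M\<^esub> v \<in> N" using v proj_eq by blast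
    then have "\<phi> (?u \<ominus>\<^bsub>M\<^esub> v) = \<zero>\<^bsub>X\<^esub>" by (rule X(2))
    then have "\<phi> ?u \<ominus>\<^bsub>X\<^esub> \<phi> v = \<zero>\<^bsub>X\<^esub>"
      using u v X(1) by (simp add: diff_smult X.diff_smult lmap_add lmap_smult lmap_closed)
    then show ?thesis using u v X(1) by (simp add: \<psi>_def X.diff_zero_iff lmap_closed)
  qed
  have "lmap (quot_rep M N) X \<psi>"
    by (rule lmapI; (unfold quot_carrier)?; (elim imageE)?)
      (simp_all add: * lmap_closed[OF X(1)] lmap_add[OF quot_lmap, symmetric] lmap_smult[OF quot_lmap, symmetric]
        lmap_add[OF X(1)] lmap_smult[OF X(1)])
  then show thesis using * that by blast
qed

end

section \<open>Homomorphisms and representations of Lie subalgebras\<close>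

definition rhom :: "'x set \<Rightarrow> ('x, 'm) rep \<Rightarrow> ('x, 'n) rep \<Rightarrow> ('m \<Rightarrow> 'n) \<Rightarrow> bool" where
  "rhom L M M' \<phi> \<longleftrightarrow> lmap M M' \<phi> \<and> (\<forall>x\<in>L. \<forall>v\<in>carrier M. \<phi> (act M x v) = act M' x (\<phi> v))"

lemma rhomI: "lmap M M' \<phi> \<Longrightarrow> (\<And>x v. x \<in> L \<Longrightarrow> v \<in> carrier M \<Longrightarrow> \<phi> (act M x v) = act M' x (\<phi> v)) \<Longrightarrow> rhom L M M' \<phi>"
  and rhom_lmap: "rhom L M M' \<phi> \<Longrightarrow> lmap M M' \<phi>"
  and rhom_act: "rhom L M M' \<phi> \<Longrightarrow> x \<in> L \<Longrightarrow> v \<in> carrier M \<Longrightarrow> \<phi> (act M x v) = act M' x (\<phi> v)"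
  by (simp_all add: rhom_def)

lemmas rhom_closed = lmap_closed[OF rhom_lmap]
lemmas rhom_add = lmap_add[OF rhom_lmap]
lemmas rhom_smult = lmap_smult[OF rhom_lmap]

lemma rhom_comp: "rhom L M M' \<phi> \<Longrightarrow> rhom L M' M'' \<psi> \<Longrightarrow> rhom L M M'' (\<lambda>v. \<psi> (\<phi> v))"
  by (simp add: rhom_def lmap_def)

lemma rhom_mono: "rhom L M M' \<phi> \<Longrightarrow> K \<subseteq> L \<Longrightarrow> rhom K M M' \<phi>"
  by (auto simp: rhom_def)

lemma rep_iso_iff: "rep_iso L M M' \<longleftrightarrow> (\<exists>\<phi>. rhom L M M' \<phi> \<and> bij_betw \<phi> (carrier M) (carrier M'))"
  unfolding rep_iso_def rhom_def lmap_def
  by (rule arg_cong[where f = Ex], rule ext, rule iffI) (use bij_betwE in blast)+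

lemma lmap_inverse:
  assumes M: "cmod M" and \<phi>: "lmap M M' \<phi>" "bij_betw \<phi> (carrier M) (carrier M')"
  shows "lmap M' M (inv_into (carrier M) \<phi>)"
proof -
  interpret M: cvec M by (rule cvecI[OF M])
  have inj: "inj_on \<phi> (carrier M)" and im: "carrier M' = \<phi> ` carrier M"
    using \<phi>(2) by (auto simp: bij_betw_def)
  show ?thesis
    by (rule lmapI; (unfold im)?; (elim imageE)?)
      (simp_all add: inv_into_f_f[OF inj] lmap_add[OF \<phi>(1), symmetric] lmap_smult[OF \<phi>(1), symmetric])
qed

lemma rhom_inverse:
  assumes M: "cmod M" and cl: "\<And>x v. x \<in> L \<Longrightarrow> v \<in> carrier M \<Longrightarrow> act M x v \<in> carrier M"
    and \<phi>: "rhom L M M' \<phi>" "bij_betw \<phi> (carrier M) (carrier M')"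
  shows "rhom L M' M (inv_into (carrier M) \<phi>)"
proof (rule rhomI)
  have inj: "inj_on \<phi> (carrier M)" and im: "carrier M' = \<phi> ` carrier M"
    using \<phi>(2) by (auto simp: bij_betw_def)
  show "lmap M' M (inv_into (carrier M) \<phi>)" by (rule lmap_inverse[OF M rhom_lmap[OF \<phi>(1)] \<phi>(2)])
  fix x v assume x: "x \<in> L" and "v \<in> carrier M'"
  then obtain u where "u \<in> carrier M" "v = \<phi> u" using im by auto
  then show "inv_into (carrier M) \<phi> (act M' x v) = act M x (inv_into (carrier M) \<phi> v)"
    using x cl by (simp add: inv_into_f_f[OF inj] rhom_act[OF \<phi>(1), symmetric])
qed

locale lierep =
  fixes L :: "schr set" and M :: "(schr, 'm) rep" (structure)
  assumes lie: "lie_module L M"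
begin

sublocale cvec M
  using lie by (simp add: cvec_def lie_module_def)

lemma cmodM: "cmod M" using lie by (simp add: lie_module_def)

lemma act_closed [simp, intro]: "x \<in> L \<Longrightarrow> v \<in> carrier M \<Longrightarrow> act M x v \<in> carrier M"
  and act_add: "x \<in> L \<Longrightarrow> u \<in> carrier M \<Longrightarrow> v \<in> carrier M \<Longrightarrow> act M x (u \<oplus> v) = act M x u \<oplus> act M x v"
  and act_smult: "x \<in> L \<Longrightarrow> v \<in> carrier M \<Longrightarrow> act M x (c \<odot> v) = c \<odot> act M x v"
  and act_plus: "x \<in> L \<Longrightarrow> y \<in> L \<Longrightarrow> v \<in> carrier M \<Longrightarrow> act M (x + y) v = act M x v \<oplus> act M y v"
  and act_scale: "x \<in> L \<Longrightarrow> v \<in> carrier M \<Longrightarrow> act M (c *s x) v = c \<odot> act M x v"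
  and act_bracket: "x \<in> L \<Longrightarrow> y \<in> L \<Longrightarrow> v \<in> carrier M \<Longrightarrow>
      act M (bracket x y) v = act M x (act M y v) \<ominus> act M y (act M x v)"
  using lie by (simp_all add: lie_module_def)

lemma act_lmap: "x \<in> L \<Longrightarrow> lmap M M (act M x)"
  by (rule lmapI) (simp_all add: act_add act_smult)

lemma act_zero [simp]: "x \<in> L \<Longrightarrow> act M x \<zero> = \<zero>"
  using act_smult[of x \<zero> 0] by simp

lemma act_diff: "x \<in> L \<Longrightarrow> u \<in> carrier M \<Longrightarrow> v \<in> carrier M \<Longrightarrow> act M x (u \<ominus> v) = act M x u \<ominus> act M x v"
  by (simp add: diff_smult act_smult act_add)

lemma act_finsum: "x \<in> L \<Longrightarrow> f \<in> A \<rightarrow> carrier M \<Longrightarrow> act M x (finsum M f A) = (\<Oplus>i\<in>A. act M x (f i))"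
proof (induction A rule: infinite_finite_induct)
  case (insert i A)
  then have "f \<in> A \<rightarrow> carrier M" "f i \<in> carrier M" "(\<lambda>i. act M x (f i)) \<in> A \<rightarrow> carrier M" by auto
  with insert show ?case by (simp add: act_add)
qed (simp_all add: finsum_infinite)

lemma subrepI:
  assumes "H \<subseteq> carrier M" "\<zero> \<in> H" "\<And>u v. u \<in> H \<Longrightarrow> v \<in> H \<Longrightarrow> u \<oplus> v \<in> H"
    "\<And>c v. v \<in> H \<Longrightarrow> c \<odot> v \<in> H" "\<And>x v. x \<in> L \<Longrightarrow> v \<in> H \<Longrightarrow> act M x v \<in> H"
  shows "subrep L M H"
  using assms by (simp add: subrep_def submoduleI')

lemma subrep_act: "subrep L M N \<Longrightarrow> x \<in> L \<Longrightarrow> v \<in> N \<Longrightarrow> act M x v \<in> N"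
  by (simp add: subrep_def)

lemma subrep_carrier: "subrep L M (carrier M)"
  by (rule subrepI) auto

lemma subrep_0: "subrep L M {\<zero>}"
  by (rule subrepI) auto

end

lemmas subrep_submodule = subrep_def[THEN iffD1, THEN conjunct1]

lemma lierepI: "lie_module L M \<Longrightarrow> lierep L M" by (simp add: lierep_def)

lemma lie_module_image:
  assumes M: "lie_module L M" and M': "cmod M'" and \<phi>: "rhom L M M' \<phi>" "\<phi> ` carrier M = carrier M'"
    and L: "\<And>x y. x \<in> L \<Longrightarrow> y \<in> L \<Longrightarrow> x + y \<in> L \<and> bracket x y \<in> L"
      "\<And>x c. x \<in> L \<Longrightarrow> c *s x \<in> L"
  shows "lie_module L M'"
proof -
  interpret M: lierep L M by (rule lierepI[OF M])
  interpret M': cvec M' by (rule cvecI[OF M'])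
  have diff: "\<phi> u \<ominus>\<^bsub>M'\<^esub> \<phi> v = \<phi> (u \<ominus>\<^bsub>M\<^esub> v)" if "u \<in> carrier M" "v \<in> carrier M" for u v
    using that \<phi>(1) by (simp add: M.diff_smult M'.diff_smult rhom_add rhom_smult rhom_closed)
  note s = rhom_add[OF \<phi>(1), symmetric] rhom_smult[OF \<phi>(1), symmetric] rhom_act[OF \<phi>(1), symmetric] diff
  have [simp]: "\<phi> v \<in> \<phi> ` carrier M" if "v \<in> carrier M" for v using that by blast
  show ?thesis
    unfolding lie_module_def \<phi>(2)[symmetric]
    by (simp add: M' s M.act_add M.act_smult M.act_plus M.act_scale M.act_bracket L)
qed

lemma kernel_subrep:
  assumes M: "lie_module L M" and M': "lie_module L M'" and \<phi>: "rhom L M M' \<phi>" and N: "subrep L M' N"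
  shows "subrep L M {v \<in> carrier M. \<phi> v \<in> N}"
proof -
  interpret M: lierep L M by (rule lierepI[OF M])
  interpret M': lierep L M' by (rule lierepI[OF M'])
  note D = M'.submoduleD[OF subrep_submodule[OF N]]
  have "\<phi> \<zero>\<^bsub>M\<^esub> = \<zero>\<^bsub>M'\<^esub>"
    using rhom_smult[OF \<phi>, of "\<zero>\<^bsub>M\<^esub>" 0] rhom_closed[OF \<phi>, of "\<zero>\<^bsub>M\<^esub>"] by simp
  then show ?thesis
    by (intro M.subrepI) (auto simp: D rhom_add[OF \<phi>] rhom_smult[OF \<phi>] rhom_act[OF \<phi>] M'.subrep_act[OF N])
qed

lemma image_subrep:
  assumes M: "lie_module L M" and M': "lie_module L M'" and \<phi>: "rhom L M M' \<phi>" and N: "subrep L M N"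
  shows "subrep L M' (\<phi> ` N)"
proof -
  interpret M: lierep L M by (rule lierepI[OF M])
  interpret M': lierep L M' by (rule lierepI[OF M'])
  note D = M.submoduleD[OF subrep_submodule[OF N]]
  have z: "\<phi> \<zero>\<^bsub>M\<^esub> = \<zero>\<^bsub>M'\<^esub>"
    using rhom_smult[OF \<phi>, of "\<zero>\<^bsub>M\<^esub>" 0] rhom_closed[OF \<phi>, of "\<zero>\<^bsub>M\<^esub>"] by simp
  show ?thesis
    by (rule M'.subrepI)
      (auto simp: D rhom_closed[OF \<phi>] rhom_add[OF \<phi>, symmetric] rhom_smult[OF \<phi>, symmetric]
        rhom_act[OF \<phi>, symmetric] M.subrep_act[OF N] z[symmetric])
qed

section \<open>Tensor products\<close>

lemma lin_ext_superset:
  assumes "finite B" "Poly_Mapping.keys y \<subseteq> B"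
  shows "lin_ext g y = (\<Sum>k\<in>B. scale (Poly_Mapping.lookup y k) (g k))"
  unfolding lin_ext_def
  by (rule sum.mono_neutral_left) (use assms in \<open>auto simp: not_in_keys_iff_lookup_eq_zero\<close>)

lemma lin_ext_simps [simp]:
  "lin_ext g 0 = 0" "lin_ext g (Poly_Mapping.single k c) = scale c (g k)"
  by (cases "c = 0"; simp add: lin_ext_def)+

lemma lin_ext_add: "lin_ext g (y + y') = lin_ext g y + lin_ext g y'"
proof -
  let ?B = "Poly_Mapping.keys y \<union> Poly_Mapping.keys y'"
  have *: "lin_ext g x = (\<Sum>k\<in>?B. scale (Poly_Mapping.lookup x k) (g k))"
    if "Poly_Mapping.keys x \<subseteq> ?B" for x
    by (rule lin_ext_superset) (use that in auto)
  show ?thesis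
    unfolding *[OF keys_add] *[OF Un_upper1] *[OF Un_upper2]
    by (simp add: lookup_add scale_distrib sum.distrib)
qed

lemma lin_ext_scale: "lin_ext g (scale c y) = scale c (lin_ext g y)"
  by (subst lin_ext_superset[OF _ keys_scale]) (simp_all add: lin_ext_def scale_sum)

lemma keys_lin_ext:
  assumes "\<And>k. k \<in> Poly_Mapping.keys y \<Longrightarrow> Poly_Mapping.keys (g k) \<subseteq> A"
  shows "Poly_Mapping.keys (lin_ext g y) \<subseteq> A"
  unfolding lin_ext_def using keys_sum[of "\<lambda>k. scale (Poly_Mapping.lookup y k) (g k)" "Poly_Mapping.keys y"]
    keys_scale assms by fastforce

lemma free_rep_simps [simp]:
  "carrier (free_rep A g) = {y. Poly_Mapping.keys y \<subseteq> A}" "add (free_rep A g) = (+)"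
  "zero (free_rep A g) = 0" "smult (free_rep A g) = scale" "act (free_rep A g) x = lin_ext (g x)"
  by (simp_all add: free_rep_def)

lemma free_rep_cmod: "cmod (free_rep A g)"
proof (rule cmodI)
  fix u v assume "u \<in> carrier (free_rep A g)" "v \<in> carrier (free_rep A g)"
  then show "u \<oplus>\<^bsub>free_rep A g\<^esub> v \<in> carrier (free_rep A g)" using keys_add[of u v] by auto
next
  fix c v assume "v \<in> carrier (free_rep A g)"
  then show "c \<odot>\<^bsub>free_rep A g\<^esub> v \<in> carrier (free_rep A g)" using keys_scale[of c v] by auto
qed (simp_all add: scale_distrib algebra_simps)

lemma lin_span_submodule:
  assumes "cmod M" "B \<subseteq> carrier M"
  shows "submodule (lin_span M B) \<CC> M" "B \<subseteq> lin_span M B"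
proof -
  interpret cvec M by (rule cvecI[OF assms(1)])
  let ?X = "{N. submodule N \<CC> M \<and> B \<subseteq> N}"
  have X: "carrier M \<in> ?X" using assms carrier_is_submodule by auto
  have D: "N \<in> ?X \<Longrightarrow> u \<in> N \<Longrightarrow> v \<in> N \<Longrightarrow> u \<oplus>\<^bsub>M\<^esub> v \<in> N" "N \<in> ?X \<Longrightarrow> v \<in> N \<Longrightarrow> c \<odot>\<^bsub>M\<^esub> v \<in> N"
    "N \<in> ?X \<Longrightarrow> \<zero>\<^bsub>M\<^esub> \<in> N" for N u v c
    by (auto simp: submoduleD)
  show "submodule (lin_span M B) \<CC> M"
    unfolding lin_span_def
  proof (rule submoduleI')
    show "\<Inter>?X \<subseteq> carrier M" using X by blast
  qed (use D in blast)+
  show "B \<subseteq> lin_span M B" by (auto simp: lin_span_def)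
qed

lemma lin_span_minimal: "submodule N \<CC> M \<Longrightarrow> B \<subseteq> N \<Longrightarrow> lin_span M B \<subseteq> N"
  by (auto simp: lin_span_def)

section \<open>Bilinear maps and the universal property\<close>

definition bilin ::
    "(complex, 'a, 'y) module_scheme \<Rightarrow> (complex, 'b, 'z) module_scheme \<Rightarrow>
     (complex, 'c, 'w) module_scheme \<Rightarrow> ('a \<Rightarrow> 'b \<Rightarrow> 'c) \<Rightarrow> bool" where
  "bilin M N X \<beta> \<longleftrightarrow> (\<forall>m\<in>carrier M. lmap N X (\<beta> m)) \<and> (\<forall>n\<in>carrier N. lmap M X (\<lambda>m. \<beta> m n))"

lemma bilinI:
  assumes "\<And>m. m \<in> carrier M \<Longrightarrow> lmap N X (\<beta> m)" "\<And>n. n \<in> carrier N \<Longrightarrow> lmap M X (\<lambda>m. \<beta> m n)"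
  shows "bilin M N X \<beta>"
  using assms by (simp add: bilin_def)

locale tensor =
  fixes M :: "(complex, 'a, 'y) module_scheme" and N :: "(complex, 'b, 'z) module_scheme"
    and B :: "(('a \<times> 'b) \<times> ('a \<times> 'b)) set" and g :: "'x \<Rightarrow> 'a \<times> 'b \<Rightarrow> (('a \<times> 'b) \<Rightarrow>\<^sub>0 complex)"
  assumes cM: "cmod M" and cN: "cmod N"
    and B: "B \<subseteq> (carrier M \<times> carrier N) \<times> (carrier M \<times> carrier N)"
begin

sublocale M: cvec M by (rule cvecI[OF cM])
sublocale N: cvec N by (rule cvecI[OF cN])

abbreviation "F \<equiv> free_rep (carrier M \<times> carrier N) g"
definition rels where "rels = tensor_rels M N \<union>
    {Poly_Mapping.single k 1 - Poly_Mapping.single l 1 | k l. (k, l) \<in> B}"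
definition S where "S = lin_span F rels"
abbreviation "T \<equiv> tensor_rep M N B g"
abbreviation "pr \<equiv> proj F S"

definition tens where "tens m n = pr (Poly_Mapping.single (m, n) 1)"

lemma T_eq: "T = quot_rep F S"
  unfolding tensor_rep_def Let_def S_def rels_def by (rule refl)

sublocale F: cvec F by (rule cvecI[OF free_rep_cmod])

lemma single_in_F: "m \<in> carrier M \<Longrightarrow> n \<in> carrier N \<Longrightarrow> Poly_Mapping.single (m, n) c \<in> carrier F"
  by simp

lemma F_diff: "y \<in> carrier F \<Longrightarrow> y' \<in> carrier F \<Longrightarrow> y \<ominus>\<^bsub>F\<^esub> y' = y - y'"
  by (subst F.diff_smult) (simp_all add: scale_distrib)

lemma F_diff_closed: "y \<in> carrier F \<Longrightarrow> y' \<in> carrier F \<Longrightarrow> y - y' \<in> carrier F"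
  using keys_diff[of y y'] by auto

lemma rels_cases:
  assumes "y \<in> rels"
  obtains
    (add_left) m m' n where "m \<in> carrier M" "m' \<in> carrier M" "n \<in> carrier N"
      "y = Poly_Mapping.single (m \<oplus>\<^bsub>M\<^esub> m', n) 1 - Poly_Mapping.single (m, n) 1 - Poly_Mapping.single (m', n) 1"
  | (add_right) m n n' where "m \<in> carrier M" "n \<in> carrier N" "n' \<in> carrier N"
      "y = Poly_Mapping.single (m, n \<oplus>\<^bsub>N\<^esub> n') 1 - Poly_Mapping.single (m, n) 1 - Poly_Mapping.single (m, n') 1"
  | (smult_left) c m n where "m \<in> carrier M" "n \<in> carrier N"
      "y = Poly_Mapping.single (c \<odot>\<^bsub>M\<^esub> m, n) 1 - Poly_Mapping.single (m, n) c"
  | (smult_right) c m n where "m \<in> carrier M" "n \<in> carrier N"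
      "y = Poly_Mapping.single (m, c \<odot>\<^bsub>N\<^esub> n) 1 - Poly_Mapping.single (m, n) c"
  | (rel) k l where "(k, l) \<in> B" "y = Poly_Mapping.single k 1 - Poly_Mapping.single l 1"
  using assms unfolding rels_def tensor_rels_def
  by (elim UnE CollectE exE conjE) (erule (2) that(1) that(2) | erule (1) that(3) that(4) | erule that(5), assumption)+

lemma rels_subset: "rels \<subseteq> carrier F"
proof
  fix y assume "y \<in> rels"
  then show "y \<in> carrier F"
  proof (cases rule: rels_cases)
    case (rel k l)
    then have "k \<in> carrier M \<times> carrier N" "l \<in> carrier M \<times> carrier N" using B by auto
    then show ?thesis unfolding rel by (intro F_diff_closed) simp_all
  qed (simp only:; intro F_diff_closed single_in_F; simp)+
qed

lemma tensor_relsI: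
  "m \<in> carrier M \<Longrightarrow> m' \<in> carrier M \<Longrightarrow> n \<in> carrier N \<Longrightarrow>
    Poly_Mapping.single (m \<oplus>\<^bsub>M\<^esub> m', n) 1 - Poly_Mapping.single (m, n) 1 - Poly_Mapping.single (m', n) 1 \<in> rels"
  "m \<in> carrier M \<Longrightarrow> n \<in> carrier N \<Longrightarrow> n' \<in> carrier N \<Longrightarrow>
    Poly_Mapping.single (m, n \<oplus>\<^bsub>N\<^esub> n') 1 - Poly_Mapping.single (m, n) 1 - Poly_Mapping.single (m, n') 1 \<in> rels"
  "m \<in> carrier M \<Longrightarrow> n \<in> carrier N \<Longrightarrow>
    Poly_Mapping.single (c \<odot>\<^bsub>M\<^esub> m, n) 1 - Poly_Mapping.single (m, n) c \<in> rels"
  "m \<in> carrier M \<Longrightarrow> n \<in> carrier N \<Longrightarrow>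
    Poly_Mapping.single (m, c \<odot>\<^bsub>N\<^esub> n) 1 - Poly_Mapping.single (m, n) c \<in> rels"
  unfolding rels_def tensor_rels_def
  subgoal by (rule UnI1, rule UnI1, rule UnI1, rule UnI1, rule CollectI, intro exI conjI, rule refl)
  subgoal by (rule UnI1, rule UnI1, rule UnI1, rule UnI2, rule CollectI, intro exI conjI, rule refl)
  subgoal by (rule UnI1, rule UnI1, rule UnI2, rule CollectI, intro exI conjI, rule refl)
  subgoal by (rule UnI1, rule UnI2, rule CollectI, intro exI conjI, rule refl)
  done

lemma S_sub: "submodule S \<CC> F" and rels_S: "rels \<subseteq> S"
  unfolding S_def by (rule lin_span_submodule[OF free_rep_cmod rels_subset])+

lemma cT: "cmod T"
  unfolding T_eq by (rule quot_cmod[OF free_rep_cmod S_sub])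

sublocale T: cvec T by (rule cvecI[OF cT])

lemma pr_lmap: "lmap F T pr"
  unfolding T_eq by (rule quot_lmap[OF free_rep_cmod S_sub])

lemma pr_rel: "y \<in> carrier F \<Longrightarrow> y' \<in> carrier F \<Longrightarrow> y - y' \<in> S \<Longrightarrow> pr y = pr y'"
  by (subst proj_eq[OF free_rep_cmod S_sub]) (simp_all add: F_diff)

lemma pr_add: "y \<in> carrier F \<Longrightarrow> y' \<in> carrier F \<Longrightarrow> pr (y + y') = pr y \<oplus>\<^bsub>T\<^esub> pr y'"
  using lmap_add[OF pr_lmap, of y y'] by simp

lemma pr_scale: "y \<in> carrier F \<Longrightarrow> pr (scale c y) = c \<odot>\<^bsub>T\<^esub> pr y"
  using lmap_smult[OF pr_lmap, of y c] by simp

lemma pr_closed: "y \<in> carrier F \<Longrightarrow> pr y \<in> carrier T"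
  using lmap_closed[OF pr_lmap, of y] by simp

lemma pr_zero: "pr 0 = \<zero>\<^bsub>T\<^esub>"
  using quot_zero(1)[OF free_rep_cmod S_sub] by (simp add: T_eq)

lemma pr_sum: "(\<And>i. i \<in> I \<Longrightarrow> f i \<in> carrier F) \<Longrightarrow> pr (\<Sum>i\<in>I. f i) = (\<Oplus>\<^bsub>T\<^esub>i\<in>I. pr (f i))"
proof (induction I rule: infinite_finite_induct)
  case (insert i I)
  have "(\<Sum>i\<in>I. f i) \<in> carrier F"
    using keys_sum[of f I] insert.prems by (fastforce simp: subset_iff)
  then show ?case using insert pr_closed by (simp add: pr_add Pi_iff)
qed (simp_all add: pr_zero T.finsum_infinite)

lemma pr_lin_ext:
  assumes "Poly_Mapping.keys y \<subseteq> A" "\<And>k. k \<in> A \<Longrightarrow> f k \<in> carrier F"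
  shows "pr (lin_ext f y) = lext T (\<lambda>k. pr (f k)) y"
proof -
  have "pr (lin_ext f y) = (\<Oplus>\<^bsub>T\<^esub>k\<in>Poly_Mapping.keys y. pr (scale (Poly_Mapping.lookup y k) (f k)))"
    unfolding lin_ext_def by (rule pr_sum) (use assms keys_scale in fastforce)
  also have "\<dots> = lext T (\<lambda>k. pr (f k)) y"
    unfolding lext_def by (rule T.finsum_cong') (use assms pr_closed in \<open>auto simp: pr_scale subset_iff\<close>)
  finally show ?thesis .
qed

lemma tens_closed [simp, intro]: "m \<in> carrier M \<Longrightarrow> n \<in> carrier N \<Longrightarrow> tens m n \<in> carrier T"
  unfolding tens_def by (rule pr_closed) simp

lemma tens_rel: "((m, n), (m', n')) \<in> B \<Longrightarrow> tens m n = tens m' n'"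
proof -
  assume *: "((m, n), (m', n')) \<in> B"
  then have "m \<in> carrier M" "n \<in> carrier N" "m' \<in> carrier M" "n' \<in> carrier N" using B by auto
  then show ?thesis unfolding tens_def using * by (intro pr_rel subsetD[OF rels_S]) (auto simp: rels_def intro!: UnI2)
qed

lemma tens_bilin: "bilin M N T tens"
proof (rule bilinI)
  fix m assume m: "m \<in> carrier M"
  show "lmap N T (tens m)"
  proof (rule lmapI)
    fix n n' assume n: "n \<in> carrier N" "n' \<in> carrier N"
    let ?s = "\<lambda>n. Poly_Mapping.single (m, n) (1::complex)"
    have "?s (n \<oplus>\<^bsub>N\<^esub> n') - (?s n + ?s n') \<in> S"
      unfolding diff_diff_eq[symmetric] using m n by (intro subsetD[OF rels_S] tensor_relsI)
    then have "pr (?s (n \<oplus>\<^bsub>N\<^esub> n')) = pr (?s n + ?s n')"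
      using m n keys_add[of "?s n" "?s n'"] by (intro pr_rel) auto
    then show "tens m (n \<oplus>\<^bsub>N\<^esub> n') = tens m n \<oplus>\<^bsub>T\<^esub> tens m n'" using m n by (simp add: tens_def pr_add)
  next
    fix c n assume n: "n \<in> carrier N"
    have "Poly_Mapping.single (m, c \<odot>\<^bsub>N\<^esub> n) 1 - Poly_Mapping.single (m, n) c \<in> S"
      using m n by (intro subsetD[OF rels_S] tensor_relsI)
    then have "pr (Poly_Mapping.single (m, c \<odot>\<^bsub>N\<^esub> n) 1) = pr (Poly_Mapping.single (m, n) c)"
      using m n by (intro pr_rel) auto
    also have "\<dots> = c \<odot>\<^bsub>T\<^esub> tens m n" using m n pr_scale[of "Poly_Mapping.single (m, n) 1" c] by (simp add: tens_def)
    finally show "tens m (c \<odot>\<^bsub>N\<^esub> n) = c \<odot>\<^bsub>T\<^esub> tens m n" by (simp add: tens_def)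
  qed (use m in simp)
next
  fix n assume n: "n \<in> carrier N"
  show "lmap M T (\<lambda>m. tens m n)"
  proof (rule lmapI)
    fix m m' assume m: "m \<in> carrier M" "m' \<in> carrier M"
    let ?s = "\<lambda>m. Poly_Mapping.single (m, n) (1::complex)"
    have "?s (m \<oplus>\<^bsub>M\<^esub> m') - (?s m + ?s m') \<in> S"
      unfolding diff_diff_eq[symmetric] using m n by (intro subsetD[OF rels_S] tensor_relsI)
    then have "pr (?s (m \<oplus>\<^bsub>M\<^esub> m')) = pr (?s m + ?s m')"
      using m n keys_add[of "?s m" "?s m'"] by (intro pr_rel) auto
    then show "tens (m \<oplus>\<^bsub>M\<^esub> m') n = tens m n \<oplus>\<^bsub>T\<^esub> tens m' n" using m n by (simp add: tens_def pr_add)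
  next
    fix c m assume m: "m \<in> carrier M"
    have "Poly_Mapping.single (c \<odot>\<^bsub>M\<^esub> m, n) 1 - Poly_Mapping.single (m, n) c \<in> S"
      using m n by (intro subsetD[OF rels_S] tensor_relsI)
    then have "pr (Poly_Mapping.single (c \<odot>\<^bsub>M\<^esub> m, n) 1) = pr (Poly_Mapping.single (m, n) c)"
      using m n by (intro pr_rel) auto
    also have "\<dots> = c \<odot>\<^bsub>T\<^esub> tens m n" using m n pr_scale[of "Poly_Mapping.single (m, n) 1" c] by (simp add: tens_def)
    finally show "tens (c \<odot>\<^bsub>M\<^esub> m) n = c \<odot>\<^bsub>T\<^esub> tens m n" by (simp add: tens_def)
  qed (use n in simp)
qed

lemma tens_add_left: "m \<in> carrier M \<Longrightarrow> m' \<in> carrier M \<Longrightarrow> n \<in> carrier N \<Longrightarrow>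
    tens (m \<oplus>\<^bsub>M\<^esub> m') n = tens m n \<oplus>\<^bsub>T\<^esub> tens m' n"
  and tens_smult_left: "m \<in> carrier M \<Longrightarrow> n \<in> carrier N \<Longrightarrow> tens (c \<odot>\<^bsub>M\<^esub> m) n = c \<odot>\<^bsub>T\<^esub> tens m n"
  and tens_add_right: "m \<in> carrier M \<Longrightarrow> n \<in> carrier N \<Longrightarrow> n' \<in> carrier N \<Longrightarrow>
    tens m (n \<oplus>\<^bsub>N\<^esub> n') = tens m n \<oplus>\<^bsub>T\<^esub> tens m n'"
  and tens_smult_right: "m \<in> carrier M \<Longrightarrow> n \<in> carrier N \<Longrightarrow> tens m (c \<odot>\<^bsub>N\<^esub> n) = c \<odot>\<^bsub>T\<^esub> tens m n"
  using tens_bilin by (simp_all add: bilin_def lmap_def)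

lemma tens_zero [simp]: "n \<in> carrier N \<Longrightarrow> tens \<zero>\<^bsub>M\<^esub> n = \<zero>\<^bsub>T\<^esub>" "m \<in> carrier M \<Longrightarrow> tens m \<zero>\<^bsub>N\<^esub> = \<zero>\<^bsub>T\<^esub>"
  using tens_smult_left[of "\<zero>\<^bsub>M\<^esub>" n 0] tens_smult_right[of m "\<zero>\<^bsub>N\<^esub>" 0] by auto

lemma tens_diff:
  "m \<in> carrier M \<Longrightarrow> m' \<in> carrier M \<Longrightarrow> n \<in> carrier N \<Longrightarrow>
    tens (m \<ominus>\<^bsub>M\<^esub> m') n = tens m n \<ominus>\<^bsub>T\<^esub> tens m' n"
  "m \<in> carrier M \<Longrightarrow> n \<in> carrier N \<Longrightarrow> n' \<in> carrier N \<Longrightarrow>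
    tens m (n \<ominus>\<^bsub>N\<^esub> n') = tens m n \<ominus>\<^bsub>T\<^esub> tens m n'"
  by (simp_all add: M.diff_smult N.diff_smult T.diff_smult tens_add_left tens_add_right
      tens_smult_left tens_smult_right)

text \<open>Coefficients are absorbed in the left factor, so that each step adds a pure
  tensor.\<close>

lemma tens_induct [consumes 1, case_names zero add]:
  assumes u: "u \<in> carrier T" and z: "P \<zero>\<^bsub>T\<^esub>"
    and a: "\<And>m n u. m \<in> carrier M \<Longrightarrow> n \<in> carrier N \<Longrightarrow> u \<in> carrier T \<Longrightarrow> P u \<Longrightarrow> P (tens m n \<oplus>\<^bsub>T\<^esub> u)"
  shows "P u"
proof -
  obtain y where y: "y \<in> carrier F" "u = pr y"
    using u quot_carrier[OF free_rep_cmod S_sub] by (auto simp: T_eq)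
  have "Poly_Mapping.keys y \<subseteq> carrier M \<times> carrier N" using y(1) by simp
  then have "P (pr y)"
  proof (induction y rule: pm_induct)
    case zero
    show ?case using z by (simp only: pr_zero)
  next
    case (add k c y)
    obtain m n where k: "k = (m, n)" "m \<in> carrier M" "n \<in> carrier N" using add(1) by auto
    have "pr (Poly_Mapping.single k c) = tens (c \<odot>\<^bsub>M\<^esub> m) n"
      using k pr_scale[of "Poly_Mapping.single (m, n) 1" c] by (simp add: tens_smult_left) (simp add: tens_def)
    then show ?case using a[of "c \<odot>\<^bsub>M\<^esub> m" n "pr y"] add k by (simp add: pr_add pr_closed)
  qed
  then show ?thesis using y by simp
qed

lemma tens_lmap_eq:
  assumes X: "cmod X" and f: "lmap T X f" "lmap T X f'"
    and eq: "\<And>m n. m \<in> carrier M \<Longrightarrow> n \<in> carrier N \<Longrightarrow> f (tens m n) = f' (tens m n)" and u: "u \<in> carrier T"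
  shows "f u = f' u"
  using u
proof (induction u rule: tens_induct)
  case zero
  interpret X: cvec X by (rule cvecI[OF X])
  show ?case using lmap_smult[OF f(1), of "\<zero>\<^bsub>T\<^esub>" 0] lmap_smult[OF f(2), of "\<zero>\<^bsub>T\<^esub>" 0]
    lmap_closed[OF f(1), of "\<zero>\<^bsub>T\<^esub>"] lmap_closed[OF f(2), of "\<zero>\<^bsub>T\<^esub>"] by simp
qed (simp add: lmap_add[OF f(1)] lmap_add[OF f(2)] eq)

text \<open>The linear extension of \<open>\<beta>\<close> to the free space kills the tensor
  relations by bilinearity and the relations from \<open>B\<close> by assumption, hence it factors
  through the quotient.\<close>

lemma universal:
  assumes X: "cmod X" and \<beta>: "bilin M N X \<beta>"
    and B\<beta>: "\<And>m n m' n'. ((m, n), (m', n')) \<in> B \<Longrightarrow> \<beta> m n = \<beta> m' n'"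
  obtains \<psi> where "lmap T X \<psi>" "\<And>m n. m \<in> carrier M \<Longrightarrow> n \<in> carrier N \<Longrightarrow> \<psi> (tens m n) = \<beta> m n"
proof -
  interpret X: cvec X by (rule cvecI[OF X])
  let ?b = "\<lambda>(m, n). \<beta> m n"
  let ?\<phi> = "lext X ?b"
  have bl: "\<And>m. m \<in> carrier M \<Longrightarrow> lmap N X (\<beta> m)" "\<And>n. n \<in> carrier N \<Longrightarrow> lmap M X (\<lambda>m. \<beta> m n)"
    using \<beta> by (auto simp: bilin_def)
  have \<beta>c: "\<beta> m n \<in> carrier X" if "m \<in> carrier M" "n \<in> carrier N" for m n
    using bl that lmap_closed by fast
  then have c: "?b \<in> Poly_Mapping.keys y \<rightarrow> carrier X" if "y \<in> carrier F" for y
    using that by auto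
  have \<phi>: "lmap F X ?\<phi>"
    by (rule lmapI) (simp_all add: c X.lext_closed X.lext_add X.lext_scale)
  have s: "?\<phi> (Poly_Mapping.single (m, n) d) = d \<odot>\<^bsub>X\<^esub> \<beta> m n" if "m \<in> carrier M" "n \<in> carrier N" for m n d
    using that \<beta>c by (simp add: X.lext_single)
  have d: "?\<phi> (y - y') = ?\<phi> y \<ominus>\<^bsub>X\<^esub> ?\<phi> y'" if "y \<in> carrier F" "y' \<in> carrier F" for y y'
    using lmap_add[OF \<phi> that(1) F.smult_closed'[OF that(2), of "-1"]] lmap_smult[OF \<phi> that(2), of "-1"]
      lmap_closed[OF \<phi>] that by (simp add: X.diff_smult scale_distrib)
  have "rels \<subseteq> {y \<in> carrier F. ?\<phi> y = \<zero>\<^bsub>X\<^esub>}"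
  proof
    fix y assume y: "y \<in> rels"
    then have "?\<phi> y = \<zero>\<^bsub>X\<^esub>"
    proof (cases rule: rels_cases)
      case (add_left m m' n)
      have "?\<phi> y = \<beta> (m \<oplus>\<^bsub>M\<^esub> m') n \<ominus>\<^bsub>X\<^esub> \<beta> m n \<ominus>\<^bsub>X\<^esub> \<beta> m' n"
        unfolding add_left using add_left(1-3)
        by (subst d, intro F_diff_closed single_in_F, simp_all add: single_in_F d s \<beta>c del: free_rep_simps)
      also have "\<dots> = \<zero>\<^bsub>X\<^esub>" using add_left \<beta>c lmap_add[OF bl(2)]
        by (intro X.vec_eqI) (simp_all add: cfun_add)
      finally show ?thesis .
    next
      case (add_right m n n')
      have "?\<phi> y = \<beta> m (n \<oplus>\<^bsub>N\<^esub> n') \<ominus>\<^bsub>X\<^esub> \<beta> m n \<ominus>\<^bsub>X\<^esub> \<beta> m n'"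
        unfolding add_right using add_right(1-3)
        by (subst d, intro F_diff_closed single_in_F, simp_all add: single_in_F d s \<beta>c del: free_rep_simps)
      also have "\<dots> = \<zero>\<^bsub>X\<^esub>" using add_right \<beta>c lmap_add[OF bl(1)]
        by (intro X.vec_eqI) (simp_all add: cfun_add)
      finally show ?thesis .
    next
      case (smult_left c m n)
      have "?\<phi> y = \<beta> (c \<odot>\<^bsub>M\<^esub> m) n \<ominus>\<^bsub>X\<^esub> c \<odot>\<^bsub>X\<^esub> \<beta> m n"
        unfolding smult_left using smult_left(1-2) by (simp_all add: single_in_F d s \<beta>c del: free_rep_simps)
      then show ?thesis using smult_left \<beta>c lmap_smult[OF bl(2)] by simp
    next
      case (smult_right c m n)
      have "?\<phi> y = \<beta> m (c \<odot>\<^bsub>N\<^esub> n) \<ominus>\<^bsub>X\<^esub> c \<odot>\<^bsub>X\<^esub> \<beta> m n"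
        unfolding smult_right using smult_right(1-2) by (simp_all add: single_in_F d s \<beta>c del: free_rep_simps)
      then show ?thesis using smult_right \<beta>c lmap_smult[OF bl(1)] by simp
    next
      case (rel k l)
      obtain m n m' n' where kl: "k = (m, n)" "l = (m', n')" by fastforce
      then have k: "m \<in> carrier M" "n \<in> carrier N" "m' \<in> carrier M" "n' \<in> carrier N" using B rel by auto
      have "?\<phi> y = \<beta> m n \<ominus>\<^bsub>X\<^esub> \<beta> m' n'"
        unfolding rel kl using k by (simp_all add: single_in_F d s \<beta>c del: free_rep_simps)
      then show ?thesis using k \<beta>c B\<beta>[OF rel(1)[unfolded kl]] by simp
    qed
    then show "y \<in> {y \<in> carrier F. ?\<phi> y = \<zero>\<^bsub>X\<^esub>}" using y rels_subset by blast
  qed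
  moreover have "submodule {y \<in> carrier F. ?\<phi> y = \<zero>\<^bsub>X\<^esub>} \<CC> F"
    by (rule F.submoduleI') (use F.M.a_closed F.smult_closed' in
      \<open>auto simp: lmap_add[OF \<phi>] lmap_smult[OF \<phi>] simp del: free_rep_simps\<close>, simp_all)
  ultimately have "S \<subseteq> {y \<in> carrier F. ?\<phi> y = \<zero>\<^bsub>X\<^esub>}" unfolding S_def by (intro lin_span_minimal)
  then have "\<And>y. y \<in> S \<Longrightarrow> ?\<phi> y = \<zero>\<^bsub>X\<^esub>" by blast
  from quot_factor[OF free_rep_cmod S_sub \<phi> this X]
  obtain \<psi> where "lmap T X \<psi>" "\<And>v. v \<in> carrier F \<Longrightarrow> \<psi> (pr v) = ?\<phi> v"
    unfolding T_eq by blast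
  then show thesis by (intro that[of \<psi>]) (simp_all add: tens_def s \<beta>c)
qed

text \<open>The operator on the quotient is meaningful only once \<open>lin_ext (g x)\<close> is
  known to preserve the relations \<open>S\<close>. This is obtained backwards: the universal
  property gives a map \<open>\<psi>\<close> on the quotient, an induction shows that
  \<open>pr\<close> intertwines \<open>lin_ext (g x)\<close> with \<open>\<psi>\<close>, and so
  elements with class zero go to elements with class zero.\<close>

lemma act_tens:
  assumes G: "\<And>m n. m \<in> carrier M \<Longrightarrow> n \<in> carrier N \<Longrightarrow> g x (m, n) \<in> carrier F \<and> pr (g x (m, n)) = G m n"
    and bl: "bilin M N T G" and BG: "\<And>m n m' n'. ((m, n), (m', n')) \<in> B \<Longrightarrow> G m n = G m' n'"
  shows "lmap T T (act T x)" "\<And>m n. m \<in> carrier M \<Longrightarrow> n \<in> carrier N \<Longrightarrow> act T x (tens m n) = G m n"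
proof -
  obtain \<psi> where \<psi>: "lmap T T \<psi>" "\<And>m n. m \<in> carrier M \<Longrightarrow> n \<in> carrier N \<Longrightarrow> \<psi> (tens m n) = G m n"
    using universal[OF cT bl BG] by blast
  have \<psi>0: "\<psi> \<zero>\<^bsub>T\<^esub> = \<zero>\<^bsub>T\<^esub>"
    using lmap_smult[OF \<psi>(1), of "\<zero>\<^bsub>T\<^esub>" 0] lmap_closed[OF \<psi>(1), of "\<zero>\<^bsub>T\<^esub>"] by simp
  have c: "lin_ext (g x) y \<in> carrier F" if "y \<in> carrier F" for y
  proof -
    have "Poly_Mapping.keys (g x k) \<subseteq> carrier M \<times> carrier N" if "k \<in> carrier M \<times> carrier N" for k
      using that G[of "fst k" "snd k"] by (auto simp: mem_Times_iff)
    with that have "Poly_Mapping.keys (lin_ext (g x) y) \<subseteq> carrier M \<times> carrier N"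
      unfolding free_rep_simps by (intro keys_lin_ext) blast
    then show ?thesis by simp
  qed
  have gF: "g x k \<in> carrier F" "\<psi> (pr (Poly_Mapping.single k 1)) = pr (g x k)" if "k \<in> carrier M \<times> carrier N" for k
    using that G \<psi>(2) by (auto simp: tens_def)
  have *: "pr (lin_ext (g x) y) = \<psi> (pr y)" if "Poly_Mapping.keys y \<subseteq> carrier M \<times> carrier N" for y
    using that
  proof (induction y rule: pm_induct)
    case zero
    show ?case by (simp only: lin_ext_simps pr_zero \<psi>0)
  next
    case (add k a y)
    have s: "pr (Poly_Mapping.single k a) = a \<odot>\<^bsub>T\<^esub> pr (Poly_Mapping.single k 1)"
      using pr_scale[of "Poly_Mapping.single k 1" a] add(1) by simp
    have "pr (lin_ext (g x) (Poly_Mapping.single k a + y)) = a \<odot>\<^bsub>T\<^esub> pr (g x k) \<oplus>\<^bsub>T\<^esub> pr (lin_ext (g x) y)"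
      using gF[OF add(1)] c[of y] add(2) F.smult_closed'[OF gF(1)[OF add(1)], of a]
      by (simp only: lin_ext_add lin_ext_simps pr_add pr_scale) (simp add: pr_add pr_scale)
    also have "\<dots> = \<psi> (pr (Poly_Mapping.single k a + y))"
      using add pr_closed[of y] pr_closed[of "Poly_Mapping.single k 1"]
      by (simp add: pr_add pr_closed s lmap_add[OF \<psi>(1)] lmap_smult[OF \<psi>(1)] gF(2))
    finally show ?case .
  qed
  have S0: "pr y = \<zero>\<^bsub>T\<^esub> \<longleftrightarrow> y \<in> S" if "y \<in> carrier F" for y
    unfolding T_eq by (rule proj_zero_iff[OF free_rep_cmod S_sub that])
  have SF: "y \<in> carrier F" if "y \<in> S" for y
    using F.submoduleD[OF S_sub] that by blast
  have "lin_ext (g x) y \<in> S" if "y \<in> S" for y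
    using S0[OF c[OF SF[OF that]]] S0[OF SF[OF that]] *[of y] SF[OF that] \<psi>0 that by simp
  moreover have "lmap F F (act F x)"
    using c by (intro lmapI) (simp_all add: lin_ext_add lin_ext_scale)
  ultimately have a: "act T x (pr y) = \<psi> (pr y)" if "y \<in> carrier F" for y
    using quot_act[OF free_rep_cmod S_sub, of x y] that * by (simp add: T_eq)
  have a': "act T x u = \<psi> u" if "u \<in> carrier T" for u
    using that a quot_carrier[OF free_rep_cmod S_sub] by (auto simp: T_eq)
  then show "lmap T T (act T x)"
    using \<psi>(1) by (simp add: lmap_def)
  show "act T x (tens m n) = G m n" if "m \<in> carrier M" "n \<in> carrier N" for m n
    using that a' \<psi>(2) by simp
qed

end

section \<open>Modules over Lie subalgebras\<close>

text \<open>Every subalgebra in question is spanned by some of the six basis elements. Written as a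
  coordinate subspace, its closure under the bracket is a computation with coordinates.\<close>

definition coordsp :: "gen set \<Rightarrow> schr set" where
  "coordsp A = {x. \<forall>b. b \<notin> A \<longrightarrow> x $ b = 0}"

lemma bas_nth: "bas a $ b = (if a = b then 1 else 0)"
  by (simp add: axis_def eq_commute)

lemma schr_expand: "x \<in> coordsp A \<Longrightarrow> x = (\<Sum>b\<in>A. x $ b *s bas b)"
  by (auto simp: coordsp_def vec_eq_iff bas_nth if_distrib sum.delta cong: if_cong)

lemma bas_in [simp]: "bas b \<in> coordsp A \<longleftrightarrow> b \<in> A"
  by (auto simp: coordsp_def bas_nth)

lemma coordsp_UNIV: "coordsp UNIV = UNIV"
  by (simp add: coordsp_def)

lemma coordsp_lin: "x \<in> coordsp A \<Longrightarrow> y \<in> coordsp A \<Longrightarrow> x + y \<in> coordsp A"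
  "x \<in> coordsp A \<Longrightarrow> c *s x \<in> coordsp A" "0 \<in> coordsp A"
  by (simp_all add: coordsp_def)

lemma coordsp_mono: "A \<subseteq> B \<Longrightarrow> coordsp A \<subseteq> coordsp B"
  by (auto simp: coordsp_def)

lemma span_bas: "vec.span (bas ` A) = coordsp A"
proof (rule vec.span_unique)
  show "bas ` A \<subseteq> coordsp A" by auto
  show "vec.subspace (coordsp A)" by (simp add: vec.subspace_def coordsp_lin)
  fix T :: "schr set" assume T: "bas ` A \<subseteq> T" "vec.subspace T"
  show "coordsp A \<subseteq> T"
  proof
    fix x assume "x \<in> coordsp A"
    then have "x = (\<Sum>b\<in>A. x $ b *s bas b)" by (rule schr_expand)
    also have "\<dots> \<in> T" using T by (intro vec.subspace_sum vec.subspace_scale) auto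
    finally show "x \<in> T" .
  qed
qed

abbreviation "ageG \<equiv> {gE, gH, gP, gQ, gZ}"
abbreviation "heisG \<equiv> {gP, gQ, gZ}"
abbreviation "sl2G \<equiv> {gE, gF, gH}"

lemma age1_coordsp: "age1 = coordsp ageG"
  and heis_coordsp: "heis = coordsp heisG"
  and sl2_coordsp: "sl2 = coordsp sl2G"
  using span_bas[of ageG] span_bas[of heisG] span_bas[of sl2G]
  by (simp_all add: age1_def heis_def sl2_def)

lemma all_gen: "(\<forall>c. P c) \<longleftrightarrow> P gF \<and> P gQ \<and> P gH \<and> P gE \<and> P gP \<and> P gZ"
  by (metis gen.exhaust)

definition lie_sub :: "schr set \<Rightarrow> bool" where
  "lie_sub L \<longleftrightarrow> 0 \<in> L \<and> (\<forall>x\<in>L. \<forall>y\<in>L. x + y \<in> L \<and> bracket x y \<in> L) \<and> (\<forall>c. \<forall>x\<in>L. c *s x \<in> L)"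

lemma lie_sub_coordsp:
  assumes "\<And>x y. x \<in> coordsp A \<Longrightarrow> y \<in> coordsp A \<Longrightarrow> bracket x y \<in> coordsp A"
  shows "lie_sub (coordsp A)"
  using assms by (simp add: lie_sub_def coordsp_lin)

lemma lie_sub_UNIV: "lie_sub UNIV"
  by (simp add: lie_sub_def)

lemma lie_sub_gens:
  "lie_sub (coordsp ageG)" "lie_sub (coordsp heisG)" "lie_sub (coordsp sl2G)"
  "lie_sub (coordsp {gH, gZ, gQ})" "lie_sub (coordsp {gQ, gZ})" "lie_sub (coordsp {gE, gH})"
  by (rule lie_sub_coordsp; simp add: coordsp_def all_gen bracket_coords)+

lemma bracket_bas: "bracket (bas a) (bas b) = bracket_table a b - bracket_table b a"
proof -
  have "bracket (bas a) (bas b) = (\<Sum>a'\<in>UNIV. \<Sum>b'\<in>UNIV. if a' = a \<and> b' = b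
      then bracket_table a b - bracket_table b a else 0)"
    unfolding bracket_def by (intro sum.cong refl) (auto simp: bas_nth)
  also have "\<dots> = (\<Sum>a'\<in>UNIV. if a' = a then bracket_table a b - bracket_table b a else 0)"
    by (intro sum.cong refl) (simp add: sum.delta)
  finally show ?thesis by (simp add: sum.delta)
qed

text \<open>\<open>shift\<close> is minus the \<open>h\<close>-weight (see
  \<open>bracket_gH\<close>), and brackets add weights. The alternative \<open>k = 0\<close> covers
  commuting pairs, whose total weight may be the weight of no basis element.\<close>

lemma bracket_bas_graded:
  "\<exists>k c. bracket (bas a) (bas b) = k *s bas c \<and> (k = 0 \<or> shift c = shift a + shift b)"
proof -
  have "\<exists>k c. bracket_table a b - bracket_table b a = k *s bas c \<and> (k = 0 \<or> shift c = shift a + shift b)"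
    (is "\<exists>k c. ?P k c")
  proof -
    have "\<exists>k\<in>{0, 1, -1, 2, -2}. \<exists>c. ?P k c"
      by (cases a; cases b; simp add: shift_def; (intro exI conjI)?; simp?)
        (auto simp: shift_def vec_eq_iff all_gen bas_nth intro: exI[of _ gF] exI[of _ gQ] exI[of _ gH] exI[of _ gE] exI[of _ gP] exI[of _ gZ])
    then show ?thesis by blast
  qed
  then show ?thesis by (simp only: bracket_bas)
qed

lemma bracket_gH: "bracket (bas gH) (bas b) = (- of_int (shift b)) *s bas b"
  unfolding bracket_bas by (cases b) (simp_all add: shift_def vec_eq_iff)

context lierep
begin

text \<open>All rules are oriented towards the order \<open>f, q, p, e, h, z\<close>, with
  \<open>f\<close> applied last. As rewrite rules they bring every product of operators into this
  ordered form, after which identities in the enveloping algebra are linear arithmetic.\<close>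

lemma comm_rules:
  assumes v: "v \<in> carrier M"
  shows
    "bas gH \<in> L \<Longrightarrow> bas gF \<in> L \<Longrightarrow> act M (bas gH) (act M (bas gF) v) = act M (bas gF) (act M (bas gH) v) \<oplus> (-2) \<odot> act M (bas gF) v"
    "bas gH \<in> L \<Longrightarrow> bas gQ \<in> L \<Longrightarrow> act M (bas gH) (act M (bas gQ) v) = act M (bas gQ) (act M (bas gH) v) \<oplus> (-1) \<odot> act M (bas gQ) v"
    "bas gH \<in> L \<Longrightarrow> bas gP \<in> L \<Longrightarrow> act M (bas gH) (act M (bas gP) v) = act M (bas gP) (act M (bas gH) v) \<oplus> act M (bas gP) v"
    "bas gH \<in> L \<Longrightarrow> bas gE \<in> L \<Longrightarrow> act M (bas gH) (act M (bas gE) v) = act M (bas gE) (act M (bas gH) v) \<oplus> 2 \<odot> act M (bas gE) v"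
    "bas gE \<in> L \<Longrightarrow> bas gF \<in> L \<Longrightarrow> bas gH \<in> L \<Longrightarrow> act M (bas gE) (act M (bas gF) v) = act M (bas gF) (act M (bas gE) v) \<oplus> act M (bas gH) v"
    "bas gE \<in> L \<Longrightarrow> bas gQ \<in> L \<Longrightarrow> bas gP \<in> L \<Longrightarrow> act M (bas gE) (act M (bas gQ) v) = act M (bas gQ) (act M (bas gE) v) \<oplus> act M (bas gP) v"
    "bas gE \<in> L \<Longrightarrow> bas gP \<in> L \<Longrightarrow> act M (bas gE) (act M (bas gP) v) = act M (bas gP) (act M (bas gE) v)"
    "bas gP \<in> L \<Longrightarrow> bas gF \<in> L \<Longrightarrow> bas gQ \<in> L \<Longrightarrow> act M (bas gP) (act M (bas gF) v) = act M (bas gF) (act M (bas gP) v) \<oplus> (-1) \<odot> act M (bas gQ) v"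
    "bas gP \<in> L \<Longrightarrow> bas gQ \<in> L \<Longrightarrow> bas gZ \<in> L \<Longrightarrow> act M (bas gP) (act M (bas gQ) v) = act M (bas gQ) (act M (bas gP) v) \<oplus> act M (bas gZ) v"
    "bas gQ \<in> L \<Longrightarrow> bas gF \<in> L \<Longrightarrow> act M (bas gQ) (act M (bas gF) v) = act M (bas gF) (act M (bas gQ) v)"
    "b \<noteq> gZ \<Longrightarrow> bas gZ \<in> L \<Longrightarrow> bas b \<in> L \<Longrightarrow> act M (bas gZ) (act M (bas b) v) = act M (bas b) (act M (bas gZ) v)"
proof -
  have *: "act M (bas a) (act M (bas b) v) = act M (bas b) (act M (bas a) v) \<oplus> k \<odot> act M (bas c) v"
    if "bas a \<in> L" "bas b \<in> L" "bas c \<in> L" "bracket_table a b - bracket_table b a = k *s bas c" for a b c k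
  proof -
    have e: "k \<odot> act M (bas c) v = act M (bas a) (act M (bas b) v) \<ominus> act M (bas b) (act M (bas a) v)"
      using act_bracket[OF that(1,2) v] act_scale[OF that(3) v, of k] by (simp add: bracket_bas that(4))
    show ?thesis unfolding e using that v by (intro vec_eqI) (simp_all add: cfun_add)
  qed
  show "bas gH \<in> L \<Longrightarrow> bas gF \<in> L \<Longrightarrow> act M (bas gH) (act M (bas gF) v) = act M (bas gF) (act M (bas gH) v) \<oplus> (-2) \<odot> act M (bas gF) v"
    by (rule *) simp_all
  show "bas gH \<in> L \<Longrightarrow> bas gQ \<in> L \<Longrightarrow> act M (bas gH) (act M (bas gQ) v) = act M (bas gQ) (act M (bas gH) v) \<oplus> (-1) \<odot> act M (bas gQ) v"
    by (rule *) simp_all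
  show "bas gH \<in> L \<Longrightarrow> bas gP \<in> L \<Longrightarrow> act M (bas gH) (act M (bas gP) v) = act M (bas gP) (act M (bas gH) v) \<oplus> act M (bas gP) v"
    using *[of gH gP gP 1] v by simp
  show "bas gH \<in> L \<Longrightarrow> bas gE \<in> L \<Longrightarrow> act M (bas gH) (act M (bas gE) v) = act M (bas gE) (act M (bas gH) v) \<oplus> 2 \<odot> act M (bas gE) v"
    by (rule *) simp_all
  show "bas gE \<in> L \<Longrightarrow> bas gF \<in> L \<Longrightarrow> bas gH \<in> L \<Longrightarrow> act M (bas gE) (act M (bas gF) v) = act M (bas gF) (act M (bas gE) v) \<oplus> act M (bas gH) v"
    using *[of gE gF gH 1] v by simp
  show "bas gE \<in> L \<Longrightarrow> bas gQ \<in> L \<Longrightarrow> bas gP \<in> L \<Longrightarrow> act M (bas gE) (act M (bas gQ) v) = act M (bas gQ) (act M (bas gE) v) \<oplus> act M (bas gP) v"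
    using *[of gE gQ gP 1] v by simp
  show "bas gE \<in> L \<Longrightarrow> bas gP \<in> L \<Longrightarrow> act M (bas gE) (act M (bas gP) v) = act M (bas gP) (act M (bas gE) v)"
    using *[of gE gP gP 0] v by simp
  show "bas gP \<in> L \<Longrightarrow> bas gF \<in> L \<Longrightarrow> bas gQ \<in> L \<Longrightarrow> act M (bas gP) (act M (bas gF) v) = act M (bas gF) (act M (bas gP) v) \<oplus> (-1) \<odot> act M (bas gQ) v"
    by (rule *) simp_all
  show "bas gP \<in> L \<Longrightarrow> bas gQ \<in> L \<Longrightarrow> bas gZ \<in> L \<Longrightarrow> act M (bas gP) (act M (bas gQ) v) = act M (bas gQ) (act M (bas gP) v) \<oplus> act M (bas gZ) v"
    using *[of gP gQ gZ 1] v by simp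
  show "bas gQ \<in> L \<Longrightarrow> bas gF \<in> L \<Longrightarrow> act M (bas gQ) (act M (bas gF) v) = act M (bas gF) (act M (bas gQ) v)"
    using *[of gQ gF gF 0] v by simp
  show "b \<noteq> gZ \<Longrightarrow> bas gZ \<in> L \<Longrightarrow> bas b \<in> L \<Longrightarrow> act M (bas gZ) (act M (bas b) v) = act M (bas b) (act M (bas gZ) v)"
    using *[of gZ b gZ 0] v by (cases b) simp_all
qed

lemma act_0: "x \<in> L \<Longrightarrow> v \<in> carrier M \<Longrightarrow> act M 0 v = \<zero>"
  using act_scale[of x v 0] by simp

lemma act_expand:
  assumes L: "L = coordsp A" and x: "x \<in> L" and v: "v \<in> carrier M"
  shows "act M x v = (\<Oplus>b\<in>A. x $ b \<odot> act M (bas b) v)"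
proof -
  have b: "c *s bas b \<in> L" if "b \<in> A" for b c using that by (simp add: L coordsp_lin)
  have z: "act M 0 v = \<zero>" by (rule act_0[OF x v])
  have "act M (\<Sum>b\<in>B. x $ b *s bas b) v = (\<Oplus>b\<in>B. x $ b \<odot> act M (bas b) v) \<and> (\<Sum>b\<in>B. x $ b *s bas b) \<in> L"
    if "B \<subseteq> A" for B
    using finite[of B] that
  proof (induction B rule: finite_induct)
    case empty
    then show ?case by (simp add: z L coordsp_lin)
  next
    case (insert b B)
    have bL: "bas b \<in> L" using insert by (simp add: L)
    have "(\<lambda>b. x $ b \<odot> act M (bas b) v) \<in> B \<rightarrow> carrier M"
      using insert v by (auto simp: L intro!: smult_closed' act_closed)
    then show ?case
      using insert b[of b] bL v by (auto simp: act_plus act_scale L coordsp_lin)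
  qed
  from this[OF order_refl] show ?thesis using schr_expand[of x A] x L by simp
qed

lemma subrep_basisI:
  assumes L: "L = coordsp A" and H: "submodule H \<CC> M" and b: "\<And>b v. b \<in> A \<Longrightarrow> v \<in> H \<Longrightarrow> act M (bas b) v \<in> H"
  shows "subrep L M H"
  unfolding subrep_def
proof (intro conjI ballI)
  fix x v assume x: "x \<in> L" "v \<in> H"
  then have "act M x v = (\<Oplus>b\<in>A. x $ b \<odot> act M (bas b) v)"
    using submoduleD(2)[OF H] by (intro act_expand[OF L]) auto
  also have "\<dots> \<in> H"
    by (rule submodule_finsum[OF H]) (use x b submoduleD(5)[OF H] in auto)
  finally show "act M x v \<in> H" .
qed (rule H)

end

lemma lmap_zero:
  assumes "cmod M" "cmod M'" "lmap M M' \<phi>"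
  shows "\<phi> \<zero>\<^bsub>M\<^esub> = \<zero>\<^bsub>M'\<^esub>"
proof -
  interpret M: cvec M by (rule cvecI[OF assms(1)])
  interpret M': cvec M' by (rule cvecI[OF assms(2)])
  show ?thesis
    using lmap_smult[OF assms(3), of "\<zero>\<^bsub>M\<^esub>" 0] lmap_closed[OF assms(3), of "\<zero>\<^bsub>M\<^esub>"] by simp
qed

lemma lmap_finsum:
  assumes "cmod M" "cmod M'" "lmap M M' \<phi>" "f \<in> I \<rightarrow> carrier M"
  shows "\<phi> (finsum M f I) = (\<Oplus>\<^bsub>M'\<^esub>i\<in>I. \<phi> (f i))"
proof -
  interpret M: cvec M by (rule cvecI[OF assms(1)])
  interpret M': cvec M' by (rule cvecI[OF assms(2)])
  show ?thesis using assms(4)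
  proof (induction I rule: infinite_finite_induct)
    case (insert i I)
    then have "f \<in> I \<rightarrow> carrier M" "f i \<in> carrier M" "(\<lambda>i. \<phi> (f i)) \<in> I \<rightarrow> carrier M'" "\<phi> (f i) \<in> carrier M'"
      using lmap_closed[OF assms(3)] by auto
    with insert show ?case by (simp add: lmap_add[OF assms(3)])
  qed (simp_all add: M.finsum_infinite M'.finsum_infinite lmap_zero[OF assms(1-3)])
qed

lemma rhom_basisI:
  assumes M: "lie_module (coordsp A) M" and M': "lie_module (coordsp A) M'" and \<phi>: "lmap M M' \<phi>"
    and b: "\<And>b v. b \<in> A \<Longrightarrow> v \<in> carrier M \<Longrightarrow> \<phi> (act M (bas b) v) = act M' (bas b) (\<phi> v)"
  shows "rhom (coordsp A) M M' \<phi>"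
proof (rule rhomI[OF \<phi>])
  interpret M: lierep "coordsp A" M by (rule lierepI[OF M])
  interpret M': lierep "coordsp A" M' by (rule lierepI[OF M'])
  fix x v assume x: "x \<in> coordsp A" and v: "v \<in> carrier M"
  have "\<phi> (act M x v) = (\<Oplus>\<^bsub>M'\<^esub>b\<in>A. \<phi> (x $ b \<odot>\<^bsub>M\<^esub> act M (bas b) v))"
    unfolding M.act_expand[OF refl x v]
    by (rule lmap_finsum[OF M.cmodM M'.cmodM \<phi>]) (use v in \<open>auto intro!: M.smult_closed'\<close>)
  also have "\<dots> = act M' x (\<phi> v)"
    unfolding M'.act_expand[OF refl x lmap_closed[OF \<phi> v]]
    by (rule M'.finsum_cong') (simp_all add: lmap_smult[OF \<phi>] b v lmap_closed[OF \<phi>] Pi_def)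
  finally show "\<phi> (act M x v) = act M' x (\<phi> v)" .
qed

text \<open>Both sides of the bracket relation are bilinear in the Lie algebra elements, so pairs of
  basis elements suffice. The separating family \<open>\<Xi>\<close> is left open: all functionals
  for an abstract module, coordinate functionals where operators are given by formulas.\<close>

lemma lie_module_basisI:
  assumes M: "cmod M" and act: "act M = basis_act M g" and g: "\<And>b. lmap M M (g b)"
    and cfun: "\<And>\<xi>. \<Xi> \<xi> \<Longrightarrow> cfun M \<xi>"
    and sep: "\<And>u v. u \<in> carrier M \<Longrightarrow> v \<in> carrier M \<Longrightarrow> (\<And>\<xi>. \<Xi> \<xi> \<Longrightarrow> \<xi> u = \<xi> v) \<Longrightarrow> u = v"
    and rel: "\<And>a b v \<xi>. a \<in> A \<Longrightarrow> b \<in> A \<Longrightarrow> v \<in> carrier M \<Longrightarrow> \<Xi> \<xi> \<Longrightarrow>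
      \<xi> (g a (g b v)) - \<xi> (g b (g a v)) = (\<Sum>c\<in>UNIV. bracket (bas a) (bas b) $ c * \<xi> (g c v))"
  shows "lie_module (coordsp A) M"
proof -
  interpret cvec M by (rule cvecI[OF M])
  have gc: "v \<in> carrier M \<Longrightarrow> g b v \<in> carrier M" for b v using g lmap_closed by fast
  have cl: "act M x v \<in> carrier M" if "v \<in> carrier M" for x v
    unfolding act basis_act_def by (rule finsum_closed) (use gc that in auto)
  have \<xi>: "\<xi> (act M x v) = (\<Sum>c\<in>UNIV. x $ c * \<xi> (g c v))" if "v \<in> carrier M" "cfun M \<xi>" for \<xi> x v
    unfolding act basis_act_def using that gc by (subst cfun_finsum) (auto simp: cfun_smult)
  have g\<xi>: "cfun M (\<lambda>v. \<xi> (g c v))" if "cfun M \<xi>" for \<xi> c by (rule cfun_comp[OF g that])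
  have \<xi>2: "\<xi> (act M x (act M y v)) = (\<Sum>a\<in>UNIV. \<Sum>b\<in>UNIV. x $ a * y $ b * \<xi> (g a (g b v)))"
    if "v \<in> carrier M" "cfun M \<xi>" for \<xi> x y v
    by (simp add: \<xi>[OF cl[OF that(1)] that(2)] \<xi>[OF that(1) g\<xi>[OF that(2)]] sum_distrib_left mult.assoc)
  have br: "bracket x y $ c = (\<Sum>a\<in>UNIV. \<Sum>b\<in>UNIV. x $ a * y $ b * bracket (bas a) (bas b) $ c)" for x y c
    unfolding bracket_bas by (simp add: bracket_def)
  show ?thesis
    unfolding lie_module_def
  proof (intro conjI ballI allI)
    fix x y v assume x: "x \<in> coordsp A" and y: "y \<in> coordsp A" and v: "v \<in> carrier M"
    show "act M (bracket x y) v = act M x (act M y v) \<ominus>\<^bsub>M\<^esub> act M y (act M x v)"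
    proof (rule sep)
      fix \<xi> assume f': "\<Xi> \<xi>"
      note f = cfun[OF f']
      have "\<xi> (act M x (act M y v) \<ominus>\<^bsub>M\<^esub> act M y (act M x v)) =
          (\<Sum>a\<in>UNIV. \<Sum>b\<in>UNIV. x $ a * y $ b * \<xi> (g a (g b v))) - (\<Sum>a\<in>UNIV. \<Sum>b\<in>UNIV. x $ b * y $ a * \<xi> (g a (g b v)))"
        using f v cl by (simp add: \<xi>2 mult.commute)
      also have "(\<Sum>a\<in>UNIV. \<Sum>b\<in>UNIV. x $ b * y $ a * \<xi> (g a (g b v))) = (\<Sum>a\<in>UNIV. \<Sum>b\<in>UNIV. x $ a * y $ b * \<xi> (g b (g a v)))"
        by (rule sum.swap)
      also have "(\<Sum>a\<in>UNIV. \<Sum>b\<in>UNIV. x $ a * y $ b * \<xi> (g a (g b v))) - \<dots> =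
          (\<Sum>a\<in>UNIV. \<Sum>b\<in>UNIV. x $ a * y $ b * (\<Sum>c\<in>UNIV. bracket (bas a) (bas b) $ c * \<xi> (g c v)))"
        unfolding sum_subtractf[symmetric]
      proof (intro sum.cong refl)
        fix a b
        have "x $ a * y $ b = 0 \<or> a \<in> A \<and> b \<in> A" using x y by (auto simp: coordsp_def)
        then show "x $ a * y $ b * \<xi> (g a (g b v)) - x $ a * y $ b * \<xi> (g b (g a v)) =
            x $ a * y $ b * (\<Sum>c\<in>UNIV. bracket (bas a) (bas b) $ c * \<xi> (g c v))"
          using rel[OF _ _ v f', of a b] by (auto simp: right_diff_distrib[symmetric])
      qed
      also have "\<dots> = (\<Sum>c\<in>UNIV. \<Sum>a\<in>UNIV. \<Sum>b\<in>UNIV. x $ a * y $ b * bracket (bas a) (bas b) $ c * \<xi> (g c v))"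
      proof -
        have "(\<Sum>a\<in>UNIV. \<Sum>b\<in>UNIV. x $ a * y $ b * (\<Sum>c\<in>UNIV. bracket (bas a) (bas b) $ c * \<xi> (g c v))) =
            (\<Sum>a\<in>UNIV. \<Sum>b\<in>UNIV. \<Sum>c\<in>UNIV. x $ a * y $ b * bracket (bas a) (bas b) $ c * \<xi> (g c v))"
          by (simp add: sum_distrib_left mult.assoc)
        also have "\<dots> = (\<Sum>a\<in>UNIV. \<Sum>c\<in>UNIV. \<Sum>b\<in>UNIV. x $ a * y $ b * bracket (bas a) (bas b) $ c * \<xi> (g c v))"
          by (intro sum.cong refl sum.swap)
        also have "\<dots> = (\<Sum>c\<in>UNIV. \<Sum>a\<in>UNIV. \<Sum>b\<in>UNIV. x $ a * y $ b * bracket (bas a) (bas b) $ c * \<xi> (g c v))"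
          by (rule sum.swap)
        finally show ?thesis .
      qed
      also have "\<dots> = \<xi> (act M (bracket x y) v)"
        unfolding \<xi>[OF v f]
        by (rule sum.cong[OF refl], subst br[of x y]) (simp only: sum_distrib_right)
      finally show "\<xi> (act M (bracket x y) v) = \<xi> (act M x (act M y v) \<ominus>\<^bsub>M\<^esub> act M y (act M x v))" by simp
    qed (use cl v in auto)
  qed (use M cl in \<open>auto intro!: vec_eqI simp: \<xi> cfun_add cfun_smult g\<xi>[THEN cfun_add] g\<xi>[THEN cfun_smult]
        sum.distrib sum_distrib_left algebra_simps\<close>)
qed

lemma lie_module_mono: "lie_module L M \<Longrightarrow> K \<subseteq> L \<Longrightarrow> lie_module K M"
  unfolding lie_module_def by (meson subsetD)

section \<open>Simple quotients\<close>

lemma lie_quot: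
  assumes M: "lie_module L M" and N: "subrep L M N" and L: "lie_sub L"
  shows "lie_module L (quot_rep M N)" "rhom L M (quot_rep M N) (proj M N)"
    "carrier (quot_rep M N) = proj M N ` carrier M" "\<zero>\<^bsub>quot_rep M N\<^esub> = proj M N \<zero>\<^bsub>M\<^esub>"
    "\<And>v. v \<in> carrier M \<Longrightarrow> proj M N v = \<zero>\<^bsub>quot_rep M N\<^esub> \<longleftrightarrow> v \<in> N"
proof -
  interpret M: lierep L M by (rule lierepI[OF M])
  note q = M.cmodM subrep_submodule[OF N]
  show hom: "rhom L M (quot_rep M N) (proj M N)"
    by (rule rhomI[OF quot_lmap[OF q]], subst quot_act[OF q])
      (auto simp: M.act_lmap M.subrep_act[OF N])
  show c: "carrier (quot_rep M N) = proj M N ` carrier M" by (rule quot_carrier[OF q])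
  show "lie_module L (quot_rep M N)"
    by (rule lie_module_image[OF M quot_cmod[OF q] hom c[symmetric]]) (use L in \<open>auto simp: lie_sub_def\<close>)
  show "\<zero>\<^bsub>quot_rep M N\<^esub> = proj M N \<zero>\<^bsub>M\<^esub>" by (rule quot_zero(1)[OF q])
  show "\<And>v. v \<in> carrier M \<Longrightarrow> proj M N v = \<zero>\<^bsub>quot_rep M N\<^esub> \<longleftrightarrow> v \<in> N" by (rule proj_zero_iff[OF q])
qed

lemma kernel_subrep0:
  assumes "lie_module L M" "lie_module L M'" "rhom L M M' \<phi>"
  shows "subrep L M {v \<in> carrier M. \<phi> v = \<zero>\<^bsub>M'\<^esub>}"
  using kernel_subrep[OF assms lierep.subrep_0[OF lierepI[OF assms(2)]]] by simp

lemma quot_factor_rhom: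
  assumes M: "lie_module L M" and X: "lie_module L X" and N: "subrep L M N" and L: "lie_sub L"
    and \<phi>: "rhom L M X \<phi>" "\<And>n. n \<in> N \<Longrightarrow> \<phi> n = \<zero>\<^bsub>X\<^esub>"
  obtains \<psi> where "rhom L (quot_rep M N) X \<psi>" "\<And>v. v \<in> carrier M \<Longrightarrow> \<psi> (proj M N v) = \<phi> v"
proof -
  interpret M: lierep L M by (rule lierepI[OF M])
  interpret X: lierep L X by (rule lierepI[OF X])
  note q = M.cmodM subrep_submodule[OF N]
  note lq = lie_quot[OF M N L]
  obtain \<psi> where \<psi>: "lmap (quot_rep M N) X \<psi>" "\<And>v. v \<in> carrier M \<Longrightarrow> \<psi> (proj M N v) = \<phi> v"
    using quot_factor[OF q rhom_lmap[OF \<phi>(1)] \<phi>(2) X.cmodM] by blast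
  have "rhom L (quot_rep M N) X \<psi>"
  proof (rule rhomI[OF \<psi>(1)])
    fix x v assume x: "x \<in> L" and "v \<in> carrier (quot_rep M N)"
    then obtain u where u: "u \<in> carrier M" "v = proj M N u" using lq(3) by auto
    then show "\<psi> (act (quot_rep M N) x v) = act X x (\<psi> v)"
      using x by (simp add: rhom_act[OF lq(2), symmetric] \<psi>(2) rhom_act[OF \<phi>(1)])
  qed
  then show thesis using \<psi>(2) that by blast
qed

lemma inj_onI_lmap:
  assumes "cmod M" "cmod M'" "lmap M M' \<phi>" "\<And>v. v \<in> carrier M \<Longrightarrow> \<phi> v = \<zero>\<^bsub>M'\<^esub> \<Longrightarrow> v = \<zero>\<^bsub>M\<^esub>"
  shows "inj_on \<phi> (carrier M)"
proof (rule inj_onI)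
  interpret M: cvec M by (rule cvecI[OF assms(1)])
  interpret M': cvec M' by (rule cvecI[OF assms(2)])
  fix u v assume uv: "u \<in> carrier M" "v \<in> carrier M" "\<phi> u = \<phi> v"
  have "\<phi> (u \<ominus>\<^bsub>M\<^esub> v) = \<phi> u \<ominus>\<^bsub>M'\<^esub> \<phi> v"
    using uv lmap_closed[OF assms(3)] by (simp add: M'.add_minus_smult M.diff_smult M'.diff_smult lmap_add[OF assms(3)] lmap_smult[OF assms(3)])
  then have "\<phi> (u \<ominus>\<^bsub>M\<^esub> v) = \<zero>\<^bsub>M'\<^esub>" using uv lmap_closed[OF assms(3)] by simp
  then have "u \<ominus>\<^bsub>M\<^esub> v = \<zero>\<^bsub>M\<^esub>" using uv assms(4) by simp
  then show "u = v" using uv by (simp add: M.diff_zero_iff)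
qed

lemma first_iso:
  assumes M: "lie_module L M" and X: "lie_module L X" and L: "lie_sub L"
    and \<phi>: "rhom L M X \<phi>" "\<phi> ` carrier M = carrier X"
  shows "rep_iso L (quot_rep M {v \<in> carrier M. \<phi> v = \<zero>\<^bsub>X\<^esub>}) X"
proof -
  let ?N = "{v \<in> carrier M. \<phi> v = \<zero>\<^bsub>X\<^esub>}"
  interpret M: lierep L M by (rule lierepI[OF M])
  interpret X: lierep L X by (rule lierepI[OF X])
  have N: "subrep L M ?N" by (rule kernel_subrep0[OF M X \<phi>(1)])
  note lq = lie_quot[OF M N L]
  obtain \<psi> where \<psi>: "rhom L (quot_rep M ?N) X \<psi>" "\<And>v. v \<in> carrier M \<Longrightarrow> \<psi> (proj M ?N v) = \<phi> v"
    using quot_factor_rhom[OF M X N L \<phi>(1)] by blast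
  interpret Q: lierep L "quot_rep M ?N" by (rule lierepI[OF lq(1)])
  have "inj_on \<psi> (carrier (quot_rep M ?N))"
  proof (rule inj_onI_lmap[OF Q.cmodM X.cmodM rhom_lmap[OF \<psi>(1)]])
    fix v assume v: "v \<in> carrier (quot_rep M ?N)" "\<psi> v = \<zero>\<^bsub>X\<^esub>"
    then obtain u where u: "u \<in> carrier M" "v = proj M ?N u" using lq(3) by auto
    then show "v = \<zero>\<^bsub>quot_rep M ?N\<^esub>" using v \<psi>(2) lq(5) by simp
  qed
  moreover have "\<psi> ` carrier (quot_rep M ?N) = carrier X"
    unfolding lq(3) image_image \<phi>(2)[symmetric] by (rule image_cong[OF refl \<psi>(2)])
  ultimately show ?thesis using \<psi>(1) by (auto simp: rep_iso_iff bij_betw_def)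
qed

text \<open>Submodules of the quotient correspond to the submodules of \<open>M\<close> above
  \<open>N\<close>, by preimage and image. In this form uniqueness of a simple quotient can be read
  off from a largest proper submodule.\<close>

lemma simple_quotient_iff:
  assumes M: "lie_module L M" and L: "lie_sub L"
  shows "simple_quotient L M N \<longleftrightarrow> subrep L M N \<and> N \<noteq> carrier M \<and>
    (\<forall>N'. subrep L M N' \<longrightarrow> N \<subseteq> N' \<longrightarrow> N' = N \<or> N' = carrier M)"
proof (cases "subrep L M N")
  case N: True
  interpret M: lierep L M by (rule lierepI[OF M])
  note lq = lie_quot[OF M N L]
  interpret Q: lierep L "quot_rep M N" by (rule lierepI[OF lq(1)])
  let ?Q = "quot_rep M N"
  note ND = M.submoduleD[OF subrep_submodule[OF N]]
  have ne: "carrier ?Q \<noteq> {\<zero>\<^bsub>?Q\<^esub>} \<longleftrightarrow> N \<noteq> carrier M"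
  proof -
    have "carrier ?Q = {\<zero>\<^bsub>?Q\<^esub>} \<longleftrightarrow> (\<forall>v\<in>carrier M. proj M N v = \<zero>\<^bsub>?Q\<^esub>)"
      unfolding lq(3) using M.zero_closed by blast
    also have "\<dots> \<longleftrightarrow> (\<forall>v\<in>carrier M. v \<in> N)" using lq(5) by blast
    finally have "carrier ?Q = {\<zero>\<^bsub>?Q\<^esub>} \<longleftrightarrow> (\<forall>v\<in>carrier M. v \<in> N)" .
    then show ?thesis using ND(1) by blast
  qed
  have "(\<forall>C. subrep L ?Q C \<longrightarrow> C = {\<zero>\<^bsub>?Q\<^esub>} \<or> C = carrier ?Q) \<longleftrightarrow>
    (\<forall>N'. subrep L M N' \<longrightarrow> N \<subseteq> N' \<longrightarrow> N' = N \<or> N' = carrier M)"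
  proof (intro iffI allI impI)
    fix C assume *: "\<forall>N'. subrep L M N' \<longrightarrow> N \<subseteq> N' \<longrightarrow> N' = N \<or> N' = carrier M" and C: "subrep L ?Q C"
    let ?N' = "{v \<in> carrier M. proj M N v \<in> C}"
    note CD = Q.submoduleD[OF subrep_submodule[OF C]]
    have "subrep L M ?N'" by (rule kernel_subrep[OF M lq(1,2) C])
    moreover have "N \<subseteq> ?N'" using ND lq(5) CD(3) by (metis (mono_tags, lifting) mem_Collect_eq subsetI)
    ultimately consider "?N' = N" | "?N' = carrier M" using * by blast
    then show "C = {\<zero>\<^bsub>?Q\<^esub>} \<or> C = carrier ?Q"
    proof cases
      case 1
      have "c = \<zero>\<^bsub>?Q\<^esub>" if c: "c \<in> C" for c
      proof -
        obtain v where v: "v \<in> carrier M" "c = proj M N v" using CD(2)[OF c] unfolding lq(3) by blast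
        then have "v \<in> N" using 1 c by blast
        then show ?thesis using v lq(5) by blast
      qed
      then have "C = {\<zero>\<^bsub>?Q\<^esub>}" using CD(3) by blast
      then show ?thesis ..
    next
      case 2
      then have "C = carrier ?Q" using CD(1) unfolding lq(3) by blast
      then show ?thesis ..
    qed
  next
    fix N' assume *: "\<forall>C. subrep L ?Q C \<longrightarrow> C = {\<zero>\<^bsub>?Q\<^esub>} \<or> C = carrier ?Q" and N': "subrep L M N'" "N \<subseteq> N'"
    note D = M.submoduleD[OF subrep_submodule[OF N'(1)]]
    have "subrep L ?Q (proj M N ` N')" by (rule image_subrep[OF M lq(1,2) N'(1)])
    then consider "proj M N ` N' = {\<zero>\<^bsub>?Q\<^esub>}" | "proj M N ` N' = carrier ?Q" using * by blast
    then show "N' = N \<or> N' = carrier M"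
    proof cases
      case 1
      have "v \<in> N" if v: "v \<in> N'" for v
      proof -
        have "proj M N v = \<zero>\<^bsub>?Q\<^esub>" using 1 imageI[OF v, of "proj M N"] by simp
        then show ?thesis using lq(5)[OF D(2)[OF v]] by simp
      qed
      then show ?thesis using N' by blast
    next
      case 2
      have "v \<in> N'" if v: "v \<in> carrier M" for v
      proof -
        obtain u where u: "u \<in> N'" "proj M N v = proj M N u" using 2 v unfolding lq(3) by blast
        then have "v \<ominus>\<^bsub>M\<^esub> u \<in> N'" using proj_eq[OF M.cmodM subrep_submodule[OF N] v D(2)[OF u(1)]] N'(2) by blast
        then have "(v \<ominus>\<^bsub>M\<^esub> u) \<oplus>\<^bsub>M\<^esub> u \<in> N'" using D(4) u(1) by blast
        moreover have "(v \<ominus>\<^bsub>M\<^esub> u) \<oplus>\<^bsub>M\<^esub> u = v" using v D(2)[OF u(1)] by (intro M.vec_eqI) (simp_all add: cfun_add)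
        ultimately show ?thesis by simp
      qed
      then show ?thesis using D(1) by blast
    qed
  qed
  then show ?thesis using N ne lq(1) by (simp add: simple_quotient_def simple_module_def irreducible_rep_def)
qed (simp add: simple_quotient_def)

lemma unique_simple_quotient:
  assumes M: "lie_module L M" and L: "lie_sub L" and K: "subrep L M K" "K \<noteq> carrier M"
    and max: "\<And>N. subrep L M N \<Longrightarrow> N \<noteq> carrier M \<Longrightarrow> N \<subseteq> K"
  shows "has_unique_simple_quotient L M" "the_simple_quotient L M = quot_rep M K"
proof -
  have *: "simple_quotient L M N \<longleftrightarrow> N = K" for N
    unfolding simple_quotient_iff[OF M L] using K max by blast
  show "has_unique_simple_quotient L M" by (simp add: has_unique_simple_quotient_def *)
  show "the_simple_quotient L M = quot_rep M K" by (simp add: the_simple_quotient_def *)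
qed

lemma unique_maximal:
  assumes M: "lie_module L M" and L: "lie_sub L" and u: "has_unique_simple_quotient L M"
    and K: "simple_quotient L M K"
  shows "the_simple_quotient L M = quot_rep M K"
  using u K unfolding has_unique_simple_quotient_def the_simple_quotient_def by (simp add: the1_equality)

text \<open>Applying \<open>A - \<beta> j\<close> eliminates the component \<open>u j\<close>.\<close>

lemma (in cvec) eigen_components:
  assumes D: "submodule D \<CC> M" and A: "lmap M M A" "\<And>v. v \<in> D \<Longrightarrow> A v \<in> D"
    and J: "finite J" "inj_on \<beta> J" "\<And>i. i \<in> J \<Longrightarrow> u i \<in> carrier M"
      "\<And>i. i \<in> J \<Longrightarrow> A (u i) = \<beta> i \<odot> u i"
    and sum: "(\<Oplus>i\<in>J. u i) \<in> D" and i: "i \<in> J"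
  shows "u i \<in> D"
  using J sum i
proof (induction J arbitrary: u i rule: finite_induct)
  case (insert j J)
  note DD = submoduleD[OF D]
  have uJ: "u \<in> J \<rightarrow> carrier M" "u j \<in> carrier M" using insert.prems by auto
  let ?s = "\<Oplus>i\<in>J. u i"
  have s: "?s \<in> carrier M" using uJ by simp
  have sum: "u j \<oplus> ?s \<in> D" using insert uJ by simp
  have AJ: "(\<lambda>i. A (u i)) \<in> J \<rightarrow> carrier M" using uJ lmap_closed[OF A(1)] by auto
  have "A (u j \<oplus> ?s) = \<beta> j \<odot> u j \<oplus> (\<Oplus>i\<in>J. A (u i))"
    using uJ s insert.prems(3)[of j] by (simp add: lmap_add[OF A(1)] lmap_finsum[OF module_axioms module_axioms A(1)])
  also have "(\<Oplus>i\<in>J. A (u i)) = (\<Oplus>i\<in>J. \<beta> i \<odot> u i)"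
    by (rule finsum_cong') (use insert.prems uJ in auto)
  finally have As: "A (u j \<oplus> ?s) = \<beta> j \<odot> u j \<oplus> (\<Oplus>i\<in>J. \<beta> i \<odot> u i)" .
  have eq: "(\<Oplus>i\<in>J. (\<beta> i - \<beta> j) \<odot> u i) = A (u j \<oplus> ?s) \<ominus> \<beta> j \<odot> (u j \<oplus> ?s)"
  proof (rule vec_eqI)
    fix \<xi> assume f: "cfun M \<xi>"
    have p: "(\<lambda>i. \<beta> i \<odot> u i) \<in> J \<rightarrow> carrier M" "(\<lambda>i. (\<beta> i - \<beta> j) \<odot> u i) \<in> J \<rightarrow> carrier M" using uJ by auto
    have "(\<Sum>i\<in>J. \<xi> (\<beta> i \<odot> u i)) = (\<Sum>i\<in>J. \<beta> i * \<xi> (u i))" "(\<Sum>i\<in>J. \<xi> ((\<beta> i - \<beta> j) \<odot> u i)) = (\<Sum>i\<in>J. (\<beta> i - \<beta> j) * \<xi> (u i))"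
      by (rule sum.cong; use uJ cfun_smult[OF f] in auto)+
    then show "\<xi> (\<Oplus>i\<in>J. (\<beta> i - \<beta> j) \<odot> u i) = \<xi> (A (u j \<oplus> ?s) \<ominus> \<beta> j \<odot> (u j \<oplus> ?s))"
      unfolding As using uJ s p
      by (simp add: f cfun_finsum cfun_add[OF f] cfun_smult[OF f])
        (simp add: left_diff_distrib sum_subtractf sum_distrib_left algebra_simps)
  next
    show "(\<Oplus>i\<in>J. (\<beta> i - \<beta> j) \<odot> u i) \<in> carrier M" using uJ by (intro finsum_closed) auto
    show "A (u j \<oplus> ?s) \<ominus> \<beta> j \<odot> (u j \<oplus> ?s) \<in> carrier M"
      using uJ s by (intro M.minus_closed smult_closed' lmap_closed[OF A(1)]) simp_all
  qed
  have in_D: "(\<Oplus>i\<in>J. (\<beta> i - \<beta> j) \<odot> u i) \<in> D"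
    unfolding eq using sum A(2) DD(5,6) by blast
  have J: "u i \<in> D" if i: "i \<in> J" for i
  proof -
    have "(\<beta> i - \<beta> j) \<odot> u i \<in> D"
    proof (rule insert.IH[of "\<lambda>i. (\<beta> i - \<beta> j) \<odot> u i"])
      fix k assume k: "k \<in> J"
      then show "A ((\<beta> k - \<beta> j) \<odot> u k) = \<beta> k \<odot> ((\<beta> k - \<beta> j) \<odot> u k)"
        using insert.prems uJ by (auto simp: lmap_smult[OF A(1)] smult_smult mult.commute Pi_iff)
    qed (use insert.prems in_D uJ i in auto)
    then have "inverse (\<beta> i - \<beta> j) \<odot> ((\<beta> i - \<beta> j) \<odot> u i) \<in> D" using DD by blast
    moreover have "\<beta> i \<noteq> \<beta> j" using insert.prems(1) insert.hyps i by (auto simp: inj_on_def)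
    ultimately show ?thesis using i uJ by (auto simp: smult_smult Pi_iff)
  qed
  moreover have "u j \<in> D"
  proof -
    have "?s \<in> D" by (rule submodule_finsum[OF D J])
    then have "(u j \<oplus> ?s) \<ominus> ?s \<in> D" by (rule DD(6)[OF sum])
    moreover have "(u j \<oplus> ?s) \<ominus> ?s = u j" using uJ s by (intro vec_eqI) (simp_all add: cfun_add)
    ultimately show ?thesis by simp
  qed
  ultimately show ?case using insert.prems by auto
qed simp

section \<open>Graded cyclic modules\<close>

text \<open>Highest weight modules (\<open>s = 1\<close>) and lowest weight modules
  (\<open>s = -1\<close>) are treated together. The degree of a basis element \<open>b\<close> is
  \<open>s * shift b\<close>; elements of negative degree kill the generator, and those of degree
  zero act on it by scalars.\<close>

locale graded_cyclic = lierep "coordsp A" M for A :: "gen set" and M :: "(schr, 'm) rep" (structure) +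
  fixes s :: int and w :: 'm
  assumes A: "lie_sub (coordsp A)" and s: "s * s = 1" and w: "w \<in> carrier M"
    and low: "\<And>b. b \<in> A \<Longrightarrow> s * shift b < 0 \<Longrightarrow> act M (bas b) w = \<zero>"
    and diag: "\<And>b. b \<in> A \<Longrightarrow> shift b = 0 \<Longrightarrow> \<exists>c. act M (bas b) w = c \<odot> w"
    and gen: "\<And>N. subrep (coordsp A) M N \<Longrightarrow> w \<in> N \<Longrightarrow> N = carrier M"
begin

text \<open>Only elements of positive degree are applied to the generator. That this already
  exhausts the module replaces a triangular decomposition of the enveloping algebra.\<close>

inductive graded :: "int \<Rightarrow> 'm \<Rightarrow> bool" where
  base: "graded 0 (c \<odot> w)"
| zero: "graded n \<zero>"
| add: "graded n u \<Longrightarrow> graded n v \<Longrightarrow> graded n (u \<oplus> v)"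
| raise: "b \<in> A \<Longrightarrow> 0 < s * shift b \<Longrightarrow> graded n u \<Longrightarrow> graded (n + s * shift b) (act M (bas b) u)"

lemma graded_closed: "graded n u \<Longrightarrow> u \<in> carrier M"
  by (induction rule: graded.induct) (use w in auto)

lemma graded_smult: "graded n u \<Longrightarrow> graded n (c \<odot> u)"
proof (induction rule: graded.induct)
  case (base d)
  then show ?case using w graded.base[of "c * d"] by (simp add: smult_smult)
next
  case (raise b n u)
  then show ?case using graded.raise[of b n "c \<odot> u"] graded_closed[of n u] by (simp add: act_smult)
qed (auto simp: graded_closed smult_add_right intro: graded.intros)

lemma bracket_gens:
  assumes "a \<in> A" "b \<in> A"
  obtains (zero) "bracket (bas a) (bas b) = 0"
    | (gen) k c where "bracket (bas a) (bas b) = k *s bas c" "shift c = shift a + shift b" "c \<in> A"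
proof -
  obtain k c where kc: "bracket (bas a) (bas b) = k *s bas c" "k = 0 \<or> shift c = shift a + shift b"
    using bracket_bas_graded by blast
  have *: "k *s bas c \<in> coordsp A" using A assms kc(1) by (metis bas_in lie_sub_def)
  show thesis
  proof (cases "k = 0")
    case True
    then show ?thesis using kc zero by simp
  next
    case False
    then have "c \<in> A" using * by (auto simp: coordsp_def bas_nth split: if_split_asm)
    then show ?thesis using gen kc False by blast
  qed
qed

text \<open>To apply \<open>b\<close> to a raised vector, \<open>b\<close> is moved past the last
  raising element \<open>a\<close>. The commutator is a multiple of a basis element whose degree is
  the sum of the two, so the induction hypothesis, which holds for all basis elements, covers both
  terms.\<close>

lemma graded_act: "graded n u \<Longrightarrow> b \<in> A \<Longrightarrow> graded (n + s * shift b) (act M (bas b) u)"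
proof (induction arbitrary: b rule: graded.induct)
  case (base c)
  consider "0 < s * shift b" | "s * shift b < 0" | "s * shift b = 0" by linarith
  then show ?case
  proof cases
    case 1
    then show ?thesis using graded.raise[OF base 1 graded.base] by simp
  next
    case 2
    then show ?thesis using low[OF base 2] base w by (simp add: act_smult graded.zero)
  next
    case 3
    then have "shift b = 0" using s by auto
    then obtain d where "act M (bas b) w = d \<odot> w" using diag base by blast
    then show ?thesis using base w \<open>shift b = 0\<close> graded.base[of "c * d"] by (simp add: act_smult smult_smult)
  qed
next
  case (add n u v)
  then show ?case using graded_closed by (simp add: act_add graded.add)
next
  case (raise a n u)
  have u: "u \<in> carrier M" using raise graded_closed by blast
  have eq: "act M (bas b) (act M (bas a) u) = act M (bas a) (act M (bas b) u) \<oplus> act M (bracket (bas b) (bas a)) u"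
    using u raise by (subst act_bracket) (auto intro!: vec_eqI simp: cfun_add)
  have "graded (n + s * shift b + s * shift a) (act M (bas a) (act M (bas b) u))"
    by (rule graded.raise) (use raise in auto)
  then have 1: "graded (n + s * shift a + s * shift b) (act M (bas a) (act M (bas b) u))"
    by (simp add: algebra_simps)
  have 2: "graded (n + s * shift a + s * shift b) (act M (bracket (bas b) (bas a)) u)"
    using raise.prems raise.hyps(1)
  proof (cases rule: bracket_gens)
    case zero
    then show ?thesis using act_0[of "bas a" u] u raise by (simp add: graded.zero)
  next
    case (gen k c)
    then have "act M (bracket (bas b) (bas a)) u = k \<odot> act M (bas c) u" using u by (simp add: act_scale)
    then show ?thesis using graded_smult[OF raise.IH[OF gen(3)], of k] gen(2) by (simp add: algebra_simps)
  qed
  show ?case unfolding eq by (rule graded.add[OF 1 2])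
qed (auto intro: graded.intros)

text \<open>A raised vector of degree at most zero comes from a vector of negative degree, which is
  zero by induction; in degree zero only the generator remains.\<close>

lemma graded_low: "graded n u \<Longrightarrow> (n < 0 \<longrightarrow> u = \<zero>) \<and> (n = 0 \<longrightarrow> (\<exists>c. u = c \<odot> w))"
proof (induction rule: graded.induct)
  case (zero n)
  then show ?case using w by (auto intro: exI[of _ 0])
next
  case (add n u v)
  show ?case
  proof (intro conjI impI)
    assume "n < 0"
    then show "u \<oplus> v = \<zero>" using add by simp
  next
    assume "n = 0"
    then obtain c d where "u = c \<odot> w" "v = d \<odot> w" using add by blast
    then show "\<exists>c. u \<oplus> v = c \<odot> w" using w by (intro exI[of _ "c + d"]) (simp add: smult_add_left)
  qed
next
  case (raise b n u)
  then show ?case using w by (auto intro: exI[of _ 0])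
qed auto

lemma graded_weight:
  assumes H: "gH \<in> A" and h: "act M (bas gH) w = \<mu> \<odot> w"
  shows "graded n u \<Longrightarrow> act M (bas gH) u = (\<mu> - of_int (s * n)) \<odot> u"
proof (induction rule: graded.induct)
  case (base c)
  then show ?case using w h H by (simp add: act_smult smult_smult mult.commute)
next
  case (add n u v)
  then show ?case using graded_closed H by (simp add: act_add smult_add_right)
next
  case (raise b n u)
  have u: "u \<in> carrier M" using raise graded_closed by blast
  have "act M (bracket (bas gH) (bas b)) u = (- of_int (shift b)) \<odot> act M (bas b) u"
    unfolding bracket_gH by (rule act_scale) (use raise u in auto)
  moreover have "act M (bracket (bas gH) (bas b)) u = act M (bas gH) (act M (bas b) u) \<ominus> act M (bas b) (act M (bas gH) u)"
    by (rule act_bracket) (use H raise u in auto)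
  ultimately have e: "act M (bas gH) (act M (bas b) u) \<ominus> act M (bas b) (act M (bas gH) u) = (- of_int (shift b)) \<odot> act M (bas b) u"
    by simp
  have bA: "bas b \<in> coordsp A" "bas gH \<in> coordsp A" using H raise by auto
  have "act M (bas gH) (act M (bas b) u) = act M (bas b) (act M (bas gH) u) \<oplus> (- of_int (shift b)) \<odot> act M (bas b) u"
    unfolding e[symmetric] using bA u by (intro vec_eqI) (simp_all add: cfun_add)
  also have "\<dots> = (\<mu> - of_int (s * n) - of_int (shift b)) \<odot> act M (bas b) u"
    unfolding raise.IH using bA u by (intro vec_eqI) (simp_all add: act_smult cfun_add cfun_smult algebra_simps)
  also have "s * (n + s * shift b) = s * n + shift b" using s by (simp add: distrib_left mult.assoc[symmetric])
  then have "\<mu> - of_int (s * n) - of_int (shift b) = (\<mu> - of_int (s * (n + s * shift b)) :: complex)" by simp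
  finally show ?case .
qed (use H in auto)

text \<open>A total function of finite support, so that decompositions can be added degree by
  degree. Uniqueness of the components is not built in; it comes from the eigenvalues of
  \<open>h\<close>.\<close>

definition gsum :: "(int \<Rightarrow> 'm) \<Rightarrow> 'm \<Rightarrow> bool" where
  "gsum f u \<longleftrightarrow> (\<forall>n. graded n (f n)) \<and> (\<exists>J. finite J \<and> (\<forall>n. n \<notin> J \<longrightarrow> f n = \<zero>) \<and> u = (\<Oplus>n\<in>J. f n))"

lemma gsum_superset:
  assumes "\<forall>n. graded n (f n)" "finite J" "\<forall>n. n \<notin> J \<longrightarrow> f n = \<zero>" "J \<subseteq> K" "finite K"
  shows "(\<Oplus>n\<in>J. f n) = (\<Oplus>n\<in>K. f n)"
proof -
  have "f n \<in> carrier M" for n using assms(1) graded_closed by blast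
  then show ?thesis by (intro M.add.finprod_mono_neutral_cong_left) (use assms in auto)
qed

lemma gsum_add: "gsum f u \<Longrightarrow> gsum g v \<Longrightarrow> gsum (\<lambda>n. f n \<oplus> g n) (u \<oplus> v)"
proof -
  assume f: "gsum f u" and g: "gsum g v"
  obtain J where J: "finite J" "\<forall>n. n \<notin> J \<longrightarrow> f n = \<zero>" "u = (\<Oplus>n\<in>J. f n)" and gf: "\<forall>n. graded n (f n)"
    using f by (auto simp: gsum_def)
  obtain K where K: "finite K" "\<forall>n. n \<notin> K \<longrightarrow> g n = \<zero>" "v = (\<Oplus>n\<in>K. g n)" and gg: "\<forall>n. graded n (g n)"
    using g by (auto simp: gsum_def)
  have "u = (\<Oplus>n\<in>J \<union> K. f n)" unfolding J(3) by (rule gsum_superset) (use J K gf in auto)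
  moreover have "v = (\<Oplus>n\<in>J \<union> K. g n)" unfolding K(3) by (rule gsum_superset) (use J K gg in auto)
  ultimately have "u \<oplus> v = (\<Oplus>n\<in>J \<union> K. f n \<oplus> g n)"
    using graded_closed gf gg by (subst M.finsum_addf) auto
  then show ?thesis
    unfolding gsum_def using J K gf gg graded.add by (intro conjI exI[of _ "J \<union> K"]) auto
qed

lemma gsum_single: "graded n u \<Longrightarrow> gsum (\<lambda>m. if m = n then u else \<zero>) u"
  unfolding gsum_def using graded_closed by (intro conjI exI[of _ "{n}"]) (auto intro: graded.intros)

lemma gsum_zero: "gsum (\<lambda>_. \<zero>) \<zero>"
  unfolding gsum_def by (intro conjI exI[of _ "{}"]) (auto intro: graded.intros)

lemma gsum_smult: "gsum f u \<Longrightarrow> gsum (\<lambda>n. c \<odot> f n) (c \<odot> u)"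
proof -
  assume "gsum f u"
  then obtain J where J: "finite J" "\<forall>n. n \<notin> J \<longrightarrow> f n = \<zero>" "u = (\<Oplus>n\<in>J. f n)" and gf: "\<forall>n. graded n (f n)"
    by (auto simp: gsum_def)
  have "c \<odot> u = (\<Oplus>n\<in>J. c \<odot> f n)"
    unfolding J(3) by (rule finsum_smult_ldistr) (use J gf graded_closed in auto)
  then show ?thesis unfolding gsum_def using J gf graded_smult by (intro conjI exI[of _ J]) auto
qed

lemma gsum_closed: "gsum f u \<Longrightarrow> u \<in> carrier M"
  unfolding gsum_def using graded_closed by (auto intro!: M.finsum_closed)

lemma gsum_exists: "u \<in> carrier M \<Longrightarrow> \<exists>f. gsum f u"
proof -
  assume u: "u \<in> carrier M"
  let ?D = "{u. \<exists>f. gsum f u}"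
  have D: "submodule ?D \<CC> M"
    by (rule submoduleI') (use gsum_closed gsum_zero gsum_add gsum_smult in blast)+
  have "subrep (coordsp A) M ?D"
  proof (rule subrep_basisI[OF refl D])
    fix b v assume b: "b \<in> A" and "v \<in> ?D"
    then obtain f J where f: "\<forall>n. graded n (f n)" "finite J" "v = (\<Oplus>n\<in>J. f n)"
      by (auto simp: gsum_def)
    have "act M (bas b) v = (\<Oplus>n\<in>J. act M (bas b) (f n))"
      unfolding f(3) by (rule act_finsum) (use b f graded_closed in auto)
    also have "\<dots> \<in> ?D"
    proof (rule submodule_finsum[OF D])
      fix n assume "n \<in> J"
      show "act M (bas b) (f n) \<in> ?D"
        using gsum_single[OF graded_act[OF f(1)[rule_format, of n] b]] by blast
    qed
    finally show "act M (bas b) v \<in> ?D" .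
  qed
  moreover have "w \<in> ?D" using gsum_single[OF graded.base[of 1]] w by auto
  ultimately have "?D = carrier M" by (rule gen)
  then show ?thesis using u by blast
qed

text \<open>Different degrees have different eigenvalues of \<open>h\<close>, so that a submodule
  contains the components of each of its elements.\<close>

lemma gsum_component:
  assumes H: "gH \<in> A" and h: "act M (bas gH) w = \<mu> \<odot> w" and f: "gsum f u"
    and D: "subrep (coordsp A) M D" "u \<in> D"
  shows "f n \<in> D"
proof -
  obtain J where J: "finite J" "\<forall>n. n \<notin> J \<longrightarrow> f n = \<zero>" "u = (\<Oplus>n\<in>J. f n)" and gf: "\<forall>n. graded n (f n)"
    using f by (auto simp: gsum_def)
  show ?thesis
  proof (cases "n \<in> J")
    case True
    show ?thesis
    proof (rule eigen_components[OF subrep_submodule[OF D(1)] act_lmap, of "bas gH" J "\<lambda>n. \<mu> - of_int (s * n)" f n])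
      show "inj_on (\<lambda>n. \<mu> - of_int (s * n) :: complex) J"
        using s by (intro inj_onI) (auto simp flip: of_int_mult)
      show "act M (bas gH) (f i) = (\<mu> - of_int (s * i)) \<odot> f i" for i
        by (rule graded_weight[OF H h]) (use gf in blast)
    qed (use H J D True gf graded_closed subrep_act[OF D(1)] in auto)
  next
    case False
    then show ?thesis using J(2) submoduleD(3)[OF subrep_submodule[OF D(1)]] by simp
  qed
qed

text \<open>The part of degree zero is spanned by the generator. A submodule containing a vector
  with nonzero component there contains the generator and is everything.\<close>

lemma maximal_subrep:
  assumes H: "gH \<in> A" and h: "act M (bas gH) w = \<mu> \<odot> w" and w0: "w \<noteq> \<zero>"
  obtains K where "subrep (coordsp A) M K" "K \<noteq> carrier M"
    "\<And>N. subrep (coordsp A) M N \<Longrightarrow> N \<noteq> carrier M \<Longrightarrow> N \<subseteq> K"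
proof -
  let ?L = "coordsp A"
  let ?low = "{u. \<exists>f. gsum f u \<and> f 0 = \<zero>}"
  \<comment> \<open>The union of all submodules inside \<open>?low\<close> is closed under addition,
    because the sum of two of them is again a submodule inside \<open>?low\<close>.\<close>
  define K where "K = {v. \<exists>N. subrep ?L M N \<and> N \<subseteq> ?low \<and> v \<in> N}"
  note comp = gsum_component[OF H h]
  have w_low: "w \<notin> ?low"
  proof
    assume "w \<in> ?low"
    then obtain f where f: "gsum f w" "f 0 = \<zero>" by blast
    \<comment> \<open>Two decompositions of \<open>w\<close> are subtracted: \<open>?f\<close>
      decomposes the zero vector, and \<open>comp\<close> for the zero submodule forces its
      component \<open>w\<close> of degree zero to vanish.\<close>
    let ?f = "\<lambda>n. (if n = 0 then w else \<zero>) \<oplus> (-1) \<odot> f n"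
    have "gsum ?f (w \<oplus> (-1) \<odot> w)"
      using w by (intro gsum_add gsum_smult f gsum_single) (use graded.base[of 1] in simp)
    then have "?f 0 \<in> {\<zero>}"
      by (rule comp[OF _ subrep_0]) (simp add: w add_minus_smult)
    then show False using w w0 by (simp add: f(2))
  qed
  have low0: "\<zero> \<in> ?low" using gsum_zero by auto
  have proper: "N \<subseteq> ?low" if N: "subrep ?L M N" "N \<noteq> carrier M" for N
  proof
    fix v assume v: "v \<in> N"
    note ND = submoduleD[OF subrep_submodule[OF N(1)]]
    obtain f where f: "gsum f v" using gsum_exists[OF ND(2)[OF v]] by blast
    obtain c where c: "f 0 = c \<odot> w" using f graded_low[of 0 "f 0"] by (auto simp: gsum_def)
    have "c \<odot> w \<in> N" using comp[OF f N(1) v, of 0] c by simp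
    have "c = 0"
    proof (rule ccontr)
      assume "c \<noteq> 0"
      then have "w \<in> N" using ND(5)[OF \<open>c \<odot> w \<in> N\<close>, of "inverse c"] w by (simp add: smult_smult)
      then show False using gen N by blast
    qed
    then show "v \<in> ?low" using f c w by auto
  qed
  have K: "subrep ?L M K"
  proof (rule subrepI)
    show "K \<subseteq> carrier M" unfolding K_def using submoduleD(1)[OF subrep_submodule] by blast
    show "\<zero> \<in> K" unfolding K_def using subrep_0 low0 by blast
    fix c v assume "v \<in> K"
    then show "c \<odot> v \<in> K" unfolding K_def using submoduleD(5)[OF subrep_submodule] by blast
  next
    fix x v assume "x \<in> ?L" "v \<in> K"
    then show "act M x v \<in> K" unfolding K_def using subrep_act by blast
  next
    fix u v assume "u \<in> K" "v \<in> K"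
    then obtain N N' where N: "subrep ?L M N" "N \<subseteq> ?low" "u \<in> N" "subrep ?L M N'" "N' \<subseteq> ?low" "v \<in> N'"
      unfolding K_def by blast
    note D = submoduleD[OF subrep_submodule[OF N(1)]] and D' = submoduleD[OF subrep_submodule[OF N(4)]]
    let ?S = "{a \<oplus> b |a b. a \<in> N \<and> b \<in> N'}"
    have "subrep ?L M ?S"
    proof (rule subrepI)
      show "?S \<subseteq> carrier M" using D(2) D'(2) by auto
      show "\<zero> \<in> ?S" using D(3) D'(3) M.l_zero[OF M.zero_closed] by (metis (mono_tags, lifting) mem_Collect_eq)
    next
      fix p q assume "p \<in> ?S" "q \<in> ?S"
      then obtain a b a' b' where *: "p = a \<oplus> b" "q = a' \<oplus> b'" "a \<in> N" "b \<in> N'" "a' \<in> N" "b' \<in> N'" by blast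
      then have "p \<oplus> q = (a \<oplus> a') \<oplus> (b \<oplus> b')" using D(2) D'(2) by (intro vec_eqI) (simp_all add: cfun_add)
      then show "p \<oplus> q \<in> ?S" using * D(4) D'(4) by blast
    next
      fix c p assume "p \<in> ?S"
      then obtain a b where *: "p = a \<oplus> b" "a \<in> N" "b \<in> N'" by blast
      then have "c \<odot> p = c \<odot> a \<oplus> c \<odot> b" using D(2) D'(2) by (simp add: smult_add_right)
      then show "c \<odot> p \<in> ?S" using * D(5) D'(5) by blast
    next
      fix x p assume x: "x \<in> ?L" and "p \<in> ?S"
      then obtain a b where *: "p = a \<oplus> b" "a \<in> N" "b \<in> N'" by blast
      then have "act M x p = act M x a \<oplus> act M x b" using x D(2) D'(2) by (simp add: act_add)
      then show "act M x p \<in> ?S" using * x subrep_act N by blast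
    qed
    moreover have "?S \<subseteq> ?low"
    proof
      fix p assume "p \<in> ?S"
      then obtain a b where *: "p = a \<oplus> b" "a \<in> N" "b \<in> N'" by blast
      then obtain f g where "gsum f a" "f 0 = \<zero>" "gsum g b" "g 0 = \<zero>" using N by blast
      then show "p \<in> ?low" unfolding * using gsum_add[of f a g b] by auto
    qed
    ultimately show "u \<oplus> v \<in> K" unfolding K_def using N by blast
  qed
  have "w \<notin> K" using w_low unfolding K_def by blast
  then have "K \<noteq> carrier M" using w by blast
  moreover have "N \<subseteq> K" if "subrep ?L M N" "N \<noteq> carrier M" for N
    using proper[OF that] that(1) unfolding K_def by blast
  ultimately show thesis by (rule that[OF K])
qed

lemma unique_quotient:
  assumes H: "gH \<in> A" and h: "act M (bas gH) w = \<mu> \<odot> w" and w0: "w \<noteq> \<zero>"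
  shows "has_unique_simple_quotient (coordsp A) M"
  by (rule maximal_subrep[OF assms]) (rule unique_simple_quotient(1)[OF lie A])

end

section \<open>Tensor products of representations\<close>

definition lt_fun where
  "lt_fun M N = (\<lambda>x (m, n). Poly_Mapping.single (act M x m, n) 1 + Poly_Mapping.single (m, act N x n) 1)"

lemma lt_fun_apply: "lt_fun M N x (m, n) = Poly_Mapping.single (act M x m, n) 1 + Poly_Mapping.single (m, act N x n) 1"
  by (simp add: lt_fun_def)

locale lie_tensor_mod = M: lierep UNIV M + N: lierep UNIV N
  for M :: "(schr, 'm) rep" and N :: "(schr, 'n) rep"
begin

sublocale tensor M N "{}" "lt_fun M N"
  by (simp add: tensor_def M.cmodM N.cmodM)

lemma T_lie_tensor: "T = lie_tensor M N"
  by (simp add: lie_tensor_def lt_fun_def)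

lemma lie_tensor_act:
  "lmap T T (act T x)"
  "m \<in> carrier M \<Longrightarrow> n \<in> carrier N \<Longrightarrow> act T x (tens m n) = tens (act M x m) n \<oplus>\<^bsub>T\<^esub> tens m (act N x n)"
proof -
  let ?G = "\<lambda>m n. tens (act M x m) n \<oplus>\<^bsub>T\<^esub> tens m (act N x n)"
  have c: "Poly_Mapping.single (act M x m, n) 1 + Poly_Mapping.single (m, act N x n) 1 \<in> carrier F"
    if "m \<in> carrier M" "n \<in> carrier N" for m n
    using F.M.a_closed[OF single_in_F[of "act M x m" n 1] single_in_F[of m "act N x n" 1]] that by simp
  have P: "pr (Poly_Mapping.single (act M x m, n) 1 + Poly_Mapping.single (m, act N x n) 1) = ?G m n"
    if "m \<in> carrier M" "n \<in> carrier N" for m n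
    unfolding tens_def by (rule pr_add; rule single_in_F) (use that in auto)
  have G: "lt_fun M N x (m, n) \<in> carrier F \<and> pr (lt_fun M N x (m, n)) = ?G m n"
    if "m \<in> carrier M" "n \<in> carrier N" for m n
    unfolding lt_fun_apply using c[OF that] P[OF that] by blast
  have bl: "bilin M N T ?G"
    by (intro bilinI lmapI; (intro T.vec_eqI)?)
      (simp_all add: tens_add_left tens_add_right tens_smult_left tens_smult_right M.act_add M.act_smult
        N.act_add N.act_smult cfun_add cfun_smult algebra_simps)
  show "lmap T T (act T x)"
    by (rule act_tens(1)[OF G bl]) simp_all
  show "m \<in> carrier M \<Longrightarrow> n \<in> carrier N \<Longrightarrow> act T x (tens m n) = ?G m n"
    by (rule act_tens(2)[OF G bl]) simp_all
qed

lemma lie_tensor_lie: "lie_module UNIV T"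
proof -
  have lm: "lmap T T (\<lambda>u. act T x u)" for x by (rule lie_tensor_act(1))
  have cl: "act T x u \<in> carrier T" if "u \<in> carrier T" for x u by (rule lmap_closed[OF lm that])
  note t = lie_tensor_act(2)
  have 1: "act T (x + y) u = act T x u \<oplus>\<^bsub>T\<^esub> act T y u" if "u \<in> carrier T" for x y u
    by (rule tens_lmap_eq[OF cT lm _ _ that]; intro lmapI T.vec_eqI;
      simp add: cl lmap_add[OF lm] lmap_smult[OF lm] cfun_add cfun_smult
        t M.act_plus N.act_plus tens_add_left tens_add_right algebra_simps)
  have 2: "act T (c *s x) u = c \<odot>\<^bsub>T\<^esub> act T x u" if "u \<in> carrier T" for x c u
    by (rule tens_lmap_eq[OF cT lm _ _ that]; intro lmapI T.vec_eqI;
      simp add: cl lmap_add[OF lm] lmap_smult[OF lm] cfun_add cfun_smult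
        t M.act_scale N.act_scale tens_smult_left tens_smult_right algebra_simps)
  have 3: "act T (bracket x y) u = act T x (act T y u) \<ominus>\<^bsub>T\<^esub> act T y (act T x u)" if "u \<in> carrier T" for x y u
    by (rule tens_lmap_eq[OF cT lm _ _ that]; intro lmapI T.vec_eqI;
      simp add: cl lmap_add[OF lm] lmap_smult[OF lm] cfun_add cfun_smult
        t M.act_bracket N.act_bracket tens_diff algebra_simps)
  show ?thesis
    unfolding lie_module_def by (simp add: cT cl 1 2 3 lmap_add[OF lm] lmap_smult[OF lm])
qed

end

section \<open>Enveloping algebras\<close>

lemma letters_simps [simp]: "letters 0 = []" "letters (u + v) = letters u @ letters v"
  by (simp_all add: zero_word_def plus_word_def)

lemma free_alg_simps [simp]:
  "mult (free_alg L) = (*)" "one (free_alg L) = 1" "zero (free_alg L) = 0" "add (free_alg L) = (+)"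
  by (simp_all add: free_alg_def)

lemma free_alg_mem: "y \<in> carrier (free_alg L) \<longleftrightarrow> (\<forall>w\<in>Poly_Mapping.keys y. set (letters w) \<subseteq> L)"
  by (simp add: free_alg_def)

lemma free_alg_closed:
  "0 \<in> carrier (free_alg L)" "1 \<in> carrier (free_alg L)"
  "y \<in> carrier (free_alg L) \<Longrightarrow> y' \<in> carrier (free_alg L) \<Longrightarrow> y + y' \<in> carrier (free_alg L)"
  "y \<in> carrier (free_alg L) \<Longrightarrow> y' \<in> carrier (free_alg L) \<Longrightarrow> y - y' \<in> carrier (free_alg L)"
  "y \<in> carrier (free_alg L) \<Longrightarrow> - y \<in> carrier (free_alg L)"
  "y \<in> carrier (free_alg L) \<Longrightarrow> y' \<in> carrier (free_alg L) \<Longrightarrow> y * y' \<in> carrier (free_alg L)"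
  "const c \<in> carrier (free_alg L)" "x \<in> L \<Longrightarrow> letter x \<in> carrier (free_alg L)"
  using keys_add[of y y'] keys_diff[of y y'] keys_mult[of y y'] by (fastforce simp: free_alg_mem)+

lemma free_alg_mono: "K \<subseteq> L \<Longrightarrow> carrier (free_alg K) \<subseteq> carrier (free_alg L)"
  by (fastforce simp: free_alg_mem)

lemma free_alg_ring: "ring (free_alg L)"
proof (rule ringI)
  show "abelian_group (free_alg L)"
  proof (rule abelian_groupI)
    fix y assume "y \<in> carrier (free_alg L)"
    then show "\<exists>y'\<in>carrier (free_alg L). y' \<oplus>\<^bsub>free_alg L\<^esub> y = \<zero>\<^bsub>free_alg L\<^esub>"
      by (intro bexI[of _ "- y"]) (simp_all add: free_alg_closed)
  qed (simp_all add: free_alg_closed algebra_simps)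
  show "Group.monoid (free_alg L)"
    by (rule monoidI) (simp_all add: free_alg_closed mult.assoc)
qed (simp_all add: distrib_left distrib_right)

lemma free_alg_a_inv:
  assumes "y \<in> carrier (free_alg L)"
  shows "\<ominus>\<^bsub>free_alg L\<^esub> y = - y"
proof -
  interpret ring "free_alg L" by (rule free_alg_ring)
  show ?thesis using minus_equality[of "- y" y] assms by (simp add: free_alg_closed)
qed

lemma free_alg_minus: "y \<in> carrier (free_alg L) \<Longrightarrow> y' \<in> carrier (free_alg L) \<Longrightarrow> y \<ominus>\<^bsub>free_alg L\<^esub> y' = y - y'"
  by (simp add: a_minus_def free_alg_a_inv)

lemma free_alg_idealI:
  assumes "I \<subseteq> carrier (free_alg L)" "0 \<in> I" "\<And>a b. a \<in> I \<Longrightarrow> b \<in> I \<Longrightarrow> a + b \<in> I"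
    "\<And>a. a \<in> I \<Longrightarrow> - a \<in> I"
    "\<And>a x. a \<in> I \<Longrightarrow> x \<in> carrier (free_alg L) \<Longrightarrow> x * a \<in> I \<and> a * x \<in> I"
  shows "ideal I (free_alg L)"
proof (rule idealI[OF free_alg_ring])
  have "group (add_monoid (free_alg L))"
    using abelian_group.a_group[OF ring.is_abelian_group[OF free_alg_ring]] .
  then show "subgroup I (add_monoid (free_alg L))"
  proof (rule group.subgroupI)
    fix a assume a: "a \<in> I"
    then have "\<ominus>\<^bsub>free_alg L\<^esub> a \<in> I" using assms(1,4) free_alg_a_inv[of a L] by auto
    then show "inv\<^bsub>add_monoid (free_alg L)\<^esub> a \<in> I" unfolding a_inv_def .
  qed (use assms in auto)
qed (use assms in auto)

lemma idealD:
  assumes "ideal I (free_alg L)"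
  shows "a \<in> I \<Longrightarrow> a \<in> carrier (free_alg L)" "0 \<in> I"
    "a \<in> I \<Longrightarrow> b \<in> I \<Longrightarrow> a + b \<in> I" "a \<in> I \<Longrightarrow> - a \<in> I"
    "a \<in> I \<Longrightarrow> x \<in> carrier (free_alg L) \<Longrightarrow> x * a \<in> I"
    "a \<in> I \<Longrightarrow> x \<in> carrier (free_alg L) \<Longrightarrow> a * x \<in> I"
proof -
  interpret ideal I "free_alg L" by fact
  show c: "a \<in> I \<Longrightarrow> a \<in> carrier (free_alg L)" for a using a_subset by blast
  show "0 \<in> I" using additive_subgroup.zero_closed[OF is_additive_subgroup] by simp
  show "a \<in> I \<Longrightarrow> b \<in> I \<Longrightarrow> a + b \<in> I" using additive_subgroup.a_closed[OF is_additive_subgroup, of a b] by simp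
  show "a \<in> I \<Longrightarrow> - a \<in> I" using additive_subgroup.a_inv_closed[OF is_additive_subgroup, of a] free_alg_a_inv[OF c] by simp
  show "a \<in> I \<Longrightarrow> x \<in> carrier (free_alg L) \<Longrightarrow> x * a \<in> I" using I_l_closed[of a x] by simp
  show "a \<in> I \<Longrightarrow> x \<in> carrier (free_alg L) \<Longrightarrow> a * x \<in> I" using I_r_closed[of a x] by simp
qed

text \<open>Quotient of a free algebra by the ideal of given relations; both the enveloping algebras
  and the Weyl algebra are instances.\<close>

locale free_quot =
  fixes L :: "'a set" and R :: "('a word \<Rightarrow>\<^sub>0 complex) set"
  assumes R: "R \<subseteq> carrier (free_alg L)"
begin

definition "I = Idl\<^bsub>free_alg L\<^esub> R"
definition "U = free_alg L Quot I"
definition "cl y = I +>\<^bsub>free_alg L\<^esub> y"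

lemma I_ideal: "ideal I (free_alg L)"
  unfolding I_def by (rule ring.genideal_ideal[OF free_alg_ring R])

lemma R_I: "R \<subseteq> I"
  unfolding I_def by (rule ring.genideal_self[OF free_alg_ring R])

lemma I_min: "ideal J (free_alg L) \<Longrightarrow> R \<subseteq> J \<Longrightarrow> I \<subseteq> J"
  unfolding I_def by (rule ring.genideal_minimal[OF free_alg_ring])

sublocale U: ring U
  unfolding U_def by (rule ideal.quotient_is_ring[OF I_ideal])

lemma carrier_U: "carrier U = cl ` carrier (free_alg L)"
  by (auto simp: U_def FactRing_def A_RCOSETS_def' cl_def)

lemma cl_closed [simp]: "y \<in> carrier (free_alg L) \<Longrightarrow> cl y \<in> carrier U"
  by (simp add: carrier_U)

lemma cl_hom: "cl \<in> ring_hom (free_alg L) U"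
  using ideal.rcos_ring_hom[OF I_ideal] unfolding U_def cl_def[abs_def] .

lemma cl_add: "y \<in> carrier (free_alg L) \<Longrightarrow> y' \<in> carrier (free_alg L) \<Longrightarrow> cl (y + y') = cl y \<oplus>\<^bsub>U\<^esub> cl y'"
  and cl_mult: "y \<in> carrier (free_alg L) \<Longrightarrow> y' \<in> carrier (free_alg L) \<Longrightarrow> cl (y * y') = cl y \<otimes>\<^bsub>U\<^esub> cl y'"
  and cl_one: "cl 1 = \<one>\<^bsub>U\<^esub>"
  using ring_hom_add[OF cl_hom, of y y'] ring_hom_mult[OF cl_hom, of y y'] ring_hom_one[OF cl_hom] by simp_all

lemma cl_eq:
  assumes "y \<in> carrier (free_alg L)" "y' \<in> carrier (free_alg L)" "y - y' \<in> I"
  shows "cl y = cl y'"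
proof -
  interpret ideal I "free_alg L" by (rule I_ideal)
  show ?thesis
    using quotient_eq_iff_same_a_r_cos[OF I_ideal assms(1,2)] assms free_alg_minus[OF assms(1,2)]
    by (simp add: cl_def)
qed

lemma cl_mem: "y' \<in> cl y \<Longrightarrow> y \<in> carrier (free_alg L) \<Longrightarrow> y' \<in> carrier (free_alg L) \<and> y' - y \<in> I"
  using idealD[OF I_ideal] by (auto simp: cl_def a_r_coset_def' intro!: free_alg_closed)

lemma cl_self: "y \<in> cl y"
  using idealD(2)[OF I_ideal] by (auto simp: cl_def a_r_coset_def' intro!: bexI[of _ 0])

lemma the_elem_image:
  assumes "y \<in> carrier (free_alg L)" "\<And>y'. y' \<in> carrier (free_alg L) \<Longrightarrow> y' - y \<in> I \<Longrightarrow> f y' = f y"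
  shows "the_elem (f ` cl y) = f y"
proof -
  have "f ` cl y = {f y}" using cl_mem[OF _ assms(1)] assms(2) cl_self[of y] by blast
  then show ?thesis by simp
qed

end

section \<open>Action of the free algebra on a representation\<close>

context lierep
begin

lemma foldr_closed: "set xs \<subseteq> L \<Longrightarrow> v \<in> carrier M \<Longrightarrow> foldr (act M) xs v \<in> carrier M"
  by (induction xs) auto

lemma foldr_add: "set xs \<subseteq> L \<Longrightarrow> u \<in> carrier M \<Longrightarrow> v \<in> carrier M \<Longrightarrow>
    foldr (act M) xs (u \<oplus> v) = foldr (act M) xs u \<oplus> foldr (act M) xs v"
  and foldr_smult: "set xs \<subseteq> L \<Longrightarrow> v \<in> carrier M \<Longrightarrow> foldr (act M) xs (c \<odot> v) = c \<odot> foldr (act M) xs v"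
  by (induction xs) (auto simp: foldr_closed act_add act_smult)

lemma free_act_lext: "free_act M y v = lext M (\<lambda>w. foldr (act M) (letters w) v) y"
  by (simp add: free_act_def lext_def)

lemma fa_pi: "y \<in> carrier (free_alg L) \<Longrightarrow> v \<in> carrier M \<Longrightarrow> (\<lambda>w. foldr (act M) (letters w) v) \<in> Poly_Mapping.keys y \<rightarrow> carrier M"
  by (auto simp: free_alg_mem intro!: foldr_closed)

lemma fa_closed [simp]: "y \<in> carrier (free_alg L) \<Longrightarrow> v \<in> carrier M \<Longrightarrow> free_act M y v \<in> carrier M"
  unfolding free_act_lext by (rule lext_closed[OF fa_pi])

lemma fa_add: "y \<in> carrier (free_alg L) \<Longrightarrow> y' \<in> carrier (free_alg L) \<Longrightarrow> v \<in> carrier M \<Longrightarrow>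
    free_act M (y + y') v = free_act M y v \<oplus> free_act M y' v"
  unfolding free_act_lext by (rule lext_add[OF fa_pi fa_pi])

lemma fa_scale: "y \<in> carrier (free_alg L) \<Longrightarrow> v \<in> carrier M \<Longrightarrow> free_act M (scale c y) v = c \<odot> free_act M y v"
  unfolding free_act_lext by (rule lext_scale[OF fa_pi])

lemma scale_in_free_alg: "y \<in> carrier (free_alg L) \<Longrightarrow> scale c y \<in> carrier (free_alg L)"
  using keys_scale by (fastforce simp: free_alg_mem)

lemma fa_diff: "y \<in> carrier (free_alg L) \<Longrightarrow> y' \<in> carrier (free_alg L) \<Longrightarrow> v \<in> carrier M \<Longrightarrow>
    free_act M (y - y') v = free_act M y v \<ominus> free_act M y' v"
  using fa_add[of y "scale (-1) y'" v] fa_scale[of y' v "-1"] scale_in_free_alg[of y' "-1"]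
  by (simp add: scale_distrib diff_smult)

lemma fa_single: "set (letters w) \<subseteq> L \<Longrightarrow> v \<in> carrier M \<Longrightarrow>
    free_act M (Poly_Mapping.single w c) v = c \<odot> foldr (act M) (letters w) v"
  unfolding free_act_lext by (rule lext_single) (simp add: foldr_closed)

lemma fa_zero [simp]: "free_act M 0 v = \<zero>"
  by (simp add: free_act_lext)

lemma free_alg_induct [consumes 1, case_names zero add]:
  assumes "y \<in> carrier (free_alg L)" "P 0"
    "\<And>w c y. set (letters w) \<subseteq> L \<Longrightarrow> y \<in> carrier (free_alg L) \<Longrightarrow> P y \<Longrightarrow> P (Poly_Mapping.single w c + y)"
  shows "P y"
proof -
  have "Poly_Mapping.keys y \<subseteq> {w. set (letters w) \<subseteq> L}" using assms(1) by (auto simp: free_alg_mem)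
  then show ?thesis
  proof (induction y rule: pm_induct)
    case (add k c y)
    show ?case by (rule assms(3)) (use add in \<open>auto simp: free_alg_mem\<close>)
  qed (rule assms(2))
qed

lemma single_in_free_alg: "set (letters w) \<subseteq> L \<Longrightarrow> Poly_Mapping.single w c \<in> carrier (free_alg L)"
  by (simp add: free_alg_mem)

lemma fa_mult:
  assumes "y \<in> carrier (free_alg L)" "y' \<in> carrier (free_alg L)" "v \<in> carrier M"
  shows "free_act M (y * y') v = free_act M y (free_act M y' v)"
  using assms(1)
proof (induction y rule: free_alg_induct)
  case (add w c y)
  have "free_act M (Poly_Mapping.single w c * y') v = c \<odot> foldr (act M) (letters w) (free_act M y' v)"
    using assms(2)
  proof (induction y' rule: free_alg_induct)
    case zero
    have "foldr (act M) (letters w) \<zero> = \<zero>"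
      using foldr_smult[of "letters w" "\<zero>" 0] foldr_closed[of "letters w" "\<zero>"] add by simp
    then show ?case by simp
  next
    case (add w' c' y')
    note w = \<open>set (letters w) \<subseteq> L\<close>
    have "free_act M (Poly_Mapping.single w c * Poly_Mapping.single w' c') v = c \<odot> foldr (act M) (letters w) (free_act M (Poly_Mapping.single w' c') v)"
      using w add(1) assms(3) by (simp add: mult_single fa_single foldr_smult smult_smult foldr_closed)
    then show ?case using add w assms(3)
      by (simp add: distrib_left fa_add free_alg_closed single_in_free_alg foldr_add foldr_closed smult_add_right)
  qed
  then show ?case using add assms(2,3)
    by (simp add: distrib_right fa_add free_alg_closed single_in_free_alg fa_single)
qed simp

lemma fa_lmap:
  assumes "y \<in> carrier (free_alg L)"
  shows "lmap M M (free_act M y)"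
  using assms
proof (induction y rule: free_alg_induct)
  case (add w c y)
  then show ?case
    by (intro lmapI; (intro vec_eqI)?)
      (simp_all add: fa_add single_in_free_alg fa_single foldr_add foldr_smult foldr_closed
        lmap_add[OF add(3)] lmap_smult[OF add(3)] cfun_add cfun_smult algebra_simps)
qed (simp add: lmap_def)

lemma fa_const: "v \<in> carrier M \<Longrightarrow> free_act M (const c) v = c \<odot> v"
  by (simp add: fa_single)

lemma fa_letter: "x \<in> L \<Longrightarrow> v \<in> carrier M \<Longrightarrow> free_act M (letter x) v = act M x v"
  by (simp add: fa_single)

end

lemma uea_rels_subset:
  assumes "lie_sub L"
  shows "uea_rels L \<subseteq> carrier (free_alg L)"
proof
  fix y assume "y \<in> uea_rels L"
  then consider x x' where "y = letter (x + x') - letter x - letter x'" "x \<in> L" "x' \<in> L"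
    | c x where "y = letter (c *s x) - const c * letter x" "x \<in> L"
    | x x' where "y = letter x * letter x' - letter x' * letter x - letter (bracket x x')" "x \<in> L" "x' \<in> L"
    unfolding uea_rels_def by blast
  then show "y \<in> carrier (free_alg L)"
    by cases (use assms in \<open>auto simp: lie_sub_def intro!: free_alg_closed\<close>)
qed

locale uea_alg =
  fixes L :: "schr set"
  assumes L: "lie_sub L"
begin

sublocale free_quot L "uea_rels L"
  by unfold_locales (rule uea_rels_subset[OF L])

lemma folds: "uea_ideal L = I" "uea L = U" "uea_class L = cl"
  by (auto simp: fun_eq_iff uea_ideal_def uea_def uea_class_def I_def U_def cl_def)

lemma rels_I:
  "x \<in> L \<Longrightarrow> y \<in> L \<Longrightarrow> letter (x + y) - letter x - letter y \<in> I"
  "x \<in> L \<Longrightarrow> letter (c *s x) - const c * letter x \<in> I"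
  "x \<in> L \<Longrightarrow> y \<in> L \<Longrightarrow> letter x * letter y - letter y * letter x - letter (bracket x y) \<in> I"
  subgoal by (rule subsetD[OF R_I], unfold uea_rels_def, rule UnI1, rule UnI1, rule CollectI, intro exI conjI, rule refl)
  subgoal by (rule subsetD[OF R_I], unfold uea_rels_def, rule UnI1, rule UnI2, rule CollectI, intro exI conjI, rule refl)
  subgoal by (rule subsetD[OF R_I], unfold uea_rels_def, rule UnI2, rule CollectI, intro exI conjI, rule refl)
  done

lemma cl_letter:
  "x \<in> L \<Longrightarrow> y \<in> L \<Longrightarrow> cl (letter (x + y)) = cl (letter x) \<oplus>\<^bsub>U\<^esub> cl (letter y)"
  "x \<in> L \<Longrightarrow> cl (letter (c *s x)) = cl (const c) \<otimes>\<^bsub>U\<^esub> cl (letter x)"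
  "x \<in> L \<Longrightarrow> y \<in> L \<Longrightarrow> cl (letter x) \<otimes>\<^bsub>U\<^esub> cl (letter y) =
    cl (letter y) \<otimes>\<^bsub>U\<^esub> cl (letter x) \<oplus>\<^bsub>U\<^esub> cl (letter (bracket x y))"
proof -
  have Lc: "x \<in> L \<Longrightarrow> y \<in> L \<Longrightarrow> x + y \<in> L \<and> bracket x y \<in> L" "x \<in> L \<Longrightarrow> c *s x \<in> L" for x y c
    using L by (auto simp: lie_sub_def)
  show "cl (letter (x + y)) = cl (letter x) \<oplus>\<^bsub>U\<^esub> cl (letter y)" if "x \<in> L" "y \<in> L"
  proof -
    have "letter (x + y) - (letter x + letter y) \<in> I"
      unfolding diff_diff_eq[symmetric] by (intro rels_I that)
    then have "cl (letter (x + y)) = cl (letter x + letter y)"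
      using that Lc by (intro cl_eq) (simp_all add: free_alg_closed)
    then show ?thesis using that by (simp add: cl_add free_alg_closed)
  qed
  show "cl (letter (c *s x)) = cl (const c) \<otimes>\<^bsub>U\<^esub> cl (letter x)" if "x \<in> L"
  proof -
    have "letter (c *s x) - const c * letter x \<in> I" by (intro rels_I that)
    then have "cl (letter (c *s x)) = cl (const c * letter x)"
      using that Lc by (intro cl_eq) (simp_all add: free_alg_closed)
    then show ?thesis using that by (simp add: cl_mult free_alg_closed)
  qed
  show "cl (letter x) \<otimes>\<^bsub>U\<^esub> cl (letter y) = cl (letter y) \<otimes>\<^bsub>U\<^esub> cl (letter x) \<oplus>\<^bsub>U\<^esub> cl (letter (bracket x y))"
    if "x \<in> L" "y \<in> L"
  proof -
    have "letter x * letter y - (letter y * letter x + letter (bracket x y)) \<in> I"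
      unfolding diff_diff_eq[symmetric] by (intro rels_I that)
    moreover have "letter x * letter y \<in> carrier (free_alg L)" "letter y * letter x \<in> carrier (free_alg L)"
      "letter (bracket x y) \<in> carrier (free_alg L)"
      using that Lc by (blast intro: free_alg_closed)+
    ultimately have "cl (letter x * letter y) = cl (letter y * letter x + letter (bracket x y))"
      using that Lc by (intro cl_eq) (simp_all add: free_alg_closed)
    then show ?thesis using that Lc by (simp add: cl_add cl_mult free_alg_closed)
  qed
qed

lemma cl_const:
  "cl (const (c + d)) = cl (const c) \<oplus>\<^bsub>U\<^esub> cl (const d)" "cl (const (c * d)) = cl (const c) \<otimes>\<^bsub>U\<^esub> cl (const d)"
  "cl (const 1) = \<one>\<^bsub>U\<^esub>"
proof -
  show "cl (const (c + d)) = cl (const c) \<oplus>\<^bsub>U\<^esub> cl (const d)"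
    by (simp add: single_add cl_add free_alg_closed)
  show "cl (const (c * d)) = cl (const c) \<otimes>\<^bsub>U\<^esub> cl (const d)"
    by (simp add: cl_mult[symmetric] free_alg_closed mult_single)
qed (simp add: cl_one)

lemma cl_const_commute:
  assumes "u \<in> carrier U"
  shows "cl (const c) \<otimes>\<^bsub>U\<^esub> u = u \<otimes>\<^bsub>U\<^esub> cl (const c)"
proof -
  obtain y where y: "y \<in> carrier (free_alg L)" "u = cl y" using assms carrier_U by auto
  have "const c * y = y * const c"
  proof -
    have "Poly_Mapping.keys y \<subseteq> UNIV" by simp
    then show ?thesis
      by (induction y rule: pm_induct) (simp_all add: distrib_left distrib_right mult_single mult.commute)
  qed
  then show ?thesis using y by (simp add: cl_mult[symmetric] free_alg_closed)
qed

lemma space_simps [simp]: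
  "carrier (uea_space L) = carrier U" "add (uea_space L) = add U" "zero (uea_space L) = zero U"
  "smult (uea_space L) c u = cl (const c) \<otimes>\<^bsub>U\<^esub> u"
  by (simp_all add: uea_space_def ring.extend_def folds)

lemma space_cmod: "cmod (uea_space L)"
proof (rule cmodI)
  fix u assume "u \<in> carrier (uea_space L)"
  then show "- 1 \<odot>\<^bsub>uea_space L\<^esub> u \<oplus>\<^bsub>uea_space L\<^esub> u = \<zero>\<^bsub>uea_space L\<^esub>"
    using cl_const(1)[of "-1" 1] cl_const(3) U.l_distr[of "cl (const (-1))" "cl (const 1)" u]
      cl_add[of 0 0] U.add.l_cancel_one[of "cl 0" "cl 0"]
    by (simp add: free_alg_closed)
qed (simp_all add: free_alg_closed cl_const cl_one U.a_ac U.l_distr U.r_distr U.m_assoc)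

text \<open>The elements of the free algebra that annihilate \<open>M\<close> form a two-sided
  ideal, and the module axioms say that it contains the defining relations.\<close>

lemma fa_ideal:
  assumes M: "lie_module L M" and y: "y \<in> I" and v: "v \<in> carrier M"
  shows "free_act M y v = \<zero>\<^bsub>M\<^esub>"
proof -
  interpret M: lierep L M by (rule lierepI[OF M])
  have Lc: "x \<in> L \<Longrightarrow> y \<in> L \<Longrightarrow> x + y \<in> L \<and> bracket x y \<in> L" "x \<in> L \<Longrightarrow> c *s x \<in> L" for x y c
    using L by (auto simp: lie_sub_def)
  let ?J = "{y \<in> carrier (free_alg L). \<forall>v\<in>carrier M. free_act M y v = \<zero>\<^bsub>M\<^esub>}"
  have "ideal ?J (free_alg L)"
  proof (rule free_alg_idealI)
    fix a x assume "a \<in> ?J" "x \<in> carrier (free_alg L)"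
    then show "x * a \<in> ?J \<and> a * x \<in> ?J"
      by (auto simp: M.fa_mult free_alg_closed lmap_zero[OF M.cmodM M.cmodM M.fa_lmap])
  next
    fix a assume "a \<in> ?J"
    then show "- a \<in> ?J" using M.fa_diff[of 0 a] by (auto simp: free_alg_closed)
  qed (auto simp: free_alg_closed M.fa_add)
  moreover have "uea_rels L \<subseteq> ?J"
  proof
    fix y assume y: "y \<in> uea_rels L"
    then consider x x' where "y = letter (x + x') - letter x - letter x'" "x \<in> L" "x' \<in> L"
      | c x where "y = letter (c *s x) - const c * letter x" "x \<in> L"
      | x x' where "y = letter x * letter x' - letter x' * letter x - letter (bracket x x')" "x \<in> L" "x' \<in> L"
      unfolding uea_rels_def by blast
    then have "free_act M y v = \<zero>\<^bsub>M\<^esub>" if "v \<in> carrier M" for v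
    proof cases
      case 1
      then show ?thesis using that Lc
        by (intro M.vec_eqI) (simp_all add: free_alg_closed M.fa_diff M.fa_letter M.act_plus cfun_add)
    next
      case 2
      then show ?thesis using that Lc
        by (intro M.vec_eqI) (simp_all add: free_alg_closed M.fa_diff M.fa_mult M.fa_const M.fa_letter M.act_scale)
    next
      case 3
      then show ?thesis using that Lc
        by (intro M.vec_eqI) (simp_all add: free_alg_closed M.fa_diff M.fa_mult M.fa_letter M.act_bracket)
    qed
    then show "y \<in> ?J" using y uea_rels_subset[OF L] by blast
  qed
  ultimately have "I \<subseteq> ?J" by (rule I_min)
  then show ?thesis using y v by blast
qed

lemma fa_cong:
  assumes "lie_module L M" "y \<in> carrier (free_alg L)" "y' \<in> carrier (free_alg L)" "y' - y \<in> I" "v \<in> carrier M"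
  shows "free_act M y' v = free_act M y v"
proof -
  interpret M: lierep L M by (rule lierepI[OF assms(1)])
  have "free_act M y' v \<ominus>\<^bsub>M\<^esub> free_act M y v = \<zero>\<^bsub>M\<^esub>"
    using fa_ideal[OF assms(1,4,5)] assms by (simp add: M.fa_diff)
  then show ?thesis using assms by (simp add: M.diff_zero_iff)
qed

lemma uea_act_cl:
  assumes "lie_module L M" "y \<in> carrier (free_alg L)" "v \<in> carrier M"
  shows "uea_act M (cl y) v = free_act M y v"
  unfolding uea_act_def by (rule the_elem_image[OF assms(2)]) (rule fa_cong[OF assms(1,2) _ _ assms(3)])

end

text \<open>This makes \<open>uea_incl\<close> independent of the representative.\<close>

lemma uea_ideal_mono:
  assumes "lie_sub K" "lie_sub L" "K \<subseteq> L"
  shows "uea_ideal K \<subseteq> uea_ideal L"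
proof -
  interpret K: uea_alg K by (simp add: uea_alg_def assms)
  interpret L: uea_alg L by (simp add: uea_alg_def assms)
  have "ideal (L.I \<inter> carrier (free_alg K)) (free_alg K)"
    by (rule free_alg_idealI)
      (use idealD[OF L.I_ideal] free_alg_mono[OF assms(3)] in \<open>auto intro!: free_alg_closed\<close>)
  moreover have "uea_rels K \<subseteq> L.I \<inter> carrier (free_alg K)"
  proof -
    have "uea_rels K \<subseteq> uea_rels L" using assms(3) unfolding uea_rels_def by blast
    then show ?thesis using L.R_I K.R by blast
  qed
  ultimately have "K.I \<subseteq> L.I \<inter> carrier (free_alg K)" by (rule K.I_min)
  then show ?thesis by (simp add: K.folds L.folds)
qed

section \<open>Induced modules\<close>

definition ind_rel where
  "ind_rel L K V = {((u \<otimes>\<^bsub>uea L\<^esub> uea_incl L Y, v), (u, uea_act V Y v)) |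
        u Y v. u \<in> carrier (uea L) \<and> Y \<in> carrier (uea K) \<and> v \<in> carrier V}"

definition ind_fun where
  "ind_fun L = (\<lambda>x (u, v). Poly_Mapping.single (uea_class L (letter x) \<otimes>\<^bsub>uea L\<^esub> u, v) (1::complex))"

lemma ind_fun_apply: "ind_fun L x (u, v) = Poly_Mapping.single (uea_class L (letter x) \<otimes>\<^bsub>uea L\<^esub> u, v) 1"
  by (simp add: ind_fun_def)

locale induced = uea_alg L + K: uea_alg K + V: lierep K V
  for L K :: "schr set" and V :: "(schr, 'v) rep" +
  assumes KL: "K \<subseteq> L"
begin

lemma lieV: "lie_module K V" by (rule V.lie)

lemma incl_cl:
  assumes y: "y \<in> carrier (free_alg K)"
  shows "uea_incl L (K.cl y) = cl y"
  unfolding uea_incl_def folds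
proof (rule K.the_elem_image[OF y])
  fix y' assume "y' \<in> carrier (free_alg K)" "y' - y \<in> K.I"
  moreover have "K.I \<subseteq> I"
    using uea_ideal_mono[OF K.L L KL] by (simp add: folds K.folds)
  ultimately show "cl y' = cl y"
    using free_alg_mono[OF KL] y by (intro cl_eq) auto
qed

lemma ind_rel_cases:
  assumes "((u, v), (u', v')) \<in> ind_rel L K V"
  obtains y where "y \<in> carrier (free_alg K)" "u' \<in> carrier U" "v \<in> carrier V" "u = u' \<otimes>\<^bsub>U\<^esub> cl y"
    "v' = free_act V y v"
proof -
  from assms obtain Y where Y: "u' \<in> carrier U" "Y \<in> carrier K.U" "v \<in> carrier V"
    "u = u' \<otimes>\<^bsub>U\<^esub> uea_incl L Y" "v' = uea_act V Y v"
    unfolding ind_rel_def folds K.folds by auto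
  then obtain y where "y \<in> carrier (free_alg K)" "Y = K.cl y" using K.carrier_U by auto
  then show thesis using that[of y] Y incl_cl K.uea_act_cl[OF lieV] by simp
qed

lemma cl_K_closed: "y \<in> carrier (free_alg K) \<Longrightarrow> cl y \<in> carrier U"
  using free_alg_mono[OF KL] by auto

lemma ind_relI:
  assumes "y \<in> carrier (free_alg K)" "u \<in> carrier U" "v \<in> carrier V"
  shows "((u \<otimes>\<^bsub>U\<^esub> cl y, v), (u, free_act V y v)) \<in> ind_rel L K V"
  unfolding ind_rel_def folds K.folds
  using assms by (intro CollectI exI[of _ u] exI[of _ "K.cl y"] exI[of _ v])
    (simp add: incl_cl K.uea_act_cl[OF lieV])

sublocale tensor "uea_space L" V "ind_rel L K V" "ind_fun L"
proof (rule tensor.intro[OF space_cmod V.cmodM])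
  show "ind_rel L K V \<subseteq> (carrier (uea_space L) \<times> carrier V) \<times> (carrier (uea_space L) \<times> carrier V)"
  proof
    fix p assume p: "p \<in> ind_rel L K V"
    obtain u v u' v' where "p = ((u, v), (u', v'))" by (metis surj_pair)
    with p show "p \<in> (carrier (uea_space L) \<times> carrier V) \<times> (carrier (uea_space L) \<times> carrier V)"
      by (auto elim!: ind_rel_cases simp: cl_K_closed)
  qed
qed

lemma T_Ind: "Ind L K V = T"
  by (simp add: Ind_def ind_rel_def ind_fun_def[abs_def])

lemma ind_act:
  assumes x: "x \<in> L"
  shows "lmap T T (act T x)"
    "u \<in> carrier U \<Longrightarrow> v \<in> carrier V \<Longrightarrow> act T x (tens u v) = tens (cl (letter x) \<otimes>\<^bsub>U\<^esub> u) v"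
proof -
  let ?G = "\<lambda>u v. tens (cl (letter x) \<otimes>\<^bsub>U\<^esub> u) v"
  have cx: "cl (letter x) \<in> carrier U" using x by (simp add: free_alg_closed)
  have G: "ind_fun L x (u, v) \<in> carrier F \<and> pr (ind_fun L x (u, v)) = ?G u v"
    if "u \<in> carrier (uea_space L)" "v \<in> carrier V" for u v
    using that cx by (simp add: ind_fun_apply tens_def folds)
  have sm: "cl (letter x) \<otimes>\<^bsub>U\<^esub> (cl (const c) \<otimes>\<^bsub>U\<^esub> u) = cl (const c) \<otimes>\<^bsub>U\<^esub> (cl (letter x) \<otimes>\<^bsub>U\<^esub> u)"
    if "u \<in> carrier U" for c u
    using cl_const_commute[OF cx, of c] that cx
    by (simp add: U.m_assoc[symmetric] free_alg_closed)
  have bl: "bilin (uea_space L) V T ?G"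
  proof (intro bilinI lmapI)
    fix u c v assume "u \<in> carrier (uea_space L)" "v \<in> carrier V"
    then show "?G (c \<odot>\<^bsub>uea_space L\<^esub> u) v = c \<odot>\<^bsub>T\<^esub> ?G u v"
      using tens_smult_left[of "cl (letter x) \<otimes>\<^bsub>U\<^esub> u" v c] cx by (simp add: sm)
  next
    fix u u' v assume "u \<in> carrier (uea_space L)" "u' \<in> carrier (uea_space L)" "v \<in> carrier V"
    then show "?G (u \<oplus>\<^bsub>uea_space L\<^esub> u') v = ?G u v \<oplus>\<^bsub>T\<^esub> ?G u' v"
      using tens_add_left[of "cl (letter x) \<otimes>\<^bsub>U\<^esub> u" "cl (letter x) \<otimes>\<^bsub>U\<^esub> u'" v] cx by (simp add: U.r_distr)
  qed (use cx in \<open>simp_all add: tens_add_right tens_smult_right\<close>)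
  have BG: "?G u v = ?G u' v'" if "((u, v), (u', v')) \<in> ind_rel L K V" for u v u' v'
    using that
  proof (cases rule: ind_rel_cases)
    case (1 y)
    have "((cl (letter x) \<otimes>\<^bsub>U\<^esub> u' \<otimes>\<^bsub>U\<^esub> cl y, v), (cl (letter x) \<otimes>\<^bsub>U\<^esub> u', free_act V y v)) \<in> ind_rel L K V"
      by (rule ind_relI) (use 1 cx in simp_all)
    from tens_rel[OF this] show ?thesis using 1 cx cl_K_closed by (simp add: U.m_assoc)
  qed
  show "lmap T T (act T x)" by (rule act_tens(1)[OF G bl BG])
  show "u \<in> carrier U \<Longrightarrow> v \<in> carrier V \<Longrightarrow> act T x (tens u v) = ?G u v"
    using act_tens(2)[OF G bl BG, of u v] by simp
qed

lemma ind_lie: "lie_module L T"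
proof -
  have lm: "x \<in> L \<Longrightarrow> lmap T T (\<lambda>u. act T x u)" for x by (rule ind_act(1))
  have cl: "act T x u \<in> carrier T" if "x \<in> L" "u \<in> carrier T" for x u by (rule lmap_closed[OF lm that(2)]) (rule that)
  have tc: "u \<in> carrier U \<Longrightarrow> v \<in> carrier V \<Longrightarrow> tens u v \<in> carrier T" for u v
    using tens_closed[of u v] by simp
  have cx: "x \<in> L \<Longrightarrow> cl (letter x) \<in> carrier U" for x by (simp add: free_alg_closed)
  have Lc: "x \<in> L \<Longrightarrow> y \<in> L \<Longrightarrow> x + y \<in> L" "x \<in> L \<Longrightarrow> y \<in> L \<Longrightarrow> bracket x y \<in> L" "x \<in> L \<Longrightarrow> c *s x \<in> L" for x y c
    using L by (auto simp: lie_sub_def)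
  have ta: "tens (u \<oplus>\<^bsub>U\<^esub> u') v = tens u v \<oplus>\<^bsub>T\<^esub> tens u' v"
    if "u \<in> carrier U" "u' \<in> carrier U" "v \<in> carrier V" for u u' v
    using tens_add_left[of u u' v] that by simp
  have ts: "tens (cl (const c) \<otimes>\<^bsub>U\<^esub> u) v = c \<odot>\<^bsub>T\<^esub> tens u v"
    if "u \<in> carrier U" "v \<in> carrier V" for u c v
    using tens_smult_left[of u v c] that by simp
  note t = ind_act(2)
  have 1: "act T (x + y) u = act T x u \<oplus>\<^bsub>T\<^esub> act T y u" if "x \<in> L" "y \<in> L" "u \<in> carrier T" for x y u
  proof (rule tens_lmap_eq[OF cT lm _ _ that(3)])
    show "lmap T T (\<lambda>u. act T x u \<oplus>\<^bsub>T\<^esub> act T y u)"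
      using that by (intro lmapI T.vec_eqI) (simp_all add: cl lmap_add[OF lm] lmap_smult[OF lm] cfun_add cfun_smult algebra_simps)
    fix u v assume "u \<in> carrier (uea_space L)" "v \<in> carrier V"
    then show "act T (x + y) (tens u v) = act T x (tens u v) \<oplus>\<^bsub>T\<^esub> act T y (tens u v)"
      using that by (simp add: t Lc cl_letter cx U.l_distr ta)
  qed (use that Lc in auto)
  have 2: "act T (c *s x) u = c \<odot>\<^bsub>T\<^esub> act T x u" if "x \<in> L" "u \<in> carrier T" for x c u
  proof (rule tens_lmap_eq[OF cT lm _ _ that(2)])
    show "lmap T T (\<lambda>u. c \<odot>\<^bsub>T\<^esub> act T x u)"
      using that by (intro lmapI T.vec_eqI) (simp_all add: cl lmap_add[OF lm] lmap_smult[OF lm] cfun_add cfun_smult algebra_simps)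
    fix u v assume "u \<in> carrier (uea_space L)" "v \<in> carrier V"
    then show "act T (c *s x) (tens u v) = c \<odot>\<^bsub>T\<^esub> act T x (tens u v)"
      using that by (simp add: t Lc cl_letter cx U.m_assoc ts free_alg_closed)
  qed (use that Lc in auto)
  have 3: "act T (bracket x y) u = act T x (act T y u) \<ominus>\<^bsub>T\<^esub> act T y (act T x u)" if "x \<in> L" "y \<in> L" "u \<in> carrier T" for x y u
  proof (rule tens_lmap_eq[OF cT lm _ _ that(3)])
    show "lmap T T (\<lambda>u. act T x (act T y u) \<ominus>\<^bsub>T\<^esub> act T y (act T x u))"
      using that by (intro lmapI T.vec_eqI) (simp_all add: cl lmap_add[OF lm] lmap_smult[OF lm] cfun_add cfun_smult algebra_simps)
    fix u v assume uv: "u \<in> carrier (uea_space L)" "v \<in> carrier V"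
    have "cl (letter x) \<otimes>\<^bsub>U\<^esub> (cl (letter y) \<otimes>\<^bsub>U\<^esub> u) =
        cl (letter y) \<otimes>\<^bsub>U\<^esub> (cl (letter x) \<otimes>\<^bsub>U\<^esub> u) \<oplus>\<^bsub>U\<^esub> cl (letter (bracket x y)) \<otimes>\<^bsub>U\<^esub> u"
      using that uv Lc cx by (simp add: U.m_assoc[symmetric] cl_letter(3)[of x y] U.l_distr)
    then have "act T x (act T y (tens u v)) = act T y (act T x (tens u v)) \<oplus>\<^bsub>T\<^esub> act T (bracket x y) (tens u v)"
      using that uv by (simp add: t cx ta Lc)
    then show "act T (bracket x y) (tens u v) = act T x (act T y (tens u v)) \<ominus>\<^bsub>T\<^esub> act T y (act T x (tens u v))"
      using that uv by (intro T.vec_eqI) (simp_all add: cl Lc tc cfun_add)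
  qed (use that Lc in auto)
  show ?thesis
    unfolding lie_module_def by (simp add: cT cl 1 2 3 lmap_add[OF lm] lmap_smult[OF lm])
qed

definition "\<iota> v = tens \<one>\<^bsub>U\<^esub> v"

lemma iota_rhom: "rhom K V T \<iota>"
proof (rule rhomI)
  show "lmap V T \<iota>"
    unfolding \<iota>_def by (rule lmapI) (simp_all add: tens_add_right tens_smult_right)
  fix x v assume x: "x \<in> K" and v: "v \<in> carrier V"
  then have xL: "x \<in> L" using KL by blast
  have "((\<one>\<^bsub>U\<^esub> \<otimes>\<^bsub>U\<^esub> cl (letter x), v), (\<one>\<^bsub>U\<^esub>, free_act V (letter x) v)) \<in> ind_rel L K V"
    by (rule ind_relI) (use x v in \<open>simp_all add: free_alg_closed\<close>)
  from tens_rel[OF this] show "\<iota> (act V x v) = act T x (\<iota> v)"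
    using x xL v by (simp add: \<iota>_def ind_act V.fa_letter free_alg_closed)
qed

lemma iota_closed: "v \<in> carrier V \<Longrightarrow> \<iota> v \<in> carrier T"
  by (rule rhom_closed[OF iota_rhom])

text \<open>A tensor \<open>tens (cl y) v\<close> is a combination of words of letters applied to
  \<open>\<iota> v\<close>, since each letter multiplies the left factor.\<close>

lemma ind_generated:
  assumes N: "subrep L T N" and iN: "\<iota> ` carrier V \<subseteq> N"
  shows "N = carrier T"
proof -
  interpret TT: lierep L T by (rule lierepI[OF ind_lie])
  note D = T.submoduleD[OF subrep_submodule[OF N]]
  have *: "tens (cl y) v \<in> N" if y: "y \<in> carrier (free_alg L)" and v: "v \<in> carrier V" for y v
    using y
  proof (induction y rule: TT.free_alg_induct)
    case zero
    have "tens (cl 0) v = 0 \<odot>\<^bsub>T\<^esub> tens (cl 0) v"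
      using tens_smult_left[of "cl 0" v 0] v cl_mult[of "const 0" 0] by (simp add: free_alg_closed)
    then show ?case using tens_closed[of "cl 0" v] D(3) v by (simp add: free_alg_closed)
  next
    case (add w c y)
    have w: "tens (cl (Poly_Mapping.single (Word xs) 1)) v \<in> N \<and> Poly_Mapping.single (Word xs) (1::complex) \<in> carrier (free_alg L)"
      if "set xs \<subseteq> L" for xs
      using that
    proof (induction xs)
      case Nil
      have "(Poly_Mapping.single (Word []) 1 :: schr word \<Rightarrow>\<^sub>0 complex) = 1" by (simp flip: zero_word_def)
      then show ?case using iN v by (auto simp: \<iota>_def cl_one free_alg_closed)
    next
      case (Cons x xs)
      have "Poly_Mapping.single (Word (x # xs)) (1::complex) = letter x * Poly_Mapping.single (Word xs) 1"
        by (simp add: mult_single plus_word_def)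
      then have "cl (Poly_Mapping.single (Word (x # xs)) 1) = cl (letter x) \<otimes>\<^bsub>U\<^esub> cl (Poly_Mapping.single (Word xs) 1)"
        using Cons by (simp add: cl_mult free_alg_closed)
      then have "tens (cl (Poly_Mapping.single (Word (x # xs)) 1)) v = act T x (tens (cl (Poly_Mapping.single (Word xs) 1)) v)"
        using Cons v by (simp add: ind_act)
      then show ?case using Cons TT.subrep_act[OF N, of x] by (simp add: free_alg_mem)
    qed
    have w': "tens (cl (Poly_Mapping.single w 1)) v \<in> N" "Poly_Mapping.single w (1::complex) \<in> carrier (free_alg L)"
      using w[of "letters w"] add(1) by (cases w; simp)+
    have "Poly_Mapping.single w c = const c * Poly_Mapping.single w 1" by (simp add: mult_single)
    then have "cl (Poly_Mapping.single w c + y) = cl (const c) \<otimes>\<^bsub>U\<^esub> cl (Poly_Mapping.single w 1) \<oplus>\<^bsub>U\<^esub> cl y"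
      using add w' by (simp add: cl_add cl_mult free_alg_closed)
    then have "tens (cl (Poly_Mapping.single w c + y)) v = c \<odot>\<^bsub>T\<^esub> tens (cl (Poly_Mapping.single w 1)) v \<oplus>\<^bsub>T\<^esub> tens (cl y) v"
      using tens_add_left[of "cl (const c) \<otimes>\<^bsub>U\<^esub> cl (Poly_Mapping.single w 1)" "cl y" v]
        tens_smult_left[of "cl (Poly_Mapping.single w 1)" v c] add w' v by (simp add: free_alg_closed)
    then show ?case using D(4,5) w'(1) add by simp
  qed
  have "u \<in> N" if "u \<in> carrier T" for u
    using that
  proof (induction u rule: tens_induct)
    case zero
    show ?case by (rule D(3))
  next
    case (add u v t)
    then have "tens u v \<in> N" using * carrier_U by auto
    then show ?case using D(4) add by simp
  qed
  then show ?thesis using D(1) by blast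
qed

text \<open>Frobenius reciprocity. The map sending \<open>(u, v)\<close> to \<open>u\<close> applied
  to \<open>\<theta> v\<close> respects the balancing relations because \<open>\<theta>\<close>
  commutes with the action of the free algebra on \<open>K\<close>.\<close>

lemma ind_universal:
  assumes X: "lie_module L X" and \<theta>: "rhom K V X \<theta>"
  obtains \<psi> where "rhom L T X \<psi>" "\<And>v. v \<in> carrier V \<Longrightarrow> \<psi> (\<iota> v) = \<theta> v"
proof -
  interpret X: lierep L X by (rule lierepI[OF X])
  have \<theta>c: "v \<in> carrier V \<Longrightarrow> \<theta> v \<in> carrier X" for v by (rule rhom_closed[OF \<theta>])
  let ?\<beta> = "\<lambda>u v. uea_act X u (\<theta> v)"
  have \<beta>: "?\<beta> (cl y) v = free_act X y (\<theta> v)" if "y \<in> carrier (free_alg L)" "v \<in> carrier V" for y v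
    by (rule uea_act_cl[OF X that(1) \<theta>c[OF that(2)]])
  have bl: "bilin (uea_space L) V X ?\<beta>"
  proof (intro bilinI lmapI)
    fix u c v assume "u \<in> carrier (uea_space L)" and v: "v \<in> carrier V"
    then obtain y where y: "y \<in> carrier (free_alg L)" "u = cl y" using carrier_U by auto
    then show "?\<beta> (c \<odot>\<^bsub>uea_space L\<^esub> u) v = c \<odot>\<^bsub>X\<^esub> ?\<beta> u v"
      using \<beta>[OF _ v] v \<theta>c by (simp add: cl_mult[symmetric] free_alg_closed X.fa_mult X.fa_const)
  next
    fix u u' v assume "u \<in> carrier (uea_space L)" "u' \<in> carrier (uea_space L)" and v: "v \<in> carrier V"
    then obtain y y' where y: "y \<in> carrier (free_alg L)" "u = cl y" "y' \<in> carrier (free_alg L)" "u' = cl y'" using carrier_U by auto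
    then show "?\<beta> (u \<oplus>\<^bsub>uea_space L\<^esub> u') v = ?\<beta> u v \<oplus>\<^bsub>X\<^esub> ?\<beta> u' v"
      using \<beta>[OF _ v] v \<theta>c by (simp add: cl_add[symmetric] free_alg_closed X.fa_add)
  next
    fix u v v' assume "u \<in> carrier (uea_space L)" and v: "v \<in> carrier V" "v' \<in> carrier V"
    then obtain y where y: "y \<in> carrier (free_alg L)" "u = cl y" using carrier_U by auto
    then show "?\<beta> u (v \<oplus>\<^bsub>V\<^esub> v') = ?\<beta> u v \<oplus>\<^bsub>X\<^esub> ?\<beta> u v'"
      using v \<theta>c by (simp add: uea_act_cl[OF X] rhom_add[OF \<theta>] lmap_add[OF X.fa_lmap])
  next
    fix u c v assume "u \<in> carrier (uea_space L)" and v: "v \<in> carrier V"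
    then obtain y where y: "y \<in> carrier (free_alg L)" "u = cl y" using carrier_U by auto
    then show "?\<beta> u (c \<odot>\<^bsub>V\<^esub> v) = c \<odot>\<^bsub>X\<^esub> ?\<beta> u v"
      using v \<theta>c by (simp add: uea_act_cl[OF X] rhom_smult[OF \<theta>] lmap_smult[OF X.fa_lmap])
  next
    fix u v assume "u \<in> carrier (uea_space L)" and v: "v \<in> carrier V"
    then obtain y where y: "y \<in> carrier (free_alg L)" "u = cl y" using carrier_U by auto
    then show "?\<beta> u v \<in> carrier X" "?\<beta> u v \<in> carrier X" using \<beta> v \<theta>c by simp_all
  qed
  have \<theta>fold: "\<theta> (foldr (act V) xs v) = foldr (act X) xs (\<theta> v)" if "set xs \<subseteq> K" "v \<in> carrier V" for xs v
    using that(1) by (induction xs) (simp_all add: rhom_act[OF \<theta>] V.foldr_closed that(2))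
  have fold_in: "foldr (act X) xs (\<theta> v) \<in> carrier X" if "set xs \<subseteq> K" "v \<in> carrier V" for xs v
    using that KL \<theta>c by (intro X.foldr_closed) auto
  have \<theta>fa: "\<theta> (free_act V y v) = free_act X y (\<theta> v)" if "y \<in> carrier (free_alg K)" "v \<in> carrier V" for y v
    using that(1)
  proof (induction y rule: V.free_alg_induct)
    case zero
    then show ?case by (simp add: lmap_zero[OF V.cmodM X.cmodM rhom_lmap[OF \<theta>]])
  next
    case (add w c y)
    have "Poly_Mapping.single w c \<in> carrier (free_alg L)" "y \<in> carrier (free_alg L)" "set (letters w) \<subseteq> L"
      using V.single_in_free_alg[OF add(1)] free_alg_mono[OF KL] add KL by auto
    then show ?case using add that(2) \<theta>c fold_in
      by (simp add: V.fa_add X.fa_add V.single_in_free_alg V.fa_single X.fa_single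
        rhom_add[OF \<theta>] rhom_smult[OF \<theta>] \<theta>fold V.foldr_closed)
  qed
  have BG: "?\<beta> u v = ?\<beta> u' v'" if "((u, v), (u', v')) \<in> ind_rel L K V" for u v u' v'
    using that
  proof (cases rule: ind_rel_cases)
    case (1 y)
    then obtain x where x: "x \<in> carrier (free_alg L)" "u' = cl x" using carrier_U by auto
    have yL: "y \<in> carrier (free_alg L)" using 1 free_alg_mono[OF KL] by auto
    show ?thesis unfolding 1(4,5) x(2) using \<beta>[of "x * y" v] \<beta>[of x "free_act V y v"] 1 x yL \<theta>c
      by (simp add: cl_mult[symmetric] free_alg_closed X.fa_mult \<theta>fa)
  qed
  obtain \<psi> where \<psi>: "lmap T X \<psi>" "\<And>u v. u \<in> carrier (uea_space L) \<Longrightarrow> v \<in> carrier V \<Longrightarrow> \<psi> (tens u v) = ?\<beta> u v"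
    using universal[OF X.cmodM bl BG] by blast
  have "rhom L T X \<psi>"
  proof (rule rhomI[OF \<psi>(1)])
    fix x t assume x: "x \<in> L" and t: "t \<in> carrier T"
    show "\<psi> (act T x t) = act X x (\<psi> t)"
    proof (rule tens_lmap_eq[OF X.cmodM _ _ _ t])
      show "lmap T X (\<lambda>t. \<psi> (act T x t))" by (rule lmap_comp[OF ind_act(1)[OF x] \<psi>(1)])
      show "lmap T X (\<lambda>t. act X x (\<psi> t))" by (rule lmap_comp[OF \<psi>(1) X.act_lmap[OF x]])
      fix u v assume "u \<in> carrier (uea_space L)" and v: "v \<in> carrier V"
      then obtain y where y: "y \<in> carrier (free_alg L)" "u = cl y" using carrier_U by auto
      then show "\<psi> (act T x (tens u v)) = act X x (\<psi> (tens u v))"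
        using x v \<theta>c \<beta>[OF _ v]
        by (simp add: ind_act \<psi>(2) free_alg_closed cl_mult[symmetric] X.fa_mult X.fa_letter)
    qed
  qed
  moreover have "\<psi> (\<iota> v) = \<theta> v" if "v \<in> carrier V" for v
  proof -
    have "free_act X 1 (\<theta> v) = \<theta> v" using X.fa_const[of "\<theta> v" 1] \<theta>c[OF that] by simp
    then show ?thesis using \<beta>[of 1 v] that by (simp add: \<iota>_def \<psi>(2) cl_one free_alg_closed)
  qed
  ultimately show thesis by (rule that)
qed

end

section \<open>A coordinate model of modules induced from the ageing algebra\<close>

text \<open>The coefficients arise from moving a basis element past powers of \<open>f\<close>:
  \<open>[h, f^k] = -2k f^k\<close>, \<open>[p, f^k] = -k f^(k-1) q\<close> and
  \<open>[e, f^k] = k f^(k-1) (h - (k-1))\<close>. The entry of index \<open>k\<close> collects the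
  contributions of \<open>f^k\<close> and \<open>f^(k+1)\<close>, which explains the factors
  \<open>Suc k\<close>.\<close>

definition seq_op :: "(schr, 'v) rep \<Rightarrow> gen \<Rightarrow> (nat \<Rightarrow> 'v) \<Rightarrow> (nat \<Rightarrow> 'v)" where
  "seq_op V b u = (\<lambda>k. case b of
       gF \<Rightarrow> (if k = 0 then \<zero>\<^bsub>V\<^esub> else u (k - 1))
     | gH \<Rightarrow> act V (bas gH) (u k) \<oplus>\<^bsub>V\<^esub> (- 2 * of_nat k) \<odot>\<^bsub>V\<^esub> u k
     | gP \<Rightarrow> act V (bas gP) (u k) \<oplus>\<^bsub>V\<^esub> (- of_nat (Suc k)) \<odot>\<^bsub>V\<^esub> act V (bas gQ) (u (Suc k))
     | gE \<Rightarrow> act V (bas gE) (u k) \<oplus>\<^bsub>V\<^esub> of_nat (Suc k) \<odot>\<^bsub>V\<^esub>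
         (act V (bas gH) (u (Suc k)) \<oplus>\<^bsub>V\<^esub> (- of_nat k) \<odot>\<^bsub>V\<^esub> u (Suc k))
     | _ \<Rightarrow> act V (bas b) (u k))"

lemma seq_op_simps:
  "seq_op V gF u 0 = \<zero>\<^bsub>V\<^esub>" "seq_op V gF u (Suc k) = u k"
  "seq_op V gH u k = act V (bas gH) (u k) \<oplus>\<^bsub>V\<^esub> (- 2 * of_nat k) \<odot>\<^bsub>V\<^esub> u k"
  "seq_op V gP u k = act V (bas gP) (u k) \<oplus>\<^bsub>V\<^esub> (- of_nat (Suc k)) \<odot>\<^bsub>V\<^esub> act V (bas gQ) (u (Suc k))"
  "seq_op V gE u k = act V (bas gE) (u k) \<oplus>\<^bsub>V\<^esub> of_nat (Suc k) \<odot>\<^bsub>V\<^esub>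
         (act V (bas gH) (u (Suc k)) \<oplus>\<^bsub>V\<^esub> (- of_nat k) \<odot>\<^bsub>V\<^esub> u (Suc k))"
  "seq_op V gQ u k = act V (bas gQ) (u k)" "seq_op V gZ u k = act V (bas gZ) (u k)"
  by (simp_all add: seq_op_def)

text \<open>The sequence \<open>u\<close> stands for the formal sum of the \<open>f^k u k\<close>.\<close>

definition seq_mod :: "(schr, 'v) rep \<Rightarrow> (schr, nat \<Rightarrow> 'v) rep" where
  "seq_mod V = \<lparr>carrier = {u. \<forall>k. u k \<in> carrier V}, mult = undefined, one = undefined,
     zero = (\<lambda>_. \<zero>\<^bsub>V\<^esub>), add = (\<lambda>u v k. u k \<oplus>\<^bsub>V\<^esub> v k), smult = (\<lambda>c u k. c \<odot>\<^bsub>V\<^esub> u k), act = undefined\<rparr>"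

definition seq_rep :: "(schr, 'v) rep \<Rightarrow> (schr, nat \<Rightarrow> 'v) rep" where
  "seq_rep V = (seq_mod V)\<lparr>act := basis_act (seq_mod V) (seq_op V)\<rparr>"

lemma basis_act_cong:
  assumes "carrier M = carrier M'" "add M = add M'" "zero M = zero M'" "smult M = smult M'"
  shows "basis_act M g = basis_act M' g"
  by (auto simp: fun_eq_iff basis_act_def finsum_def finprod_def assms)

locale age_rep = V: lierep age1 V for V :: "(schr, 'v) rep"
begin

abbreviation "P \<equiv> seq_rep V"

lemma seq_simps [simp]:
  "carrier P = {u. \<forall>k. u k \<in> carrier V}" "zero P = (\<lambda>_. \<zero>\<^bsub>V\<^esub>)" "add P = (\<lambda>u v k. u k \<oplus>\<^bsub>V\<^esub> v k)"
  "smult P = (\<lambda>c u k. c \<odot>\<^bsub>V\<^esub> u k)"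
  by (simp_all add: seq_rep_def seq_mod_def)

lemma seq_act: "act P = basis_act P (seq_op V)"
  unfolding seq_rep_def by (simp, rule basis_act_cong) simp_all

lemma seq_cmod: "cmod P"
  by (rule cmodI) (auto simp: fun_eq_iff V.M.a_assoc V.M.a_comm V.smult_add_left V.smult_add_right V.smult_smult
      V.add_minus_smult V.M.l_neg V.M.r_neg V.M.a_lcomm V.minus_smult[symmetric])

lemma gens_age [simp]:
  "bas gE \<in> age1" "bas gH \<in> age1" "bas gP \<in> age1" "bas gQ \<in> age1" "bas gZ \<in> age1"
  by (simp_all add: age1_coordsp)

lemma seq_op_closed: "(\<forall>k. u k \<in> carrier V) \<Longrightarrow> seq_op V b u k \<in> carrier V"
  by (cases b; cases k) (simp_all add: seq_op_simps)

lemma seq_op_lmap: "lmap P P (seq_op V b)"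
proof (rule lmapI)
  fix u v assume u: "u \<in> carrier P" "v \<in> carrier P"
  show "seq_op V b (u \<oplus>\<^bsub>P\<^esub> v) = seq_op V b u \<oplus>\<^bsub>P\<^esub> seq_op V b v"
  proof
    fix k show "seq_op V b (u \<oplus>\<^bsub>P\<^esub> v) k = (seq_op V b u \<oplus>\<^bsub>P\<^esub> seq_op V b v) k"
      using u by (cases b; cases k; intro V.vec_eqI)
        (simp_all add: seq_op_simps V.act_add cfun_add cfun_smult algebra_simps)
  qed
next
  fix c v assume u: "v \<in> carrier P"
  show "seq_op V b (c \<odot>\<^bsub>P\<^esub> v) = c \<odot>\<^bsub>P\<^esub> seq_op V b v"
  proof
    fix k show "seq_op V b (c \<odot>\<^bsub>P\<^esub> v) k = (c \<odot>\<^bsub>P\<^esub> seq_op V b v) k"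
      using u by (cases b; cases k; intro V.vec_eqI)
        (simp_all add: seq_op_simps V.act_smult cfun_add cfun_smult algebra_simps)
  qed
qed (simp add: seq_op_closed)

text \<open>The brackets are tested by functionals that see one entry of a sequence and are linear
  on \<open>V\<close>. The case distinction on the index isolates the entry 0, where
  \<open>f\<close> produces zero.\<close>

lemma seq_lie: "lie_module UNIV P"
proof -
  define \<Xi> where "\<Xi> \<xi> \<longleftrightarrow> (\<exists>\<eta> k. cfun V \<eta> \<and> \<xi> = (\<lambda>u::nat \<Rightarrow> 'v. \<eta> (u k)))" for \<xi>
  have "lie_module (coordsp UNIV) P"
  proof (rule lie_module_basisI[OF seq_cmod seq_act seq_op_lmap, where \<Xi> = \<Xi>])
    show "cfun P \<xi>" if "\<Xi> \<xi>" for \<xi>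
      using that by (auto simp: \<Xi>_def cfun_def)
    show "u = v" if u: "u \<in> carrier P" "v \<in> carrier P" and \<xi>: "\<And>\<xi>. \<Xi> \<xi> \<Longrightarrow> \<xi> u = \<xi> v" for u v
    proof
      fix k show "u k = v k"
      proof (rule V.vec_eqI)
        fix \<eta> assume "cfun V \<eta>"
        then have "\<Xi> (\<lambda>u. \<eta> (u k))" unfolding \<Xi>_def by blast
        then show "\<eta> (u k) = \<eta> (v k)" by (rule \<xi>)
      qed (use u in auto)
    qed
    fix a b u \<xi> assume "u \<in> carrier P" "\<Xi> \<xi>"
    then obtain \<eta> k where u: "\<forall>k. u k \<in> carrier V" and \<eta>: "cfun V \<eta>" "\<xi> = (\<lambda>u. \<eta> (u k))"
      by (auto simp: \<Xi>_def)
    have u': "u k \<in> carrier V" for k using u by simp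
    note [simp] = u' seq_op_closed[OF u] \<eta>(1)
    show "\<xi> (seq_op V a (seq_op V b u)) - \<xi> (seq_op V b (seq_op V a u)) =
        (\<Sum>c\<in>UNIV. bracket (bas a) (bas b) $ c * \<xi> (seq_op V c u))"
      unfolding \<eta>(2) sum_gen bracket_coords
      by (cases a; cases b; cases k;
        simp add: bas_nth seq_op_simps V.act_add V.act_smult V.comm_rules cfun_add[OF \<eta>(1)] cfun_smult[OF \<eta>(1)];
        simp add: algebra_simps)
  qed
  then show ?thesis by (simp add: coordsp_UNIV)
qed


end

lemma age1_sub: "lie_sub age1"
  using lie_sub_gens(1) by (simp add: age1_coordsp)

locale age_induced = age_rep V for V :: "(schr, 'v) rep"
begin

sublocale induced UNIV age1 V
  by unfold_locales (simp_all add: lie_sub_UNIV age1_sub)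

sublocale T: lierep UNIV T
  by (rule lierepI[OF ind_lie])

sublocale P: lierep UNIV P
  by (rule lierepI[OF seq_lie])

lemma seq_act_bas: "u \<in> carrier P \<Longrightarrow> act P (bas b) u = seq_op V b u"
proof -
  assume u: "u \<in> carrier P"
  then have c: "seq_op V c u \<in> carrier P" for c using lmap_closed[OF seq_op_lmap] by blast
  show ?thesis unfolding seq_act basis_act_def
  proof (rule P.vec_eqI)
    fix \<xi> assume f: "cfun P \<xi>"
    have "\<xi> (\<Oplus>\<^bsub>P\<^esub>c\<in>UNIV. bas b $ c \<odot>\<^bsub>P\<^esub> seq_op V c u) = (\<Sum>c\<in>UNIV. bas b $ c * \<xi> (seq_op V c u))"
      using c by (subst P.cfun_finsum[OF f]) (auto simp: cfun_smult[OF f] simp del: seq_simps)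
    then show "\<xi> (\<Oplus>\<^bsub>P\<^esub>c\<in>UNIV. bas b $ c \<odot>\<^bsub>P\<^esub> seq_op V c u) = \<xi> (seq_op V b u)"
      by (simp add: bas_nth if_distrib[of "\<lambda>x. x * _"] cong: if_cong)
  qed (use c in \<open>auto simp del: seq_simps intro!: P.finsum_closed P.smult_closed'\<close>)
qed

lemma embed_rhom: "rhom age1 V P (\<lambda>v k. if k = 0 then v else \<zero>\<^bsub>V\<^esub>)" (is "rhom _ _ _ ?j")
proof -
  have "rhom (coordsp ageG) V P ?j"
  proof (rule rhom_basisI)
    show "lie_module (coordsp ageG) V" using V.lie by (simp add: age1_coordsp)
    show "lie_module (coordsp ageG) P" by (rule lie_module_mono[OF seq_lie]) simp
    show "lmap V P ?j" by (rule lmapI) (auto simp: fun_eq_iff)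
    fix b v assume b: "b \<in> ageG" and v: "v \<in> carrier V"
    then have j: "?j v \<in> carrier P" by simp
    show "?j (act V (bas b) v) = act P (bas b) (?j v)"
      unfolding seq_act_bas[OF j]
    proof
      fix k show "?j (act V (bas b) v) k = seq_op V b (?j v) k"
        using b v by (cases b; cases k) (simp_all add: seq_op_simps)
    qed
  qed
  then show ?thesis by (simp add: age1_coordsp)
qed

text \<open>The image of \<open>f^k v\<close> is the sequence with the single entry \<open>v\<close>
  at place \<open>k\<close>, so the coefficients of a sum of such terms can be recovered.\<close>

lemma coordinate_map:
  "\<exists>\<Phi>. rhom UNIV T P \<Phi> \<and> (\<forall>v\<in>carrier V. \<Phi> (\<iota> v) = (\<lambda>k. if k = 0 then v else \<zero>\<^bsub>V\<^esub>))"
proof (rule ind_universal[OF seq_lie embed_rhom])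
  fix \<Phi> assume "rhom UNIV T P \<Phi>" "\<And>v. v \<in> carrier V \<Longrightarrow> \<Phi> (\<iota> v) = (\<lambda>k. if k = 0 then v else \<zero>\<^bsub>V\<^esub>)"
  then show ?thesis by (intro exI[of _ \<Phi>] conjI ballI)
qed

lemma iota_inj: "v \<in> carrier V \<Longrightarrow> \<iota> v = \<zero>\<^bsub>T\<^esub> \<Longrightarrow> v = \<zero>\<^bsub>V\<^esub>"
proof -
  assume v: "v \<in> carrier V" "\<iota> v = \<zero>\<^bsub>T\<^esub>"
  obtain \<Phi> where \<Phi>': "rhom UNIV T P \<Phi> \<and> (\<forall>v\<in>carrier V. \<Phi> (\<iota> v) = (\<lambda>k. if k = 0 then v else \<zero>\<^bsub>V\<^esub>))"
    using coordinate_map by (rule exE)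
  note \<Phi> = conjunct1[OF \<Phi>'] conjunct2[OF \<Phi>', rule_format]
  have "\<Phi> (\<iota> v) = \<zero>\<^bsub>P\<^esub>"
    unfolding v(2) by (rule lmap_zero[OF T.cmodM P.cmodM rhom_lmap[OF \<Phi>(1)]])
  then have "\<Phi> (\<iota> v) 0 = \<zero>\<^bsub>V\<^esub>" by simp
  then show ?thesis using \<Phi>(2)[OF v(1)] by simp
qed

lemma iota_preimage: "subrep UNIV T N \<Longrightarrow> subrep age1 V {v \<in> carrier V. \<iota> v \<in> N}"
proof (rule kernel_subrep[OF V.lie _ iota_rhom])
  assume N: "subrep UNIV T N"
  show "subrep age1 T N" using N by (simp add: subrep_def)
  show "lie_module age1 T" by (rule lie_module_mono[OF ind_lie]) simp
qed

lemma generated_by: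
  assumes V: "\<And>N. subrep age1 V N \<Longrightarrow> w \<in> N \<Longrightarrow> N = carrier V" and w: "w \<in> carrier V"
    and N: "subrep UNIV T N" "\<iota> w \<in> N"
  shows "N = carrier T"
proof (rule ind_generated[OF N(1)])
  have "{v \<in> carrier V. \<iota> v \<in> N} = carrier V"
    by (rule V[OF iota_preimage[OF N(1)]]) (use w N in simp)
  then show "\<iota> ` carrier V \<subseteq> N" by blast
qed

lemma highest_weight:
  assumes hw: "highest_weight_module age1 V"
  shows "highest_weight_module UNIV T" "has_unique_simple_quotient UNIV T"
proof -
  obtain w \<mu> \<zeta> where w: "w \<in> carrier V" "w \<noteq> \<zero>\<^bsub>V\<^esub>" "act V (bas gH) w = \<mu> \<odot>\<^bsub>V\<^esub> w" "act V (bas gZ) w = \<zeta> \<odot>\<^bsub>V\<^esub> w"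
    "act V (bas gE) w = \<zero>\<^bsub>V\<^esub>" "act V (bas gP) w = \<zero>\<^bsub>V\<^esub>"
    and gen: "\<And>N. subrep age1 V N \<Longrightarrow> w \<in> N \<Longrightarrow> N = carrier V"
    using hw unfolding highest_weight_module_def by blast
  have i0: "\<iota> \<zero>\<^bsub>V\<^esub> = \<zero>\<^bsub>T\<^esub>" by (rule lmap_zero[OF V.cmodM T.cmodM rhom_lmap[OF iota_rhom]])
  have iw: "\<iota> w \<in> carrier T" by (rule iota_closed[OF w(1)])
  have nz: "\<iota> w \<noteq> \<zero>\<^bsub>T\<^esub>" using iota_inj w by blast
  have a: "act T (bas gH) (\<iota> w) = \<mu> \<odot>\<^bsub>T\<^esub> \<iota> w" "act T (bas gZ) (\<iota> w) = \<zeta> \<odot>\<^bsub>T\<^esub> \<iota> w"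
    "act T (bas gE) (\<iota> w) = \<zero>\<^bsub>T\<^esub>" "act T (bas gP) (\<iota> w) = \<zero>\<^bsub>T\<^esub>"
    using rhom_act[OF iota_rhom, of _ w] w(1,3-6) rhom_smult[OF iota_rhom w(1)] i0 by (metis gens_age)+
  note g = generated_by[OF gen w(1)]
  show "highest_weight_module UNIV T"
    unfolding highest_weight_module_def
  proof (intro conjI bexI[of _ "\<iota> w"] allI impI)
    show "\<exists>\<mu>. act T (bas gH) (\<iota> w) = \<mu> \<odot>\<^bsub>T\<^esub> \<iota> w" using a(1) by (rule exI)
    show "\<exists>\<zeta>. act T (bas gZ) (\<iota> w) = \<zeta> \<odot>\<^bsub>T\<^esub> \<iota> w" using a(2) by (rule exI)
    show "N = carrier T" if "subrep UNIV T N \<and> \<iota> w \<in> N" for N using g that by blast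
  qed (rule ind_lie iw nz a)+
  interpret graded_cyclic UNIV T 1 "\<iota> w"
  proof (unfold_locales, unfold coordsp_UNIV)
    show "act T (bas b) (\<iota> w) = \<zero>\<^bsub>T\<^esub>" if "1 * shift b < 0" for b
      using that a by (cases b) (simp_all add: shift_def)
    show "\<exists>c. act T (bas b) (\<iota> w) = c \<odot>\<^bsub>T\<^esub> \<iota> w" if "shift b = 0" for b
      using that a by (cases b) (auto simp: shift_def)
  qed (use ind_lie iw g in \<open>simp_all add: lie_sub_UNIV\<close>)
  show "has_unique_simple_quotient UNIV T"
    using unique_quotient[OF _ a(1) nz] by (simp add: coordsp_UNIV)
qed

text \<open>Horner form of a sum of terms \<open>f^k v_k\<close>: acting by \<open>f\<close> amounts
  to prepending a zero coefficient, which suits induction on the list.\<close>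

primrec horner :: "'v list \<Rightarrow> (((schr word \<Rightarrow>\<^sub>0 complex) set \<times> 'v) \<Rightarrow>\<^sub>0 complex) set" where
  "horner [] = \<zero>\<^bsub>T\<^esub>"
| "horner (v # vs) = \<iota> v \<oplus>\<^bsub>T\<^esub> act T (bas gF) (horner vs)"

lemma horner_closed: "set vs \<subseteq> carrier V \<Longrightarrow> horner vs \<in> carrier T"
  by (induction vs) (auto simp: iota_closed)

lemma horner_add:
  "set vs \<subseteq> carrier V \<Longrightarrow> set us \<subseteq> carrier V \<Longrightarrow> \<exists>ws. set ws \<subseteq> carrier V \<and> horner vs \<oplus>\<^bsub>T\<^esub> horner us = horner ws"
proof (induction vs arbitrary: us)
  case Nil
  then show ?case using horner_closed by (intro exI[of _ us]) simp
next
  case (Cons v vs)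
  show ?case
  proof (cases us)
    case Nil
    then show ?thesis using Cons horner_closed[of "v # vs"] by (intro exI[of _ "v # vs"]) (simp del: horner.simps(2))
  next
    case (Cons u us')
    then obtain ws where ws: "set ws \<subseteq> carrier V" "horner vs \<oplus>\<^bsub>T\<^esub> horner us' = horner ws"
      using Cons.IH[of us'] Cons.prems by auto
    have "horner (v # vs) \<oplus>\<^bsub>T\<^esub> horner us = horner ((v \<oplus>\<^bsub>V\<^esub> u) # ws)"
      using Cons Cons.prems horner_closed[of vs] horner_closed[of us']
      by (intro T.vec_eqI) (auto simp: ws(2)[symmetric] T.act_add rhom_add[OF iota_rhom] iota_closed cfun_add)
    then show ?thesis using ws(1) Cons Cons.prems by (intro exI[of _ "(v \<oplus>\<^bsub>V\<^esub> u) # ws"]) auto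
  qed
qed

lemma horner_smult:
  "set vs \<subseteq> carrier V \<Longrightarrow> c \<odot>\<^bsub>T\<^esub> horner vs = horner (map (\<lambda>v. c \<odot>\<^bsub>V\<^esub> v) vs)"
  by (induction vs) (auto simp: horner_closed iota_closed T.smult_add_right T.act_smult rhom_smult[OF iota_rhom, symmetric]
      T.act_smult[symmetric])

lemma i0: "\<iota> \<zero>\<^bsub>V\<^esub> = \<zero>\<^bsub>T\<^esub>"
  by (rule lmap_zero[OF V.cmodM T.cmodM rhom_lmap[OF iota_rhom]])

text \<open>A basis element \<open>b\<close> other than \<open>f\<close> is moved past the outermost
  \<open>f\<close>; the commutator is a multiple of a basis element, so the induction must range
  over all basis elements at once.\<close>

lemma horner_act:
  "set vs \<subseteq> carrier V \<Longrightarrow> \<exists>ws. set ws \<subseteq> carrier V \<and> act T (bas b) (horner vs) = horner ws"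
proof (induction vs arbitrary: b)
  case Nil
  then show ?case by (intro exI[of _ "[]"]) simp
next
  case (Cons v vs)
  have v: "v \<in> carrier V" and vs: "set vs \<subseteq> carrier V" using Cons.prems by auto
  have f: "\<exists>ws. set ws \<subseteq> carrier V \<and> act T (bas gF) (horner us) = horner ws" if "set us \<subseteq> carrier V" for us
    using that horner_closed[OF that] by (intro exI[of _ "\<zero>\<^bsub>V\<^esub> # us"]) (simp add: i0)
  show ?case
  proof (cases "b = gF")
    case True
    then show ?thesis using f Cons.prems by blast
  next
    case False
    then have b: "bas b \<in> age1" by (cases b) (simp_all add: age1_coordsp)
    have hv: "horner vs \<in> carrier T" by (rule horner_closed[OF vs])
    obtain k c where kc: "bracket (bas b) (bas gF) = k *s bas c" using bracket_bas_graded by blast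
    have "act T (bas b) (act T (bas gF) (horner vs)) =
        act T (bas gF) (act T (bas b) (horner vs)) \<oplus>\<^bsub>T\<^esub> act T (bracket (bas b) (bas gF)) (horner vs)"
      using hv by (intro T.vec_eqI) (simp_all add: T.act_bracket cfun_add)
    also have "act T (bracket (bas b) (bas gF)) (horner vs) = k \<odot>\<^bsub>T\<^esub> act T (bas c) (horner vs)"
      using hv by (simp add: kc T.act_scale)
    finally have e: "act T (bas b) (horner (v # vs)) = \<iota> (act V (bas b) v) \<oplus>\<^bsub>T\<^esub>
        (act T (bas gF) (act T (bas b) (horner vs)) \<oplus>\<^bsub>T\<^esub> k \<odot>\<^bsub>T\<^esub> act T (bas c) (horner vs))"
      using hv v b by (simp add: T.act_add iota_closed rhom_act[OF iota_rhom])
    obtain us where us: "set us \<subseteq> carrier V" "act T (bas b) (horner vs) = horner us" using Cons.IH vs by blast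
    obtain us' where us': "set us' \<subseteq> carrier V" "act T (bas gF) (horner us) = horner us'" using f us by blast
    obtain ts where ts: "set ts \<subseteq> carrier V" "act T (bas c) (horner vs) = horner ts" using Cons.IH vs by blast
    have ts': "set (map (\<lambda>v. k \<odot>\<^bsub>V\<^esub> v) ts) \<subseteq> carrier V" using ts by auto
    obtain rs where rs: "set rs \<subseteq> carrier V" "horner us' \<oplus>\<^bsub>T\<^esub> horner (map (\<lambda>v. k \<odot>\<^bsub>V\<^esub> v) ts) = horner rs"
      using horner_add[OF us'(1) ts'] by blast
    have "\<iota> (act V (bas b) v) = horner [act V (bas b) v]" using v b iota_closed by simp
    then have "act T (bas b) (horner (v # vs)) = horner [act V (bas b) v] \<oplus>\<^bsub>T\<^esub> horner rs"
      using e by (simp only: us us' ts rs horner_smult)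
    then show ?thesis using horner_add[OF _ rs(1), of "[act V (bas b) v]"] v b by auto
  qed
qed

lemma horner_exists: "u \<in> carrier T \<Longrightarrow> \<exists>vs. set vs \<subseteq> carrier V \<and> u = horner vs"
proof -
  assume u: "u \<in> carrier T"
  let ?D = "{u. \<exists>vs. set vs \<subseteq> carrier V \<and> u = horner vs}"
  have D: "submodule ?D \<CC> T"
  proof (rule T.submoduleI')
    show "?D \<subseteq> carrier T" using horner_closed by blast
    show "\<zero>\<^bsub>T\<^esub> \<in> ?D" by (auto intro: exI[of _ "[]"])
    show "u \<oplus>\<^bsub>T\<^esub> v \<in> ?D" if "u \<in> ?D" "v \<in> ?D" for u v
      using that horner_add by auto
    show "c \<odot>\<^bsub>T\<^esub> u \<in> ?D" if "u \<in> ?D" for c u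
    proof -
      obtain vs where vs: "set vs \<subseteq> carrier V" "u = horner vs" using \<open>u \<in> ?D\<close> by blast
      then have "set (map (\<lambda>v. c \<odot>\<^bsub>V\<^esub> v) vs) \<subseteq> carrier V" by auto
      then show ?thesis using horner_smult[OF vs(1), of c] vs(2) by blast
    qed
  qed
  have "subrep UNIV T ?D"
    by (rule T.subrep_basisI[OF coordsp_UNIV[symmetric] D]) (use horner_act in blast)
  moreover have "\<iota> ` carrier V \<subseteq> ?D"
  proof clarify
    fix v assume "v \<in> carrier V"
    then show "\<exists>vs. set vs \<subseteq> carrier V \<and> \<iota> v = horner vs" by (intro exI[of _ "[v]"]) (simp add: iota_closed)
  qed
  ultimately have "?D = carrier T" by (rule ind_generated)
  then show ?thesis using u by blast
qed

lemma p_nilpotent_simple: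
  assumes simple: "irreducible_rep age1 V"
    and p: "\<And>v. v \<in> carrier V \<Longrightarrow> act V (bas gP) v = \<zero>\<^bsub>V\<^esub>"
    and q: "\<And>v. v \<in> carrier V \<Longrightarrow> act V (bas gQ) v = \<zero>\<^bsub>V\<^esub> \<Longrightarrow> v = \<zero>\<^bsub>V\<^esub>"
  shows "simple_module UNIV T"
proof -
  obtain \<Phi> where \<Phi>': "rhom UNIV T P \<Phi> \<and> (\<forall>v\<in>carrier V. \<Phi> (\<iota> v) = (\<lambda>k. if k = 0 then v else \<zero>\<^bsub>V\<^esub>))"
    using coordinate_map by (rule exE)
  note \<Phi> = conjunct1[OF \<Phi>'] conjunct2[OF \<Phi>', rule_format]
  have \<Phi>c: "\<Phi> u \<in> carrier P" if "u \<in> carrier T" for u by (rule rhom_closed[OF \<Phi>(1) that])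
  have \<Phi>0: "\<Phi> \<zero>\<^bsub>T\<^esub> = \<zero>\<^bsub>P\<^esub>" by (rule lmap_zero[OF T.cmodM P.cmodM rhom_lmap[OF \<Phi>(1)]])
  have horn: "\<Phi> (horner vs) = (\<lambda>k. if k < length vs then vs ! k else \<zero>\<^bsub>V\<^esub>)" if "set vs \<subseteq> carrier V" for vs
    using that
  proof (induction vs)
    case Nil
    then show ?case by (simp add: \<Phi>0)
  next
    case (Cons v vs)
    have v: "v \<in> carrier V" and vs: "set vs \<subseteq> carrier V" using Cons.prems by auto
    have nth: "vs ! n \<in> carrier V" if "n < length vs" for n using vs that nth_mem by blast
    have "\<Phi> (horner (v # vs)) = \<Phi> (\<iota> v) \<oplus>\<^bsub>P\<^esub> seq_op V gF (\<Phi> (horner vs))"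
      using v horner_closed[OF vs]
      by (simp add: rhom_add[OF \<Phi>(1)] iota_closed rhom_act[OF \<Phi>(1)] seq_act_bas[OF \<Phi>c] del: seq_simps)
    also have "\<dots> = (\<lambda>k. if k < length (v # vs) then (v # vs) ! k else \<zero>\<^bsub>V\<^esub>)"
    proof
      fix k show "(\<Phi> (\<iota> v) \<oplus>\<^bsub>P\<^esub> seq_op V gF (\<Phi> (horner vs))) k = (if k < length (v # vs) then (v # vs) ! k else \<zero>\<^bsub>V\<^esub>)"
        using v vs by (cases k) (auto simp: \<Phi>(2) Cons.IH[OF vs] seq_op_simps nth)
    qed
    finally show ?case .
  qed
  have horn0: "horner vs = \<zero>\<^bsub>T\<^esub>" if "\<forall>v\<in>set vs. v = \<zero>\<^bsub>V\<^esub>" for vs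
    using that by (induction vs) (simp_all add: i0)
  have fin: "\<exists>n. \<forall>k\<ge>n. \<Phi> u k = \<zero>\<^bsub>V\<^esub>" if u: "u \<in> carrier T" for u
  proof -
    obtain vs where "set vs \<subseteq> carrier V" "u = horner vs" using horner_exists[OF u] by blast
    then show ?thesis by (intro exI[of _ "length vs"]) (simp add: horn)
  qed
  have inj: "u = \<zero>\<^bsub>T\<^esub>" if u: "u \<in> carrier T" "\<forall>k. \<Phi> u k = \<zero>\<^bsub>V\<^esub>" for u
  proof -
    obtain vs where vs: "set vs \<subseteq> carrier V" "u = horner vs" using horner_exists[OF u(1)] by blast
    have "\<forall>k<length vs. vs ! k = \<zero>\<^bsub>V\<^esub>"
    proof (intro allI impI)
      fix k assume "k < length vs"
      then show "vs ! k = \<zero>\<^bsub>V\<^esub>" using u(2)[rule_format, of k] by (simp add: vs(2) horn[OF vs(1)])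
    qed
    then have "\<forall>v\<in>set vs. v = \<zero>\<^bsub>V\<^esub>" by (simp add: all_set_conv_all_nth)
    then show ?thesis unfolding vs(2) by (rule horn0)
  qed
  \<comment> \<open>Induction on a strict bound \<open>n\<close> for the degree of \<open>u\<close>
    in \<open>f\<close>.\<close>
  have hit: "\<exists>v\<in>carrier V. v \<noteq> \<zero>\<^bsub>V\<^esub> \<and> \<iota> v \<in> N"
    if N: "subrep UNIV T N" "u \<in> N" "u \<noteq> \<zero>\<^bsub>T\<^esub>" "\<forall>k\<ge>n. \<Phi> u k = \<zero>\<^bsub>V\<^esub>" for N u n
    using N(2-4)
  proof (induction n arbitrary: u)
    case 0
    have "u = \<zero>\<^bsub>T\<^esub>"
      by (rule inj[OF T.submoduleD(2)[OF subrep_submodule[OF N(1)] 0(1)]]) (use 0(3) in simp)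
    then show ?case using 0(2) by simp
  next
    case (Suc n)
    have u: "u \<in> carrier T" by (rule T.submoduleD(2)[OF subrep_submodule[OF N(1)] Suc.prems(1)])
    have \<Phi>u: "\<Phi> u k \<in> carrier V" for k using \<Phi>c[OF u] by simp
    show ?case
    proof (cases "\<Phi> u n = \<zero>\<^bsub>V\<^esub>")
      case True
      then have "\<forall>k\<ge>n. \<Phi> u k = \<zero>\<^bsub>V\<^esub>" using Suc.prems(3) by (metis Suc_leI le_neq_implies_less)
      then show ?thesis by (rule Suc.IH[OF Suc.prems(1,2)])
    next
      case False
      show ?thesis
      proof (cases n)
        case 0
        \<comment> \<open>An element of degree zero in \<open>f\<close> has the same coordinates as
          the image of its entry 0, and the coordinates determine it.\<close>
        have "\<iota> (\<Phi> u 0) = u"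
        proof -
          have k: "\<Phi> (\<iota> (\<Phi> u 0)) k = \<Phi> u k" for k
            using Suc.prems(3) 0 \<Phi>(2)[OF \<Phi>u[of 0]] by (cases k) auto
          have c: "\<iota> (\<Phi> u 0) \<in> carrier T" by (rule iota_closed[OF \<Phi>u])
          have "\<Phi> (\<iota> (\<Phi> u 0) \<ominus>\<^bsub>T\<^esub> u) k = \<zero>\<^bsub>V\<^esub>" for k
            using c u \<Phi>u by (simp add: T.diff_smult rhom_add[OF \<Phi>(1)] rhom_smult[OF \<Phi>(1)] k V.add_minus_smult)
          then have "\<iota> (\<Phi> u 0) \<ominus>\<^bsub>T\<^esub> u = \<zero>\<^bsub>T\<^esub>" using c u by (intro inj) auto
          then show ?thesis using c u by (simp add: T.diff_zero_iff)
        qed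
        then show ?thesis using Suc.prems False 0 \<Phi>u by (intro bexI[of _ "\<Phi> u 0"]) auto
      next
        case (Suc m)
        \<comment> \<open>As \<open>p\<close> kills \<open>V\<close>, only the commutator with
          powers of \<open>f\<close> survives: \<open>p\<close> shifts the sequence down and applies
          a nonzero multiple of \<open>q\<close>, so the leading entry stays nonzero.\<close>
        have eq: "\<Phi> (act T (bas gP) u) k = (- of_nat (Suc k)) \<odot>\<^bsub>V\<^esub> act V (bas gQ) (\<Phi> u (Suc k))" for k
        proof -
          have "\<Phi> (act T (bas gP) u) = seq_op V gP (\<Phi> u)"
            using rhom_act[OF \<Phi>(1) _ u, of "bas gP"] seq_act_bas[OF \<Phi>c[OF u]] by simp
          then show ?thesis using \<Phi>u by (simp add: seq_op_simps p)
        qed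
        have "\<Phi> (act T (bas gP) u) m \<noteq> \<zero>\<^bsub>V\<^esub>"
        proof
          assume "\<Phi> (act T (bas gP) u) m = \<zero>\<^bsub>V\<^esub>"
          then have "act V (bas gQ) (\<Phi> u n) = \<zero>\<^bsub>V\<^esub>"
            using V.smult_eq_zero[of "act V (bas gQ) (\<Phi> u n)" "- of_nat (Suc m)"] eq[of m] Suc \<Phi>u
            by (simp del: of_nat_Suc)
          from q[OF \<Phi>u this] show False using False by simp
        qed
        then have nz: "act T (bas gP) u \<noteq> \<zero>\<^bsub>T\<^esub>" using \<Phi>0 by auto
        show ?thesis
        proof (rule Suc.IH[OF _ nz])
          show "act T (bas gP) u \<in> N" by (rule T.subrep_act[OF N(1)]) (use Suc.prems in auto)
          show "\<forall>k\<ge>n. \<Phi> (act T (bas gP) u) k = \<zero>\<^bsub>V\<^esub>" using Suc.prems(3) by (simp add: eq)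
        qed
      qed
    qed
  qed
  have "irreducible_rep UNIV T"
    unfolding irreducible_rep_def
  proof (intro conjI allI impI)
    obtain v where v: "v \<in> carrier V" "v \<noteq> \<zero>\<^bsub>V\<^esub>"
      using simple V.M.zero_closed unfolding irreducible_rep_def by blast
    then have "\<iota> v \<noteq> \<zero>\<^bsub>T\<^esub>" "\<iota> v \<in> carrier T" using iota_inj[OF v(1)] iota_closed[OF v(1)] by auto
    then show "carrier T \<noteq> {\<zero>\<^bsub>T\<^esub>}" by auto
    fix N assume N: "subrep UNIV T N"
    note D = T.submoduleD[OF subrep_submodule[OF N]]
    show "N = {\<zero>\<^bsub>T\<^esub>} \<or> N = carrier T"
    proof (cases "N = {\<zero>\<^bsub>T\<^esub>}")
      case False
      have "\<not> N \<subseteq> {\<zero>\<^bsub>T\<^esub>}"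
      proof
        assume "N \<subseteq> {\<zero>\<^bsub>T\<^esub>}"
        then have "N = {\<zero>\<^bsub>T\<^esub>}" by (rule equalityI) (use D(3) in simp)
        then show False using False by contradiction
      qed
      then obtain u where u: "u \<in> N" "u \<noteq> \<zero>\<^bsub>T\<^esub>" unfolding subset_iff singleton_iff by blast
      obtain n where "\<forall>k\<ge>n. \<Phi> u k = \<zero>\<^bsub>V\<^esub>" using fin[OF D(2)[OF u(1)]] by (rule exE)
      from hit[OF N u this] obtain v where v: "v \<in> {v \<in> carrier V. \<iota> v \<in> N}" "v \<noteq> \<zero>\<^bsub>V\<^esub>" by auto
      have "{v \<in> carrier V. \<iota> v \<in> N} = {\<zero>\<^bsub>V\<^esub>} \<or> {v \<in> carrier V. \<iota> v \<in> N} = carrier V"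
        using simple iota_preimage[OF N] unfolding irreducible_rep_def by simp
      then have "{v \<in> carrier V. \<iota> v \<in> N} = carrier V" using v by auto
      then have "\<iota> ` carrier V \<subseteq> N" by auto
      then show ?thesis using ind_generated[OF N] by simp
    qed simp
  qed
  then show ?thesis using ind_lie by (simp add: simple_module_def)
qed

end

section \<open>Tensor products of Heisenberg and sl2 modules\<close>

lemma basis_act_cfun:
  assumes "cmod M" "\<And>b. lmap M M (g b)" "v \<in> carrier M"
  shows "basis_act M g x v \<in> carrier M"
    "cfun M \<xi> \<Longrightarrow> \<xi> (basis_act M g x v) = (\<Sum>b\<in>UNIV. x $ b * \<xi> (g b v))"
proof -
  interpret cvec M by (rule cvecI[OF assms(1)])
  have g: "g b v \<in> carrier M" for b by (rule lmap_closed[OF assms(2,3)])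
  show "basis_act M g x v \<in> carrier M"
    unfolding basis_act_def by (rule M.finsum_closed) (use g in auto)
  show "cfun M \<xi> \<Longrightarrow> \<xi> (basis_act M g x v) = (\<Sum>b\<in>UNIV. x $ b * \<xi> (g b v))"
    unfolding basis_act_def by (subst cfun_finsum) (use g in \<open>auto simp: cfun_smult\<close>)
qed

lemma basis_act_bas:
  assumes "cmod M" "\<And>b. lmap M M (g b)" "v \<in> carrier M"
  shows "basis_act M g (bas b) v = g b v"
proof -
  interpret cvec M by (rule cvecI[OF assms(1)])
  show ?thesis
  proof (rule vec_eqI)
    fix \<xi> assume "cfun M \<xi>"
    then have "\<xi> (basis_act M g (bas b) v) = (\<Sum>c\<in>UNIV. bas b $ c * \<xi> (g c v))"
      by (rule basis_act_cfun(2)[OF assms])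
    also have "\<dots> = (\<Sum>c\<in>UNIV. if b = c then \<xi> (g c v) else 0)"
      by (rule sum.cong) (simp_all add: bas_nth)
    finally show "\<xi> (basis_act M g (bas b) v) = \<xi> (g b v)" by simp
  qed (rule basis_act_cfun(1)[OF assms] lmap_closed[OF assms(2,3)])+
qed

lemma cmod_cong:
  assumes "cmod M" "carrier M = carrier M'" "add M = add M'" "zero M = zero M'" "smult M = smult M'"
  shows "cmod M'"
proof (rule cmod_image[OF assms(1), of _ "\<lambda>v. v"])
  show "lmap M M' (\<lambda>v. v)" using assms(2-5) cvec.smult_closed'[OF cvecI[OF assms(1)]]
    by (auto simp: lmap_def)
qed (use assms(2-5) in auto)

lemma gens_sl2 [simp]: "bas gE \<in> sl2" "bas gF \<in> sl2" "bas gH \<in> sl2"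
  by (simp_all add: sl2_coordsp)

lemma gens_heis [simp]: "bas gP \<in> heis" "bas gQ \<in> heis" "bas gZ \<in> heis"
  by (simp_all add: heis_coordsp)

lemma sl2_sub: "lie_sub sl2" and heis_sub: "lie_sub heis"
  using lie_sub_gens by (simp_all add: sl2_coordsp heis_coordsp)

section \<open>Extension of sl2-modules by zero\<close>

locale sl2_rep = W: lierep sl2 W for W :: "(schr, 'w) rep"
begin

abbreviation "E \<equiv> extend_sl2 W"

definition "sl2_op b v = (if b \<in> {gP, gQ, gZ} then \<zero>\<^bsub>W\<^esub> else act W (bas b) v)"

lemma extend_simps [simp]:
  "carrier E = carrier W" "add E = add W" "zero E = zero W" "smult E = smult W"
  by (simp_all add: extend_sl2_def)

lemma extend_cmod: "cmod E"
  by (rule cmod_cong[OF W.cmodM]) simp_all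

lemma sl2_op_lmap: "lmap E E (sl2_op b)"
  by (rule lmapI; cases b) (simp_all add: sl2_op_def W.act_add W.act_smult)

lemma extend_act: "act E = basis_act E sl2_op"
proof -
  have "act E = basis_act W sl2_op" by (simp add: extend_sl2_def sl2_op_def[abs_def])
  then show ?thesis using basis_act_cong[of W E sl2_op] by simp
qed

lemma extend_bas: "v \<in> carrier W \<Longrightarrow> act E (bas b) v = sl2_op b v"
  unfolding extend_act using basis_act_bas[OF extend_cmod sl2_op_lmap] by simp

lemma extend_lie: "lie_module UNIV E"
proof -
  have "lie_module (coordsp UNIV) E"
  proof (rule lie_module_basisI[OF extend_cmod extend_act sl2_op_lmap, where \<Xi> = "cfun E"])
    show "u = v" if "u \<in> carrier E" "v \<in> carrier E" "\<And>\<xi>. cfun E \<xi> \<Longrightarrow> \<xi> u = \<xi> v" for u v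
      by (rule cvec.vec_eqI[OF cvecI[OF extend_cmod] that])
    fix a b v \<xi> assume v: "v \<in> carrier E" and "cfun E \<xi>"
    then have \<xi>: "cfun W \<xi>" by (simp add: cfun_def)
    show "\<xi> (sl2_op a (sl2_op b v)) - \<xi> (sl2_op b (sl2_op a v)) = (\<Sum>c\<in>UNIV. bracket (bas a) (bas b) $ c * \<xi> (sl2_op c v))"
      unfolding sum_gen bracket_coords using v \<xi>
      by (cases a; cases b; simp add: sl2_op_def bas_nth W.comm_rules cfun_add cfun_smult)
  qed
  then show ?thesis by (simp add: coordsp_UNIV)
qed

lemma extend_act_sl2: "x \<in> sl2 \<Longrightarrow> v \<in> carrier W \<Longrightarrow> act E x v = act W x v"
proof -
  assume x: "x \<in> sl2" and v: "v \<in> carrier W"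
  have x': "x \<in> coordsp sl2G" using x by (simp add: sl2_coordsp)
  interpret E: lierep UNIV E by (rule lierepI[OF extend_lie])
  show ?thesis
  proof (rule W.vec_eqI)
    fix \<xi> assume \<xi>: "cfun W \<xi>"
    then have \<xi>E: "cfun E \<xi>" by (simp add: cfun_def)
    have c: "lmap E E (sl2_op b)" for b by (rule sl2_op_lmap)
    have "\<xi> (act E x v) = (\<Sum>b\<in>UNIV. x $ b * \<xi> (sl2_op b v))"
      unfolding extend_act using basis_act_cfun(2)[OF extend_cmod c _ \<xi>E, where v = v and x = x] v by simp
    also have "\<dots> = (\<Sum>b\<in>sl2G. x $ b * \<xi> (act W (bas b) v))"
      using x' \<xi> by (simp add: sum_gen sl2_op_def coordsp_def)
    also have "\<dots> = \<xi> (act W x v)"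
      unfolding W.act_expand[OF sl2_coordsp x v]
      by (subst W.cfun_finsum[OF \<xi>]) (use v \<xi> in \<open>auto simp: cfun_smult sl2_coordsp intro!: W.smult_closed' W.act_closed\<close>)
    finally show "\<xi> (act E x v) = \<xi> (act W x v)" .
  qed (use E.act_closed[of x v] v x in simp_all)
qed

lemma extend_act_heis: "v \<in> carrier W \<Longrightarrow> b \<in> heisG \<Longrightarrow> act E (bas b) v = \<zero>\<^bsub>W\<^esub>"
  by (auto simp: extend_bas sl2_op_def)

end

lemma one_dim_simps [simp]:
  "carrier (one_dim \<theta>) = UNIV" "add (one_dim \<theta>) = (+)" "zero (one_dim \<theta>) = 0" "smult (one_dim \<theta>) = (*)"
  "act (one_dim \<theta>) = (\<lambda>x c. \<theta> x * c)"
  by (simp_all add: one_dim_def)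

lemma one_dim_cmod: "cmod (one_dim \<theta>)"
  by (rule cmodI) (simp_all add: algebra_simps)

lemma one_dim_lie:
  assumes "\<And>x y. \<theta> (x + y) = \<theta> x + \<theta> y" "\<And>c x. \<theta> (c *s x) = c * \<theta> x"
    and "\<And>x y. x \<in> K \<Longrightarrow> y \<in> K \<Longrightarrow> \<theta> (bracket x y) = 0"
  shows "lie_module K (one_dim \<theta>)"
proof -
  interpret cvec "one_dim \<theta>" by (rule cvecI[OF one_dim_cmod])
  have "u \<ominus>\<^bsub>one_dim \<theta>\<^esub> v = u - v" for u v by (simp add: diff_smult)
  then show ?thesis using assms by (simp add: lie_module_def one_dim_cmod algebra_simps)
qed

text \<open>If \<open>pq\<close> has simple spectrum on \<open>M\<close>, its eigenvectors separate the components of a tensor,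
  so that the submodules of \<open>M \<otimes> W\<close> have the form \<open>M \<otimes> W'\<close>.\<close>

locale twist = M: lierep UNIV M + sl2_rep W for M :: "(schr, 'm) rep" and W :: "(schr, 'w) rep" +
  fixes m :: "'i \<Rightarrow> 'm" and \<beta> :: "'i \<Rightarrow> complex"
  assumes m: "m i \<in> carrier M" and inj_\<beta>: "inj \<beta>"
    and pq: "act M (bas gP) (act M (bas gQ) (m i)) = \<beta> i \<odot>\<^bsub>M\<^esub> m i"
    and span: "u \<in> carrier M \<Longrightarrow> \<exists>J f. finite J \<and> u = (\<Oplus>\<^bsub>M\<^esub>i\<in>J. f i \<odot>\<^bsub>M\<^esub> m i)"
    and trans: "\<exists>c xs. c \<noteq> 0 \<and> set xs \<subseteq> {bas gP, bas gQ} \<and> foldr (act M) xs (m i) = c \<odot>\<^bsub>M\<^esub> m j"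
begin

sublocale E: lierep UNIV E by (rule lierepI[OF extend_lie])

sublocale lie_tensor_mod M E ..

sublocale TT: lierep UNIV T by (rule lierepI[OF lie_tensor_lie])

lemma tens_sl2: "x \<in> sl2 \<Longrightarrow> u \<in> carrier M \<Longrightarrow> w \<in> carrier W \<Longrightarrow>
    act T x (tens u w) = tens (act M x u) w \<oplus>\<^bsub>T\<^esub> tens u (act W x w)"
  using lie_tensor_act(2)[of u w x] by (simp add: extend_act_sl2)

lemma tens_heis: "b \<in> heisG \<Longrightarrow> u \<in> carrier M \<Longrightarrow> w \<in> carrier W \<Longrightarrow>
    act T (bas b) (tens u w) = tens (act M (bas b) u) w"
  using lie_tensor_act(2)[of u w "bas b"] extend_act_heis[of w b] tens_zero(2)[of u] by simp

lemma tens_m_smult: "u \<in> carrier M \<Longrightarrow> w \<in> carrier W \<Longrightarrow> tens (c \<odot>\<^bsub>M\<^esub> u) w = c \<odot>\<^bsub>T\<^esub> tens u w"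
  "u \<in> carrier M \<Longrightarrow> w \<in> carrier W \<Longrightarrow> tens u (c \<odot>\<^bsub>W\<^esub> w) = c \<odot>\<^bsub>T\<^esub> tens u w"
  using tens_smult_left[of u w c] tens_smult_right[of u w c] by simp_all

lemma tens_m_add: "u \<in> carrier M \<Longrightarrow> u' \<in> carrier M \<Longrightarrow> w \<in> carrier W \<Longrightarrow>
    tens (u \<oplus>\<^bsub>M\<^esub> u') w = tens u w \<oplus>\<^bsub>T\<^esub> tens u' w"
  "u \<in> carrier M \<Longrightarrow> w \<in> carrier W \<Longrightarrow> w' \<in> carrier W \<Longrightarrow>
    tens u (w \<oplus>\<^bsub>W\<^esub> w') = tens u w \<oplus>\<^bsub>T\<^esub> tens u w'"
  using tens_add_left[of u u' w] tens_add_right[of u w w'] by simp_all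

lemma tens_left_lmap: "w \<in> carrier W \<Longrightarrow> lmap M T (\<lambda>u. tens u w)"
  by (rule lmapI) (simp_all add: tens_m_add tens_m_smult)

definition decomp :: "'i set \<Rightarrow> ('i \<Rightarrow> 'w) \<Rightarrow> (('m \<times> 'w) \<Rightarrow>\<^sub>0 complex) set \<Rightarrow> bool" where
  "decomp J w t \<longleftrightarrow> finite J \<and> (\<forall>i. w i \<in> carrier W) \<and> (\<forall>i. i \<notin> J \<longrightarrow> w i = \<zero>\<^bsub>W\<^esub>) \<and>
     t = (\<Oplus>\<^bsub>T\<^esub>i\<in>J. tens (m i) (w i))"

lemma decomp_superset: "decomp J w t \<Longrightarrow> J \<subseteq> K \<Longrightarrow> finite K \<Longrightarrow> decomp K w t"
proof -
  assume d: "decomp J w t" and K: "J \<subseteq> K" "finite K"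
  have "(\<Oplus>\<^bsub>T\<^esub>i\<in>J. tens (m i) (w i)) = (\<Oplus>\<^bsub>T\<^esub>i\<in>K. tens (m i) (w i))"
    by (rule T.M.add.finprod_mono_neutral_cong_left)
      (use d K tens_zero(2)[OF m] in \<open>auto simp: decomp_def m\<close>)
  then show ?thesis using d K by (auto simp: decomp_def)
qed

lemma decomp_add: "decomp J w t \<Longrightarrow> decomp K w' t' \<Longrightarrow> decomp (J \<union> K) (\<lambda>i. w i \<oplus>\<^bsub>W\<^esub> w' i) (t \<oplus>\<^bsub>T\<^esub> t')"
proof -
  assume d: "decomp J w t" and d': "decomp K w' t'"
  then have f: "finite J" "finite K" by (auto simp: decomp_def)
  have D: "decomp (J \<union> K) w t" "decomp (J \<union> K) w' t'"
    using decomp_superset[OF d] decomp_superset[OF d'] f by auto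
  then have "t \<oplus>\<^bsub>T\<^esub> t' = (\<Oplus>\<^bsub>T\<^esub>i\<in>J \<union> K. tens (m i) (w i) \<oplus>\<^bsub>T\<^esub> tens (m i) (w' i))"
    by (subst T.M.finsum_addf) (auto simp: decomp_def m)
  also have "\<dots> = (\<Oplus>\<^bsub>T\<^esub>i\<in>J \<union> K. tens (m i) (w i \<oplus>\<^bsub>W\<^esub> w' i))"
    by (rule T.M.finsum_cong') (use D in \<open>auto simp: decomp_def m tens_m_add\<close>)
  finally show ?thesis using D by (auto simp: decomp_def)
qed

lemma decomp_exists: "t \<in> carrier T \<Longrightarrow> \<exists>J w. decomp J w t"
proof (induction t rule: tens_induct)
  case zero
  show ?case by (rule exI[of _ "{}"], rule exI[of _ "\<lambda>_. \<zero>\<^bsub>W\<^esub>"]) (simp add: decomp_def)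
next
  case (add u w t)
  then have w: "w \<in> carrier W" by simp
  obtain J f where J: "finite J" "u = (\<Oplus>\<^bsub>M\<^esub>i\<in>J. f i \<odot>\<^bsub>M\<^esub> m i)" using span[OF add(1)] by blast
  have "tens u w = (\<Oplus>\<^bsub>T\<^esub>i\<in>J. tens (f i \<odot>\<^bsub>M\<^esub> m i) w)"
    unfolding J(2) by (rule lmap_finsum[OF M.cmodM cT tens_left_lmap[OF w]]) (auto simp: m)
  also have "\<dots> = (\<Oplus>\<^bsub>T\<^esub>i\<in>J. tens (m i) (if i \<in> J then f i \<odot>\<^bsub>W\<^esub> w else \<zero>\<^bsub>W\<^esub>))"
    by (rule T.M.finsum_cong') (use w in \<open>auto simp: tens_m_smult m\<close>)
  finally have "decomp J (\<lambda>i. if i \<in> J then f i \<odot>\<^bsub>W\<^esub> w else \<zero>\<^bsub>W\<^esub>) (tens u w)"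
    using J w by (simp add: decomp_def)
  moreover obtain K w' where "decomp K w' t" using add by blast
  ultimately show ?case using decomp_add by blast
qed

lemma decomp_component:
  assumes D: "subrep UNIV T D" "t \<in> D" and d: "decomp J w t" and i: "i \<in> J"
  shows "tens (m i) (w i) \<in> D"
proof (rule T.eigen_components[OF subrep_submodule[OF D(1)], where J = J and \<beta> = \<beta>
      and A = "\<lambda>t. act T (bas gP) (act T (bas gQ) t)"])
  show "lmap T T (\<lambda>t. act T (bas gP) (act T (bas gQ) t))"
    by (rule lmap_comp[OF lie_tensor_act(1) lie_tensor_act(1)])
  show "inj_on \<beta> J" by (rule inj_on_subset[OF inj_\<beta>]) simp
  show "act T (bas gP) (act T (bas gQ) (tens (m j) (w j))) = \<beta> j \<odot>\<^bsub>T\<^esub> tens (m j) (w j)" for j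
    using d by (simp add: decomp_def tens_heis m pq tens_m_smult)
qed (use D d i TT.subrep_act[OF D(1)] in \<open>auto simp: decomp_def m\<close>)

lemma heis_move:
  assumes D: "subrep UNIV T D" and w: "w \<in> carrier W" and i: "tens (m i) w \<in> D"
  shows "tens (m j) w \<in> D"
proof -
  obtain c xs where c: "c \<noteq> 0" "set xs \<subseteq> {bas gP, bas gQ}" "foldr (act M) xs (m i) = c \<odot>\<^bsub>M\<^esub> m j"
    using trans by blast
  have "tens (foldr (act M) xs (m i)) w \<in> D \<and> foldr (act M) xs (m i) \<in> carrier M"
    using c(2)
  proof (induction xs)
    case Nil
    then show ?case using i m by simp
  next
    case (Cons x xs)
    then obtain b where b: "x = bas b" "b \<in> heisG" by auto
    then show ?case
      using Cons w TT.subrep_act[OF D, of x "tens (foldr (act M) xs (m i)) w"] by (simp add: tens_heis)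
  qed
  then have "c \<odot>\<^bsub>T\<^esub> tens (m j) w \<in> D" using c(3) w m by (simp add: tens_m_smult)
  then have "inverse c \<odot>\<^bsub>T\<^esub> (c \<odot>\<^bsub>T\<^esub> tens (m j) w) \<in> D" by (rule T.submoduleD(5)[OF subrep_submodule[OF D]])
  then show ?thesis using c(1) w m by (simp add: T.smult_smult)
qed

text \<open>The largest subset of \<open>W\<close> whose tensors with all of \<open>M\<close> lie in
  \<open>D\<close>.\<close>

definition "slice D = {w \<in> carrier W. \<forall>u\<in>carrier M. tens u w \<in> D}"

lemma slice_single:
  assumes D: "subrep UNIV T D" and w: "w \<in> carrier W" and i: "tens (m i) w \<in> D"
  shows "w \<in> slice D"
  unfolding slice_def
proof (intro CollectI conjI ballI w)
  fix u assume u: "u \<in> carrier M"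
  obtain J f where J: "finite J" "u = (\<Oplus>\<^bsub>M\<^esub>i\<in>J. f i \<odot>\<^bsub>M\<^esub> m i)" using span[OF u] by blast
  have "tens u w = (\<Oplus>\<^bsub>T\<^esub>i\<in>J. tens (f i \<odot>\<^bsub>M\<^esub> m i) w)"
    unfolding J(2) by (rule lmap_finsum[OF M.cmodM cT tens_left_lmap[OF w]]) (auto simp: m)
  also have "\<dots> \<in> D"
  proof (rule T.submodule_finsum[OF subrep_submodule[OF D]])
    fix j
    have "f j \<odot>\<^bsub>T\<^esub> tens (m j) w \<in> D"
      by (rule T.submoduleD(5)[OF subrep_submodule[OF D]]) (rule heis_move[OF D w i])
    then show "tens (f j \<odot>\<^bsub>M\<^esub> m j) w \<in> D" using w m by (simp add: tens_m_smult)
  qed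
  finally show "tens u w \<in> D" .
qed

text \<open>By the Leibniz rule, \<open>u \<otimes> x w\<close> is the difference of
  \<open>x (u \<otimes> w)\<close> and \<open>(x u) \<otimes> w\<close>, and both of these lie in
  \<open>D\<close>.\<close>

lemma slice_subrep:
  assumes D: "subrep UNIV T D"
  shows "subrep sl2 W (slice D)"
proof -
  note DD = T.submoduleD[OF subrep_submodule[OF D]]
  show ?thesis
  proof (rule W.subrepI)
    show "\<zero>\<^bsub>W\<^esub> \<in> slice D" using DD(3) tens_zero(2) by (simp add: slice_def)
    fix x w assume x: "x \<in> sl2" and w: "w \<in> slice D"
    show "act W x w \<in> slice D"
      unfolding slice_def
    proof (intro CollectI conjI ballI)
      fix u assume u: "u \<in> carrier M"
      have c: "w \<in> carrier W" "tens u w \<in> D" "tens (act M x u) w \<in> D" using w u by (auto simp: slice_def)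
      have "tens u (act W x w) = act T x (tens u w) \<ominus>\<^bsub>T\<^esub> tens (act M x u) w"
        using x u c by (intro T.vec_eqI) (simp_all add: tens_sl2 cfun_add)
      also have "\<dots> \<in> D" by (rule DD(6)[OF TT.subrep_act[OF D _ c(2)] c(3)]) simp
      finally show "tens u (act W x w) \<in> D" .
    qed (use w x in \<open>simp add: slice_def\<close>)
  qed (use DD(4,5) in \<open>auto simp: slice_def tens_m_add tens_m_smult\<close>)
qed

lemma slice_full:
  assumes D: "subrep UNIV T D" and full: "slice D = carrier W"
  shows "D = carrier T"
proof -
  note DD = T.submoduleD[OF subrep_submodule[OF D]]
  have "t \<in> D" if "t \<in> carrier T" for t
    using that
  proof (induction t rule: tens_induct)
    case (add u w t)
    then have "w \<in> slice D" using full by simp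
    then have "tens u w \<in> D" using add(1) by (simp add: slice_def)
    then show ?case using add DD(4) by blast
  qed (rule DD(3))
  then show ?thesis using DD(1) by blast
qed

text \<open>The product of a functional not vanishing at \<open>u\<close> and one not vanishing at
  \<open>w\<close> is bilinear, hence factors through the tensor product. Here
  \<open>one_dim undefined\<close> stands for the vector space of complex numbers.\<close>

lemma tensor_nonzero:
  assumes "u \<in> carrier M" "u \<noteq> \<zero>\<^bsub>M\<^esub>" "w \<in> carrier W" "w \<noteq> \<zero>\<^bsub>W\<^esub>"
  shows "tens u w \<noteq> \<zero>\<^bsub>T\<^esub>"
proof
  assume z: "tens u w = \<zero>\<^bsub>T\<^esub>"
  obtain \<xi> where \<xi>: "cfun M \<xi>" "\<xi> u \<noteq> 0" using M.cfun_separates assms by blast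
  obtain \<eta> where \<eta>: "cfun W \<eta>" "\<eta> w \<noteq> 0" using W.cfun_separates assms by blast
  have "bilin M E (one_dim undefined) (\<lambda>u w. \<xi> u * \<eta> w)"
    using \<xi>(1) \<eta>(1) by (auto simp: bilin_def lmap_def cfun_def algebra_simps)
  then obtain \<psi> where \<psi>: "lmap T (one_dim undefined) \<psi>"
    "\<And>u w. u \<in> carrier M \<Longrightarrow> w \<in> carrier E \<Longrightarrow> \<psi> (tens u w) = \<xi> u * \<eta> w"
    using universal[OF one_dim_cmod[of undefined], where \<beta> = "\<lambda>u w. \<xi> u * \<eta> w"] by auto
  have "\<psi> (tens u w) = 0" unfolding z using lmap_zero[OF cT one_dim_cmod \<psi>(1)] by simp
  then show False using \<psi>(2)[of u w] assms \<xi> \<eta> by simp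
qed

end

lemma extend_rhom:
  assumes W: "lie_module sl2 W" and W': "lie_module sl2 W'" and \<phi>: "rhom sl2 W W' \<phi>"
  shows "rhom UNIV (extend_sl2 W) (extend_sl2 W') \<phi>"
proof -
  interpret A: sl2_rep W using W by (simp add: sl2_rep_def lierep_def)
  interpret B: sl2_rep W' using W' by (simp add: sl2_rep_def lierep_def)
  have "rhom (coordsp UNIV) (extend_sl2 W) (extend_sl2 W') \<phi>"
  proof (rule rhom_basisI)
    show "lie_module (coordsp UNIV) (extend_sl2 W)" "lie_module (coordsp UNIV) (extend_sl2 W')"
      using A.extend_lie B.extend_lie by (simp_all add: coordsp_UNIV)
    show "lmap (extend_sl2 W) (extend_sl2 W') \<phi>" using rhom_lmap[OF \<phi>] by (simp add: lmap_def)
    fix b v assume v: "v \<in> carrier (extend_sl2 W)"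
    show "\<phi> (act (extend_sl2 W) (bas b) v) = act (extend_sl2 W') (bas b) (\<phi> v)"
      using v rhom_closed[OF \<phi>, of v] rhom_act[OF \<phi>, of _ v] lmap_zero[OF A.W.cmodM B.W.cmodM rhom_lmap[OF \<phi>]]
      by (cases b) (simp_all add: A.extend_bas B.extend_bas A.sl2_op_def B.sl2_op_def)
  qed
  then show ?thesis by (simp add: coordsp_UNIV)
qed

context twist
begin

text \<open>The kernel of the map from \<open>M \<otimes> W\<close> to
  \<open>M \<otimes> (W/W')\<close> is the largest proper submodule: the slice of a proper submodule
  \<open>D\<close> is proper, hence inside \<open>W'\<close>, and the components of any element of
  \<open>D\<close> have their right factors in this slice.\<close>

lemma unique_quotient:
  assumes nz: "m i \<noteq> \<zero>\<^bsub>M\<^esub>" and W': "subrep sl2 W W'" "W' \<noteq> carrier W"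
    and max: "\<And>N. subrep sl2 W N \<Longrightarrow> N \<noteq> carrier W \<Longrightarrow> N \<subseteq> W'"
  shows "has_unique_simple_quotient UNIV T"
    and "rep_iso UNIV (the_simple_quotient UNIV T) (lie_tensor M (extend_sl2 (quot_rep W W')))"
proof -
  let ?\<pi> = "proj W W'"
  note lq = lie_quot[OF W.lie W'(1) sl2_sub]
  interpret Q: sl2_rep "quot_rep W W'" using lq(1) by (simp add: sl2_rep_def lierep_def)
  interpret QE: lierep UNIV Q.E by (rule lierepI[OF Q.extend_lie])
  interpret B: lie_tensor_mod M Q.E ..
  interpret BT: lierep UNIV B.T by (rule lierepI[OF B.lie_tensor_lie])
  have \<pi>: "rhom UNIV E Q.E ?\<pi>" by (rule extend_rhom[OF W.lie lq(1,2)])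
  have \<pi>c: "?\<pi> w \<in> carrier Q.E" if "w \<in> carrier W" for w using rhom_closed[OF \<pi>, of w] that by simp
  have "bilin M E B.T (\<lambda>u w. B.tens u (?\<pi> w))"
    by (intro bilinI lmapI)
      (simp_all add: \<pi>c rhom_add[OF \<pi>, simplified] rhom_smult[OF \<pi>, simplified]
        B.tens_add_left B.tens_smult_left B.tens_add_right[simplified] B.tens_smult_right[simplified] \<pi>c[simplified])
  then obtain \<Psi> where \<Psi>: "lmap T B.T \<Psi>"
    "\<And>u w. u \<in> carrier M \<Longrightarrow> w \<in> carrier E \<Longrightarrow> \<Psi> (tens u w) = B.tens u (?\<pi> w)"
    using universal[OF B.cT] by blast
  have \<Psi>': "\<Psi> (tens u w) = B.tens u (?\<pi> w)" if "u \<in> carrier M" "w \<in> carrier W" for u w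
    using \<Psi>(2) that by simp
  have hom: "rhom UNIV T B.T \<Psi>"
  proof (rule rhomI[OF \<Psi>(1)])
    fix x t assume t: "t \<in> carrier T"
    show "\<Psi> (act T x t) = act B.T x (\<Psi> t)"
    proof (rule tens_lmap_eq[OF B.cT _ _ _ t])
      show "lmap T B.T (\<lambda>t. \<Psi> (act T x t))" by (rule lmap_comp[OF lie_tensor_act(1) \<Psi>(1)])
      show "lmap T B.T (\<lambda>t. act B.T x (\<Psi> t))" by (rule lmap_comp[OF \<Psi>(1) B.lie_tensor_act(1)])
      fix u w assume u: "u \<in> carrier M" and w: "w \<in> carrier E"
      have ew: "act E x w \<in> carrier E" using w E.act_closed[of x w] by simp
      have "\<Psi> (act T x (tens u w)) = B.tens (act M x u) (?\<pi> w) \<oplus>\<^bsub>B.T\<^esub> B.tens u (?\<pi> (act E x w))"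
        using u w ew tens_closed[of "act M x u" w] tens_closed[of u "act E x w"]
        by (simp add: lie_tensor_act lmap_add[OF \<Psi>(1)] \<Psi>')
      also have "?\<pi> (act E x w) = act Q.E x (?\<pi> w)" by (rule rhom_act[OF \<pi> _ w]) simp
      also have "B.tens (act M x u) (?\<pi> w) \<oplus>\<^bsub>B.T\<^esub> B.tens u (act Q.E x (?\<pi> w)) = act B.T x (\<Psi> (tens u w))"
        using u w \<pi>c[of w] by (subst B.lie_tensor_act(2)[symmetric]) (simp_all add: \<Psi>')
      finally show "\<Psi> (act T x (tens u w)) = act B.T x (\<Psi> (tens u w))" .
    qed
  qed
  have \<Psi>0: "\<Psi> \<zero>\<^bsub>T\<^esub> = \<zero>\<^bsub>B.T\<^esub>" by (rule lmap_zero[OF cT B.cT \<Psi>(1)])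
  have surj: "\<Psi> ` carrier T = carrier B.T"
  proof
    show "\<Psi> ` carrier T \<subseteq> carrier B.T" using lmap_closed[OF \<Psi>(1)] by auto
    show "carrier B.T \<subseteq> \<Psi> ` carrier T"
    proof
      fix t assume "t \<in> carrier B.T"
      then show "t \<in> \<Psi> ` carrier T"
      proof (induction t rule: B.tens_induct)
        case zero
        show ?case by (rule image_eqI[where x = "\<zero>\<^bsub>T\<^esub>"]) (simp_all add: \<Psi>0)
      next
        case (add u c t)
        then obtain w where w: "w \<in> carrier W" "c = ?\<pi> w" using lq(3) by auto
        obtain s where s: "s \<in> carrier T" "t = \<Psi> s" using add by auto
        have "B.tens u c \<oplus>\<^bsub>B.T\<^esub> t = \<Psi> (tens u w \<oplus>\<^bsub>T\<^esub> s)"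
          using add(1) w s by (simp add: lmap_add[OF \<Psi>(1)] \<Psi>')
        then show ?case using add(1) w s by (intro image_eqI[of _ _ "tens u w \<oplus>\<^bsub>T\<^esub> s"]) simp_all
      qed
    qed
  qed
  define K where "K = {t \<in> carrier T. \<Psi> t = \<zero>\<^bsub>B.T\<^esub>}"
  have K: "subrep UNIV T K"
    unfolding K_def by (rule kernel_subrep0[OF lie_tensor_lie B.lie_tensor_lie hom])
  have Kne: "K \<noteq> carrier T"
  proof -
    obtain w where w: "w \<in> carrier W" "w \<notin> W'" using W.submoduleD(1)[OF subrep_submodule[OF W'(1)]] W'(2) by auto
    \<comment> \<open>The tensor product with the quotient of \<open>W\<close> satisfies the same
      assumptions, so nonzero pure tensors can be detected there as well.\<close>
    interpret BQ: twist M "quot_rep W W'" m \<beta> by unfold_locales (rule m inj_\<beta> pq span trans; assumption?)+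
    have "?\<pi> w \<noteq> \<zero>\<^bsub>quot_rep W W'\<^esub>" using lq(5) w by simp
    then have "B.tens (m i) (?\<pi> w) \<noteq> \<zero>\<^bsub>B.T\<^esub>"
      using BQ.tensor_nonzero[OF m nz, of "?\<pi> w"] \<pi>c[OF w(1)] by simp
    then have "tens (m i) w \<notin> K" using \<Psi>'[OF m w(1)] by (simp add: K_def)
    then show ?thesis using w m by auto
  qed
  have Kmax: "D \<subseteq> K" if D: "subrep UNIV T D" "D \<noteq> carrier T" for D
  proof
    fix t assume t: "t \<in> D"
    have tc: "t \<in> carrier T" by (rule T.submoduleD(2)[OF subrep_submodule[OF D(1)] t])
    have "slice D \<noteq> carrier W" using slice_full[OF D(1)] D(2) by auto
    then have sl: "slice D \<subseteq> W'" by (rule max[OF slice_subrep[OF D(1)]])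
    obtain J w where d: "decomp J w t" using decomp_exists[OF tc] by auto
    have w: "w j \<in> carrier W" for j using d by (simp add: decomp_def)
    have z: "\<Psi> (tens (m j) (w j)) = \<zero>\<^bsub>B.T\<^esub>" if "j \<in> J" for j
    proof -
      have "w j \<in> W'" using sl slice_single[OF D(1) w decomp_component[OF D(1) t d that]] by auto
      then have "?\<pi> (w j) = \<zero>\<^bsub>Q.E\<^esub>" using lq(5)[OF w] by simp
      then show ?thesis using \<Psi>'[OF m w] B.tens_zero(2)[OF m] by simp
    qed
    have "t = (\<Oplus>\<^bsub>T\<^esub>j\<in>J. tens (m j) (w j))" using d by (simp add: decomp_def)
    then have "\<Psi> t = (\<Oplus>\<^bsub>B.T\<^esub>j\<in>J. \<Psi> (tens (m j) (w j)))"
      by (simp only:) (rule lmap_finsum[OF cT B.cT \<Psi>(1)], use m w in simp)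
    also have "\<dots> = (\<Oplus>\<^bsub>B.T\<^esub>j\<in>J. \<zero>\<^bsub>B.T\<^esub>)" by (rule B.T.M.finsum_cong') (use z in auto)
    finally show "t \<in> K" using tc by (simp add: K_def)
  qed
  note u = unique_simple_quotient[OF lie_tensor_lie lie_sub_UNIV K Kne Kmax]
  show "has_unique_simple_quotient UNIV T" by (rule u(1))
  show "rep_iso UNIV (the_simple_quotient UNIV T) (lie_tensor M Q.E)"
  proof -
    have "rep_iso UNIV (quot_rep T K) B.T"
      unfolding K_def by (rule first_iso[OF lie_tensor_lie B.lie_tensor_lie lie_sub_UNIV hom surj])
    then have "rep_iso UNIV (the_simple_quotient UNIV T) B.T"
      by (subst u(2))
    then show ?thesis by (subst B.T_lie_tensor[symmetric])
  qed
qed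

end

section \<open>Verma modules of sl2\<close>

locale sl2_verma =
  fixes \<mu> :: complex
begin

definition "V0 = (one_dim (\<lambda>x. x $ gH * \<mu>) :: (schr, complex) rep)"

lemma V0_simps [simp]:
  "carrier V0 = UNIV" "add V0 = (+)" "zero V0 = 0" "smult V0 = (*)" "act V0 x c = x $ gH * \<mu> * c"
  by (simp_all add: V0_def)

text \<open>The \<open>h\<close>-coordinate of a bracket in the ageing algebra vanishes, so this
  character of the span of \<open>e\<close> and \<open>h\<close> is also one of the whole ageing
  algebra, zero on \<open>e, p, q, z\<close>. Hence the sequence model is available for
  \<open>V0\<close>, and its restriction to sl2 provides coordinates on the Verma module.\<close>

lemma V0_lie: "lie_module age1 V0" "lie_module (coordsp {gE, gH}) V0"
  unfolding V0_def by (rule one_dim_lie; simp add: age1_coordsp coordsp_def bracket_coords algebra_simps)+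

sublocale I: induced sl2 "coordsp {gE, gH}" V0
proof unfold_locales
  show "coordsp {gE, gH} \<subseteq> sl2" unfolding sl2_coordsp by (rule coordsp_mono) auto
qed (use lie_sub_gens V0_lie in \<open>simp_all add: sl2_coordsp\<close>)

sublocale A: age_induced V0
  by unfold_locales (rule V0_lie)

abbreviation "W \<equiv> I.T"

lemma W_eq: "verma_sl2 \<mu> = W"
proof -
  have "vec.span {bas gE, bas gH} = coordsp {gE, gH}" using span_bas[of "{gE, gH}"] by simp
  then show ?thesis using I.T_Ind by (simp add: V0_def)
qed

sublocale W: lierep sl2 W
  by (rule lierepI[OF I.ind_lie])

definition "w = I.\<iota> 1"

lemma w_closed [simp]: "w \<in> carrier W"
  unfolding w_def by (rule I.iota_closed) simp

lemma iota_w: "I.\<iota> c = c \<odot>\<^bsub>W\<^esub> w"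
  using rhom_smult[OF I.iota_rhom, of 1 c] by (simp add: w_def)

lemma w_act: "act W (bas gE) w = \<zero>\<^bsub>W\<^esub>" "act W (bas gH) w = \<mu> \<odot>\<^bsub>W\<^esub> w"
proof -
  have "I.\<iota> (act V0 (bas b) 1) = act W (bas b) w" if "b \<in> {gE, gH}" for b
    unfolding w_def by (rule rhom_act[OF I.iota_rhom]) (use that in auto)
  from this[of gE] this[of gH] show "act W (bas gE) w = \<zero>\<^bsub>W\<^esub>" "act W (bas gH) w = \<mu> \<odot>\<^bsub>W\<^esub> w"
    by (simp_all add: iota_w bas_nth)
qed

lemma w_generates: "subrep sl2 W N \<Longrightarrow> w \<in> N \<Longrightarrow> N = carrier W"
  by (rule I.ind_generated) (auto simp: iota_w I.T.submoduleD(5)[OF subrep_submodule])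

text \<open>\<open>\<kappa> k\<close> is the coefficient of \<open>f^k w\<close>, read off as the
  entry \<open>k\<close> of the sequence attached to a vector.\<close>

lemma coords:
  "\<exists>\<kappa> :: nat \<Rightarrow> _ \<Rightarrow> complex. (\<forall>k. cfun W (\<kappa> k)) \<and> (\<forall>k. \<kappa> k w = (if k = 0 then 1 else 0)) \<and>
    (\<forall>u\<in>carrier W. \<kappa> 0 (act W (bas gF) u) = 0 \<and> (\<forall>k. \<kappa> (Suc k) (act W (bas gF) u) = \<kappa> k u))"
proof -
  have P: "lie_module sl2 A.P" by (rule lie_module_mono[OF A.seq_lie]) simp
  have K: "coordsp {gE, gH} \<subseteq> age1" unfolding age1_coordsp by (rule coordsp_mono) auto
  have "rhom (coordsp {gE, gH}) V0 A.P (\<lambda>v k. if k = 0 then v else \<zero>\<^bsub>V0\<^esub>)"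
    by (rule rhom_mono[OF A.embed_rhom K])
  then show ?thesis
  proof (rule I.ind_universal[OF P])
    fix \<psi> assume \<psi>: "rhom sl2 W A.P \<psi>" and \<psi>w: "\<And>v. v \<in> carrier V0 \<Longrightarrow> \<psi> (I.\<iota> v) = (\<lambda>k. if k = 0 then v else \<zero>\<^bsub>V0\<^esub>)"
    have "\<psi> (act W (bas gF) u) = seq_op V0 gF (\<psi> u)" if "u \<in> carrier W" for u
      using rhom_act[OF \<psi> _ that, of "bas gF"] A.seq_act_bas[OF rhom_closed[OF \<psi> that], of gF] by simp
    moreover have "cfun W (\<lambda>u. \<psi> u k)" for k
      using rhom_add[OF \<psi>] rhom_smult[OF \<psi>] by (simp add: cfun_def)
    ultimately show ?thesis
      using \<psi>w[of 1] by (intro exI[of _ "\<lambda>k u. \<psi> u k"]) (auto simp: w_def seq_op_simps)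
  qed
qed

lemma w_nonzero: "w \<noteq> \<zero>\<^bsub>W\<^esub>"
proof
  assume z: "w = \<zero>\<^bsub>W\<^esub>"
  from coords show False
  proof (rule exE)
    fix \<kappa> :: "nat \<Rightarrow> _ \<Rightarrow> complex"
    assume \<kappa>: "(\<forall>k. cfun W (\<kappa> k)) \<and> (\<forall>k. \<kappa> k w = (if k = 0 then 1 else 0)) \<and>
      (\<forall>u\<in>carrier W. \<kappa> 0 (act W (bas gF) u) = 0 \<and> (\<forall>k. \<kappa> (Suc k) (act W (bas gF) u) = \<kappa> k u))"
    then have "cfun W (\<kappa> 0)" "\<kappa> 0 w = 1" by auto
    then show False using z I.T.cfun_zero[of "\<kappa> 0"] by simp
  qed
qed

lemma maximal:
  "\<exists>K. subrep sl2 W K \<and> K \<noteq> carrier W \<and> (\<forall>N. subrep sl2 W N \<longrightarrow> N \<noteq> carrier W \<longrightarrow> N \<subseteq> K)"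
proof -
  interpret graded_cyclic sl2G W 1 w
  proof (unfold_locales, unfold sl2_coordsp[symmetric])
    show "act W (bas b) w = \<zero>\<^bsub>W\<^esub>" if "b \<in> sl2G" "1 * shift b < 0" for b
      using that w_act by (auto simp: shift_def)
    show "\<exists>c. act W (bas b) w = c \<odot>\<^bsub>W\<^esub> w" if "b \<in> sl2G" "shift b = 0" for b
      using that w_act by (auto simp: shift_def)
  qed (use I.ind_lie w_generates sl2_sub in simp_all)
  show ?thesis
    by (rule maximal_subrep[OF _ w_act(2) w_nonzero]) (auto simp: sl2_coordsp)
qed

end

text \<open>Since \<open>h\<close> acts on the highest weight vector of the Verma module by
  \<open>\<mu>\<close>, and \<open>e, p, q\<close> kill it while \<open>z\<close> does so by
  extension, the space \<open>M \<otimes> w\<close> is \<open>M\<close> with \<open>h\<close>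
  shifted by \<open>\<mu>\<close>. The last assumptions say that \<open>V\<close> is this module
  over the ageing algebra.\<close>

locale twist_verma = S: sl2_verma \<mu> + TW: twist M "S.W" m \<beta> + AV: age_induced V
  for \<mu> and M :: "(schr, 'm) rep" and m :: "'i \<Rightarrow> 'm" and \<beta> and V :: "(schr, 'v) rep" +
  fixes \<theta> :: "'v \<Rightarrow> 'm"
  assumes \<theta>: "lmap V M \<theta>" "bij_betw \<theta> (carrier V) (carrier M)"
    and \<theta>_act: "\<And>b v. b \<in> {gE, gP, gQ, gZ} \<Longrightarrow> v \<in> carrier V \<Longrightarrow> \<theta> (act V (bas b) v) = act M (bas b) (\<theta> v)"
    and \<theta>_H: "\<And>v. v \<in> carrier V \<Longrightarrow> \<theta> (act V (bas gH) v) = act M (bas gH) (\<theta> v) \<oplus>\<^bsub>M\<^esub> \<mu> \<odot>\<^bsub>M\<^esub> \<theta> v"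
begin

lemma theta_closed: "v \<in> carrier V \<Longrightarrow> \<theta> v \<in> carrier M"
  by (rule lmap_closed[OF \<theta>(1)])

lemma leading_rhom: "rhom age1 V TW.T (\<lambda>v. TW.tens (\<theta> v) S.w)"
proof -
  have "rhom (coordsp ageG) V TW.T (\<lambda>v. TW.tens (\<theta> v) S.w)"
  proof (rule rhom_basisI)
    show "lie_module (coordsp ageG) V" using AV.V.lie by (simp add: age1_coordsp)
    show "lie_module (coordsp ageG) TW.T" by (rule lie_module_mono[OF TW.lie_tensor_lie]) simp
    show "lmap V TW.T (\<lambda>v. TW.tens (\<theta> v) S.w)"
      by (rule lmap_comp[OF \<theta>(1) TW.tens_left_lmap]) simp
    fix b v assume b: "b \<in> ageG" and v: "v \<in> carrier V"
    have tv: "\<theta> v \<in> carrier M" by (rule theta_closed[OF v])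
    consider "b \<in> heisG" | "b = gE" | "b = gH" using b by auto
    then show "TW.tens (\<theta> (act V (bas b) v)) S.w = act TW.T (bas b) (TW.tens (\<theta> v) S.w)"
    proof cases
      case 1
      then have "b \<in> {gE, gP, gQ, gZ}" by auto
      then show ?thesis using TW.tens_heis[OF 1 tv] \<theta>_act v by simp
    next
      case 2
      then show ?thesis using TW.tens_sl2[of "bas gE" "\<theta> v" S.w] tv v TW.tens_zero(2)[OF tv] \<theta>_act[of gE v]
        by (simp add: S.w_act)
    next
      case 3
      then show ?thesis using TW.tens_sl2[of "bas gH" "\<theta> v" S.w] tv v \<theta>_H[of v]
        by (simp add: S.w_act TW.tens_m_add TW.tens_m_smult)
    qed
  qed
  then show ?thesis by (simp add: age1_coordsp)
qed

text \<open>Surjectivity: the slice of the image contains the generator of the Verma module.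
  Injectivity: on \<open>M \<otimes> W\<close> the element \<open>f\<close> acts on both factors,
  but only its action on \<open>W\<close> raises the power of \<open>f\<close> there, so the
  comparison of coefficients is triangular.\<close>

lemma induced_iso: "rep_iso UNIV AV.T TW.T"
proof (rule AV.ind_universal[OF TW.lie_tensor_lie leading_rhom])
  fix \<psi> assume \<psi>: "rhom UNIV AV.T TW.T \<psi>"
    and \<psi>\<iota>: "\<And>v. v \<in> carrier V \<Longrightarrow> \<psi> (AV.\<iota> v) = TW.tens (\<theta> v) S.w"
  have \<theta>0: "\<theta> \<zero>\<^bsub>V\<^esub> = \<zero>\<^bsub>M\<^esub>" by (rule lmap_zero[OF AV.V.cmodM TW.M.cmodM \<theta>(1)])
  have \<theta>inj: "v = \<zero>\<^bsub>V\<^esub>" if "v \<in> carrier V" "\<theta> v = \<zero>\<^bsub>M\<^esub>" for v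
    using \<theta>(2) that \<theta>0 AV.V.M.zero_closed by (metis bij_betw_inv_into_left)
  have \<psi>0: "\<psi> \<zero>\<^bsub>AV.T\<^esub> = \<zero>\<^bsub>TW.T\<^esub>" by (rule lmap_zero[OF AV.cT TW.cT rhom_lmap[OF \<psi>]])
  have surj: "\<psi> ` carrier AV.T = carrier TW.T"
  proof -
    let ?X = "\<psi> ` carrier AV.T"
    have X: "subrep UNIV TW.T ?X"
      by (rule image_subrep[OF AV.ind_lie TW.lie_tensor_lie \<psi> AV.T.subrep_carrier])
    \<comment> \<open>Every element of \<open>M\<close> is some \<open>\<theta> v\<close>, and its
      tensor with the highest weight vector is the image of \<open>\<iota> v\<close>.\<close>
    have "S.w \<in> TW.slice ?X"
      unfolding TW.slice_def
    proof (intro CollectI conjI ballI)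
      fix u assume "u \<in> carrier M"
      then obtain v where v: "v \<in> carrier V" "u = \<theta> v" using \<theta>(2) by (auto simp: bij_betw_def)
      then have "TW.tens u S.w = \<psi> (AV.\<iota> v)" using \<psi>\<iota> by simp
      then show "TW.tens u S.w \<in> ?X" using AV.iota_closed[OF v(1)] by (rule image_eqI)
    qed simp
    then have "TW.slice ?X = carrier S.W" by (rule S.w_generates[OF TW.slice_subrep[OF X]])
    then show ?thesis by (rule TW.slice_full[OF X])
  qed
  obtain \<kappa> :: "nat \<Rightarrow> _ \<Rightarrow> complex" where \<kappa>': "(\<forall>k. cfun S.W (\<kappa> k)) \<and> (\<forall>k. \<kappa> k S.w = (if k = 0 then 1 else 0)) \<and>
    (\<forall>u\<in>carrier S.W. \<kappa> 0 (act S.W (bas gF) u) = 0 \<and> (\<forall>k. \<kappa> (Suc k) (act S.W (bas gF) u) = \<kappa> k u))"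
    using S.coords by (rule exE)
  have \<kappa>: "cfun S.W (\<kappa> k)" "\<kappa> k S.w = (if k = 0 then 1 else 0)"
    "u \<in> carrier S.W \<Longrightarrow> \<kappa> 0 (act S.W (bas gF) u) = 0"
    "u \<in> carrier S.W \<Longrightarrow> \<kappa> (Suc k) (act S.W (bas gF) u) = \<kappa> k u" for u k
    using \<kappa>' by auto
  \<comment> \<open>\<open>\<tau> k\<close> contracts the Verma factor with
    \<open>\<kappa> k\<close>, that is, it extracts the coefficient in \<open>M\<close> of
    \<open>f^k w\<close>.\<close>
  have "\<exists>\<tau>. lmap TW.T M \<tau> \<and> (\<forall>u\<in>carrier M. \<forall>w\<in>carrier S.W. \<tau> (TW.tens u w) = \<kappa> k w \<odot>\<^bsub>M\<^esub> u)" for k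
  proof -
    have "bilin M TW.E M (\<lambda>u w. \<kappa> k w \<odot>\<^bsub>M\<^esub> u)"
      by (intro bilinI lmapI) (simp_all add: cfun_add[OF \<kappa>(1)] cfun_smult[OF \<kappa>(1)] TW.M.smult_add_left
          TW.M.smult_add_right TW.M.smult_smult mult.commute)
    then show ?thesis using TW.universal[OF TW.M.cmodM] by (metis TW.extend_simps(1) empty_iff)
  qed
  then have "\<exists>\<tau>. \<forall>k. lmap TW.T M (\<tau> k) \<and> (\<forall>u\<in>carrier M. \<forall>w\<in>carrier S.W. \<tau> k (TW.tens u w) = \<kappa> k w \<odot>\<^bsub>M\<^esub> u)"
    by (intro choice allI)
  then obtain \<tau> where \<tau>': "\<forall>k. lmap TW.T M (\<tau> k) \<and> (\<forall>u\<in>carrier M. \<forall>w\<in>carrier S.W. \<tau> k (TW.tens u w) = \<kappa> k w \<odot>\<^bsub>M\<^esub> u)"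
    by (rule exE)
  have \<tau>: "lmap TW.T M (\<tau> k)" "\<And>u w. u \<in> carrier M \<Longrightarrow> w \<in> carrier S.W \<Longrightarrow> \<tau> k (TW.tens u w) = \<kappa> k w \<odot>\<^bsub>M\<^esub> u" for k
    using \<tau>' by auto
  let ?f = "act TW.T (bas gF)"
  have fl: "lmap TW.T TW.T ?f" by (rule TW.lie_tensor_act(1))
  have \<tau>c: "\<tau> k t \<in> carrier M" if "t \<in> carrier TW.T" for k t by (rule lmap_closed[OF \<tau>(1) that])
  have f0: "\<tau> 0 (?f t) = act M (bas gF) (\<tau> 0 t)" if "t \<in> carrier TW.T" for t
  proof (rule TW.tens_lmap_eq[OF TW.M.cmodM _ _ _ that])
    show "lmap TW.T M (\<lambda>t. \<tau> 0 (?f t))" by (rule lmap_comp[OF fl \<tau>(1)])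
    show "lmap TW.T M (\<lambda>t. act M (bas gF) (\<tau> 0 t))" by (rule lmap_comp[OF \<tau>(1) TW.M.act_lmap]) simp
    fix u w assume "u \<in> carrier M" "w \<in> carrier TW.E"
    then show "\<tau> 0 (?f (TW.tens u w)) = act M (bas gF) (\<tau> 0 (TW.tens u w))"
      by (simp add: TW.tens_sl2 lmap_add[OF \<tau>(1)] \<tau>(2) \<kappa> TW.M.act_smult)
  qed
  have fS: "\<tau> (Suc k) (?f t) = act M (bas gF) (\<tau> (Suc k) t) \<oplus>\<^bsub>M\<^esub> \<tau> k t" if "t \<in> carrier TW.T" for t k
  proof (rule TW.tens_lmap_eq[OF TW.M.cmodM _ _ _ that])
    show "lmap TW.T M (\<lambda>t. \<tau> (Suc k) (?f t))" by (rule lmap_comp[OF fl \<tau>(1)])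
    show "lmap TW.T M (\<lambda>t. act M (bas gF) (\<tau> (Suc k) t) \<oplus>\<^bsub>M\<^esub> \<tau> k t)"
      by (intro lmapI TW.M.vec_eqI)
        (simp_all add: \<tau>c lmap_add[OF \<tau>(1)] lmap_smult[OF \<tau>(1)] TW.M.act_add TW.M.act_smult cfun_add cfun_smult algebra_simps)
    fix u w assume "u \<in> carrier M" "w \<in> carrier TW.E"
    then show "\<tau> (Suc k) (?f (TW.tens u w)) = act M (bas gF) (\<tau> (Suc k) (TW.tens u w)) \<oplus>\<^bsub>M\<^esub> \<tau> k (TW.tens u w)"
      by (simp add: TW.tens_sl2 lmap_add[OF \<tau>(1)] \<tau>(2) \<kappa> TW.M.act_smult)
  qed
  have \<tau>0: "\<tau> k \<zero>\<^bsub>TW.T\<^esub> = \<zero>\<^bsub>M\<^esub>" for k by (rule lmap_zero[OF TW.cT TW.M.cmodM \<tau>(1)])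
  have step: "\<psi> (AV.horner (v # vs)) = TW.tens (\<theta> v) S.w \<oplus>\<^bsub>TW.T\<^esub> ?f (\<psi> (AV.horner vs))"
    "\<psi> (AV.horner vs) \<in> carrier TW.T"
    if "v \<in> carrier V" "set vs \<subseteq> carrier V" for v vs
    using that AV.horner_closed[OF that(2)] rhom_closed[OF \<psi>]
    by (simp_all add: rhom_add[OF \<psi>] AV.iota_closed rhom_act[OF \<psi>] \<psi>\<iota>)
  \<comment> \<open>Lower coefficients are mixed with the action of \<open>f\<close> on
    \<open>M\<close>; the highest one is exactly \<open>\<theta>\<close> of the last entry of the
    list.\<close>
  have top: "(\<forall>k\<ge>length vs. \<tau> k (\<psi> (AV.horner vs)) = \<zero>\<^bsub>M\<^esub>) \<and>
      (vs \<noteq> [] \<longrightarrow> \<tau> (length vs - 1) (\<psi> (AV.horner vs)) = \<theta> (last vs))" if "set vs \<subseteq> carrier V" for vs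
    using that
  proof (induction vs)
    case Nil
    then show ?case by (simp add: \<psi>0 \<tau>0)
  next
    case (Cons v vs)
    have v: "v \<in> carrier V" and vs: "set vs \<subseteq> carrier V" using Cons.prems by auto
    have tv: "\<theta> v \<in> carrier M" by (rule theta_closed[OF v])
    let ?t = "\<psi> (AV.horner vs)"
    have t: "?t \<in> carrier TW.T" "?f ?t \<in> carrier TW.T" using step(2)[OF v vs] lmap_closed[OF fl] by auto
    have e0: "\<tau> 0 (\<psi> (AV.horner (v # vs))) = \<theta> v \<oplus>\<^bsub>M\<^esub> act M (bas gF) (\<tau> 0 ?t)"
      unfolding step(1)[OF v vs] using tv t by (simp add: lmap_add[OF \<tau>(1)] \<tau>(2) \<kappa>(2) f0)
    have eS: "\<tau> (Suc k) (\<psi> (AV.horner (v # vs))) = act M (bas gF) (\<tau> (Suc k) ?t) \<oplus>\<^bsub>M\<^esub> \<tau> k ?t" for k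
      unfolding step(1)[OF v vs] using tv t \<tau>c[OF t(1)] by (simp add: lmap_add[OF \<tau>(1)] \<tau>(2) \<kappa>(2) fS)
    note IH = Cons.IH[OF vs]
    show ?case
    proof (intro conjI allI impI)
      fix k assume k: "length (v # vs) \<le> k"
      then obtain j where "k = Suc j" "length vs \<le> j" by (cases k) auto
      then show "\<tau> k (\<psi> (AV.horner (v # vs))) = \<zero>\<^bsub>M\<^esub>" using IH eS[of j] by simp
    next
      show "\<tau> (length (v # vs) - 1) (\<psi> (AV.horner (v # vs))) = \<theta> (last (v # vs))"
      proof (cases vs)
        case Nil
        then have "\<tau> 0 ?t = \<zero>\<^bsub>M\<^esub>" using IH by simp
        then show ?thesis using e0 Nil tv by simp
      next
        case (Cons v' vs')
        then have "length vs = Suc (length vs - 1)" by simp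
        moreover have "last vs \<in> carrier V" using vs Cons by auto
        ultimately show ?thesis using eS[of "length vs - 1"] IH Cons theta_closed[of "last vs"] by simp
      qed
    qed
  qed
  have inj: "u = \<zero>\<^bsub>AV.T\<^esub>" if u: "u \<in> carrier AV.T" "\<psi> u = \<zero>\<^bsub>TW.T\<^esub>" for u
  proof -
    obtain vs where vs: "set vs \<subseteq> carrier V" "u = AV.horner vs" using AV.horner_exists[OF u(1)] by auto
    have "AV.horner vs = \<zero>\<^bsub>AV.T\<^esub>" if "set vs \<subseteq> carrier V" "\<psi> (AV.horner vs) = \<zero>\<^bsub>TW.T\<^esub>" for vs
      using that
    proof (induction vs rule: rev_induct)
      case (snoc v vs)
      have "\<theta> v = \<zero>\<^bsub>M\<^esub>" using top[OF snoc.prems(1)] snoc.prems(2) by (simp add: \<tau>0)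
      then have v: "v = \<zero>\<^bsub>V\<^esub>" using \<theta>inj snoc.prems(1) by simp
      have "AV.horner (us @ [\<zero>\<^bsub>V\<^esub>]) = AV.horner us" for us
        by (induction us) (simp_all add: AV.i0)
      \<comment> \<open>The last coefficient has been shown to vanish and is dropped, which shortens
        the list.\<close>
      then show ?case using snoc v by simp
    qed simp
    then show ?thesis using vs u by simp
  qed
  have "inj_on \<psi> (carrier AV.T)"
    by (rule inj_onI_lmap[OF AV.cT TW.cT rhom_lmap[OF \<psi>] inj])
  then show ?thesis using \<psi> surj by (auto simp: rep_iso_iff bij_betw_def)
qed

lemma conclusion:
  assumes nz: "m i \<noteq> \<zero>\<^bsub>M\<^esub>"
  shows "let T = lie_tensor M (extend_sl2 (verma_sl2 \<mu>)) in
     rep_iso UNIV (H_ind V) T \<and> has_unique_simple_quotient UNIV T \<and>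
     rep_iso UNIV (the_simple_quotient UNIV T) (lie_tensor M (extend_sl2 (simple_sl2 \<mu>)))"
proof -
  obtain K where K: "subrep sl2 S.W K" "K \<noteq> carrier S.W"
    "\<And>N. subrep sl2 S.W N \<Longrightarrow> N \<noteq> carrier S.W \<Longrightarrow> N \<subseteq> K"
    using S.maximal by blast
  have "the_simple_quotient sl2 S.W = quot_rep S.W K"
    by (rule unique_simple_quotient(2)[OF S.I.ind_lie sl2_sub K])
  then show ?thesis
    using induced_iso TW.unique_quotient[OF nz K]
    by (simp add: Let_def S.W_eq TW.T_lie_tensor AV.T_Ind)
qed

end

section \<open>Extension of Heisenberg modules by quadratic operators\<close>

locale heis_ext = V: lierep heis V for V :: "(schr, 'v) rep" +
  fixes z :: complex
  assumes z: "z \<noteq> 0" and z_act: "v \<in> carrier V \<Longrightarrow> act V (bas gZ) v = z \<odot>\<^bsub>V\<^esub> v"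
begin

abbreviation "X \<equiv> extend_heis z V"

text \<open>The oscillator representation: the quadratic expressions in \<open>p\<close> and
  \<open>q\<close> realise sl2. The summand 1/2 comes from symmetrising, because
  \<open>-(pq + qp)/(2z) = -pq/z + 1/2\<close>.\<close>

definition "heis_op b v = (case b of
       gE \<Rightarrow> (1 / (2 * z)) \<odot>\<^bsub>V\<^esub> act V (bas gP) (act V (bas gP) v)
     | gF \<Rightarrow> (- 1 / (2 * z)) \<odot>\<^bsub>V\<^esub> act V (bas gQ) (act V (bas gQ) v)
     | gH \<Rightarrow> (- 1 / z) \<odot>\<^bsub>V\<^esub> act V (bas gP) (act V (bas gQ) v) \<oplus>\<^bsub>V\<^esub> (1 / 2) \<odot>\<^bsub>V\<^esub> v
     | _ \<Rightarrow> act V (bas b) v)"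

lemma ext_simps [simp]:
  "carrier X = carrier V" "add X = add V" "zero X = zero V" "smult X = smult V"
  by (simp_all add: extend_heis_def)

lemma ext_cmod: "cmod X"
  by (rule cmod_cong[OF V.cmodM]) simp_all

lemma heis_op_lmap: "lmap X X (heis_op b)"
proof (rule lmapI)
  fix u v assume "u \<in> carrier X" "v \<in> carrier X"
  then show "heis_op b (u \<oplus>\<^bsub>X\<^esub> v) = heis_op b u \<oplus>\<^bsub>X\<^esub> heis_op b v"
    by (cases b; intro V.vec_eqI) (simp_all add: heis_op_def V.act_add cfun_add cfun_smult algebra_simps)
next
  fix c v assume "v \<in> carrier X"
  then show "heis_op b (c \<odot>\<^bsub>X\<^esub> v) = c \<odot>\<^bsub>X\<^esub> heis_op b v"
    by (cases b; intro V.vec_eqI) (simp_all add: heis_op_def V.act_smult cfun_add cfun_smult algebra_simps)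
next
  fix v assume "v \<in> carrier X"
  then show "heis_op b v \<in> carrier X" by (cases b) (simp_all add: heis_op_def)
qed

lemma ext_act: "act X = basis_act X heis_op"
proof -
  have "act X = basis_act V heis_op" by (simp add: extend_heis_def heis_op_def[abs_def])
  then show ?thesis using basis_act_cong[of V X heis_op] by simp
qed

lemma ext_bas: "v \<in> carrier V \<Longrightarrow> act X (bas b) v = heis_op b v"
  unfolding ext_act using basis_act_bas[OF ext_cmod heis_op_lmap] by simp

lemma ext_lie: "lie_module UNIV X"
proof -
  have "lie_module (coordsp UNIV) X"
  proof (rule lie_module_basisI[OF ext_cmod ext_act heis_op_lmap, where \<Xi> = "cfun X"])
    show "u = v" if "u \<in> carrier X" "v \<in> carrier X" "\<And>\<xi>. cfun X \<xi> \<Longrightarrow> \<xi> u = \<xi> v" for u v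
      by (rule cvec.vec_eqI[OF cvecI[OF ext_cmod] that])
    fix a b v \<xi> assume v: "v \<in> carrier X" and "cfun X \<xi>"
    then have \<xi>: "cfun V \<xi>" by (simp add: cfun_def)
    have v': "v \<in> carrier V" using v by simp
    show "\<xi> (heis_op a (heis_op b v)) - \<xi> (heis_op b (heis_op a v)) = (\<Sum>c\<in>UNIV. bracket (bas a) (bas b) $ c * \<xi> (heis_op c v))"
      unfolding sum_gen bracket_coords
      by (cases a; cases b; simp add: heis_op_def bas_nth v' \<xi> V.act_add V.act_smult V.comm_rules z_act
          cfun_add[OF \<xi>] cfun_smult[OF \<xi>]; simp add: z field_simps)
  qed
  then show ?thesis by (simp add: coordsp_UNIV)
qed

end

text \<open>The common setting of parts (b) and (d): as a Heisenberg module \<open>V\<close> is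
  \<open>Y\<close>, while \<open>e\<close> and \<open>h - \<mu>\<close> act on \<open>V\<close> by
  the quadratic expressions of the oscillator representation. The remaining assumptions express that
  \<open>pq\<close> has simple spectrum on the basis \<open>m\<close> and that powers of
  \<open>p\<close> or of \<open>q\<close> connect any two basis vectors.\<close>

locale ext_verma = H: heis_ext Y zdot + AV: age_induced V
  for Y :: "(schr, 'y) rep" and zdot and V :: "(schr, 'v) rep" +
  fixes m :: "'i \<Rightarrow> 'y" and \<beta> :: "'i \<Rightarrow> complex" and \<mu> :: complex and \<theta> :: "'v \<Rightarrow> 'y"
  assumes m: "m i \<in> carrier Y" and inj_\<beta>: "inj \<beta>"
    and pq: "act Y (bas gP) (act Y (bas gQ) (m i)) = \<beta> i \<odot>\<^bsub>Y\<^esub> m i"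
    and span: "u \<in> carrier Y \<Longrightarrow> \<exists>J f. finite J \<and> u = (\<Oplus>\<^bsub>Y\<^esub>i\<in>J. f i \<odot>\<^bsub>Y\<^esub> m i)"
    and trans: "\<exists>c n b. c \<noteq> 0 \<and> b \<in> {gP, gQ} \<and> (act Y (bas b) ^^ n) (m i) = c \<odot>\<^bsub>Y\<^esub> m j"
    and nz: "m i \<noteq> \<zero>\<^bsub>Y\<^esub>"
    and \<theta>: "lmap V Y \<theta>" "bij_betw \<theta> (carrier V) (carrier Y)"
    and \<theta>_act: "\<And>b v. b \<in> heisG \<Longrightarrow> v \<in> carrier V \<Longrightarrow> \<theta> (act V (bas b) v) = act Y (bas b) (\<theta> v)"
    and V_E: "\<And>v. v \<in> carrier V \<Longrightarrow> act V (bas gE) v = (1 / (2 * zdot)) \<odot>\<^bsub>V\<^esub> act V (bas gP) (act V (bas gP) v)"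
    and V_H: "\<And>v. v \<in> carrier V \<Longrightarrow> act V (bas gH) v =
        (- 1 / zdot) \<odot>\<^bsub>V\<^esub> act V (bas gP) (act V (bas gQ) v) \<oplus>\<^bsub>V\<^esub> (\<mu> + 1 / 2) \<odot>\<^bsub>V\<^esub> v"
begin

lemma ext_conclusion:
  "let M = extend_heis zdot Y; T = lie_tensor M (extend_sl2 (verma_sl2 \<mu>)) in
     rep_iso UNIV (H_ind V) T \<and> has_unique_simple_quotient UNIV T \<and>
     rep_iso UNIV (the_simple_quotient UNIV T) (lie_tensor M (extend_sl2 (simple_sl2 \<mu>)))"
proof -
  interpret X: lierep UNIV H.X by (rule lierepI[OF H.ext_lie])
  interpret S: sl2_verma \<mu> .
  have b: "act H.X (bas b) v = act Y (bas b) v" if "b \<in> heisG" "v \<in> carrier Y" for b v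
    using that by (auto simp: H.ext_bas H.heis_op_def)
  have \<theta>c: "\<theta> v \<in> carrier Y" if "v \<in> carrier V" for v by (rule lmap_closed[OF \<theta>(1) that])
  have fs: "finsum H.X f J = finsum Y f J" for f :: "'i \<Rightarrow> 'y" and J
    by (simp add: finsum_def finprod_def)
  interpret TV: twist_verma \<mu> H.X m \<beta> V \<theta>
  proof unfold_locales
    show "m i \<in> carrier H.X" for i by (simp add: m)
    show "inj \<beta>" by (rule inj_\<beta>)
    show "act H.X (bas gP) (act H.X (bas gQ) (m i)) = \<beta> i \<odot>\<^bsub>H.X\<^esub> m i" for i
      using pq[of i] m by (simp add: b)
    show "\<exists>J f. finite J \<and> u = (\<Oplus>\<^bsub>H.X\<^esub>i\<in>J. f i \<odot>\<^bsub>H.X\<^esub> m i)" if "u \<in> carrier H.X" for u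
      using span[of u] that by (simp add: fs)
    show "\<exists>c xs. c \<noteq> 0 \<and> set xs \<subseteq> {bas gP, bas gQ} \<and> foldr (act H.X) xs (m i) = c \<odot>\<^bsub>H.X\<^esub> m j" for i j
    proof -
      obtain c n d where *: "c \<noteq> 0" "d \<in> {gP, gQ}" "(act Y (bas d) ^^ n) (m i) = c \<odot>\<^bsub>Y\<^esub> m j"
        using trans[of i j] by blast
      then have d: "d \<in> heisG" "bas d \<in> heis" by auto
      have "foldr (act H.X) (replicate n (bas d)) (m i) = (act Y (bas d) ^^ n) (m i) \<and> (act Y (bas d) ^^ n) (m i) \<in> carrier Y" for n
        using d by (induction n) (simp_all add: m b)
      then show ?thesis using * by (intro exI[of _ c] exI[of _ "replicate n (bas d)"]) auto
    qed
    show "lmap V H.X \<theta>" using \<theta>(1) by (simp add: lmap_def)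
    show "bij_betw \<theta> (carrier V) (carrier H.X)" using \<theta>(2) by simp
    fix d v assume v: "v \<in> carrier V"
    show "\<theta> (act V (bas gH) v) = act H.X (bas gH) (\<theta> v) \<oplus>\<^bsub>H.X\<^esub> \<mu> \<odot>\<^bsub>H.X\<^esub> \<theta> v"
      using v \<theta>c by (simp add: H.ext_bas H.heis_op_def V_H lmap_add[OF \<theta>(1)] lmap_smult[OF \<theta>(1)] \<theta>_act)
        (intro H.V.vec_eqI; simp add: cfun_add cfun_smult algebra_simps)
    assume "d \<in> {gE, gP, gQ, gZ}"
    then show "\<theta> (act V (bas d) v) = act H.X (bas d) (\<theta> v)"
      using v \<theta>c by (auto simp: H.ext_bas H.heis_op_def V_E lmap_smult[OF \<theta>(1)] \<theta>_act)
  qed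
  show ?thesis using TV.conclusion[of undefined] nz by (simp add: Let_def)
qed

end

section \<open>Modules given by operators on a basis\<close>

lemma finsum_sum:
  assumes "cmod M" "carrier M = UNIV" "add M = (+)" "zero M = (0 :: 'a :: comm_monoid_add)"
  shows "finsum M f J = sum f J"
proof -
  interpret cvec M by (rule cvecI[OF assms(1)])
  show ?thesis
    by (induction J rule: infinite_finite_induct) (simp_all add: assms finsum_infinite)
qed

definition pm_rep :: "(gen \<Rightarrow> 'k \<Rightarrow> ('k \<Rightarrow>\<^sub>0 complex)) \<Rightarrow> (schr, 'k \<Rightarrow>\<^sub>0 complex) rep" where
  "pm_rep g = (let X = \<lparr>carrier = UNIV, mult = undefined, one = undefined, zero = 0, add = (+), smult = scale,
     act = undefined\<rparr> in X\<lparr>act := basis_act X (\<lambda>b. lin_ext (g b))\<rparr>)"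

locale pm =
  fixes X :: "(schr, 'k \<Rightarrow>\<^sub>0 complex) rep" and g :: "gen \<Rightarrow> 'k \<Rightarrow> ('k \<Rightarrow>\<^sub>0 complex)"
  assumes car [simp]: "carrier X = UNIV" "add X = (+)" "zero X = 0" "smult X = scale"
    and act: "act X = basis_act X (\<lambda>b. lin_ext (g b))"
begin

lemma cmodX: "cmod X"
  by (rule cmodI) (simp_all add: scale_distrib algebra_simps)

lemma op_lmap: "lmap X X (lin_ext (g b))"
  by (simp add: lmap_def lin_ext_add lin_ext_scale)

lemma act_bas [simp]: "act X (bas b) y = lin_ext (g b) y"
  unfolding act by (rule basis_act_bas[OF cmodX op_lmap]) simp

text \<open>Coordinates serve as test functionals, since the coordinates of an image are given by
  explicit formulas.\<close>

lemma lieI: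
  assumes "\<And>a b y k. a \<in> A \<Longrightarrow> b \<in> A \<Longrightarrow>
      Poly_Mapping.lookup (lin_ext (g a) (lin_ext (g b) y)) k - Poly_Mapping.lookup (lin_ext (g b) (lin_ext (g a) y)) k =
      (\<Sum>c\<in>UNIV. bracket (bas a) (bas b) $ c * Poly_Mapping.lookup (lin_ext (g c) y) k)"
  shows "lie_module (coordsp A) X"
  by (rule lie_module_basisI[OF cmodX act op_lmap, where \<Xi> = "\<lambda>\<xi>. \<exists>k. \<xi> = (\<lambda>y. Poly_Mapping.lookup y k)"])
    (use assms in \<open>auto simp: cfun_def lookup_add intro!: poly_mapping_eqI\<close>)

end

interpretation laurent_pm: pm "laurent_rep g" g for g
proof -
  have "basis_act laurent (\<lambda>b. lin_ext (g b)) = basis_act (laurent_rep g) (\<lambda>b. lin_ext (g b))"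
    by (auto simp: fun_eq_iff basis_act_def finsum_def finprod_def laurent_rep_def laurent_def module.extend_def)
  then show "pm (laurent_rep g) g"
    by unfold_locales (simp_all add: laurent_rep_def laurent_def module.extend_def)
qed

interpretation pm_pm: pm "pm_rep g" g for g
proof -
  let ?X = "\<lparr>carrier = UNIV, mult = undefined, one = undefined, zero = 0, add = (+), smult = scale,
     act = undefined\<rparr>"
  have "basis_act ?X (\<lambda>b. lin_ext (g b)) = basis_act (pm_rep g) (\<lambda>b. lin_ext (g b))"
    by (rule basis_act_cong) (simp_all add: pm_rep_def Let_def)
  then show "pm (pm_rep g) g"
    by unfold_locales (simp_all add: pm_rep_def Let_def)
qed

lemma lookup_lin_ext_shift:
  assumes "\<And>i. g i = scale (c i) (mon (i + s))"
  shows "Poly_Mapping.lookup (lin_ext g y) k = c (k - s) * Poly_Mapping.lookup y (k - s)"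
proof -
  have "Poly_Mapping.keys y \<subseteq> UNIV" by simp
  then show ?thesis
  proof (induction y rule: pm_induct)
    case (add i d y)
    then show ?case by (auto simp: lin_ext_add lookup_add lookup_single when_def assms algebra_simps)
  qed simp
qed

definition G_op where
  "G_op zdot lam b i = (case b of
       gQ \<Rightarrow> mon (i + 1)
     | gP \<Rightarrow> scale (zdot * (lam + of_int i)) (mon (i - 1))
     | gZ \<Rightarrow> scale zdot (mon i)
     | _ \<Rightarrow> 0)"

lemma G_heis_op: "G_heis zdot lam = laurent_rep (G_op zdot lam)"
  by (simp add: G_heis_def G_op_def[abs_def])

lemma lookup_G:
  "Poly_Mapping.lookup (lin_ext (G_op zdot lam gQ) y) k = Poly_Mapping.lookup y (k - 1)"
  "Poly_Mapping.lookup (lin_ext (G_op zdot lam gP) y) k = zdot * (lam + of_int k + 1) * Poly_Mapping.lookup y (k + 1)"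
  "Poly_Mapping.lookup (lin_ext (G_op zdot lam gZ) y) k = zdot * Poly_Mapping.lookup y k"
  subgoal by (subst lookup_lin_ext_shift[where s = 1 and c = "\<lambda>_. 1"]) (simp_all add: G_op_def)
  subgoal by (subst lookup_lin_ext_shift[where s = "-1" and c = "\<lambda>i. zdot * (lam + of_int i)"])
    (simp_all add: G_op_def add.assoc)
  subgoal by (subst lookup_lin_ext_shift[where s = 0 and c = "\<lambda>_. zdot"]) (simp_all add: G_op_def)
  done

lemma G_lie: "lie_module heis (G_heis zdot lam)"
  unfolding heis_coordsp G_heis_op
  by (rule laurent_pm.lieI)
    (auto simp: lookup_G sum_gen bracket_coords bas_nth algebra_simps)

definition Q'_op where
  "Q'_op zdot hdot lam b i = (case b of
       gQ \<Rightarrow> mon (i + 1)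
     | gP \<Rightarrow> scale (zdot * (lam + of_int i)) (mon (i - 1))
     | gZ \<Rightarrow> scale zdot (mon i)
     | gH \<Rightarrow> scale (hdot - of_int i) (mon i)
     | gE \<Rightarrow> scale (zdot / 2 * (lam + of_int i) * (lam + of_int i - 1)) (mon (i - 2))
     | gF \<Rightarrow> 0)"

lemma Q'_age1_op: "Q'_age1 zdot hdot lam = laurent_rep (Q'_op zdot hdot lam)"
  by (simp add: Q'_age1_def Q'_op_def[abs_def])

lemma Q'_G: "b \<in> heisG \<Longrightarrow> Q'_op zdot hdot lam b = G_op zdot lam b"
  by (auto simp: Q'_op_def G_op_def fun_eq_iff)

lemma lookup_Q':
  "Poly_Mapping.lookup (lin_ext (Q'_op zdot hdot lam gH) y) k = (hdot - of_int k) * Poly_Mapping.lookup y k"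
  "Poly_Mapping.lookup (lin_ext (Q'_op zdot hdot lam gE) y) k =
    zdot / 2 * (lam + of_int k + 2) * (lam + of_int k + 1) * Poly_Mapping.lookup y (k + 2)"
  subgoal by (subst lookup_lin_ext_shift[where s = 0 and c = "\<lambda>i. hdot - of_int i"]) (simp_all add: Q'_op_def)
  subgoal by (subst lookup_lin_ext_shift[where s = "-2" and c = "\<lambda>i. zdot / 2 * (lam + of_int i) * (lam + of_int i - 1)"])
    (simp_all add: Q'_op_def algebra_simps)
  done

theorem induced_Q'_decomposition:
  assumes V: "lie_module age1 V" and z: "zdot \<noteq> 0" and lam: "lam \<notin> \<int>" and iso: "rep_iso age1 V (Q'_age1 zdot hdot lam)"
  shows "let M = extend_heis zdot (G_heis zdot lam); T = lie_tensor M (extend_sl2 (verma_sl2 (lam + hdot + 1 / 2)))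
         in rep_iso UNIV (H_ind V) T \<and> has_unique_simple_quotient UNIV T \<and>
            rep_iso UNIV (the_simple_quotient UNIV T) (lie_tensor M (extend_sl2 (simple_sl2 (lam + hdot + 1 / 2))))"
proof -
  let ?G = "G_heis zdot lam" and ?Q = "Q'_age1 zdot hdot lam"
  obtain \<theta> where \<theta>: "rhom age1 V ?Q \<theta>" "bij_betw \<theta> (carrier V) (carrier ?Q)"
    using iso by (auto simp: rep_iso_iff)
  interpret AV: age_induced V by unfold_locales (rule V)
  have act: "\<theta> (act V (bas b) v) = lin_ext (Q'_op zdot hdot lam b) (\<theta> v)" if "b \<in> ageG" "v \<in> carrier V" for b v
    using rhom_act[OF \<theta>(1), of "bas b" v] that by (auto simp: Q'_age1_op age1_coordsp)
  have inj: "u = v" if "u \<in> carrier V" "v \<in> carrier V" "\<theta> u = \<theta> v" for u v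
    using that \<theta>(2) by (auto simp: bij_betw_def inj_on_def)
  \<comment> \<open>As \<open>lam\<close> is not an integer, \<open>p\<close> kills no monomial;
    thus \<open>q\<close> moves up and \<open>p\<close> moves down between any two of them.\<close>
  have l0: "lam + of_int i \<noteq> 0" for i :: int
    using lam by (metis Ints_minus Ints_of_int add_eq_0_iff add.commute minus_minus)
  \<comment> \<open>\<open>pq\<close> multiplies the monomial of degree \<open>i\<close> by
    \<open>zdot (lam + i + 1)\<close>. Comparing \<open>hdot - i\<close> with
    \<open>-(lam + i + 1) + \<mu> + 1/2\<close> gives the parameter
    \<open>\<mu> = lam + hdot + 1/2\<close>.\<close>
  interpret ext_verma ?G zdot V mon "\<lambda>i. zdot * (lam + of_int i + 1)" "lam + hdot + 1 / 2" \<theta>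
  proof unfold_locales
    show "lie_module heis ?G" by (rule G_lie)
    show "act ?G (bas gZ) v = zdot \<odot>\<^bsub>?G\<^esub> v" for v
      by (auto simp: G_heis_op lookup_G intro!: poly_mapping_eqI)
    show "act ?G (bas gP) (act ?G (bas gQ) (mon i)) = (zdot * (lam + of_int i + 1)) \<odot>\<^bsub>?G\<^esub> mon i" for i
      by (simp add: G_heis_op G_op_def add.assoc)
    show "\<exists>J f. finite J \<and> u = (\<Oplus>\<^bsub>?G\<^esub>i\<in>J. f i \<odot>\<^bsub>?G\<^esub> mon i)" for u
    proof -
      have fs: "finsum ?G f J = sum f J" for f J
        unfolding G_heis_op by (rule finsum_sum[OF laurent_pm.cmodX]) simp_all
      have "u = (\<Sum>i\<in>Poly_Mapping.keys u. scale (Poly_Mapping.lookup u i) (mon i))"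
        by (rule poly_mapping_eqI) (simp add: lookup_sum lookup_single when_def not_in_keys_iff_lookup_eq_zero)
      then show ?thesis unfolding fs by (intro exI conjI) (auto simp: G_heis_op)
    qed
    show "\<exists>c n b. c \<noteq> 0 \<and> b \<in> {gP, gQ} \<and> (act ?G (bas b) ^^ n) (mon i) = c \<odot>\<^bsub>?G\<^esub> mon j" for i j
    proof -
      have aG: "act ?G (bas b) = lin_ext (G_op zdot lam b)" for b by (rule ext) (simp add: G_heis_op)
      have sG: "smult ?G = scale" by (simp add: G_heis_op)
      show ?thesis
        unfolding aG sG
      proof (cases "i \<le> j")
        case True
        have "(lin_ext (G_op zdot lam gQ) ^^ n) (mon i) = mon (i + int n)" for n
          by (induction n) (simp_all add: G_op_def algebra_simps)
        from this[of "nat (j - i)"] show "\<exists>c n b. c \<noteq> 0 \<and> b \<in> {gP, gQ} \<and> (lin_ext (G_op zdot lam b) ^^ n) (mon i) = scale c (mon j)"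
          using True by (intro exI[of _ 1] exI[of _ "nat (j - i)"] exI[of _ gQ]) simp
      next
        case False
        have "\<exists>c. c \<noteq> 0 \<and> (lin_ext (G_op zdot lam gP) ^^ n) (mon i) = scale c (mon (i - int n))" for n
        proof (induction n)
          case (Suc n)
          then obtain c where c: "c \<noteq> 0" "(lin_ext (G_op zdot lam gP) ^^ n) (mon i) = scale c (mon (i - int n))" by blast
          let ?d = "c * (zdot * (lam + of_int (i - int n)))"
          have "(lin_ext (G_op zdot lam gP) ^^ Suc n) (mon i) = scale ?d (mon (i - int (Suc n)))"
            by (simp only: funpow.simps o_apply c(2)) (simp add: G_op_def algebra_simps)
          moreover have "?d \<noteq> 0" using c(1) z l0[of "i - int n"] by simp
          ultimately show ?case by blast
        qed (auto intro: exI[of _ 1])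
        from this[of "nat (i - j)"] obtain c where "c \<noteq> 0" "(lin_ext (G_op zdot lam gP) ^^ nat (i - j)) (mon i) = scale c (mon j)"
          using False by auto
        then show "\<exists>c n b. c \<noteq> 0 \<and> b \<in> {gP, gQ} \<and> (lin_ext (G_op zdot lam b) ^^ n) (mon i) = scale c (mon j)"
          by (intro exI[of _ c] exI[of _ "nat (i - j)"] exI[of _ gP]) simp
      qed
    qed
    have "mon i \<noteq> 0" for i by (metis lookup_single_eq lookup_zero zero_neq_one)
    then show "mon i \<noteq> \<zero>\<^bsub>?G\<^esub>" for i by (simp add: G_heis_op)
    show "lmap V ?G \<theta>" using rhom_lmap[OF \<theta>(1)] by (simp add: lmap_def Q'_age1_op G_heis_op)
    show "bij_betw \<theta> (carrier V) (carrier ?G)" using \<theta>(2) by (simp add: Q'_age1_op G_heis_op)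
    fix b v assume v: "v \<in> carrier V"
    show "\<theta> (act V (bas b) v) = act ?G (bas b) (\<theta> v)" if "b \<in> heisG"
      using act[of b v] that v Q'_G[OF that] by (auto simp: G_heis_op)
    note h = rhom_add[OF \<theta>(1)] rhom_smult[OF \<theta>(1)]
    show "act V (bas gE) v = (1 / (2 * zdot)) \<odot>\<^bsub>V\<^esub> act V (bas gP) (act V (bas gP) v)"
      by (rule inj) (use v z in \<open>auto simp: h act Q'_G Q'_age1_op lookup_Q' lookup_G field_simps intro!: poly_mapping_eqI\<close>)
    show "act V (bas gH) v = (- 1 / zdot) \<odot>\<^bsub>V\<^esub> act V (bas gP) (act V (bas gQ) v) \<oplus>\<^bsub>V\<^esub> (lam + hdot + 1 / 2 + 1 / 2) \<odot>\<^bsub>V\<^esub> v"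
      by (rule inj) (use v z in \<open>auto simp: h act Q'_G Q'_age1_op lookup_Q' lookup_G lookup_add field_simps intro!: poly_mapping_eqI\<close>)
  qed (use z in \<open>auto simp: G_heis_op inj_def\<close>)
  show ?thesis using ext_conclusion by simp
qed

section \<open>Fock modules\<close>

text \<open>Polynomials in \<open>p\<close> applied to a lowest weight vector: the basis element of
  index \<open>i\<close> is \<open>p^i w\<close>, \<open>q\<close> acts as \<open>-z\<close> times
  the derivative with respect to \<open>p\<close>, and \<open>e\<close> as \<open>p^2/(2z)\<close>.
  For \<open>i = 0\<close> the truncated index \<open>i - 1\<close> is harmless, because the
  coefficient is zero.\<close>

definition fock_op where
  "fock_op z hdot b i = (case b of
       gP \<Rightarrow> Poly_Mapping.single (Suc i) 1
     | gQ \<Rightarrow> Poly_Mapping.single (i - 1) (- z * of_nat i)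
     | gZ \<Rightarrow> Poly_Mapping.single i z
     | gH \<Rightarrow> Poly_Mapping.single i (hdot + of_nat i)
     | gE \<Rightarrow> Poly_Mapping.single (Suc (Suc i)) (1 / (2 * z))
     | gF \<Rightarrow> 0)"

abbreviation fock :: "complex \<Rightarrow> complex \<Rightarrow> (schr, nat \<Rightarrow>\<^sub>0 complex) rep" where
  "fock z hdot \<equiv> pm_rep (fock_op z hdot)"

lemma lookup_fock:
  "Poly_Mapping.lookup (lin_ext (fock_op z hdot gP) y) k = (case k of 0 \<Rightarrow> 0 | Suc j \<Rightarrow> Poly_Mapping.lookup y j)"
  "Poly_Mapping.lookup (lin_ext (fock_op z hdot gQ) y) k = - z * of_nat (Suc k) * Poly_Mapping.lookup y (Suc k)"
  "Poly_Mapping.lookup (lin_ext (fock_op z hdot gZ) y) k = z * Poly_Mapping.lookup y k"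
  "Poly_Mapping.lookup (lin_ext (fock_op z hdot gH) y) k = (hdot + of_nat k) * Poly_Mapping.lookup y k"
  "Poly_Mapping.lookup (lin_ext (fock_op z hdot gE) y) k =
     (case k of 0 \<Rightarrow> 0 | Suc j \<Rightarrow> (case j of 0 \<Rightarrow> 0 | Suc i \<Rightarrow> 1 / (2 * z) * Poly_Mapping.lookup y i))"
proof -
  have k: "Poly_Mapping.keys y \<subseteq> UNIV" by simp
  show "Poly_Mapping.lookup (lin_ext (fock_op z hdot gP) y) k = (case k of 0 \<Rightarrow> 0 | Suc j \<Rightarrow> Poly_Mapping.lookup y j)"
    using k by (induction y rule: pm_induct)
      (auto simp: lin_ext_add lookup_add lookup_single when_def fock_op_def algebra_simps split: nat.splits)
  show "Poly_Mapping.lookup (lin_ext (fock_op z hdot gQ) y) k = - z * of_nat (Suc k) * Poly_Mapping.lookup y (Suc k)"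
    using k
  proof (induction y rule: pm_induct)
    case (add i c y)
    then show ?case
      by (cases i) (auto simp: lin_ext_add lookup_add lookup_single when_def fock_op_def algebra_simps)
  qed simp
  show "Poly_Mapping.lookup (lin_ext (fock_op z hdot gZ) y) k = z * Poly_Mapping.lookup y k"
    using k by (induction y rule: pm_induct)
      (auto simp: lin_ext_add lookup_add lookup_single when_def fock_op_def algebra_simps)
  show "Poly_Mapping.lookup (lin_ext (fock_op z hdot gH) y) k = (hdot + of_nat k) * Poly_Mapping.lookup y k"
    using k by (induction y rule: pm_induct)
      (auto simp: lin_ext_add lookup_add lookup_single when_def fock_op_def algebra_simps)
  show "Poly_Mapping.lookup (lin_ext (fock_op z hdot gE) y) k =
     (case k of 0 \<Rightarrow> 0 | Suc j \<Rightarrow> (case j of 0 \<Rightarrow> 0 | Suc i \<Rightarrow> 1 / (2 * z) * Poly_Mapping.lookup y i))"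
    using k by (induction y rule: pm_induct)
      (auto simp: lin_ext_add lookup_add lookup_single when_def fock_op_def add_divide_distrib split: nat.splits)
qed

lemma fock_lie: "z \<noteq> 0 \<Longrightarrow> lie_module age1 (fock z hdot)"
  unfolding age1_coordsp
  by (rule pm_pm.lieI)
    (auto simp: lookup_fock sum_gen bracket_coords bas_nth field_simps split: nat.splits)

text \<open>Repeated application of \<open>q\<close> lowers a nonzero polynomial to a nonzero
  constant, from which \<open>p\<close> produces all monomials.\<close>

lemma fock_simple:
  assumes z: "z \<noteq> 0" and N: "submodule N \<CC> (fock z hdot)" and y: "y \<in> N" "y \<noteq> 0"
    and cl: "\<And>y. y \<in> N \<Longrightarrow> lin_ext (fock_op z hdot gP) y \<in> N" "\<And>y. y \<in> N \<Longrightarrow> lin_ext (fock_op z hdot gQ) y \<in> N"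
  shows "N = UNIV"
proof -
  interpret cvec "fock z hdot" by (rule cvecI[OF pm_pm.cmodX])
  note D = submoduleD[OF N]
  have D': "0 \<in> N" "\<And>u v. u \<in> N \<Longrightarrow> v \<in> N \<Longrightarrow> u + v \<in> N" "\<And>c v. v \<in> N \<Longrightarrow> scale c v \<in> N"
    using D(3) D(4) D(5) by simp_all
  have one: "Poly_Mapping.single 0 1 \<in> N" if "y \<in> N" "y \<noteq> 0" "\<forall>k\<ge>n. Poly_Mapping.lookup y k = 0" for y n
    using that
  proof (induction n arbitrary: y)
    case 0
    then have "y = 0" by (intro poly_mapping_eqI) simp
    then show ?case using 0 by simp
  next
    case (Suc n)
    show ?case
    proof (cases "Poly_Mapping.lookup y n = 0")
      case True
      then show ?thesis using Suc by (metis Suc_leI le_neq_implies_less)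
    next
      case False
      show ?thesis
      proof (cases n)
        case 0
        have "scale (inverse (Poly_Mapping.lookup y 0)) y = Poly_Mapping.single 0 1"
          using Suc.prems False 0 by (intro poly_mapping_eqI) (auto simp: lookup_one when_def Suc_le_eq)
        then show ?thesis using D'(3)[OF Suc.prems(1)] by metis
      next
        case (Suc j)
        let ?q = "lin_ext (fock_op z hdot gQ) y"
        have "Poly_Mapping.lookup ?q j \<noteq> 0" using False Suc z by (simp add: lookup_fock del: of_nat_Suc)
        then have "?q \<noteq> 0" by auto
        then show ?thesis using Suc.IH[OF cl(2)[OF Suc.prems(1)]] Suc.prems(3) by (simp add: lookup_fock)
      qed
    qed
  qed
  have "\<exists>n. \<forall>k\<ge>n. Poly_Mapping.lookup y k = 0"
  proof (cases "Poly_Mapping.keys y = {}")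
    case False
    then show ?thesis
      by (intro exI[of _ "Suc (Max (Poly_Mapping.keys y))"])
        (metis Max_ge finite_keys not_in_keys_iff_lookup_eq_zero not_less_eq_eq)
  qed simp
  then have 0: "Poly_Mapping.single 0 1 \<in> N" using one y by blast
  have s: "Poly_Mapping.single k 1 \<in> N" for k
  proof (induction k)
    case (Suc k)
    from cl(1)[OF this] show ?case by (simp add: fock_op_def)
  qed (rule 0)
  have "y \<in> N" for y
  proof -
    have "Poly_Mapping.keys y \<subseteq> UNIV" by simp
    then show ?thesis
    proof (induction y rule: pm_induct)
      case (add k c y)
      have "scale c (Poly_Mapping.single k 1) \<in> N" by (rule D'(3)[OF s])
      then show ?case using D'(2) add by simp
    qed (rule D'(1))
  qed
  then show ?thesis by blast
qed

lemma kernel_simple_quotient: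
  assumes M: "lie_module L M" and X: "lie_module L X" and L: "lie_sub L"
    and \<phi>: "rhom L M X \<phi>" "\<phi> ` carrier M = carrier X"
    and simple: "\<And>N. subrep L X N \<Longrightarrow> N = {\<zero>\<^bsub>X\<^esub>} \<or> N = carrier X" and nz: "carrier X \<noteq> {\<zero>\<^bsub>X\<^esub>}"
  shows "simple_quotient L M {v \<in> carrier M. \<phi> v = \<zero>\<^bsub>X\<^esub>}"
  unfolding simple_quotient_iff[OF M L]
proof (intro conjI allI impI)
  interpret M: lierep L M by (rule lierepI[OF M])
  interpret X: lierep L X by (rule lierepI[OF X])
  let ?K = "{v \<in> carrier M. \<phi> v = \<zero>\<^bsub>X\<^esub>}"
  show "subrep L M ?K" by (rule kernel_subrep0[OF M X \<phi>(1)])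
  show "?K \<noteq> carrier M"
  proof
    assume "?K = carrier M"
    then have "\<phi> ` carrier M \<subseteq> {\<zero>\<^bsub>X\<^esub>}" by auto
    then have "carrier X \<subseteq> {\<zero>\<^bsub>X\<^esub>}" by (simp only: \<phi>(2))
    then show False using nz X.zero_closed by (metis equalityI empty_subsetI insert_subset)
  qed
  fix N assume N: "subrep L M N" "?K \<subseteq> N"
  note D = M.submoduleD[OF subrep_submodule[OF N(1)]]
  from simple[OF image_subrep[OF M X \<phi>(1) N(1)]] show "N = ?K \<or> N = carrier M"
  proof
    assume "\<phi> ` N = {\<zero>\<^bsub>X\<^esub>}"
    then have "N \<subseteq> ?K" using D(1) by auto
    then show ?thesis using N(2) by auto
  next
    assume im: "\<phi> ` N = carrier X"
    have "v \<in> N" if v: "v \<in> carrier M" for v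
    proof -
      have "\<phi> v \<in> \<phi> ` N" unfolding im by (rule rhom_closed[OF \<phi>(1) v])
      then obtain n where n: "n \<in> N" "\<phi> v = \<phi> n" by auto
      have nc: "n \<in> carrier M" by (rule D(2)[OF n(1)])
      have "\<phi> (v \<ominus>\<^bsub>M\<^esub> n) = \<zero>\<^bsub>X\<^esub>"
        using v nc n(2) rhom_closed[OF \<phi>(1) nc]
        by (simp add: M.diff_smult rhom_add[OF \<phi>(1)] rhom_smult[OF \<phi>(1)] X.add_minus_smult)
      then have "v \<ominus>\<^bsub>M\<^esub> n \<in> N" using N(2) v nc by auto
      from D(4)[OF this n(1)] have "(v \<ominus>\<^bsub>M\<^esub> n) \<oplus>\<^bsub>M\<^esub> n \<in> N" .
      moreover have "(v \<ominus>\<^bsub>M\<^esub> n) \<oplus>\<^bsub>M\<^esub> n = v" using v nc by (intro M.vec_eqI) (simp_all add: cfun_add)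
      ultimately show ?thesis by simp
    qed
    then show ?thesis using D(1) by auto
  qed
qed

text \<open>Covers the lowest weight Verma modules of the ageing algebra and of the Heisenberg
  algebra; both are induced from the part of \<open>A\<close> without \<open>p\<close> and
  \<open>e\<close>, and both map onto the Fock module. In the Heisenberg case the coordinate at
  \<open>h\<close> is zero, so \<open>hdot\<close> can be chosen freely.\<close>

locale low_weight =
  fixes L :: "schr set" and A B :: "gen set" and zdot hdot :: complex and \<theta> :: "schr \<Rightarrow> complex"
  assumes zdot: "zdot \<noteq> 0" and L: "L = coordsp A" "lie_sub L" and A: "A \<subseteq> ageG" "gP \<in> A" "gQ \<in> A"
    and B: "B = A - {gP, gE}" "lie_sub (coordsp B)"
    and \<theta>: "\<And>x. x \<in> coordsp B \<Longrightarrow> \<theta> x = x $ gH * hdot + x $ gZ * zdot" "lie_module (coordsp B) (one_dim \<theta>)"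
begin

sublocale I: induced L "coordsp B" "one_dim \<theta>"
proof unfold_locales
  show "coordsp B \<subseteq> L" unfolding L(1) by (rule coordsp_mono) (use B in auto)
qed (use L B \<theta> in simp_all)

abbreviation "W \<equiv> I.T"

sublocale W: lierep L W by (rule lierepI[OF I.ind_lie])

definition "w = I.\<iota> 1"

lemma w_closed [simp]: "w \<in> carrier W"
  unfolding w_def by (rule I.iota_closed) simp

lemma iota_w: "I.\<iota> c = c \<odot>\<^bsub>W\<^esub> w"
  using rhom_smult[OF I.iota_rhom, of 1 c] by (simp add: w_def)

lemma w_act: "b \<in> B \<Longrightarrow> act W (bas b) w = (if b = gH then hdot else if b = gZ then zdot else 0) \<odot>\<^bsub>W\<^esub> w"
proof -
  assume b: "b \<in> B"
  have "I.\<iota> (act (one_dim \<theta>) (bas b) 1) = act W (bas b) w"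
    unfolding w_def by (rule rhom_act[OF I.iota_rhom]) (use b in auto)
  then show ?thesis using b \<theta>(1)[of "bas b"] by (cases b) (auto simp: iota_w bas_nth)
qed

lemma w_generates: "subrep L W N \<Longrightarrow> w \<in> N \<Longrightarrow> N = carrier W"
  by (rule I.ind_generated) (auto simp: iota_w I.T.submoduleD(5)[OF subrep_submodule])

sublocale G: graded_cyclic A W "-1" w
proof (unfold_locales, unfold L(1)[symmetric])
  show "act W (bas b) w = \<zero>\<^bsub>W\<^esub>" if "b \<in> A" "- 1 * shift b < 0" for b
  proof -
    have "b = gQ" using that A by (auto simp: shift_def)
    moreover have "gQ \<in> B" using A B(1) by auto
    ultimately show ?thesis using w_act[of gQ] by simp
  qed
  show "\<exists>c. act W (bas b) w = c \<odot>\<^bsub>W\<^esub> w" if "b \<in> A" "shift b = 0" for b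
  proof -
    have "b \<in> B" using that by (auto simp: B shift_def)
    then show ?thesis using w_act[of b] by (rule_tac exI)
  qed
qed (use I.ind_lie w_generates L(2) in simp_all)

lemma L_age: "L \<subseteq> age1"
  unfolding L(1) age1_coordsp by (rule coordsp_mono[OF A(1)])

lemma fock_L: "lie_module L (fock zdot hdot)"
  by (rule lie_module_mono[OF fock_lie[OF zdot] L_age])

lemma fock_subrep: "subrep L (fock zdot hdot) N \<Longrightarrow> N = {0} \<or> N = UNIV"
proof -
  assume N: "subrep L (fock zdot hdot) N"
  interpret F: lierep L "fock zdot hdot" by (rule lierepI[OF fock_L])
  have 0: "0 \<in> N" using F.submoduleD(3)[OF subrep_submodule[OF N]] by simp
  show ?thesis
  proof (cases "N = {0}")
    case False
    then obtain y where "y \<in> N" "y \<noteq> 0" using 0 by blast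
    then have "N = UNIV"
      using F.subrep_act[OF N, of "bas gP"] F.subrep_act[OF N, of "bas gQ"] A L(1)
      by (intro fock_simple[OF zdot subrep_submodule[OF N]]) auto
    then show ?thesis by simp
  qed simp
qed

lemma fock_map:
  obtains \<phi> where "rhom L W (fock zdot hdot) \<phi>" "\<phi> w = Poly_Mapping.single 0 1" "\<phi> ` carrier W = UNIV"
proof -
  have "rhom (coordsp B) (one_dim \<theta>) (fock zdot hdot) (Poly_Mapping.single 0)"
  proof (rule rhom_basisI[OF \<theta>(2)])
    show "lie_module (coordsp B) (fock zdot hdot)"
      by (rule lie_module_mono[OF fock_L]) (simp add: L(1) B coordsp_mono)
    show "lmap (one_dim \<theta>) (fock zdot hdot) (Poly_Mapping.single 0)" by (simp add: lmap_def single_add)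
    fix b c assume b: "b \<in> B"
    then have "b \<in> {gH, gQ, gZ}" using A B by auto
    then show "Poly_Mapping.single 0 (act (one_dim \<theta>) (bas b) c) = act (fock zdot hdot) (bas b) (Poly_Mapping.single 0 c)"
      using \<theta>(1)[of "bas b"] b by (auto simp: fock_op_def bas_nth mult.commute)
  qed
  then show thesis
  proof (rule I.ind_universal[OF fock_L])
    fix \<phi> assume \<phi>: "rhom L W (fock zdot hdot) \<phi>" and i: "\<And>v. v \<in> carrier (one_dim \<theta>) \<Longrightarrow> \<phi> (I.\<iota> v) = Poly_Mapping.single 0 v"
    have w: "\<phi> w = Poly_Mapping.single 0 1" using i[of 1] by (simp add: w_def)
    have "\<phi> w \<in> \<phi> ` carrier W" by simp
    have "\<phi> ` carrier W \<noteq> {0}"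
    proof
      assume "\<phi> ` carrier W = {0}"
      with \<open>\<phi> w \<in> \<phi> ` carrier W\<close> have "\<phi> w = 0" by simp
      then show False using w by simp
    qed
    moreover have "subrep L (fock zdot hdot) (\<phi> ` carrier W)"
      by (rule image_subrep[OF I.ind_lie fock_L \<phi> W.subrep_carrier])
    ultimately have "\<phi> ` carrier W = UNIV" by (metis fock_subrep)
    then show thesis by (rule that[OF \<phi> w])
  qed
qed

lemma w_nonzero: "w \<noteq> \<zero>\<^bsub>W\<^esub>"
proof (rule fock_map)
  fix \<phi> assume \<phi>: "rhom L W (fock zdot hdot) \<phi>" "\<phi> w = Poly_Mapping.single 0 1"
  show ?thesis
  proof
    assume "w = \<zero>\<^bsub>W\<^esub>"
    then have "Poly_Mapping.single 0 1 = (0 :: nat \<Rightarrow>\<^sub>0 complex)"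
      using \<phi>(2) lmap_zero[OF I.cT pm_pm.cmodX rhom_lmap[OF \<phi>(1)]] by simp
    then show False by simp
  qed
qed

end

text \<open>The kernel of the map from the Verma module onto the simple Fock module is a maximal
  submodule, hence the one defining the unique simple quotient.\<close>

lemma lowest_simple_fock:
  assumes z: "zdot \<noteq> 0"
  shows "rep_iso age1 (lowest_simple_age1 zdot hdot) (fock zdot hdot)"
proof -
  define \<theta> where "\<theta> = (\<lambda>x::schr. x $ gH * hdot + x $ gZ * zdot)"
  interpret low_weight age1 ageG "{gH, gZ, gQ}" zdot hdot \<theta>
  proof
    show "lie_module (coordsp {gH, gZ, gQ}) (one_dim \<theta>)"
      unfolding \<theta>_def by (rule one_dim_lie) (simp_all add: coordsp_def bracket_coords algebra_simps)
  qed (use z lie_sub_gens in \<open>auto simp: age1_coordsp \<theta>_def\<close>)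
  have eq: "lowest_verma_age1 zdot hdot = W"
    using I.T_Ind span_bas[of "{gH, gZ, gQ}"] by (simp add: \<theta>_def)
  show ?thesis
  proof (rule fock_map)
    fix \<phi> assume \<phi>: "rhom age1 W (fock zdot hdot) \<phi>" "\<phi> ` carrier W = UNIV"
    have im: "\<phi> ` carrier W = carrier (fock zdot hdot)" using \<phi>(2) by simp
    have "has_unique_simple_quotient age1 W"
      using G.unique_quotient[of hdot] w_act[of gH] w_nonzero by (simp add: age1_coordsp[symmetric])
    moreover have "simple_quotient age1 W {v \<in> carrier W. \<phi> v = \<zero>\<^bsub>fock zdot hdot\<^esub>}"
    proof (rule kernel_simple_quotient[OF I.ind_lie fock_L age1_sub \<phi>(1) im])
      show "N = {\<zero>\<^bsub>fock zdot hdot\<^esub>} \<or> N = carrier (fock zdot hdot)" if "subrep age1 (fock zdot hdot) N" for N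
        using fock_subrep[OF that] by simp
      show "carrier (fock zdot hdot) \<noteq> {\<zero>\<^bsub>fock zdot hdot\<^esub>}"
      proof
        assume c: "carrier (fock zdot hdot) = {\<zero>\<^bsub>fock zdot hdot\<^esub>}"
        have "1 \<in> carrier (fock zdot hdot)" by simp
        then have "1 \<in> {\<zero>\<^bsub>fock zdot hdot\<^esub>}" by (simp only: c)
        then show False by simp
      qed
    qed
    ultimately have "the_simple_quotient age1 W = quot_rep W {v \<in> carrier W. \<phi> v = \<zero>\<^bsub>fock zdot hdot\<^esub>}"
      by (rule unique_maximal[OF I.ind_lie age1_sub])
    moreover have "rep_iso age1 (quot_rep W {v \<in> carrier W. \<phi> v = \<zero>\<^bsub>fock zdot hdot\<^esub>}) (fock zdot hdot)"
      by (rule first_iso[OF I.ind_lie fock_L age1_sub \<phi>(1) im])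
    ultimately show ?thesis unfolding eq by simp
  qed
qed

theorem induced_lowest_simple:
  assumes V: "lie_module age1 V" and z: "zdot \<noteq> 0" and iso: "rep_iso age1 V (lowest_simple_age1 zdot hdot)"
  shows "let M = extend_heis zdot (lowest_verma_heis zdot); T = lie_tensor M (extend_sl2 (verma_sl2 (hdot - 1 / 2)))
         in rep_iso UNIV (H_ind V) T \<and> has_unique_simple_quotient UNIV T \<and>
            rep_iso UNIV (the_simple_quotient UNIV T) (lie_tensor M (extend_sl2 (simple_sl2 (hdot - 1 / 2))))"
proof -
  define \<theta> where "\<theta> = (\<lambda>x::schr. x $ gZ * zdot)"
  \<comment> \<open>The weight \<open>hdot\<close> of \<open>V\<close> is used here as well, so that
    the same Fock module receives \<open>V\<close> and the Heisenberg Verma module.\<close>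
  interpret low_weight heis heisG "{gQ, gZ}" zdot hdot \<theta>
  proof
    show "lie_module (coordsp {gQ, gZ}) (one_dim \<theta>)"
      unfolding \<theta>_def by (rule one_dim_lie) (simp_all add: coordsp_def bracket_coords algebra_simps)
    show "\<theta> x = x $ gH * hdot + x $ gZ * zdot" if "x \<in> coordsp {gQ, gZ}" for x
      using that by (simp add: \<theta>_def coordsp_def)
  qed (use z lie_sub_gens in \<open>auto simp: heis_coordsp\<close>)
  have eq: "lowest_verma_heis zdot = W"
    using I.T_Ind span_bas[of "{gQ, gZ}"] by (simp add: \<theta>_def)
  interpret AV: age_induced V by unfold_locales (rule V)
  let ?F = "fock zdot hdot"
  obtain \<phi> where \<phi>: "rhom heis W ?F \<phi>" "\<phi> w = Poly_Mapping.single 0 1" "\<phi> ` carrier W = UNIV"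
    by (rule fock_map)
  define m where "m i = (act W (bas gP) ^^ i) w" for i
  have m: "m i \<in> carrier W" for i unfolding m_def by (induction i) simp_all
  have mS: "act W (bas gP) (m i) = m (Suc i)" for i by (simp add: m_def)
  have \<phi>m: "\<phi> (m i) = Poly_Mapping.single i 1" for i
  proof (induction i)
    case 0
    show ?case by (simp add: m_def \<phi>(2))
  next
    case (Suc i)
    have "\<phi> (m (Suc i)) = act ?F (bas gP) (\<phi> (m i))"
      unfolding mS[symmetric] by (rule rhom_act[OF \<phi>(1) _ m]) simp
    then show ?case by (simp add: Suc fock_op_def)
  qed
  have single_nz: "Poly_Mapping.single i (1::complex) \<noteq> (0 :: nat \<Rightarrow>\<^sub>0 complex)" for i
    by (metis lookup_single_eq lookup_zero zero_neq_one)
  have \<phi>0: "\<phi> \<zero>\<^bsub>W\<^esub> = 0" using lmap_zero[OF I.cT pm_pm.cmodX rhom_lmap[OF \<phi>(1)]] by simp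
  \<comment> \<open>In the Heisenberg algebra \<open>p\<close> is the only raising element, so
    degree \<open>n\<close> is spanned by \<open>p^n w\<close>.\<close>
  have graded: "0 \<le> n \<longrightarrow> (\<exists>c. u = c \<odot>\<^bsub>W\<^esub> m (nat n))" if "G.graded n u" for n u
    using that
  proof (induction rule: G.graded.induct)
    case (base c)
    then show ?case by (auto simp: m_def)
  next
    case (zero n)
    then show ?case using m by (auto intro!: exI[of _ 0])
  next
    case (add n u v)
    then show ?case using I.T.smult_add_left[OF m] by metis
  next
    case (raise b n u)
    have b: "b = gP" "shift b = -1" using raise by (auto simp: shift_def)
    show ?case
    proof
      assume "0 \<le> n + - 1 * shift b"
      then consider "n = -1" | "0 \<le> n" using b by fastforce
      then show "\<exists>c. act W (bas b) u = c \<odot>\<^bsub>W\<^esub> m (nat (n + - 1 * shift b))"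
      proof cases
        case 1
        then have "u = \<zero>\<^bsub>W\<^esub>" using G.graded_low[OF raise.hyps(3)] by simp
        then show ?thesis using m b by (auto intro!: exI[of _ 0])
      next
        case 2
        then obtain c where c: "u = c \<odot>\<^bsub>W\<^esub> m (nat n)" using raise.IH by blast
        have "nat (n + - 1 * shift b) = Suc (nat n)" using 2 b by simp
        then show ?thesis using b c m by (auto simp: W.act_smult mS)
      qed
    qed
  qed
  have span: "\<exists>J f. finite J \<and> u = (\<Oplus>\<^bsub>W\<^esub>i\<in>J. f i \<odot>\<^bsub>W\<^esub> m i)" if uW: "u \<in> carrier W" for u
  proof -
    obtain f J where f: "\<forall>n. G.graded n (f n)" "finite J" "\<forall>n. n \<notin> J \<longrightarrow> f n = \<zero>\<^bsub>W\<^esub>" "u = (\<Oplus>\<^bsub>W\<^esub>n\<in>J. f n)"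
      using G.gsum_exists[OF uW] unfolding G.gsum_def by auto
    define N where "N = nat (Max (insert 0 J)) + 1"
    have N: "n < int N" if "n \<in> J" for n
    proof -
      have "n \<le> Max (insert 0 J)" using f(2) that by (intro Max_ge) auto
      then show ?thesis unfolding N_def by linarith
    qed
    \<comment> \<open>Degrees are integers but the basis is indexed by natural numbers. Components
      of negative degree vanish, and those beyond the finite support do so by definition, which
      leaves the range below \<open>N\<close>.\<close>
    let ?J = "int ` {..<N}"
    have z: "\<forall>n. n \<notin> ?J \<longrightarrow> f n = \<zero>\<^bsub>W\<^esub>"
    proof (intro allI impI)
      fix n assume nJ: "n \<notin> ?J"
      have "n < 0 \<or> n \<ge> int N"
      proof (rule ccontr)
        assume "\<not> (n < 0 \<or> n \<ge> int N)"
        then have "n = int (nat n)" "nat n \<in> {..<N}" by auto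
        then show False using nJ by blast
      qed
      then show "f n = \<zero>\<^bsub>W\<^esub>"
      proof
        assume "n < 0"
        then show ?thesis using G.graded_low[OF f(1)[rule_format, of n]] by simp
      next
        assume "n \<ge> int N"
        then show ?thesis using N f(3) by fastforce
      qed
    qed
    have "u = (\<Oplus>\<^bsub>W\<^esub>n\<in>J \<union> ?J. f n)"
      unfolding f(4) by (rule G.gsum_superset[OF f(1-3)]) (use f(2) in auto)
    also have "\<dots> = (\<Oplus>\<^bsub>W\<^esub>n\<in>?J. f n)"
      by (rule G.gsum_superset[OF f(1) _ z, symmetric]) (use f(2) in auto)
    also have "\<dots> = (\<Oplus>\<^bsub>W\<^esub>i\<in>{..<N}. f (int i))"
      by (rule I.T.M.finsum_reindex) (use G.graded_closed f(1) in \<open>auto simp: Pi_def\<close>)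
    finally have u: "u = (\<Oplus>\<^bsub>W\<^esub>i\<in>{..<N}. f (int i))" .
    have "\<forall>i. \<exists>c. f (int i) = c \<odot>\<^bsub>W\<^esub> m i"
      using graded[OF f(1)[rule_format, of "int _"]] by simp
    then obtain c where c: "\<forall>i. f (int i) = c i \<odot>\<^bsub>W\<^esub> m i" by (rule choice[THEN exE])
    show ?thesis unfolding u using c by (intro exI[of _ "{..<N}"] exI[of _ c]) simp
  qed
  have inj: "u = \<zero>\<^bsub>W\<^esub>" if u: "u \<in> carrier W" "\<phi> u = 0" for u
  proof -
    obtain J f where f: "finite J" "u = (\<Oplus>\<^bsub>W\<^esub>i\<in>J. f i \<odot>\<^bsub>W\<^esub> m i)" using span[OF u(1)] by auto
    have "\<phi> u = (\<Oplus>\<^bsub>?F\<^esub>i\<in>J. \<phi> (f i \<odot>\<^bsub>W\<^esub> m i))"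
      unfolding f(2) by (rule lmap_finsum[OF I.cT pm_pm.cmodX rhom_lmap[OF \<phi>(1)]]) (use m in auto)
    also have "\<dots> = (\<Sum>i\<in>J. Poly_Mapping.single i (f i))"
      by (subst finsum_sum[OF pm_pm.cmodX]) (simp_all add: rhom_smult[OF \<phi>(1) m] \<phi>m)
    finally have e: "(\<Sum>i\<in>J. Poly_Mapping.single i (f i)) = 0" using u(2) by simp
    have "f i = 0" if "i \<in> J" for i
      using arg_cong[OF e, of "\<lambda>y. Poly_Mapping.lookup y i"] that f(1)
      by (simp add: lookup_sum lookup_single when_def)
    then have "(\<Oplus>\<^bsub>W\<^esub>i\<in>J. f i \<odot>\<^bsub>W\<^esub> m i) = (\<Oplus>\<^bsub>W\<^esub>i\<in>J. \<zero>\<^bsub>W\<^esub>)"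
      by (intro I.T.M.finsum_cong') (use m in auto)
    then show ?thesis using f(2) by simp
  qed
  have bij: "bij_betw \<phi> (carrier W) (carrier ?F)"
    using inj_onI_lmap[OF I.cT pm_pm.cmodX rhom_lmap[OF \<phi>(1)]] inj \<phi>(3) by (simp add: bij_betw_def)
  have Winj: "u = v" if "u \<in> carrier W" "v \<in> carrier W" "\<phi> u = \<phi> v" for u v
    using that bij by (auto simp: bij_betw_def inj_on_def)
  obtain \<alpha> where \<alpha>: "rhom age1 V (lowest_simple_age1 zdot hdot) \<alpha>" "bij_betw \<alpha> (carrier V) (carrier (lowest_simple_age1 zdot hdot))"
    using iso unfolding rep_iso_iff by blast
  obtain \<gamma> where \<gamma>: "rhom age1 (lowest_simple_age1 zdot hdot) ?F \<gamma>" "bij_betw \<gamma> (carrier (lowest_simple_age1 zdot hdot)) (carrier ?F)"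
    using lowest_simple_fock[OF z, of hdot] unfolding rep_iso_iff by blast
  define \<rho> where "\<rho> = (\<lambda>v. \<gamma> (\<alpha> v))"
  have \<rho>: "rhom age1 V ?F \<rho>" "bij_betw \<rho> (carrier V) (carrier ?F)"
    using rhom_comp[OF \<alpha>(1) \<gamma>(1)] bij_betw_trans[OF \<alpha>(2) \<gamma>(2)] by (simp_all add: \<rho>_def comp_def)
  have act: "\<rho> (act V (bas b) v) = lin_ext (fock_op zdot hdot b) (\<rho> v)" if "b \<in> ageG" "v \<in> carrier V" for b v
    using rhom_act[OF \<rho>(1), of "bas b" v] that by (auto simp: age1_coordsp)
  have \<rho>inj: "u = v" if "u \<in> carrier V" "v \<in> carrier V" "\<rho> u = \<rho> v" for u v
    using that \<rho>(2) by (auto simp: bij_betw_def inj_on_def)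
  \<comment> \<open>\<open>V\<close> and the Heisenberg Verma module are compared through the Fock
    module, in which all identities are formulas for coefficients.\<close>
  let ?\<theta> = "\<lambda>v. inv_into (carrier W) \<phi> (\<rho> v)"
  have inv: "lmap ?F W (inv_into (carrier W) \<phi>)" by (rule lmap_inverse[OF I.cT rhom_lmap[OF \<phi>(1)] bij])
  have \<phi>\<theta>: "\<phi> (?\<theta> v) = \<rho> v" for v
    using bij by (auto simp: bij_betw_def f_inv_into_f)
  have \<theta>l: "lmap V W ?\<theta>" by (rule lmap_comp[OF rhom_lmap[OF \<rho>(1)] inv])
  have \<phi>act: "\<phi> (act W (bas b) u) = lin_ext (fock_op zdot hdot b) (\<phi> u)" if "b \<in> heisG" "u \<in> carrier W" for b u
    using rhom_act[OF \<phi>(1), of "bas b" u] that by (auto simp: heis_coordsp)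
  \<comment> \<open>\<open>pq\<close> multiplies \<open>p^i w\<close> by \<open>-zdot i\<close>.
    Comparing the weight \<open>hdot + i\<close> with \<open>i + \<mu> + 1/2\<close> gives
    \<open>\<mu> = hdot - 1/2\<close>.\<close>
  interpret ext_verma W zdot V m "\<lambda>i. - zdot * of_nat i" "hdot - 1 / 2" ?\<theta>
  proof unfold_locales
    show "act W (bas gZ) v = zdot \<odot>\<^bsub>W\<^esub> v" if "v \<in> carrier W" for v
      by (rule Winj) (use that in \<open>auto simp: \<phi>act rhom_smult[OF \<phi>(1)] lookup_fock intro!: poly_mapping_eqI\<close>)
    show pq: "act W (bas gP) (act W (bas gQ) (m i)) = (- zdot * of_nat i) \<odot>\<^bsub>W\<^esub> m i" for i
    proof (rule Winj)
      show "\<phi> (act W (bas gP) (act W (bas gQ) (m i))) = \<phi> ((- zdot * of_nat i) \<odot>\<^bsub>W\<^esub> m i)"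
        using m by (cases i) (simp_all add: \<phi>act rhom_smult[OF \<phi>(1)] \<phi>m fock_op_def \<phi>0 del: single_one)
    qed (use m in simp_all)
    show "\<exists>c n b. c \<noteq> 0 \<and> b \<in> {gP, gQ} \<and> (act W (bas b) ^^ n) (m i) = c \<odot>\<^bsub>W\<^esub> m j" for i j
    proof (cases "i \<le> j")
      case True
      have "(act W (bas gP) ^^ n) (m i) = m (n + i)" for n by (simp add: m_def funpow_add)
      from this[of "j - i"] show ?thesis using True m
        by (intro exI[of _ 1] exI[of _ "j - i"] exI[of _ gP]) simp
    next
      case False
      have q: "act W (bas gQ) (m (Suc k)) = (- zdot * of_nat (Suc k)) \<odot>\<^bsub>W\<^esub> m k" for k
        by (rule Winj) (use m in \<open>auto simp: \<phi>act rhom_smult[OF \<phi>(1)] lookup_fock \<phi>m lookup_single when_def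
          fock_op_def intro!: poly_mapping_eqI\<close>)
      have "\<exists>c. c \<noteq> 0 \<and> (act W (bas gQ) ^^ n) (m (n + j)) = c \<odot>\<^bsub>W\<^esub> m j" for n
      proof (induction n)
        case 0
        show ?case using m by (intro exI[of _ 1]) simp
      next
        case (Suc n)
        then obtain c where c: "c \<noteq> 0" "(act W (bas gQ) ^^ n) (m (n + j)) = c \<odot>\<^bsub>W\<^esub> m j" by blast
        have l: "lmap W W (act W (bas gQ) ^^ n)" for n
        proof (induction n)
          case (Suc n)
          show ?case using lmap_comp[OF Suc W.act_lmap[of "bas gQ"]] by (simp add: comp_def)
        qed (simp add: lmap_def)
        have "(act W (bas gQ) ^^ Suc n) (m (Suc n + j)) = (act W (bas gQ) ^^ n) ((- zdot * of_nat (Suc (n + j))) \<odot>\<^bsub>W\<^esub> m (n + j))"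
          by (simp add: funpow_swap1 q del: of_nat_Suc)
        also have "\<dots> = (- zdot * of_nat (Suc (n + j)) * c) \<odot>\<^bsub>W\<^esub> m j"
          using m by (simp add: lmap_smult[OF l] c(2) I.T.smult_smult del: of_nat_Suc)
        finally show ?case using c(1) z by (intro exI[of _ "- zdot * of_nat (Suc (n + j)) * c"]) (simp del: of_nat_Suc)
      qed
      from this[of "i - j"] obtain c where "c \<noteq> 0" "(act W (bas gQ) ^^ (i - j)) (m i) = c \<odot>\<^bsub>W\<^esub> m j" using False by auto
      then show ?thesis by (intro exI[of _ c] exI[of _ "i - j"] exI[of _ gQ]) simp
    qed
    show "m i \<noteq> \<zero>\<^bsub>W\<^esub>" for i using \<phi>m[of i] \<phi>0 single_nz[of i] by auto
    show "bij_betw ?\<theta> (carrier V) (carrier W)"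
      using bij_betw_trans[OF \<rho>(2) bij_betw_inv_into[OF bij]] by (simp add: comp_def)
    fix b v assume v: "v \<in> carrier V"
    have tv: "?\<theta> v \<in> carrier W" by (rule lmap_closed[OF \<theta>l v])
    show "?\<theta> (act V (bas b) v) = act W (bas b) (?\<theta> v)" if b: "b \<in> heisG"
    proof (rule Winj)
      show "?\<theta> (act V (bas b) v) \<in> carrier W" by (rule lmap_closed[OF \<theta>l]) (use v b in auto)
      show "act W (bas b) (?\<theta> v) \<in> carrier W" by (rule W.act_closed[OF _ tv]) (use b in auto)
      show "\<phi> (?\<theta> (act V (bas b) v)) = \<phi> (act W (bas b) (?\<theta> v))"
        using b v unfolding \<phi>\<theta> \<phi>act[OF b tv] by (intro act) auto
    qed
    note h = rhom_add[OF \<rho>(1)] rhom_smult[OF \<rho>(1)]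
    show "act V (bas gE) v = (1 / (2 * zdot)) \<odot>\<^bsub>V\<^esub> act V (bas gP) (act V (bas gP) v)"
      by (rule \<rho>inj) (use v z in \<open>auto simp: h act lookup_fock field_simps intro!: poly_mapping_eqI split: nat.splits\<close>)
    show "act V (bas gH) v = (- 1 / zdot) \<odot>\<^bsub>V\<^esub> act V (bas gP) (act V (bas gQ) v) \<oplus>\<^bsub>V\<^esub> (hdot - 1 / 2 + 1 / 2) \<odot>\<^bsub>V\<^esub> v"
      by (rule \<rho>inj) (use v z in \<open>auto simp: h act lookup_fock lookup_add field_simps intro!: poly_mapping_eqI split: nat.splits\<close>)
  qed (use z m span \<theta>l in \<open>auto simp: inj_def\<close>)
  show ?thesis using ext_conclusion unfolding eq by simp
qed

section \<open>Induction from modules killed by p\<close>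

theorem induced_Q_simple:
  assumes V: "simple_module age1 V" and iso: "rep_iso age1 V (Q_age1 lam hdot)"
  shows "simple_module UNIV (H_ind V)"
proof -
  define g where "g b i = (case b of
       gQ \<Rightarrow> mon (i + 1)
     | gE \<Rightarrow> scale lam (mon (i - 2))
     | gH \<Rightarrow> scale (hdot - of_int i) (mon i)
     | _ \<Rightarrow> 0)" for b i
  have Q: "Q_age1 lam hdot = laurent_rep g" by (simp add: Q_age1_def g_def[abs_def])
  obtain \<theta> where \<theta>: "rhom age1 V (laurent_rep g) \<theta>" "bij_betw \<theta> (carrier V) (carrier (laurent_rep g))"
    using iso unfolding Q rep_iso_iff by blast
  have lie: "lie_module age1 V" and irr: "irreducible_rep age1 V" using V by (simp_all add: simple_module_def)
  interpret AV: age_induced V by unfold_locales (rule lie)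
  have act: "\<theta> (act V (bas b) v) = lin_ext (g b) (\<theta> v)" if "b \<in> ageG" "v \<in> carrier V" for b v
    using rhom_act[OF \<theta>(1), of "bas b" v] that by (auto simp: age1_coordsp)
  have \<theta>0: "\<theta> \<zero>\<^bsub>V\<^esub> = 0" using lmap_zero[OF AV.V.cmodM laurent_pm.cmodX rhom_lmap[OF \<theta>(1)]] by simp
  have inj: "u = v" if "u \<in> carrier V" "v \<in> carrier V" "\<theta> u = \<theta> v" for u v
    using that \<theta>(2) by (auto simp: bij_betw_def inj_on_def)
  have V_act: "act V (bas b) v \<in> carrier V" if "b \<in> ageG" "v \<in> carrier V" for b v
    using that by (intro AV.V.act_closed) (auto simp: age1_coordsp)
  have P0: "lin_ext (g gP) y = 0" for y
    by (rule poly_mapping_eqI, subst lookup_lin_ext_shift[where s = 0 and c = "\<lambda>_. 0"]) (simp_all add: g_def)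
  have Q1: "Poly_Mapping.lookup (lin_ext (g gQ) y) k = Poly_Mapping.lookup y (k - 1)" for y k
    by (subst lookup_lin_ext_shift[where s = 1 and c = "\<lambda>_. 1"]) (simp_all add: g_def)
  have "simple_module UNIV AV.T"
  proof (rule AV.p_nilpotent_simple[OF irr])
    fix v assume v: "v \<in> carrier V"
    show "act V (bas gP) v = \<zero>\<^bsub>V\<^esub>"
      by (rule inj) (use v V_act in \<open>simp_all add: act P0 \<theta>0\<close>)
    assume "act V (bas gQ) v = \<zero>\<^bsub>V\<^esub>"
    then have "lin_ext (g gQ) (\<theta> v) = 0" using act[of gQ v] v \<theta>0 by simp
    then have "Poly_Mapping.lookup (\<theta> v) k = 0" for k using Q1[of "\<theta> v" "k + 1"] by simp
    then show "v = \<zero>\<^bsub>V\<^esub>" using v \<theta>0 by (intro inj) (auto intro!: poly_mapping_eqI)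
  qed
  then show ?thesis using AV.T_Ind by simp
qed

section \<open>The Dixmier--Schur lemma\<close>

text \<open>The resolvents \<open>(C - c)\<inverse> v\<close> for \<open>c \<in> \<complex>\<close> would be linearly
  independent if \<open>C\<close> had no eigenvalue, which is impossible in a space of countable dimension.\<close>

locale commuting_op = cvec M for M :: "(complex, 'm, 'z) module_scheme" (structure) +
  fixes A :: "'i \<Rightarrow> 'm \<Rightarrow> 'm" and J :: "'i set" and C :: "'m \<Rightarrow> 'm"
  assumes cJ: "countable J" and A: "\<And>i. i \<in> J \<Longrightarrow> lmap M M (A i)" and C: "lmap M M C"
    and comm: "\<And>i v. i \<in> J \<Longrightarrow> v \<in> carrier M \<Longrightarrow> C (A i v) = A i (C v)"
    and irr: "\<And>H. submodule H \<CC> M \<Longrightarrow> (\<And>i v. i \<in> J \<Longrightarrow> v \<in> H \<Longrightarrow> A i v \<in> H) \<Longrightarrow> H = {\<zero>} \<or> H = carrier M"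
begin

lemma C_simps [simp]:
  "v \<in> carrier M \<Longrightarrow> C v \<in> carrier M" "C \<zero> = \<zero>"
  "u \<in> carrier M \<Longrightarrow> v \<in> carrier M \<Longrightarrow> C (u \<oplus> v) = C u \<oplus> C v"
  "v \<in> carrier M \<Longrightarrow> C (c \<odot> v) = c \<odot> C v"
  using C lmap_zero[OF _ _ C] by (auto simp: lmap_def module_axioms)

definition ppoly :: "complex poly \<Rightarrow> 'm \<Rightarrow> 'm" where
  "ppoly p v = fold_coeffs (\<lambda>a u. a \<odot> v \<oplus> C u) p \<zero>"

lemma ppoly_0 [simp]: "ppoly 0 v = \<zero>"
  by (simp add: ppoly_def)

lemma ppoly_pCons [simp]: "v \<in> carrier M \<Longrightarrow> ppoly (pCons a p) v = a \<odot> v \<oplus> C (ppoly p v)"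
  by (cases "p = 0"; cases "a = 0") (simp_all add: ppoly_def)

lemma ppoly_closed [simp]: "v \<in> carrier M \<Longrightarrow> ppoly p v \<in> carrier M"
  by (induction p) auto

lemma ppoly_add: "v \<in> carrier M \<Longrightarrow> ppoly (p + q) v = ppoly p v \<oplus> ppoly q v"
proof (induction p q rule: poly_induct2)
  case (pCons a p b q)
  then show ?case by (intro vec_eqI) (simp_all add: cfun_add cfun_smult algebra_simps)
qed simp

lemma ppoly_smult: "v \<in> carrier M \<Longrightarrow> ppoly (Polynomial.smult c p) v = c \<odot> ppoly p v"
proof (induction p)
  case (pCons a p)
  then show ?case by (intro vec_eqI) (simp_all add: cfun_add cfun_smult algebra_simps)
qed simp

lemma ppoly_mult: "v \<in> carrier M \<Longrightarrow> ppoly (p * q) v = ppoly p (ppoly q v)"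
proof (induction p)
  case (pCons a p)
  then show ?case by (simp add: ppoly_add ppoly_smult)
qed simp

lemma ppoly_lmap: "lmap M M (ppoly p)"
proof (induction p)
  case (pCons a p)
  show ?case
    by (intro lmapI; (intro vec_eqI)?)
      (simp_all add: lmap_add[OF pCons(2)] lmap_smult[OF pCons(2)] cfun_add cfun_smult algebra_simps)
qed (simp add: lmap_def)

lemma ppoly_sum: "v \<in> carrier M \<Longrightarrow> ppoly (\<Sum>i\<in>S. f i) v = (\<Oplus>i\<in>S. ppoly (f i) v)"
proof (induction S rule: infinite_finite_induct)
  case (insert i S)
  then have "(\<lambda>i. ppoly (f i) v) \<in> S \<rightarrow> carrier M" by simp
  with insert show ?case by (simp add: ppoly_add)
qed (simp_all add: finsum_infinite)

abbreviation "sh c v \<equiv> C v \<oplus> (- c) \<odot> v"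

lemma ppoly_sh: "v \<in> carrier M \<Longrightarrow> ppoly [:-c, 1:] v = sh c v"
  by (simp add: M.a_comm)

text \<open>A nonzero complex polynomial is a product of linear factors, each of which acts
  injectively.\<close>

lemma ppoly_inj:
  assumes inj: "\<And>c v. v \<in> carrier M \<Longrightarrow> sh c v = \<zero> \<Longrightarrow> v = \<zero>" and v: "v \<in> carrier M"
  shows "p \<noteq> 0 \<Longrightarrow> ppoly p v = \<zero> \<Longrightarrow> v = \<zero>"
proof (induction "degree p" arbitrary: p)
  case 0
  then obtain a where "p = [:a:]" "a \<noteq> 0" by (auto elim!: degree_eq_zeroE)
  then show ?case using 0 v smult_eq_zero[of v a] by simp
next
  case (Suc n)
  then have "\<not> constant (poly p)" by (simp add: constant_degree)
  then obtain r where "poly p r = 0" using fundamental_theorem_of_algebra by blast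
  then obtain k where k: "p = [:-r, 1:] * k" by (auto simp: poly_eq_0_iff_dvd)
  have k0: "k \<noteq> 0" using k Suc(3) by auto
  have "degree p = Suc (degree k)" unfolding k using k0 by (subst degree_mult_eq) auto
  then have "n = degree k" using Suc(2) by simp
  have "sh r (ppoly k v) = \<zero>" using Suc(4) unfolding k ppoly_mult[OF v] ppoly_sh[OF ppoly_closed[OF v]] .
  then have "ppoly k v = \<zero>" by (rule inj[OF ppoly_closed[OF v]])
  then show ?case using Suc(1)[OF \<open>n = degree k\<close> k0] by blast
qed

text \<open>Clearing denominators with the product of all \<open>X - l\<close> turns the relation
  into \<open>g(C) v = 0\<close>, where \<open>g\<close> is the sum over \<open>d\<close> of
  \<open>a d\<close> times the product of the \<open>X - l\<close> with \<open>l \<noteq> d\<close>.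
  By injectivity \<open>g = 0\<close>, and evaluating \<open>g\<close> at \<open>c\<close> leaves
  only the summand of \<open>c\<close>.\<close>

lemma resolvents_independent:
  assumes inj: "\<And>c v. v \<in> carrier M \<Longrightarrow> sh c v = \<zero> \<Longrightarrow> v = \<zero>"
    and v: "v \<in> carrier M" "v \<noteq> \<zero>" and S: "finite S" and u: "\<And>c. c \<in> S \<Longrightarrow> u c \<in> carrier M \<and> sh c (u c) = v"
    and sum: "(\<Oplus>c\<in>S. a c \<odot> u c) = \<zero>" and c: "c \<in> S"
  shows "a c = 0"
proof -
  define Q where "Q T = (\<Prod>l\<in>T. [:-l, 1:])" for T :: "complex set"
  have Q: "ppoly (Q S) (u d) = ppoly (Q (S - {d})) v" if d: "d \<in> S" for d
  proof -
    have e: "Q S = Q (S - {d}) * [:-d, 1:]" unfolding Q_def using prod.remove[OF S d, of "\<lambda>l. [:-l, 1:]"] by (simp only: mult.commute)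
    show ?thesis unfolding e using u[OF d] by (simp only: ppoly_mult ppoly_sh)
  qed
  let ?g = "\<Sum>d\<in>S. Polynomial.smult (a d) (Q (S - {d}))"
  have uc: "(\<lambda>d. a d \<odot> u d) \<in> S \<rightarrow> carrier M" using u by auto
  have "ppoly ?g v = (\<Oplus>d\<in>S. a d \<odot> ppoly (Q (S - {d})) v)" using v by (simp add: ppoly_sum ppoly_smult)
  also have "\<dots> = (\<Oplus>d\<in>S. ppoly (Q S) (a d \<odot> u d))"
    by (rule M.finsum_cong') (use u v Q in \<open>auto simp: lmap_smult[OF ppoly_lmap]\<close>)
  also have "\<dots> = ppoly (Q S) (\<Oplus>d\<in>S. a d \<odot> u d)"
    by (rule lmap_finsum[OF module_axioms module_axioms ppoly_lmap uc, symmetric])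
  also have "\<dots> = \<zero>" unfolding sum by (rule lmap_zero[OF module_axioms module_axioms ppoly_lmap])
  finally have gv: "ppoly ?g v = \<zero>" .
  have "?g = 0"
  proof (rule ccontr)
    assume "?g \<noteq> 0"
    have "v = \<zero>" by (rule ppoly_inj[OF _ v(1) \<open>?g \<noteq> 0\<close> gv]) (rule inj)
    then show False using v(2) by blast
  qed
  then have "0 = poly ?g c" by simp
  also have "\<dots> = (\<Sum>d\<in>S. a d * (\<Prod>l\<in>S - {d}. c - l))" by (simp add: poly_sum Q_def poly_prod)
  also have "\<dots> = (\<Sum>d\<in>S. if d = c then a c * (\<Prod>l\<in>S - {c}. c - l) else 0)"
    by (rule sum.cong) (use c S in \<open>auto simp: prod_zero_iff\<close>)
  also have "\<dots> = a c * (\<Prod>l\<in>S - {c}. c - l)" using c S by simp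
  finally show ?thesis using S by (auto simp: prod_zero_iff)
qed

text \<open>Words in countably many operators are countable, and the span of their values at
  \<open>v\<close> is invariant and nonzero, hence everything.\<close>

lemma countable_span:
  assumes v: "v \<in> carrier M" "v \<noteq> \<zero>"
  obtains e :: "nat \<Rightarrow> 'm" where "\<And>k. e k \<in> carrier M" "\<And>u. u \<in> carrier M \<Longrightarrow> \<exists>y. u = lext M e y"
proof -
  let ?B = "(\<lambda>ws. foldr A ws v) ` lists J"
  define e where "e = from_nat_into ?B"
  have B: "countable ?B" "?B \<noteq> {}" using countable_lists[OF cJ] by auto
  have re: "range e = ?B" unfolding e_def by (rule range_from_nat_into[OF B(2,1)])
  have "foldr A ws v \<in> carrier M" if "ws \<in> lists J" for ws
    using that v lmap_closed[OF A] by (induction ws) auto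
  then have ec: "e k \<in> carrier M" for k using re by (metis (no_types, lifting) imageE rangeI)
  then have ep: "e \<in> T \<rightarrow> carrier M" for T by simp
  let ?H = "range (lext M e)"
  have single: "e k \<in> ?H" for k
    by (rule range_eqI[of _ _ "Poly_Mapping.single k 1"]) (simp add: lext_single ec)
  have sub: "submodule ?H \<CC> M"
  proof (rule submoduleI')
    show "\<zero> \<in> ?H" by (rule range_eqI[of _ _ 0]) simp
    show "u \<oplus> w \<in> ?H" if "u \<in> ?H" "w \<in> ?H" for u w
      using that by (auto simp: lext_add[OF ep ep, symmetric])
    show "c \<odot> u \<in> ?H" if "u \<in> ?H" for c u
      using that by (auto simp: lext_scale[OF ep, symmetric])
  qed (use lext_closed[OF ep] in auto)
  have "A i u \<in> ?H" if i: "i \<in> J" and u: "u \<in> ?H" for i u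
  proof -
    obtain y where y: "u = lext M e y" using u by auto
    have "Poly_Mapping.keys y \<subseteq> UNIV" by simp
    then have "A i (lext M e y) \<in> ?H"
    proof (induction y rule: pm_induct)
      case zero
      then show ?case using lmap_zero[OF module_axioms module_axioms A[OF i]] submoduleD(3)[OF sub] by simp
    next
      case (add k c y)
      obtain ws where ws: "ws \<in> lists J" "e k = foldr A ws v" using re by (metis (no_types, lifting) imageE rangeI)
      have "A i (e k) \<in> ?B" by (rule image_eqI[of _ _ "i # ws"]) (use ws i in auto)
      then have "A i (e k) \<in> ?H" using single re by (metis (no_types, lifting) imageE)
      moreover have "A i (lext M e (Poly_Mapping.single k c + y)) = c \<odot> A i (e k) \<oplus> A i (lext M e y)"
        using ec by (simp add: lext_add[OF ep ep] lext_single lmap_add[OF A[OF i]] lmap_smult[OF A[OF i]] lext_closed[OF ep])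
      ultimately show ?case using add(3) submoduleD(4,5)[OF sub] by simp
    qed
    then show ?thesis using y by simp
  qed
  from irr[OF sub this] have "?H = {\<zero>} \<or> ?H = carrier M" by blast
  moreover have "v \<in> ?H"
  proof -
    have "v \<in> range e" unfolding re by (rule image_eqI[of _ _ "[]"]) auto
    then show ?thesis using single by auto
  qed
  ultimately have "?H = carrier M" using v by auto
  then show thesis using that[of e] ec by (metis imageE)
qed

text \<open>Kernel and image of \<open>C - c\<close> are invariant, so if \<open>C\<close> is not a
  scalar then every \<open>C - c\<close> is bijective. This gives one resolvent of \<open>v\<close>
  for each complex number, too many for a countable spanning set.\<close>

lemma scalar: "\<exists>c. \<forall>v\<in>carrier M. C v = c \<odot> v"
proof (rule ccontr)
  assume ns: "\<not> (\<exists>c. \<forall>v\<in>carrier M. C v = c \<odot> v)"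
  have sh_lmap: "lmap M M (sh c)" for c
    by (intro lmapI; (intro vec_eqI)?) (simp_all add: cfun_add cfun_smult algebra_simps)
  have sh_A: "sh c (A i v) = A i (sh c v)" if "i \<in> J" "v \<in> carrier M" for c i v
    using that lmap_closed[OF A] by (simp add: comm lmap_add[OF A] lmap_smult[OF A])
  have sh_iff: "sh c v = \<zero> \<longleftrightarrow> C v = c \<odot> v" if "v \<in> carrier M" for c v
  proof -
    have "sh c v = C v \<ominus> c \<odot> v" using that by (intro vec_eqI) (simp_all add: cfun_add cfun_smult)
    then show ?thesis using that by (simp add: diff_zero_iff)
  qed
  have ker: "{v \<in> carrier M. sh c v = \<zero>} = {\<zero>}" for c
  proof -
    have "{v \<in> carrier M. sh c v = \<zero>} = {\<zero>} \<or> {v \<in> carrier M. sh c v = \<zero>} = carrier M"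
    proof (rule irr)
      show "submodule {v \<in> carrier M. sh c v = \<zero>} \<CC> M"
        by (rule submoduleI') (auto simp: lmap_add[OF sh_lmap, simplified] lmap_smult[OF sh_lmap, simplified] lmap_zero[OF module_axioms module_axioms sh_lmap, simplified] simp del: C_simps(3,4))
      show "A i v \<in> {v \<in> carrier M. sh c v = \<zero>}" if "i \<in> J" "v \<in> {v \<in> carrier M. sh c v = \<zero>}" for i v
        using that by (simp add: sh_A lmap_closed[OF A] lmap_zero[OF module_axioms module_axioms A])
    qed
    then show ?thesis using ns sh_iff by blast
  qed
  then have inj: "v = \<zero>" if "v \<in> carrier M" "sh c v = \<zero>" for c v using that by blast
  obtain v where v: "v \<in> carrier M" "v \<noteq> \<zero>" using ns by (metis C_simps(2) zero_smult(2))
  have surj: "sh c ` carrier M = carrier M" for c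
  proof -
    have "sh c ` carrier M = {\<zero>} \<or> sh c ` carrier M = carrier M"
    proof (rule irr)
      show "submodule (sh c ` carrier M) \<CC> M"
      proof (rule submoduleI')
        show "\<zero> \<in> sh c ` carrier M" by (rule image_eqI[of _ _ \<zero>]) simp_all
        show "x \<oplus> y \<in> sh c ` carrier M" if xy: "x \<in> sh c ` carrier M" "y \<in> sh c ` carrier M" for x y
        proof -
          obtain x' y' where "x' \<in> carrier M" "y' \<in> carrier M" "x = sh c x'" "y = sh c y'" using xy by blast
          then show ?thesis by (intro image_eqI[of _ _ "x' \<oplus> y'"]) (simp_all only: lmap_add[OF sh_lmap] M.a_closed)
        qed
        show "d \<odot> x \<in> sh c ` carrier M" if x: "x \<in> sh c ` carrier M" for d x
        proof -
          obtain x' where "x' \<in> carrier M" "x = sh c x'" using x by blast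
          then show ?thesis by (intro image_eqI[of _ _ "d \<odot> x'"]) (simp_all only: lmap_smult[OF sh_lmap] smult_closed')
        qed
      qed auto
      show "A i x \<in> sh c ` carrier M" if i: "i \<in> J" and x: "x \<in> sh c ` carrier M" for i x
      proof -
        obtain x' where "x' \<in> carrier M" "x = sh c x'" using x by blast
        then show ?thesis using i lmap_closed[OF A] by (intro image_eqI[of _ _ "A i x'"]) (simp_all only: sh_A)
      qed
    qed
    then show ?thesis using inj[OF v(1), of c] v by blast
  qed
  have "\<exists>u. u \<in> carrier M \<and> sh c u = v" for c using surj[of c] v(1) by (metis (no_types, lifting) imageE)
  then obtain u where u: "\<And>c. u c \<in> carrier M \<and> sh c (u c) = v" by metis
  have "\<exists>e::nat \<Rightarrow> 'm. (\<forall>k. e k \<in> carrier M) \<and> (\<forall>u\<in>carrier M. \<exists>y. u = lext M e y)"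
    by (rule countable_span[OF v]) blast
  then obtain e :: "nat \<Rightarrow> 'm" where e: "\<And>k. e k \<in> carrier M" "\<And>u. u \<in> carrier M \<Longrightarrow> \<exists>y. u = lext M e y"
    by blast
  have ep: "e \<in> T \<rightarrow> carrier M" for T using e(1) by simp
  have "\<exists>y. u c = lext M e y" for c by (rule e(2)) (use u in blast)
  then have "\<exists>y. \<forall>c. u c = lext M e (y c)" by (intro choice allI)
  then obtain y where y: "\<And>c. u c = lext M e (y c)" by (elim exE) simp
  \<comment> \<open>Equal expansions mean equal resolvents \<open>u d\<close>, and then
    \<open>(d - c) u d = 0\<close> with \<open>u d\<close> nonzero.\<close>
  have "y c = y d \<Longrightarrow> c = d" for c d
  proof -
    assume "y c = y d"
    then have uu: "u c = u d" using y by metis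
    have "sh c (u d) = sh d (u d)" using u[of c] u[of d] unfolding uu by simp
    then have "(d - c) \<odot> u d = \<zero>"
    proof -
      have "(d - c) \<odot> u d = sh c (u d) \<ominus> sh d (u d)"
        using conjunct1[OF u[of d]] by (intro vec_eqI) (simp_all add: cfun_add cfun_smult algebra_simps)
      also have "\<dots> = \<zero>" unfolding \<open>sh c (u d) = sh d (u d)\<close> using u[of d] v(1) by simp
      finally show ?thesis .
    qed
    moreover have "u d \<noteq> \<zero>" using u[of d] v(2) by auto
    ultimately show "c = d" using smult_eq_zero[of "u d" "d - c"] u[of d] by auto
  qed
  then have injy: "inj y" by (auto simp: inj_def)
  \<comment> \<open>\<open>?B n\<close> collects the parameters whose resolvent is expanded in the
    first \<open>n\<close> spanning vectors. The complex numbers are uncountable, so some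
    \<open>?B n\<close> is infinite, and infinitely many expansions in an
    \<open>n\<close>-dimensional space are dependent.\<close>
  let ?B = "\<lambda>n. {c. Poly_Mapping.keys (y c) \<subseteq> {..<n}}"
  have "\<exists>n::nat. infinite (?B n)"
  proof (rule ccontr)
    assume "\<not> ?thesis"
    then have "countable (\<Union>n. ?B n)" by (intro countable_UN) (auto intro: countable_finite)
    moreover have "(\<Union>n. ?B n) = UNIV"
    proof -
      have "\<exists>n. Poly_Mapping.keys (y c) \<subseteq> {..<n}" for c
        using finite_nat_iff_bounded[of "Poly_Mapping.keys (y c)"] by simp
      then show ?thesis by blast
    qed
    ultimately show False using uncountable_UNIV_complex by simp
  qed
  then obtain n where n: "infinite (?B n)" by blast
  have "z \<in> pmvs.span ((\<lambda>i. Poly_Mapping.single i 1) ` {..<n})" if "Poly_Mapping.keys z \<subseteq> {..<n}" for z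
    using that
  proof (induction z rule: pm_induct)
    case (add k d z)
    have "scale d (Poly_Mapping.single k 1) \<in> pmvs.span ((\<lambda>i. Poly_Mapping.single i 1) ` {..<n})"
      using add by (intro pmvs.span_scale pmvs.span_base) auto
    then show ?case using add by (auto intro: pmvs.span_add)
  qed (simp add: pmvs.span_zero)
  then have "y ` ?B n \<subseteq> pmvs.span ((\<lambda>i. Poly_Mapping.single i 1) ` {..<n})" by blast
  moreover have "infinite (y ` ?B n)" using n injy by (meson finite_imageD inj_on_subset subset_UNIV)
  ultimately have "pmvs.dependent (y ` ?B n)"
    using pmvs.independent_span_bound[of "(\<lambda>i. Poly_Mapping.single i 1) ` {..<n}" "y ` ?B n"] by auto
  then obtain t r where t: "finite t" "t \<subseteq> y ` ?B n" "(\<Sum>x\<in>t. scale (r x) x) = 0" "\<exists>x\<in>t. r x \<noteq> 0"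
    unfolding pmvs.dependent_explicit by blast
  obtain S where S: "finite S" "t = y ` S" using finite_subset_image[OF t(1,2)] by blast
  have injS: "inj_on y S" using injy by (meson inj_on_subset subset_UNIV)
  have ls: "lext M e (\<Sum>c\<in>T. scale (a c) (y c)) = (\<Oplus>c\<in>T. a c \<odot> u c)" if "finite T" for T a
    using that
  proof (induction T)
    case (insert c T)
    have "(\<lambda>c. a c \<odot> u c) \<in> T \<rightarrow> carrier M" using u by auto
    with insert show ?case using u by (simp add: lext_add[OF ep ep] lext_scale[OF ep] y[symmetric])
  qed simp
  have "(\<Sum>c\<in>S. scale (r (y c)) (y c)) = 0" using t(3) unfolding S(2) sum.reindex[OF injS] comp_def .
  then have "(\<Oplus>c\<in>S. r (y c) \<odot> u c) = \<zero>" using ls[OF S(1), of "\<lambda>c. r (y c)"] by simp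
  then have "r (y c) = 0" if "c \<in> S" for c
    by (rule resolvents_independent[OF _ v S(1) u _ that, rotated]) (rule inj)
  then show False using t(4) S(2) by auto
qed

end

section \<open>The Weyl algebra\<close>

lemma (in cvec) lmap_combine:
  "lmap M M (\<lambda>v. v)" "lmap M M (\<lambda>v. \<zero>)" "lmap M M f \<Longrightarrow> lmap M M (\<lambda>v. c \<odot> f v)"
  "lmap M M f \<Longrightarrow> lmap M M g \<Longrightarrow> lmap M M (\<lambda>v. f v \<oplus> g v)"
  "lmap M M f \<Longrightarrow> lmap M M g \<Longrightarrow> lmap M M (\<lambda>v. f v \<ominus> g v)"
  subgoal by (simp add: lmap_def)
  subgoal by (simp add: lmap_def)
  subgoal by (intro lmapI; (intro vec_eqI)?)
    (simp_all add: lmap_closed lmap_add lmap_smult cfun_add cfun_smult algebra_simps)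
  subgoal by (intro lmapI; (intro vec_eqI)?)
    (simp_all add: lmap_closed lmap_add lmap_smult cfun_add cfun_smult algebra_simps)
  subgoal by (intro lmapI; (intro vec_eqI)?)
    (simp_all add: lmap_closed lmap_add lmap_smult cfun_add cfun_smult algebra_simps)
  done

lemma const_commute: "const c * y = y * const c"
proof -
  have "Poly_Mapping.keys y \<subseteq> UNIV" by simp
  then show ?thesis
    by (induction y rule: pm_induct) (simp_all add: distrib_left distrib_right mult_single mult.commute)
qed

interpretation weyl: free_quot UNIV "{letter wD * letter wT - letter wT * letter wD - 1}"
  by unfold_locales (auto intro!: free_alg_closed)

lemma weyl_folds: "weyl_ideal = weyl.I" "weyl = weyl.U" "weyl_class = weyl.cl"
  by (auto simp: fun_eq_iff weyl_ideal_def weyl_def weyl_class_def weyl.I_def weyl.U_def weyl.cl_def)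

lemma in_free_UNIV [simp]: "y \<in> carrier (free_alg UNIV)"
  by (simp add: free_alg_mem)

lemma weyl_class_eq:
  assumes "y - y' = a * (letter wD * letter wT - letter wT * letter wD - 1)"
  shows "weyl_class y = weyl_class y'"
  unfolding weyl_folds
  by (rule weyl.cl_eq) (use assms weyl.R_I idealD(5)[OF weyl.I_ideal] in auto)

lemma weyl_class_add: "weyl_class (y + y') = weyl_class y \<oplus>\<^bsub>weyl\<^esub> weyl_class y'"
  and weyl_class_mult: "weyl_class (y * y') = weyl_class y \<otimes>\<^bsub>weyl\<^esub> weyl_class y'"
  and weyl_class_closed: "weyl_class y \<in> carrier weyl"
  unfolding weyl_folds by (rule weyl.cl_add weyl.cl_mult weyl.cl_closed; simp)+

lemma weyl_rels:
  "weyl_td \<otimes>\<^bsub>weyl\<^esub> weyl_t = weyl_t \<otimes>\<^bsub>weyl\<^esub> weyl_td \<oplus>\<^bsub>weyl\<^esub> weyl_t"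
  "weyl_ttd \<otimes>\<^bsub>weyl\<^esub> weyl_t = weyl_t \<otimes>\<^bsub>weyl\<^esub> weyl_ttd \<oplus>\<^bsub>weyl\<^esub> weyl_t \<otimes>\<^bsub>weyl\<^esub> weyl_t"
  "weyl_ttd = weyl_t \<otimes>\<^bsub>weyl\<^esub> weyl_td"
  unfolding weyl_class_mult[symmetric] weyl_class_add[symmetric]
  subgoal by (rule weyl_class_eq[of _ _ "letter wT"]) (simp only: right_diff_distrib distrib_left mult.assoc mult_1_right diff_diff_eq)
  subgoal by (rule weyl_class_eq[of _ _ "letter wT * letter wT"]) (simp only: right_diff_distrib distrib_left mult.assoc mult_1_right diff_diff_eq)
  subgoal by (simp only: mult.assoc)
  done

lemma R_alg_closed:
  "r \<in> R_alg zdot \<Longrightarrow> s \<in> R_alg zdot \<Longrightarrow> r \<oplus>\<^bsub>weyl\<^esub> s \<in> R_alg zdot"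
  "r \<in> R_alg zdot \<Longrightarrow> s \<in> R_alg zdot \<Longrightarrow> r \<otimes>\<^bsub>weyl\<^esub> s \<in> R_alg zdot"
  by (simp_all add: R_alg_def generate_ring.eng_add generate_ring.eng_mult)

lemma R_alg_mem:
  "weyl_class (const c) \<in> R_alg zdot" "weyl_t \<in> R_alg zdot"
  "zdot \<noteq> 0 \<Longrightarrow> weyl_td \<in> R_alg zdot" "weyl_ttd \<in> R_alg zdot"
proof -
  have td: "weyl_td \<in> R_alg zdot" if "zdot \<noteq> 0" for zdot
    using that by (auto simp: R_alg_def intro: generate_ring.incl)
  have t: "weyl_t \<in> R_alg zdot" for zdot by (auto simp: R_alg_def intro: generate_ring.incl)
  show "weyl_class (const c) \<in> R_alg zdot" by (auto simp: R_alg_def intro: generate_ring.incl)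
  show "weyl_t \<in> R_alg zdot" "zdot \<noteq> 0 \<Longrightarrow> weyl_td \<in> R_alg zdot" by (rule t td; assumption?)+
  show "weyl_ttd \<in> R_alg zdot"
  proof (cases "zdot = 0")
    case False
    then show ?thesis unfolding weyl_rels(3) by (intro R_alg_closed t td)
  qed (auto simp: R_alg_def intro: generate_ring.incl)
qed

lemma R_alg_carrier: "r \<in> R_alg zdot \<Longrightarrow> r \<in> carrier weyl"
  unfolding R_alg_def weyl_folds
  by (erule weyl.U.generate_ring_in_carrier[rotated]) (auto simp: weyl_folds[symmetric] weyl_class_closed)

lemma weyl_const_commute: "r \<in> carrier weyl \<Longrightarrow> r \<otimes>\<^bsub>weyl\<^esub> weyl_class (const c) = weyl_class (const c) \<otimes>\<^bsub>weyl\<^esub> r"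
  unfolding weyl_folds weyl.carrier_U
  by (auto simp: weyl.cl_mult[symmetric] const_commute)

section \<open>Modules over the two subalgebras\<close>

locale R_module =
  fixes zdot :: complex and N :: "(weyl_elem, 'm) rep" (structure)
  assumes alg: "alg_module (R_alg zdot) N"
begin

sublocale N: cvec N using alg by (simp add: cvec_def alg_module_def)

abbreviation "tt \<equiv> act N weyl_t"
abbreviation "td \<equiv> act N weyl_td"
abbreviation "ttd \<equiv> act N weyl_ttd"

lemma N_act_closed: "r \<in> R_alg zdot \<Longrightarrow> v \<in> carrier N \<Longrightarrow> act N r v \<in> carrier N"
  and N_act_mult: "r \<in> R_alg zdot \<Longrightarrow> s \<in> R_alg zdot \<Longrightarrow> v \<in> carrier N \<Longrightarrow> act N (r \<otimes>\<^bsub>weyl\<^esub> s) v = act N r (act N s v)"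
  and N_act_plus: "r \<in> R_alg zdot \<Longrightarrow> s \<in> R_alg zdot \<Longrightarrow> v \<in> carrier N \<Longrightarrow> act N (r \<oplus>\<^bsub>weyl\<^esub> s) v = act N r v \<oplus> act N s v"
  and N_act_const: "v \<in> carrier N \<Longrightarrow> act N (weyl_class (const c)) v = c \<odot> v"
  using alg by (simp_all add: alg_module_def)

lemma N_act_lmap: "r \<in> R_alg zdot \<Longrightarrow> lmap N N (act N r)"
proof (rule lmapI)
  assume r: "r \<in> R_alg zdot"
  fix v assume v: "v \<in> carrier N"
  then show "act N r v \<in> carrier N" using r by (rule N_act_closed[rotated])
  show "act N r (u \<oplus> v) = act N r u \<oplus> act N r v" if "u \<in> carrier N" for u
    using alg that v r by (simp add: alg_module_def)
  show "act N r (c \<odot> v) = c \<odot> act N r v" for c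
    using N_act_mult[OF r R_alg_mem(1) v, of c] N_act_mult[OF R_alg_mem(1) r v, of c] r v
      weyl_const_commute[OF R_alg_carrier[OF r], of c] by (simp add: N_act_const N_act_closed)
qed

lemmas tt_lmap = N_act_lmap[OF R_alg_mem(2)]
lemmas ttd_lmap = N_act_lmap[OF R_alg_mem(4)]
lemmas td_lmap = N_act_lmap[OF R_alg_mem(3)]
lemmas N_ops_simps = lmap_closed[OF tt_lmap] lmap_closed[OF ttd_lmap] lmap_closed[OF td_lmap]
  lmap_add[OF tt_lmap] lmap_add[OF ttd_lmap] lmap_add[OF td_lmap]
  lmap_smult[OF tt_lmap] lmap_smult[OF ttd_lmap] lmap_smult[OF td_lmap]

lemma N_rels:
  assumes v: "v \<in> carrier N"
  shows "zdot \<noteq> 0 \<Longrightarrow> td (tt v) = tt (td v) \<oplus> tt v"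
    "ttd (tt v) = tt (ttd v) \<oplus> tt (tt v)"
    "zdot \<noteq> 0 \<Longrightarrow> ttd v = tt (td v)"
proof -
  note R = R_alg_mem(2,3,4)[of zdot]
  show "td (tt v) = tt (td v) \<oplus> tt v" if z: "zdot \<noteq> 0"
    using arg_cong[OF weyl_rels(1), of "\<lambda>r. act N r v"] R(1) R(2)[OF z] v
    by (simp add: N_act_mult N_act_plus R_alg_closed)
  show "ttd (tt v) = tt (ttd v) \<oplus> tt (tt v)"
    using arg_cong[OF weyl_rels(2), of "\<lambda>r. act N r v"] R(1,3) v
    by (simp add: N_act_mult N_act_plus R_alg_closed)
  show "ttd v = tt (td v)" if z: "zdot \<noteq> 0"
    using arg_cong[OF weyl_rels(3), of "\<lambda>r. act N r v"] R(1) R(2)[OF z] v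
    by (simp add: N_act_mult)
qed

text \<open>The second generator besides \<open>t\<close>, so that the two subalgebras share one
  argument.\<close>

definition "X v = (if zdot = 0 then ttd v else td v)"

lemma X_lmap: "lmap N N X"
proof -
  have "X = (if zdot = 0 then ttd else td)" by (rule ext) (simp add: X_def)
  then show ?thesis using ttd_lmap td_lmap by presburger
qed

lemma X_tt: "v \<in> carrier N \<Longrightarrow> X (tt v) = tt (X v) \<oplus> (if zdot = 0 then tt (tt v) else tt v)"
  by (simp add: X_def N_rels)

text \<open>Induction over the generated subring: it suffices that the two generators preserve
  \<open>H\<close>, since scalars do so already.\<close>

lemma subrep_R_I:
  assumes H: "submodule H \<CC> N" and t: "\<And>v. v \<in> H \<Longrightarrow> tt v \<in> H" and X: "\<And>v. v \<in> H \<Longrightarrow> X v \<in> H"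
  shows "subrep (R_alg zdot) N H"
proof -
  note D = N.submoduleD[OF H]
  have "r \<in> R_alg zdot \<Longrightarrow> (\<forall>v\<in>H. act N r v \<in> H)" for r
    unfolding R_alg_def
  proof (induction r rule: generate_ring.induct)
    case one
    have "\<one>\<^bsub>weyl\<^esub> = weyl_class (const 1)" by (simp add: weyl_folds weyl.cl_one)
    then show ?case using D(2) N_act_const[of _ 1] by auto
  next
    case (incl h)
    then consider c where "h = weyl_class (const c)" | "h = weyl_t" | "h = (if zdot = 0 then weyl_ttd else weyl_td)" by blast
    then show ?case
    proof cases
      case 1
      then show ?thesis using D by (auto simp: N_act_const)
    next
      case 3
      then show ?thesis using X by (auto simp: X_def split: if_splits)
    qed (use t in auto)
  next
    case (a_inv h)
    show ?case
    proof
      fix v assume v: "v \<in> H"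
      have h: "h \<in> R_alg zdot" "\<ominus>\<^bsub>weyl\<^esub> h \<in> R_alg zdot"
        using a_inv.hyps by (simp_all add: R_alg_def generate_ring.a_inv)
      have vN: "v \<in> carrier N" by (rule D(2)[OF v])
      \<comment> \<open>The axioms of \<open>alg_module\<close> determine the zero element only
        through the constant 0; identifying the two shows that the negative of \<open>h\<close> acts
        as the negative of the action of \<open>h\<close>.\<close>
      have e: "h \<oplus>\<^bsub>weyl\<^esub> \<ominus>\<^bsub>weyl\<^esub> h = weyl_class (const 0)"
      proof -
        have "h \<oplus>\<^bsub>weyl\<^esub> \<ominus>\<^bsub>weyl\<^esub> h = \<zero>\<^bsub>weyl\<^esub>"
          using R_alg_carrier[OF h(1)] unfolding weyl_folds by (rule weyl.U.r_neg)
        moreover have "weyl_class 0 \<oplus>\<^bsub>weyl\<^esub> weyl_class 0 = weyl_class 0" using weyl_class_add[of 0 0] by simp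
        then have "weyl_class 0 = \<zero>\<^bsub>weyl\<^esub>"
          using weyl_class_closed[of 0] unfolding weyl_folds using weyl.U.add.l_cancel_one by blast
        ultimately show ?thesis by simp
      qed
      have "act N h v \<oplus> act N (\<ominus>\<^bsub>weyl\<^esub> h) v = \<zero>"
        using arg_cong[OF e, of "\<lambda>r. act N r v"] vN by (simp only: N_act_plus[OF h vN] N_act_const N.zero_smult)
      then have "act N (\<ominus>\<^bsub>weyl\<^esub> h) v = (-1) \<odot> act N h v"
        using N_act_closed[OF h(1) vN] N_act_closed[OF h(2) vN]
        by (metis N.M.minus_equality N.M.a_comm N.minus_smult)
      then show "act N (\<ominus>\<^bsub>weyl\<^esub> h) v \<in> H" using a_inv.IH v D(5) by simp
    qed
  next
    case (eng_add r s)
    then have "r \<in> R_alg zdot" "s \<in> R_alg zdot" by (simp_all add: R_alg_def)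
    then show ?case using eng_add.IH D(2,4) by (auto simp: N_act_plus)
  next
    case (eng_mult r s)
    then have "r \<in> R_alg zdot" "s \<in> R_alg zdot" by (simp_all add: R_alg_def)
    then show ?case using eng_mult.IH D(2) by (auto simp: N_act_mult)
  qed
  then show ?thesis using H by (simp add: subrep_def)
qed

end

section \<open>Infinite-dimensional simple modules and the inverse of t\<close>

locale R_simple = R_module zdot N for zdot :: complex and N :: "(weyl_elem, 'm) rep" (structure) +
  assumes irr: "irreducible_rep (R_alg zdot) N" and inf: "\<not> fin_dim N"
begin

lemma R_irr: "submodule H \<CC> N \<Longrightarrow> (\<And>v. v \<in> H \<Longrightarrow> tt v \<in> H) \<Longrightarrow> (\<And>v. v \<in> H \<Longrightarrow> X v \<in> H) \<Longrightarrow> H = {\<zero>} \<or> H = carrier N"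
  using irr subrep_R_I by (simp add: irreducible_rep_def)

lemma nz: obtains v where "v \<in> carrier N" "v \<noteq> \<zero>"
proof -
  have "carrier N \<noteq> {\<zero>}" using irr by (simp add: irreducible_rep_def)
  then show thesis using that N.M.zero_closed by blast
qed

lemma tt0: "tt \<zero> = \<zero>"
  by (rule lmap_zero[OF N.module_axioms N.module_axioms tt_lmap])

lemma X0: "X \<zero> = \<zero>"
  by (rule lmap_zero[OF N.module_axioms N.module_axioms X_lmap])

text \<open>If \<open>t\<close> acted by zero, \<open>N\<close> would be a simple module over polynomials in one operator, hence
  one-dimensional.\<close>

lemma tt_nonzero: "\<exists>v\<in>carrier N. tt v \<noteq> \<zero>"
proof (rule ccontr)
  assume "\<not> ?thesis"
  then have t: "tt v = \<zero>" if "v \<in> carrier N" for v using that by blast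
  interpret commuting_op N "\<lambda>_::unit. X" UNIV X
  proof unfold_locales
    fix H assume H: "submodule H \<CC> N" and XH: "\<And>i v. i \<in> (UNIV :: unit set) \<Longrightarrow> v \<in> H \<Longrightarrow> X v \<in> H"
    show "H = {\<zero>} \<or> H = carrier N"
      by (rule R_irr[OF H]) (use t N.submoduleD(2,3)[OF H] XH in auto)
  qed (simp_all add: X_lmap)
  obtain c where c: "\<And>v. v \<in> carrier N \<Longrightarrow> X v = c \<odot> v" using scalar by blast
  obtain w where w: "w \<in> carrier N" "w \<noteq> \<zero>" by (rule nz)
  have S: "submodule (lin_span N {w}) \<CC> N" "{w} \<subseteq> lin_span N {w}"
    using lin_span_submodule[OF N.module_axioms, of "{w}"] w(1) by auto
  have "lin_span N {w} = {\<zero>} \<or> lin_span N {w} = carrier N"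
    by (rule R_irr[OF S(1)]) (use t c N.submoduleD(2,3,5)[OF S(1)] in auto)
  then have "lin_span N {w} = carrier N" using S(2) w(2) by blast
  then have "fin_dim N" unfolding fin_dim_def using w(1) by (intro exI[of _ "{w}"]) simp
  then show False using inf by blast
qed

text \<open>\<open>X t - t X\<close> is \<open>t\<close> or the square of \<open>t\<close>, so the
  kernel of \<open>t\<close> is invariant under both generators. The same relation makes the image
  of \<open>t\<close> invariant, and simplicity decides both cases because \<open>t\<close> is not
  zero.\<close>

lemma tt_inj: "v \<in> carrier N \<Longrightarrow> tt v = \<zero> \<Longrightarrow> v = \<zero>"
proof -
  let ?K = "{v \<in> carrier N. tt v = \<zero>}"
  have "submodule ?K \<CC> N"
    by (rule N.submoduleI') (auto simp: tt0 N_ops_simps)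
  then have "?K = {\<zero>} \<or> ?K = carrier N"
  proof (rule R_irr)
    fix v assume v: "v \<in> ?K"
    then have v: "v \<in> carrier N" "tt v = \<zero>" by simp_all
    show "tt v \<in> ?K" using v by (simp add: tt0)
    have "\<zero> = tt (X v) \<oplus> \<zero>" using X_tt[OF v(1)] unfolding v(2) by (simp only: tt0 X0 if_cancel)
    then show "X v \<in> ?K" using v lmap_closed[OF X_lmap v(1)] by (simp add: N_ops_simps)
  qed
  then show "v \<in> carrier N \<Longrightarrow> tt v = \<zero> \<Longrightarrow> v = \<zero>" using tt_nonzero by blast
qed

lemma tt_surj: "tt ` carrier N = carrier N"
proof -
  have "submodule (tt ` carrier N) \<CC> N"
  proof (rule N.submoduleI')
    show "\<zero> \<in> tt ` carrier N" using tt0 by (metis N.M.zero_closed imageI)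
  qed (auto simp: N_ops_simps lmap_add[OF tt_lmap, symmetric] lmap_smult[OF tt_lmap, symmetric] simp del: lmap_add[OF tt_lmap] lmap_smult[OF tt_lmap])
  then have "tt ` carrier N = {\<zero>} \<or> tt ` carrier N = carrier N"
  proof (rule R_irr)
    fix v assume "v \<in> tt ` carrier N"
    then obtain u where u: "u \<in> carrier N" "v = tt u" by blast
    show "tt v \<in> tt ` carrier N" using u by (simp add: N_ops_simps)
    have w: "(if zdot = 0 then tt u else u) \<in> carrier N" using u by (simp add: N_ops_simps)
    have "X v = tt (X u \<oplus> (if zdot = 0 then tt u else u))"
      unfolding u(2) X_tt[OF u(1)] lmap_add[OF tt_lmap lmap_closed[OF X_lmap u(1)] w] by (simp only: if_distrib[of tt])
    then show "X v \<in> tt ` carrier N"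
      by (rule image_eqI) (rule N.M.a_closed[OF lmap_closed[OF X_lmap u(1)] w])
  qed
  then show ?thesis using tt_nonzero by blast
qed

lemma tt_inj_on: "u \<in> carrier N \<Longrightarrow> v \<in> carrier N \<Longrightarrow> tt u = tt v \<Longrightarrow> u = v"
proof -
  have "inj_on tt (carrier N)"
    by (rule inj_onI_lmap[OF N.module_axioms N.module_axioms tt_lmap]) (rule tt_inj)
  then show "u \<in> carrier N \<Longrightarrow> v \<in> carrier N \<Longrightarrow> tt u = tt v \<Longrightarrow> u = v" by (simp add: inj_on_def)
qed

lemma t_inv:
  assumes "v \<in> carrier N"
  shows "t_inv N v \<in> carrier N" "tt (t_inv N v) = v"
proof -
  have "v \<in> tt ` carrier N" unfolding tt_surj by (rule assms)
  then obtain w where w: "w \<in> carrier N" "tt w = v" by (elim imageE) simp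
  have "\<exists>!w. w \<in> carrier N \<and> tt w = v"
    by (rule ex1I[of _ w], use w in simp, rule tt_inj_on) (use w in simp_all)
  from theI'[OF this] show "t_inv N v \<in> carrier N" "tt (t_inv N v) = v" by (simp_all add: t_inv_def)
qed

lemma t_inv_eq: "u \<in> carrier N \<Longrightarrow> v \<in> carrier N \<Longrightarrow> tt u = v \<Longrightarrow> t_inv N v = u"
  using t_inv[of v] tt_inj_on[of u "t_inv N v"] by simp

lemma t_inv_lmap: "lmap N N (t_inv N)"
  by (rule lmapI; (rule t_inv_eq)?) (simp_all add: t_inv N_ops_simps)

lemma d_dt_lmap: "lmap N N (d_dt N)"
  unfolding d_dt_def[abs_def] by (rule lmap_comp[OF ttd_lmap lmap_comp[OF t_inv_lmap t_inv_lmap]])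

lemma d_dt_eq:
  assumes "u \<in> carrier N" "v \<in> carrier N" "tt (tt u) = ttd v"
  shows "d_dt N v = u"
proof -
  have c: "tt u \<in> carrier N" "ttd v \<in> carrier N" using assms by (simp_all add: N_ops_simps)
  show ?thesis unfolding d_dt_def t_inv_eq[OF c assms(3)] by (rule t_inv_eq[OF assms(1) c(1) refl])
qed

lemma tt_d_dt:
  assumes "zdot \<noteq> 0" "v \<in> carrier N"
  shows "tt (d_dt N v) = td v"
proof -
  have td: "td v \<in> carrier N" using assms by (simp add: N_ops_simps)
  have "t_inv N (ttd v) = td v"
    by (rule t_inv_eq) (use assms in \<open>simp_all add: N_rels(3) N_ops_simps\<close>)
  then show ?thesis unfolding d_dt_def by (simp only: t_inv(2)[OF td])
qed

lemma d_dt_tt: "zdot \<noteq> 0 \<Longrightarrow> v \<in> carrier N \<Longrightarrow> d_dt N (tt v) = td v \<oplus> v"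
  by (rule d_dt_eq) (simp_all add: N_rels N_ops_simps)

lemma d_dt_tt_tt: "v \<in> carrier N \<Longrightarrow> d_dt N (tt (tt v)) = ttd v \<oplus> 2 \<odot> tt v"
  by (rule d_dt_eq; (intro N.vec_eqI)?) (simp_all add: N_rels(2) N_ops_simps cfun_add cfun_smult)

lemma N_op_lmap: "lmap N N (N_op zdot hdot N b i)"
proof -
  note l = N.lmap_combine tt_lmap ttd_lmap td_lmap lmap_comp[OF td_lmap td_lmap]
  show ?thesis
    unfolding N_op_def[abs_def]
    by (cases b; cases "zdot = 0"; simp only: gen.case if_True if_False simp_thms; intro l; assumption?)
qed

lemma f_op_lmap: "lmap N N (f_op cdot zdot hdot N)"
proof -
  note l = N.lmap_combine d_dt_lmap t_inv_lmap lmap_comp[OF t_inv_lmap t_inv_lmap]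
    lmap_comp[OF lmap_comp[OF d_dt_lmap d_dt_lmap] tt_lmap]
  show ?thesis
    unfolding f_op_def[abs_def]
    by (cases "zdot = 0"; simp only: if_True if_False simp_thms; intro l)
qed

end

section \<open>Modules on tensor products with Laurent polynomials\<close>

lemma laurent_simps [simp]:
  "carrier laurent = UNIV" "add laurent = (+)" "zero laurent = 0" "smult laurent = scale"
  by (simp_all add: laurent_def)

lemma laurent_cmod: "cmod laurent"
  by (rule cmodI) (simp_all add: scale_distrib algebra_simps)

definition lt_op where
  "lt_op op = (\<lambda>x (v, g). \<Sum>b\<in>UNIV. scale (x $ b) (lin_ext (\<lambda>i. Poly_Mapping.single (op b i v, mon (i + shift b)) 1) g))"

locale laurent_module = V: cvec N for N :: "(weyl_elem, 'm) rep" +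
  fixes op :: "gen \<Rightarrow> int \<Rightarrow> 'm \<Rightarrow> 'm"
  assumes op: "lmap N N (op b i)"
begin

sublocale tensor N laurent "{}" "lt_op op :: schr \<Rightarrow> _"
  by (simp add: tensor_def V.module_axioms laurent_cmod)

lemma T_laurent_tensor: "T = laurent_tensor N op"
  by (simp add: laurent_tensor_def lt_op_def)

lemma op_closed [simp]: "v \<in> carrier N \<Longrightarrow> op b i v \<in> carrier N"
  by (rule lmap_closed[OF op])

definition shifted where "shifted b v y = lext T (\<lambda>i. tens (op b i v) (mon (i + shift b))) y"

lemma shifted_pi: "v \<in> carrier N \<Longrightarrow> (\<lambda>i. tens (op b i v) (mon (i + shift b))) \<in> J \<rightarrow> carrier T"
  by simp

lemma shifted_bilin: "bilin N laurent T (shifted b)"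
proof (rule bilinI)
  fix v assume v: "v \<in> carrier N"
  show "lmap laurent T (shifted b v)"
    unfolding shifted_def by (rule lmapI) (simp_all add: T.lext_closed T.lext_add T.lext_scale shifted_pi[OF v])
next
  fix y :: "int \<Rightarrow>\<^sub>0 complex"
  show "lmap N T (\<lambda>v. shifted b v y)"
  proof (rule lmapI)
    show "shifted b v y \<in> carrier T" if "v \<in> carrier N" for v
      unfolding shifted_def by (rule T.lext_closed[OF shifted_pi[OF that]])
    show "shifted b (u \<oplus>\<^bsub>N\<^esub> v) y = shifted b u y \<oplus>\<^bsub>T\<^esub> shifted b v y" if "u \<in> carrier N" "v \<in> carrier N" for u v
      unfolding shifted_def using that
      by (intro T.vec_eqI)
        (simp_all add: T.lext_closed shifted_pi cfun_add cfun_smult T.lext_cfun lmap_add[OF op] tens_add_left sum.distrib algebra_simps)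
    show "shifted b (c \<odot>\<^bsub>N\<^esub> v) y = c \<odot>\<^bsub>T\<^esub> shifted b v y" if "v \<in> carrier N" for c v
      unfolding shifted_def using that
      by (intro T.vec_eqI)
        (simp_all add: T.lext_closed shifted_pi cfun_add cfun_smult T.lext_cfun lmap_smult[OF op] tens_smult_left sum_distrib_left algebra_simps)
  qed
qed

lemma shifted_closed [simp]: "v \<in> carrier N \<Longrightarrow> shifted b v y \<in> carrier T"
  unfolding shifted_def by (rule T.lext_closed[OF shifted_pi])

definition "lt_act x v y = (\<Oplus>\<^bsub>T\<^esub>b\<in>UNIV. x $ b \<odot>\<^bsub>T\<^esub> shifted b v y)"

lemma lt_op_class:
  assumes v: "v \<in> carrier N"
  shows "lt_op op x (v, y) \<in> carrier F \<and> pr (lt_op op x (v, y)) = lt_act x v y"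
proof -
  let ?f = "\<lambda>b i. Poly_Mapping.single (op b i v, mon (i + shift b)) (1::complex)"
  have f: "?f b i \<in> carrier F" for b i using v by (intro single_in_F) simp_all
  have l: "lin_ext (?f b) y \<in> carrier F" for b
  proof -
    have "Poly_Mapping.keys (lin_ext (?f b) y) \<subseteq> carrier N \<times> carrier laurent"
      by (rule keys_lin_ext) (use v in simp)
    then show ?thesis by simp
  qed
  have s: "scale c (lin_ext (?f b) y) \<in> carrier F" for c b
    using F.smult_closed'[OF l[of b], of c] by simp
  have "lt_op op x (v, y) = (\<Sum>b\<in>UNIV. scale (x $ b) (lin_ext (?f b) y))" by (simp add: lt_op_def)
  moreover have "(\<Sum>b\<in>B. scale (x $ b) (lin_ext (?f b) y)) \<in> carrier F" if "finite B" for B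
    using that
  proof (induction B)
    case (insert b B)
    from F.M.a_closed[OF s[of "x $ b" b] insert(3)] insert(1,2) show ?case by simp
  qed simp
  moreover have "pr (\<Sum>b\<in>UNIV. scale (x $ b) (lin_ext (?f b) y)) = lt_act x v y"
  proof -
    have e: "pr (scale (x $ b) (lin_ext (?f b) y)) = x $ b \<odot>\<^bsub>T\<^esub> shifted b v y" for b
      unfolding pr_scale[OF l] shifted_def tens_def by (subst pr_lin_ext[of _ UNIV]) (use f in simp_all)
    have "pr (\<Sum>b\<in>UNIV. scale (x $ b) (lin_ext (?f b) y)) = (\<Oplus>\<^bsub>T\<^esub>b\<in>UNIV. pr (scale (x $ b) (lin_ext (?f b) y)))"
      by (rule pr_sum) (rule s)
    then show ?thesis unfolding e lt_act_def .
  qed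
  ultimately show ?thesis by simp
qed

lemma lt_act_bilin: "bilin N laurent T (lt_act x)"
proof -
  have b1: "lmap laurent T (shifted b v)" if "v \<in> carrier N" for b v
    using shifted_bilin that by (simp add: bilin_def)
  have b2: "lmap N T (\<lambda>v. shifted b v y)" for b y
    using shifted_bilin by (simp add: bilin_def)
  have pi: "(\<lambda>b. x $ b \<odot>\<^bsub>T\<^esub> shifted b v y) \<in> UNIV \<rightarrow> carrier T" if "v \<in> carrier N" for v y
    using that by simp
  show ?thesis
    unfolding lt_act_def
    by (intro bilinI lmapI; (intro T.vec_eqI)?)
      (simp_all add: pi T.M.finsum_closed cfun_add cfun_smult T.cfun_finsum lmap_add[OF b1, simplified] lmap_smult[OF b1, simplified]
        lmap_add[OF b2] lmap_smult[OF b2] sum.distrib sum_distrib_left algebra_simps)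
qed

lemma laurent_act: "lmap T T (act T x)" "v \<in> carrier N \<Longrightarrow> act T x (tens v y) = lt_act x v y"
  by (rule act_tens[OF lt_op_class lt_act_bilin]; simp)+

lemma laurent_act_mon:
  "v \<in> carrier N \<Longrightarrow> act T x (tens v (mon i)) = (\<Oplus>\<^bsub>T\<^esub>b\<in>UNIV. x $ b \<odot>\<^bsub>T\<^esub> tens (op b i v) (mon (i + shift b)))"
  by (simp add: laurent_act(2) lt_act_def shifted_def T.lext_single)

lemma laurent_act_bas:
  assumes "v \<in> carrier N"
  shows "act T (bas b) (tens v (mon i)) = tens (op b i v) (mon (i + shift b))"
  unfolding laurent_act_mon[OF assms]
proof (rule T.vec_eqI)
  fix \<xi> assume "cfun T \<xi>"
  then show "\<xi> (\<Oplus>\<^bsub>T\<^esub>c\<in>UNIV. bas b $ c \<odot>\<^bsub>T\<^esub> tens (op c i v) (mon (i + shift c))) = \<xi> (tens (op b i v) (mon (i + shift b)))"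
    using assms by (simp add: T.cfun_finsum cfun_smult bas_nth if_distrib if_distribR cong: if_cong)
qed (use assms in \<open>auto intro!: T.M.finsum_closed\<close>)

lemma mon_span:
  assumes H: "submodule H \<CC> T" and t: "\<And>v i. v \<in> carrier N \<Longrightarrow> tens v (mon i) \<in> H"
  shows "carrier T \<subseteq> H"
proof
  note D = T.submoduleD[OF H]
  have y: "tens v y \<in> H" if v: "v \<in> carrier N" for v y
  proof -
    have "Poly_Mapping.keys y \<subseteq> UNIV" by simp
    then show ?thesis
    proof (induction y rule: pm_induct)
      case zero
      then show ?case using tens_zero(2)[OF v] D(3) by simp
    next
      case (add k c y)
      have "tens v (Poly_Mapping.single k c + y) = c \<odot>\<^bsub>T\<^esub> tens v (mon k) \<oplus>\<^bsub>T\<^esub> tens v y"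
        using tens_add_right[OF v, of "scale c (mon k)" y] tens_smult_right[OF v, of "mon k" c] by simp
      then show ?case using D(4,5) t[OF v] add by simp
    qed
  qed
  fix u assume "u \<in> carrier T"
  then show "u \<in> H" by (induction u rule: tens_induct) (use D y in auto)
qed

lemma mon_lmap_eq:
  assumes X: "cmod X" and f: "lmap T X f" "lmap T X f'"
    and eq: "\<And>v i. v \<in> carrier N \<Longrightarrow> f (tens v (mon i)) = f' (tens v (mon i))" and u: "u \<in> carrier T"
  shows "f u = f' u"
proof -
  interpret X: cvec X by (rule cvecI[OF X])
  let ?H = "{u \<in> carrier T. f u = f' u}"
  have "submodule ?H \<CC> T"
    by (rule T.submoduleI')
      (auto simp: lmap_zero[OF cT X f(1)] lmap_zero[OF cT X f(2)] lmap_add[OF f(1)] lmap_add[OF f(2)]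
        lmap_smult[OF f(1)] lmap_smult[OF f(2)])
  then have "carrier T \<subseteq> ?H" by (rule mon_span) (use eq in simp)
  then show ?thesis using u by blast
qed

end

section \<open>The Casimir element of the Schroedinger algebra\<close>

context lierep
begin

text \<open>With \<open>e' = e - p^2/(2z)\<close>, \<open>f' = f + q^2/(2z)\<close> and
  \<open>h' = h + pq/z - 1/2\<close> this is \<open>-z (2 f' e' + h'^2/2 + h') - (3/8) z\<close>,
  the Casimir element of an sl2-triple commuting with \<open>p\<close> and \<open>q\<close>.
  Multiplication by \<open>z\<close> removes the denominators, so the formula is also meaningful for
  \<open>z = 0\<close>.\<close>

definition casimir :: "'m \<Rightarrow> 'm" where
  "casimir v = act M (bas gF) (act M (bas gP) (act M (bas gP) v))
     \<ominus> act M (bas gH) (act M (bas gP) (act M (bas gQ) v))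
     \<ominus> act M (bas gE) (act M (bas gQ) (act M (bas gQ) v))
     \<ominus> 2 \<odot> act M (bas gF) (act M (bas gE) (act M (bas gZ) v))
     \<ominus> (1 / 2) \<odot> (act M (bas gH) (act M (bas gH) (act M (bas gZ) v)) \<oplus> act M (bas gH) (act M (bas gZ) v))"

lemma casimir_lmap:
  assumes "L = UNIV"
  shows "lmap M M casimir"
proof -
  have a: "lmap M M (act M x)" for x by (rule act_lmap) (simp add: assms)
  show ?thesis
    unfolding casimir_def[abs_def]
    by (intro lmap_combine lmap_comp[OF lmap_comp[OF a a] a] lmap_comp[OF a a])
qed

text \<open>For each of the six basis elements both sides are brought to the same ordered form by
  \<open>comm_rules\<close>.\<close>

lemma casimir_commute:
  assumes "L = UNIV" "v \<in> carrier M"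
  shows "casimir (act M (bas b) v) = act M (bas b) (casimir v)"
proof -
  have L: "x \<in> L" for x using assms by simp
  show ?thesis
    unfolding casimir_def using assms(2)
    by (cases b; intro vec_eqI)
      (simp_all add: L comm_rules act_add act_smult act_diff cfun_add cfun_smult algebra_simps)
qed

lemma casimir_scalar:
  assumes "L = UNIV" "irreducible_rep UNIV M"
  shows "\<exists>c. \<forall>v\<in>carrier M. casimir v = c \<odot> v"
proof -
  interpret commuting_op M "\<lambda>b. act M (bas b)" UNIV casimir
  proof unfold_locales
    show "countable (UNIV :: gen set)" by (rule countable_finite) simp
    show "lmap M M (act M (bas b))" for b by (rule act_lmap) (simp add: assms(1))
    show "lmap M M casimir" by (rule casimir_lmap[OF assms(1)])
    show "casimir (act M (bas b) v) = act M (bas b) (casimir v)" if "v \<in> carrier M" for b v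
      by (rule casimir_commute[OF assms(1) that])
    fix H assume H: "submodule H \<CC> M" "\<And>b v. b \<in> UNIV \<Longrightarrow> v \<in> H \<Longrightarrow> act M (bas b) v \<in> H"
    have "subrep L M H" by (rule subrep_basisI[where A = UNIV, OF _ H(1)]) (use H(2) in \<open>auto simp: assms(1) coordsp_UNIV\<close>)
    then show "H = {\<zero>} \<or> H = carrier M" using assms by (simp add: irreducible_rep_def)
  qed
  show ?thesis by (rule scalar)
qed

end

text \<open>In a module \<open>X\<close> on which the Casimir element is the scalar \<open>cdot\<close>, the action of \<open>f\<close> on
  the image of \<open>(p\<^sup>2 - 2 z e)\<close> is forced by the action of the ageing algebra; on
  \<open>N \<otimes> \<complex>[x, 1/x]\<close> the operator \<open>p\<^sup>2 - 2 z e\<close> is \<open>t\<^sup>2\<close> or a multiple of \<open>t\<close>, hence onto.\<close>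

locale laurent_image = R_simple zdot N + X: lierep UNIV X
  for zdot :: complex and N :: "(weyl_elem, 'm) rep" (structure) and X :: "(schr, 'x) rep" +
  fixes hdot cdot :: complex and n :: "int \<Rightarrow> 'm \<Rightarrow> 'x"
  assumes n_lmap: "lmap N X (n i)"
    and n_act: "b \<noteq> gF \<Longrightarrow> v \<in> carrier N \<Longrightarrow> act X (bas b) (n i v) = n (i + shift b) (N_op zdot hdot N b i v)"
    and cas: "u \<in> carrier X \<Longrightarrow> X.casimir u = cdot \<odot>\<^bsub>X\<^esub> u"
begin

lemma n_simps: "v \<in> carrier N \<Longrightarrow> n i v \<in> carrier X"
  "u \<in> carrier N \<Longrightarrow> v \<in> carrier N \<Longrightarrow> n i (u \<oplus> v) = n i u \<oplus>\<^bsub>X\<^esub> n i v"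
  "v \<in> carrier N \<Longrightarrow> n i (c \<odot> v) = c \<odot>\<^bsub>X\<^esub> n i v"
  by (simp_all add: lmap_closed[OF n_lmap] lmap_add[OF n_lmap] lmap_smult[OF n_lmap])

abbreviation "op \<equiv> N_op zdot hdot N"

lemma op_closed: "v \<in> carrier N \<Longrightarrow> op b i v \<in> carrier N"
  by (rule lmap_closed[OF N_op_lmap])

lemma n_acts:
  assumes "v \<in> carrier N"
  shows "act X (bas gQ) (n i v) = n (i + 1) v"
    "act X (bas gP) (n i v) = n (i - 1) (op gP i v)"
    "act X (bas gE) (n i v) = n (i - 2) (op gE i v)"
    "act X (bas gH) (n i v) = (hdot - of_int i) \<odot>\<^bsub>X\<^esub> n i v"
    "act X (bas gZ) (n i v) = zdot \<odot>\<^bsub>X\<^esub> n i v"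
  using n_act[of gQ v i] n_act[of gP v i] n_act[of gE v i] n_act[of gH v i] n_act[of gZ v i] assms
  by (simp_all add: shift_def N_op_def n_simps)

text \<open>The equation \<open>casimir (n i v) = cdot (n i v)\<close> is solved for the terms that
  begin with \<open>f\<close>, namely \<open>f (p^2 - 2 z e)\<close>. All other terms stay inside
  the ageing algebra and are given by \<open>N_op\<close>.\<close>

lemma f_relation:
  assumes v: "v \<in> carrier N"
  shows "act X (bas gF) (n (i - 2) (op gP (i - 1) (op gP i v) \<oplus> (- 2 * zdot) \<odot> op gE i v)) =
    n i (cdot \<odot> v \<oplus> (hdot - of_int i) \<odot> op gP (i + 1) v \<oplus> op gE (i + 2) v \<oplus>
      (zdot / 2 * ((hdot - of_int i)\<^sup>2 + (hdot - of_int i))) \<odot> v)" (is "?l = ?r")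
proof -
  have i: "i + 1 - 1 = i" "i - 1 - 1 = i - 2" "i + 1 + 1 = i + 2" "i + 2 - 2 = i" by simp_all
  note oc = op_closed
  have pp: "act X (bas gP) (act X (bas gP) (n i v)) = n (i - 2) (op gP (i - 1) (op gP i v))"
    using v oc by (simp only: n_acts(2) i)
  have hpq: "act X (bas gH) (act X (bas gP) (act X (bas gQ) (n i v))) = (hdot - of_int i) \<odot>\<^bsub>X\<^esub> n i (op gP (i + 1) v)"
    using v oc by (simp only: n_acts i)
  have eqq: "act X (bas gE) (act X (bas gQ) (act X (bas gQ) (n i v))) = n i (op gE (i + 2) v)"
    using v oc by (simp only: n_acts i)
  have ez: "act X (bas gE) (act X (bas gZ) (n i v)) = zdot \<odot>\<^bsub>X\<^esub> n (i - 2) (op gE i v)"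
    using v oc by (simp add: n_acts n_simps X.act_smult)
  have hz: "act X (bas gH) (act X (bas gZ) (n i v)) = (zdot * (hdot - of_int i)) \<odot>\<^bsub>X\<^esub> n i v"
    using v by (simp add: n_acts n_simps X.act_smult X.smult_smult)
  have hhz: "act X (bas gH) ((zdot * (hdot - of_int i)) \<odot>\<^bsub>X\<^esub> n i v) = (zdot * (hdot - of_int i) * (hdot - of_int i)) \<odot>\<^bsub>X\<^esub> n i v"
    using v by (simp add: n_acts n_simps X.act_smult X.smult_smult)
  have c: "X.casimir (n i v) = cdot \<odot>\<^bsub>X\<^esub> n i v" by (rule cas) (simp add: n_simps v)
  define a where "a = op gP (i - 1) (op gP i v)"
  define b where "b = op gP (i + 1) v"
  define e where "e = op gE (i + 2) v"
  define d where "d = op gE i v"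
  have cl: "a \<in> carrier N" "b \<in> carrier N" "e \<in> carrier N" "d \<in> carrier N"
    using v by (simp_all add: a_def b_def e_def d_def op_closed)
  note fin = c[unfolded X.casimir_def pp hpq eqq ez hz hhz, folded a_def b_def e_def d_def]
  show ?thesis
    unfolding a_def[symmetric] b_def[symmetric] e_def[symmetric] d_def[symmetric]
  proof (rule X.vec_eqI)
    fix \<xi> assume \<xi>: "cfun X \<xi>"
    show "\<xi> (act X (bas gF) (n (i - 2) (a \<oplus> (- 2 * zdot) \<odot> d))) =
      \<xi> (n i (cdot \<odot> v \<oplus> (hdot - of_int i) \<odot> b \<oplus> e \<oplus> (zdot / 2 * ((hdot - of_int i)\<^sup>2 + (hdot - of_int i))) \<odot> v))"
      using arg_cong[OF fin, of \<xi>] v cl \<xi>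
      by (simp add: n_simps X.act_add X.act_smult cfun_add cfun_smult power2_eq_square field_simps)
  qed (use v cl in \<open>simp_all add: n_simps\<close>)
qed

lemma f_act:
  assumes v: "v \<in> carrier N"
  shows "act X (bas gF) (n i v) = n (i + 2) (f_op cdot zdot hdot N v)"
proof (cases "zdot = 0")
  case True
  define D where "D = ttd"
  \<comment> \<open>For \<open>zdot = 0\<close> the operator \<open>p^2 - 2 z e\<close> is
    \<open>t^2\<close>; \<open>f_relation\<close> is used at the index \<open>i + 2\<close>, which
    \<open>p^2\<close> lowers to \<open>i\<close>.\<close>
  define u where "u = t_inv N (t_inv N v)"
  have u: "u \<in> carrier N" "tt (tt u) = v" using t_inv v by (simp_all add: u_def)
  have Du: "D u \<in> carrier N" "tt u \<in> carrier N" using u(1) by (simp_all add: D_def N_ops_simps)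
  have ti: "t_inv N v = tt u" by (rule t_inv_eq) (use u v Du in simp_all)
  have tiu: "t_inv N (tt u) = u" by (rule t_inv_eq) (use u Du in simp_all)
  have l: "op gP (i + 2 - 1) (op gP (i + 2) u) \<oplus> (- 2 * zdot) \<odot> op gE (i + 2) u = v"
    using u op_closed[OF u(1)] v by (simp add: N_op_def True N_ops_simps)
  \<comment> \<open>Differentiating \<open>v = t^2 u\<close> gives
    \<open>t^2 (d/dt) u + 2 t u\<close>; its last term cancels the 2 in the coefficient
    \<open>hdot - 2\<close> of \<open>f_op\<close>.\<close>
  have f: "f_op cdot zdot hdot N v = D u \<oplus> 2 \<odot> tt u \<oplus> (hdot - 2) \<odot> tt u \<oplus> cdot \<odot> u"
    using d_dt_tt_tt[OF u(1)] unfolding u(2) by (simp add: f_op_def True ti tiu D_def)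
  have o: "op gP (i + 2 + 1) u = tt u" "op gE (i + 2 + 2) u = D u \<oplus> (of_int (i + 2 + 2) - 2) \<odot> tt u"
    using True by (simp_all add: N_op_def D_def)
  have "act X (bas gF) (n (i + 2 - 2) v) = n (i + 2) (f_op cdot zdot hdot N v)"
    unfolding f_relation[OF u(1), of "i + 2", unfolded l o] f
    by (rule arg_cong[where f = "n (i + 2)"], rule N.vec_eqI)
      (use u(1) Du True in \<open>simp_all add: cfun_add cfun_smult algebra_simps\<close>)
  then show ?thesis by simp
next
  case False
  \<comment> \<open>For \<open>zdot \<noteq> 0\<close> the operator \<open>p^2 - 2 z e\<close> is
    \<open>-2 z t\<close>, whence the constant.\<close>
  define u where "u = (- 1 / (2 * zdot)) \<odot> t_inv N v"
  have u: "u \<in> carrier N" "(- 2 * zdot) \<odot> tt u = v"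
    using t_inv[OF v] v False by (simp_all add: u_def N_ops_simps N.smult_smult)
  define T where "T = tt u"
  define D where "D = td u"
  define DD where "DD = td (td u)"
  have cl: "T \<in> carrier N" "D \<in> carrier N" "DD \<in> carrier N"
    using u(1) False by (simp_all add: T_def D_def DD_def N_ops_simps)
  have oP: "op gP j w = (2 * zdot) \<odot> td w \<oplus> ((of_int j - 1) * zdot) \<odot> w" for j w
    using False by (simp add: N_op_def)
  have oE: "op gE j u = T \<oplus> ((2 * of_int j - 3) * zdot) \<odot> D \<oplus> (2 * zdot) \<odot> DD \<oplus>
      ((of_int j - 1) * (of_int j - 2) / 2 * zdot) \<odot> u" for j
    using False by (simp add: N_op_def T_def D_def DD_def)
  have oPu: "op gP j u = (2 * zdot) \<odot> D \<oplus> ((of_int j - 1) * zdot) \<odot> u" for j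
    by (simp add: oP D_def)
  have oPP: "op gP k (op gP j u) = (2 * zdot) \<odot> ((2 * zdot) \<odot> DD \<oplus> ((of_int j - 1) * zdot) \<odot> D) \<oplus>
      ((of_int k - 1) * zdot) \<odot> ((2 * zdot) \<odot> D \<oplus> ((of_int j - 1) * zdot) \<odot> u)" for j k
    unfolding oPu unfolding oP using False u(1) cl
    by (simp add: lmap_add[OF td_lmap] lmap_smult[OF td_lmap] D_def DD_def)
  \<comment> \<open>All terms in \<open>t d/dt\<close> and its square, as well as the constant ones,
    cancel between \<open>p^2\<close> and \<open>2 z e\<close>; only the summand \<open>t\<close> of
    \<open>e\<close> remains.\<close>
  have l: "op gP (i + 2 - 1) (op gP (i + 2) u) \<oplus> (- 2 * zdot) \<odot> op gE (i + 2) u = v"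
    unfolding u(2)[symmetric] oPP oE T_def[symmetric]
    by (rule N.vec_eqI) (use u(1) cl in \<open>simp_all add: cfun_add cfun_smult field_simps\<close>)
  have dt: "d_dt N v = (- 2 * zdot) \<odot> (D \<oplus> u)"
    unfolding u(2)[symmetric] using u(1) False d_dt_tt[OF False u(1)]
    by (simp only: lmap_smult[OF d_dt_lmap] lmap_closed[OF tt_lmap] D_def)
  have Du: "D \<oplus> u \<in> carrier N" using cl u(1) by simp
  have tdd: "tt (d_dt N (d_dt N v)) = (- 2 * zdot) \<odot> (DD \<oplus> D)"
    unfolding dt lmap_smult[OF d_dt_lmap Du] lmap_smult[OF tt_lmap lmap_closed[OF d_dt_lmap Du]] tt_d_dt[OF False Du]
    using u(1) cl False by (simp only: lmap_add[OF td_lmap[OF False]] D_def DD_def)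
  have ti: "t_inv N v = (- 2 * zdot) \<odot> u"
    by (rule t_inv_eq) (use u v in \<open>simp_all add: lmap_smult[OF tt_lmap]\<close>)
  have f: "f_op cdot zdot hdot N v = (- 1 / (2 * zdot)) \<odot> ((- 2 * zdot) \<odot> T)
      \<ominus> (hdot - 1 / 2) \<odot> ((- 2 * zdot) \<odot> (D \<oplus> u)) \<ominus> (- 2 * zdot) \<odot> (DD \<oplus> D)
      \<ominus> ((hdot - 1) * (hdot - 2) / 4 + cdot / (2 * zdot)) \<odot> ((- 2 * zdot) \<odot> u)"
    unfolding f_op_def using False by (simp only: if_False tdd[unfolded dt] dt ti T_def u(2))
  have "act X (bas gF) (n (i + 2 - 2) v) = n (i + 2) (f_op cdot zdot hdot N v)"
    unfolding f_relation[OF u(1), of "i + 2", unfolded l] f oE oPu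
    by (rule arg_cong[where f = "n (i + 2)"], rule N.vec_eqI)
      (use u(1) cl False in \<open>simp_all add: cfun_add cfun_smult power2_eq_square field_simps\<close>)
  then show ?thesis by simp
qed

end

text \<open>The operators affect only the action, not the underlying space. The two tensor products
  are identified by the mutually inverse maps of their universal properties.\<close>

lemma laurent_tensor_identity:
  assumes "laurent_module N op" "laurent_module N op'"
  obtains \<sigma> where "lmap (laurent_tensor N op') (laurent_tensor N op) \<sigma>"
    "bij_betw \<sigma> (carrier (laurent_tensor N op')) (carrier (laurent_tensor N op))"
    "\<And>v y. v \<in> carrier N \<Longrightarrow> \<sigma> (tensor.tens N laurent {} (lt_op op' :: schr \<Rightarrow> _) v y) = tensor.tens N laurent {} (lt_op op :: schr \<Rightarrow> _) v y"
proof -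
  interpret A: laurent_module N op by fact
  interpret B: laurent_module N op' by fact
  obtain \<sigma> where \<sigma>: "lmap B.T A.T \<sigma>" "\<And>v y. v \<in> carrier N \<Longrightarrow> y \<in> carrier laurent \<Longrightarrow> \<sigma> (B.tens v y) = A.tens v y"
    by (rule B.universal[OF A.cT A.tens_bilin]) simp_all
  obtain \<tau> where \<tau>: "lmap A.T B.T \<tau>" "\<And>v y. v \<in> carrier N \<Longrightarrow> y \<in> carrier laurent \<Longrightarrow> \<tau> (A.tens v y) = B.tens v y"
    by (rule A.universal[OF B.cT B.tens_bilin]) simp_all
  have id: "lmap M M (\<lambda>v. v)" for M :: "(schr, 'z) rep" by (simp add: lmap_def)
  have "\<tau> (\<sigma> u) = u" if "u \<in> carrier B.T" for u
    by (rule B.tens_lmap_eq[OF B.cT lmap_comp[OF \<sigma>(1) \<tau>(1)] id _ that]) (simp add: \<sigma>(2) \<tau>(2))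
  moreover have "\<sigma> (\<tau> u) = u" if "u \<in> carrier A.T" for u
    by (rule A.tens_lmap_eq[OF A.cT lmap_comp[OF \<tau>(1) \<sigma>(1)] id _ that]) (simp add: \<sigma>(2) \<tau>(2))
  ultimately have "bij_betw \<sigma> (carrier B.T) (carrier A.T)"
    by (intro bij_betw_byWitness[where f' = \<tau>]) (use lmap_closed[OF \<sigma>(1)] lmap_closed[OF \<tau>(1)] in auto)
  then show thesis using that[of \<sigma>] \<sigma> by (simp add: A.T_laurent_tensor B.T_laurent_tensor)
qed

lemma lmap_image_submodule:
  assumes M: "cmod M" and M': "cmod M'" and \<phi>: "lmap M M' \<phi>"
  shows "submodule (\<phi> ` carrier M) \<CC> M'"
proof -
  interpret M: cvec M by (rule cvecI[OF M])
  interpret M': cvec M' by (rule cvecI[OF M'])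
  show ?thesis
  proof (rule M'.submoduleI')
    show "\<zero>\<^bsub>M'\<^esub> \<in> \<phi> ` carrier M"
      unfolding lmap_zero[OF M M' \<phi>, symmetric] by (rule imageI) simp
    fix u assume "u \<in> \<phi> ` carrier M"
    then obtain u' where u: "u' \<in> carrier M" "u = \<phi> u'" by blast
    show "c \<odot>\<^bsub>M'\<^esub> u \<in> \<phi> ` carrier M" for c
      unfolding u(2) lmap_smult[OF \<phi> u(1), symmetric] by (rule imageI) (simp add: u(1))
    fix v assume "v \<in> \<phi> ` carrier M"
    then obtain v' where v: "v' \<in> carrier M" "v = \<phi> v'" by blast
    show "u \<oplus>\<^bsub>M'\<^esub> v \<in> \<phi> ` carrier M"
      unfolding u(2) v(2) lmap_add[OF \<phi> u(1) v(1), symmetric] by (rule imageI) (simp add: u(1) v(1))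
  qed (use lmap_closed[OF \<phi>] in blast)
qed

theorem induced_N_simple_quotient:
  assumes V: "simple_module age1 V" and N: "simple_alg_module (R_alg zdot) N" "\<not> fin_dim N"
    and iso: "rep_iso age1 V (N_age1 zdot hdot N)" and U: "simple_quotient UNIV (H_ind V) U"
  shows "\<exists>cdot. rep_iso UNIV (quot_rep (H_ind V) U) (N_schr cdot zdot hdot N)"
proof -
  have lie: "lie_module age1 V" and irr: "irreducible_rep age1 V" using V by (simp_all add: simple_module_def)
  interpret AV: age_induced V by unfold_locales (rule lie)
  interpret R: R_simple zdot N by unfold_locales (use N in \<open>simp_all add: simple_alg_module_def\<close>)
  interpret Y: laurent_module N "N_op zdot hdot N" by unfold_locales (rule R.N_op_lmap)
  have Y_eq: "N_age1 zdot hdot N = Y.T" by (simp add: N_age1_def Y.T_laurent_tensor)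
  let ?X = "quot_rep AV.T U"
  have U': "subrep UNIV AV.T U" "simple_module UNIV ?X"
    using U AV.T_Ind by (simp_all add: simple_quotient_def)
  note Q = lie_quot[OF AV.ind_lie U'(1) lie_sub_UNIV]
  interpret X: lierep UNIV ?X by (rule lierepI[OF Q(1)])
  have irrX: "irreducible_rep UNIV ?X" using U'(2) by (simp add: simple_module_def)
  define \<zeta> where "\<zeta> = (\<lambda>v. proj AV.T U (AV.\<iota> v))"
  have \<zeta>: "rhom age1 V ?X \<zeta>"
    unfolding \<zeta>_def by (rule rhom_comp[OF AV.iota_rhom rhom_mono[OF Q(2)]]) simp
  \<comment> \<open>The quotient inherits from \<open>H(V)\<close> that it is generated by the image
    of \<open>V\<close>.\<close>
  have gen: "H = carrier ?X" if H: "subrep UNIV ?X H" and im: "\<zeta> ` carrier V \<subseteq> H" for H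
  proof -
    have "{u \<in> carrier AV.T. proj AV.T U u \<in> H} = carrier AV.T"
      by (rule AV.ind_generated[OF kernel_subrep[OF AV.ind_lie Q(1) Q(2) H]])
        (use im AV.iota_closed in \<open>auto simp: \<zeta>_def\<close>)
    then have "carrier ?X \<subseteq> H" unfolding Q(3) by blast
    then show ?thesis using X.submoduleD(1)[OF subrep_submodule[OF H]] by blast
  qed
  \<comment> \<open>The kernel of \<open>V\<close> in the quotient is a submodule of the simple
    module \<open>V\<close>. Were it all of \<open>V\<close>, the zero submodule would contain the
    generators and the quotient would be zero.\<close>
  have \<zeta>0: "v = \<zero>\<^bsub>V\<^esub>" if v: "v \<in> carrier V" "\<zeta> v = \<zero>\<^bsub>?X\<^esub>" for v
  proof -
    let ?K = "{v \<in> carrier V. \<zeta> v = \<zero>\<^bsub>?X\<^esub>}"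
    have lX: "lie_module age1 ?X" by (rule lie_module_mono[OF Q(1)]) simp
    have "?K = {\<zero>\<^bsub>V\<^esub>} \<or> ?K = carrier V"
      using irr kernel_subrep0[OF lie lX \<zeta>] unfolding irreducible_rep_def by (elim conjE allE[of _ ?K] impE)
    moreover have "?K \<noteq> carrier V"
    proof
      assume "?K = carrier V"
      then have "\<zeta> ` carrier V \<subseteq> {\<zero>\<^bsub>?X\<^esub>}" by blast
      then have "{\<zero>\<^bsub>?X\<^esub>} = carrier ?X" by (rule gen[OF X.subrep_0])
      then show False using irrX unfolding irreducible_rep_def by (elim conjE) (erule notE, erule sym)
    qed
    ultimately show ?thesis using v by blast
  qed
  obtain \<phi> where \<phi>: "rhom age1 V Y.T \<phi>" "bij_betw \<phi> (carrier V) (carrier Y.T)"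
    using iso unfolding Y_eq rep_iso_iff by blast
  let ?\<phi>' = "inv_into (carrier V) \<phi>"
  have \<phi>': "rhom age1 Y.T V ?\<phi>'" by (rule rhom_inverse[OF AV.V.cmodM AV.V.act_closed \<phi>])
  have b\<phi>': "bij_betw ?\<phi>' (carrier Y.T) (carrier V)" by (rule bij_betw_inv_into[OF \<phi>(2)])
  define \<psi> where "\<psi> = (\<lambda>y. \<zeta> (?\<phi>' y))"
  have \<psi>: "rhom age1 Y.T ?X \<psi>" unfolding \<psi>_def by (rule rhom_comp[OF \<phi>' \<zeta>])
  have \<psi>im: "\<psi> ` carrier Y.T = \<zeta> ` carrier V"
    using b\<phi>' unfolding \<psi>_def bij_betw_def by (simp add: image_image[symmetric])
  have \<psi>inj: "inj_on \<psi> (carrier Y.T)"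
  proof -
    have "inj_on \<zeta> (carrier V)" by (rule inj_onI_lmap[OF AV.V.cmodM X.cmodM rhom_lmap[OF \<zeta>] \<zeta>0])
    then have "inj_on (\<zeta> \<circ> ?\<phi>') (carrier Y.T)" using b\<phi>' by (intro comp_inj_on) (simp_all add: bij_betw_def)
    then show ?thesis by (simp add: \<psi>_def comp_def)
  qed
  \<comment> \<open>The parameter of the target module is the eigenvalue of the Casimir
    element.\<close>
  obtain cdot where cdot: "\<And>v. v \<in> carrier ?X \<Longrightarrow> X.casimir v = cdot \<odot>\<^bsub>?X\<^esub> v"
    using X.casimir_scalar[OF refl irrX] by blast
  define n where "n i v = \<psi> (Y.tens v (mon i))" for i v
  interpret L: laurent_image zdot N ?X hdot cdot n
  proof unfold_locales
    show "lmap N ?X (n i)" for i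
    proof -
      have "lmap N Y.T (\<lambda>v. Y.tens v (mon i))" using Y.tens_bilin by (simp add: bilin_def)
      then show ?thesis unfolding n_def[abs_def] by (rule lmap_comp[OF _ rhom_lmap[OF \<psi>]])
    qed
    show "act ?X (bas b) (n i v) = n (i + shift b) (N_op zdot hdot N b i v)" if "b \<noteq> gF" "v \<in> carrier N" for b v i
    proof -
      have "bas b \<in> age1" using that(1) by (cases b) (simp_all add: age1_coordsp)
      then show ?thesis
        unfolding n_def using that(2) rhom_act[OF \<psi>, of "bas b" "Y.tens v (mon i)"] by (simp add: Y.laurent_act_bas)
    qed
  qed (rule cdot)
  define op' where "op' = (\<lambda>b i v. if b = gF then f_op cdot zdot hdot N v else N_op zdot hdot N b i v)"
  have op': "lmap N N (op' b i)" for b i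
    using R.N_op_lmap R.f_op_lmap by (cases "b = gF") (simp_all add: op'_def)
  interpret Z: laurent_module N op' by unfold_locales (rule op')
  have "N_schr cdot zdot hdot N = laurent_tensor N op'" by (simp add: N_schr_def op'_def)
  then have Z_eq: "N_schr cdot zdot hdot N = Z.T" by (simp only: Z.T_laurent_tensor)
  have n_act': "act ?X (bas b) (n i v) = n (i + shift b) (op' b i v)" if "v \<in> carrier N" for b i v
  proof (cases "b = gF")
    case True
    then show ?thesis using L.f_act[OF that, of i] by (simp add: op'_def shift_def)
  next
    case False
    then show ?thesis using L.n_act[OF False that, of i] by (simp add: op'_def)
  qed
  \<comment> \<open>\<open>L.f_act\<close> shows that \<open>f\<close> maps the image of
    \<open>V\<close> into itself, so this image is a submodule for the full algebra.\<close>
  have "subrep UNIV ?X (\<psi> ` carrier Y.T)"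
  proof (rule X.subrep_basisI[where A = UNIV])
    show im: "submodule (\<psi> ` carrier Y.T) \<CC> ?X"
      by (rule lmap_image_submodule[OF Y.cT X.cmodM rhom_lmap[OF \<psi>]])
    note D = X.submoduleD[OF im]
    fix b x assume "x \<in> \<psi> ` carrier Y.T"
    then obtain y where y: "y \<in> carrier Y.T" "x = \<psi> y" by blast
    let ?H = "{y \<in> carrier Y.T. act ?X (bas b) (\<psi> y) \<in> \<psi> ` carrier Y.T}"
    have "carrier Y.T \<subseteq> ?H"
    proof (rule Y.mon_span)
      show "submodule ?H \<CC> Y.T"
      proof (rule Y.T.submoduleI')
        show "\<zero>\<^bsub>Y.T\<^esub> \<in> ?H" using D(3) lmap_zero[OF Y.cT X.cmodM rhom_lmap[OF \<psi>]] by simp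
        show "u \<oplus>\<^bsub>Y.T\<^esub> v \<in> ?H" if "u \<in> ?H" "v \<in> ?H" for u v
          using that D(4) rhom_closed[OF \<psi>] by (simp add: rhom_add[OF \<psi>] X.act_add)
        show "c \<odot>\<^bsub>Y.T\<^esub> v \<in> ?H" if "v \<in> ?H" for c v
          using that D(5) rhom_closed[OF \<psi>] by (simp add: rhom_smult[OF \<psi>] X.act_smult)
      qed auto
      fix v i assume v: "v \<in> carrier N"
      have "act ?X (bas b) (\<psi> (Y.tens v (mon i))) = \<psi> (Y.tens (op' b i v) (mon (i + shift b)))"
        using n_act'[OF v] unfolding n_def .
      then show "Y.tens v (mon i) \<in> ?H" using v by simp
    qed
    then show "act ?X (bas b) x \<in> \<psi> ` carrier Y.T" using y by blast
  qed (simp add: coordsp_UNIV)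
  then have surj: "\<psi> ` carrier Y.T = carrier ?X" by (rule gen) (simp add: \<psi>im)
  obtain \<sigma> where \<sigma>: "lmap Z.T Y.T \<sigma>" "bij_betw \<sigma> (carrier Z.T) (carrier Y.T)"
    "\<And>v y. v \<in> carrier N \<Longrightarrow> \<sigma> (Z.tens v y) = Y.tens v y"
    by (rule laurent_tensor_identity[OF Y.laurent_module_axioms Z.laurent_module_axioms,
      folded Y.T_laurent_tensor Z.T_laurent_tensor]) (rule that)
  \<comment> \<open>\<open>\<psi>\<close> is defined on the space with the operators of the ageing
    algebra; composing with \<open>\<sigma>\<close> transports it to the same space carrying also
    the operator of \<open>f\<close>.\<close>
  define \<Theta> where "\<Theta> = (\<lambda>u. \<psi> (\<sigma> u))"
  have \<Theta>l: "lmap Z.T ?X \<Theta>" unfolding \<Theta>_def by (rule lmap_comp[OF \<sigma>(1) rhom_lmap[OF \<psi>]])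
  have \<Theta>b: "bij_betw \<Theta> (carrier Z.T) (carrier ?X)"
    using bij_betw_trans[OF \<sigma>(2), of \<psi> "carrier ?X"] \<psi>inj surj by (simp add: bij_betw_def \<Theta>_def comp_def)
  have \<Theta>n: "\<Theta> (Z.tens v (mon i)) = n i v" if "v \<in> carrier N" for v i
    using that by (simp add: \<Theta>_def \<sigma>(3) n_def)
  have \<Theta>: "rhom UNIV Z.T ?X \<Theta>"
  proof (rule rhomI[OF \<Theta>l])
    fix x u assume u: "u \<in> carrier Z.T"
    have xl: "lmap ?X ?X (act ?X x)" by (rule X.act_lmap) simp
    show "\<Theta> (act Z.T x u) = act ?X x (\<Theta> u)"
    proof (rule Z.mon_lmap_eq[OF X.cmodM lmap_comp[OF Z.laurent_act(1) \<Theta>l] lmap_comp[OF \<Theta>l xl] _ u])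
      fix v i assume v: "v \<in> carrier N"
      have "\<Theta> (act Z.T x (Z.tens v (mon i))) = (\<Oplus>\<^bsub>?X\<^esub>b\<in>UNIV. \<Theta> (x $ b \<odot>\<^bsub>Z.T\<^esub> Z.tens (op' b i v) (mon (i + shift b))))"
        unfolding Z.laurent_act_mon[OF v] by (rule lmap_finsum[OF Z.cT X.cmodM \<Theta>l]) (use v in simp)
      also have "\<dots> = (\<Oplus>\<^bsub>?X\<^esub>b\<in>UNIV. x $ b \<odot>\<^bsub>?X\<^esub> act ?X (bas b) (n i v))"
        using v by (simp add: lmap_smult[OF \<Theta>l] \<Theta>n n_act')
      also have "\<dots> = act ?X x (n i v)"
        by (rule X.act_expand[symmetric]) (simp_all add: coordsp_UNIV L.n_simps v)
      finally show "\<Theta> (act Z.T x (Z.tens v (mon i))) = act ?X x (\<Theta> (Z.tens v (mon i)))"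
        using v by (simp add: \<Theta>n)
    qed
  qed
  have "rhom UNIV ?X Z.T (inv_into (carrier Z.T) \<Theta>)"
    by (rule rhom_inverse[OF Z.cT lmap_closed[OF Z.laurent_act(1)] \<Theta> \<Theta>b])
  then have "rep_iso UNIV ?X Z.T"
    unfolding rep_iso_iff using bij_betw_inv_into[OF \<Theta>b] by blast
  then show ?thesis unfolding Z_eq[symmetric] AV.T_Ind by (rule exI)
qed

theorem theorem15:
  fixes V :: "(schr, 'v) rep"
  assumes simple_V: "simple_module age1 V"
    and weight_V: "weight_module V"
  shows
    "(highest_weight_module age1 V \<longrightarrow>
        highest_weight_module schrodinger (H_ind V) \<and> has_unique_simple_quotient schrodinger (H_ind V))
   \<and> (\<forall>zdot hdot. zdot \<noteq> 0 \<and> rep_iso age1 V (lowest_simple_age1 zdot hdot) \<longrightarrow>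
        (let M = extend_heis zdot (lowest_verma_heis zdot);
             T = lie_tensor M (extend_sl2 (verma_sl2 (hdot - 1 / 2)))
         in rep_iso schrodinger (H_ind V) T \<and> has_unique_simple_quotient schrodinger T \<and>
            rep_iso schrodinger (the_simple_quotient schrodinger T)
              (lie_tensor M (extend_sl2 (simple_sl2 (hdot - 1 / 2))))))
   \<and> (\<forall>lam hdot. lam \<noteq> 0 \<and> rep_iso age1 V (Q_age1 lam hdot) \<longrightarrow> simple_module schrodinger (H_ind V))
   \<and> (\<forall>zdot hdot lam. zdot \<noteq> 0 \<and> lam \<notin> \<int> \<and> rep_iso age1 V (Q'_age1 zdot hdot lam) \<longrightarrow>
        (let M = extend_heis zdot (G_heis zdot lam);
             T = lie_tensor M (extend_sl2 (verma_sl2 (lam + hdot + 1 / 2)))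
         in rep_iso schrodinger (H_ind V) T \<and> has_unique_simple_quotient schrodinger T \<and>
            rep_iso schrodinger (the_simple_quotient schrodinger T)
              (lie_tensor M (extend_sl2 (simple_sl2 (lam + hdot + 1 / 2))))))
   \<and> (\<forall>zdot hdot. \<forall>N :: (weyl_elem, 'n) rep.
        simple_alg_module (R_alg zdot) N \<and> \<not> fin_dim N \<and> rep_iso age1 V (N_age1 zdot hdot N) \<longrightarrow>
        (\<forall>U. simple_quotient schrodinger (H_ind V) U \<longrightarrow>
           (\<exists>cdot. rep_iso schrodinger (quot_rep (H_ind V) U) (N_schr cdot zdot hdot N))))"
proof -
  have V: "lie_module age1 V" using simple_V by (simp add: simple_module_def)
  interpret AV: age_induced V by unfold_locales (rule V)
  show ?thesis
    apply (intro conjI allI impI; (elim conjE)?)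
    subgoal using AV.highest_weight AV.T_Ind by simp
    subgoal using AV.highest_weight AV.T_Ind by simp
    subgoal by (rule induced_lowest_simple[OF V])
    subgoal by (rule induced_Q_simple[OF simple_V])
    subgoal by (rule induced_Q'_decomposition[OF V])
    subgoal by (rule induced_N_simple_quotient[OF simple_V])
    done
qed

end
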